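(* Let $M\ge 1$ be a fixed integer. For every $\varepsilon>0$ there exists $\delta=\delta(\varepsilon,M)>0$ such that the following holds for all sufficiently large $T$. Let $V\ge T^{\frac1{10}+\varepsilon}$ and let $T\le t_1<\dots<t_R\le 2T$ be real points such that $|\zeta(\tfrac12+it_r)|\ge V T^{-\delta}$ for $r=1,\dots,R$ and $t_{r+1}-t_r\ge V$ for $r=1,\dots,R-1$. Then $$ R\;\ll\; T^{\varepsilon-M/2}\,V^{-2}\max_{K\le T^{1+\varepsilon}V^{-4}}\;\int_{T/2}^{5T/2}\varphi(t)\,\Bigl|\sum_{K\le k\le K'\le 2K}(-1)^k d(k)\,k^{-1/4}\exp\bigl(2i\sqrt{2\pi k t}+c\,i\,k^{3/2}t^{-1/2}\bigr)\Bigr|^{2M}\,dt, $$ where $c=\sqrt{2\pi^3}/6$, and $\varphi$ is a non-negative smooth function supported in $[T/2,5T/2]$ such that $\varphi(t)=1$ for $T\le t\le 2T$.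
   Context: $\zeta(s)$ denotes the Riemann zeta-function and $d(k)$ the number of positive divisors of $k$. The sum is over integers $k$ with $K\le k\le K'$, where $K'$ is some number with $K\le K'\le 2K$; the maximum is taken over all $K$ with $1\le K\le T^{1+\varepsilon}V^{-4}$ and over such $K'$. The function $\varphi$ (which depends on $T$) satisfies $\varphi^{(m)}(t)\ll_m T^{-m}$ for every integer $m\ge 0$. The constant implied by $\ll$ depends only on $\varepsilon$, on the fixed integer $M$, and on the constants implied in these derivative bounds for $\varphi$; it does not depend on $T$, $V$, $R$ or the points $t_r$. *)

theory Defs
  imports "HOL-Complex_Analysis.Complex_Analysis"
begin

text \<open>
  The Riemann zeta-function as the holomorphic continuation of its Dirichlet series. By the
  identity theorem it is determined everywhere except at the pole \<open>1\<close>, where its value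
  is arbitrary.
\<close>

definition zeta :: "complex \<Rightarrow> complex" where
  "zeta = (SOME f. f holomorphic_on (- {1}) \<and>
     (\<forall>s. Re s > 1 \<longrightarrow> (\<lambda>n. 1 / of_nat (Suc n) powr s) sums f s))"

definition num_divisors :: "nat \<Rightarrow> nat" where
  "num_divisors k = card {n. n dvd k}"

text \<open>The range of summation is finite for real \<open>K\<close> and \<open>K'\<close>, which need not be integers.\<close>

definition divisor_exp_sum :: "real \<Rightarrow> real \<Rightarrow> real \<Rightarrow> complex" where
  "divisor_exp_sum K K' t =
     (\<Sum>k | K \<le> real k \<and> real k \<le> K'.
        (- 1) ^ k * of_nat (num_divisors k) * of_real (real k powr (- 1 / 4)) *
        exp (2 * \<i> * of_real (sqrt (2 * pi * real k * t)) +
             of_real (sqrt (2 * pi ^ 3) / 6) * \<i> * of_real (real k powr (3 / 2) * t powr (- 1 / 2))))"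

definition weighted_moment :: "nat \<Rightarrow> real \<Rightarrow> (real \<Rightarrow> real) \<Rightarrow> real \<Rightarrow> real \<Rightarrow> real" where
  "weighted_moment M T \<phi> K K' =
     integral {T / 2..5 * T / 2} (\<lambda>t. \<phi> t * norm (divisor_exp_sum K K' t) ^ (2 * M))"

text \<open>
  The maximum over all admissible real \<open>K \<le> X\<close> and \<open>K'\<close>. It exists because only finitely
  many sets of integers occur as range of summation. All the moments are non-negative when
  \<open>\<phi>\<close> is, so inserting \<open>0\<close> only serves to give the maximum over the empty range (\<open>X < 1\<close>)
  the value \<open>0\<close>.
\<close>

definition max_moment :: "nat \<Rightarrow> real \<Rightarrow> (real \<Rightarrow> real) \<Rightarrow> real \<Rightarrow> real" where
  "max_moment M T \<phi> X =
     Max (insert 0 {weighted_moment M T \<phi> K K' | K K'. 1 \<le> K \<and> K \<le> X \<and> K \<le> K' \<and> K' \<le> 2 * K})"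

lemma finite_moments:
  "finite {weighted_moment M T \<phi> K K' | K K'. 1 \<le> K \<and> K \<le> X \<and> K \<le> K' \<and> K' \<le> 2 * K}"
    (is "finite ?S")
proof -
  let ?g = "\<lambda>A. integral {T / 2..5 * T / 2} (\<lambda>t. \<phi> t * norm (\<Sum>k\<in>A.
        (- 1) ^ k * of_nat (num_divisors k) * of_real (real k powr (- 1 / 4)) *
        exp (2 * \<i> * of_real (sqrt (2 * pi * real k * t)) +
             of_real (sqrt (2 * pi ^ 3) / 6) * \<i> * of_real (real k powr (3 / 2) * t powr (- 1 / 2)))
        :: complex) ^ (2 * M))"
  have "?S \<subseteq> ?g ` Pow {k. k \<le> nat \<lfloor>2 * X\<rfloor>}"
  proof
    fix y assume "y \<in> ?S"
    then obtain K K' where K: "y = weighted_moment M T \<phi> K K'" "K \<le> X" "K' \<le> 2 * K"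
      by blast
    have "{k. K \<le> real k \<and> real k \<le> K'} \<in> Pow {k. k \<le> nat \<lfloor>2 * X\<rfloor>}"
      using K by (auto simp: le_nat_floor)
    moreover have "y = ?g {k. K \<le> real k \<and> real k \<le> K'}"
      by (simp add: K weighted_moment_def divisor_exp_sum_def)
    ultimately show "y \<in> ?g ` Pow {k. k \<le> nat \<lfloor>2 * X\<rfloor>}"
      by (rule rev_image_eqI)
  qed
  then show ?thesis
    by (rule finite_subset) simp
qed

text \<open>The sequence \<open>A\<close> collects the constants implied in the derivative bounds.\<close>

definition smooth_weight :: "(nat \<Rightarrow> real) \<Rightarrow> real \<Rightarrow> (real \<Rightarrow> real) \<Rightarrow> bool" where
  "smooth_weight A T \<phi> \<longleftrightarrow>
     (\<forall>m t. (deriv ^^ m) \<phi> field_differentiable at t) \<and>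
     (\<forall>t. \<phi> t \<ge> 0) \<and>
     (\<forall>t. t \<notin> {T / 2..5 * T / 2} \<longrightarrow> \<phi> t = 0) \<and>
     (\<forall>t\<in>{T..2 * T}. \<phi> t = 1) \<and>
     (\<forall>m t. \<bar>(deriv ^^ m) \<phi> t\<bar> \<le> A m * T powr (- real m))"

end

theory Submission
  imports Defs
begin

text \<open>
  Averaging \<open>zeta\<close> over a window of length \<open>G\<close>, slightly less than \<open>V^2\<close>, against a Fejer kernel leads to the
  form \<open>pform N G t\<close>, the sum of \<open>(m * n) powr (- 1 / 2) * cos (t * ln (n / m))\<close> over \<open>m, n \<le> N\<close> with weight
  \<open>max 0 (1 - G * \<bar>ln (n / m)\<bar>)\<close>. Poisson summation along the diagonals \<open>n - m = s\<close>, followed by stationary phase,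
  turns it into a divisor sum \<open>S t\<close> of length about \<open>T / G^2\<close> with the phase of \<open>divisor_exp_sum\<close>, up to powers of
  \<open>ln T\<close>. Because the Fejer kernel and its translate by \<open>pi\<close> have no common zeros, the number of points \<open>t r\<close> within
  \<open>G\<close> of \<open>\<tau>\<close> is at most \<open>\<bar>S \<tau>\<bar> + \<bar>S (\<tau> + pi * G)\<bar>\<close>. Raising this to the power \<open>2 * M\<close> and integrating over
  \<open>\<tau>\<close> bounds \<open>R * G\<close> by the \<open>2 * M\<close>-th moment of \<open>S\<close>, from which the smooth weights are removed by partial
  summation over dyadic blocks. If \<open>V\<close> exceeds \<open>T powr (1 / 4)\<close> by a small power, \<open>S\<close> is empty and there are no points.
\<close>

section \<open>Oscillatory integrals\<close>

text \<open>A Dirichlet polynomial of length about \<open>T^2 / G\<close> approximates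
  \<open>zeta\<close> on the critical line up to a multiple of \<open>sqrt G\<close>, so
  \<open>G\<close> must stay below the square of the large values by a power of \<open>T\<close>;
  hence \<open>G = U^2 * T powr (- \<eta>)\<close>. Summing the squares over the points of one
  window costs a factor \<open>G\<close>, which cancels against the square of the large value and
  leaves the surplus \<open>T powr (\<eta> / 2)\<close>. The surplus absorbs all logarithms, and it
  pushes the contribution of the non-oscillating terms below 1/2. As the number of points is an
  integer, it is then bounded by the divisor sums alone, with no constant term that high moments
  could not remove. The Fejer kernel is chosen for its compactly supported Fourier transform: the
  amplitude is cut off exactly at \<open>w = 1 / G\<close>, so the divisor sum is finite. The price
  is a corner at the cutoff; therefore the oscillatory estimates use one derivative only and allow a
  finite exceptional set, which costs a logarithm. Frequency 0 of the Poisson formula needs separate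
  care: there the diagonals are summed before integrating (\<open>zero_frequency\<close>).\<close>

lemma norm_integral_cis_le:
  fixes Q Q' :: "real \<Rightarrow> complex" and \<theta> \<theta>' g :: "real \<Rightarrow> real"
  assumes "a \<le> b" "finite S" "continuous_on {a..b} Q" "continuous_on {a..b} \<theta>'"
    and Q: "\<And>x. x \<in> {a<..<b} - S \<Longrightarrow> (Q has_vector_derivative Q' x) (at x)"
    and \<theta>: "\<And>x. x \<in> {a..b} \<Longrightarrow> (\<theta> has_real_derivative \<theta>' x) (at x)"
    and g: "\<And>x. x \<in> {a<..<b} - S \<Longrightarrow> norm (Q' x) \<le> g x"
    and g0: "\<And>x. x \<in> {a..b} \<Longrightarrow> 0 \<le> g x"
    and I: "(g has_integral I) {a..b}"
  shows "norm (integral {a..b} (\<lambda>x. Q x * of_real (\<theta>' x) * cis (\<theta> x))) \<le> norm (Q a) + norm (Q b) + I"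
proof -
  \<comment> \<open>Integration by parts as the fundamental theorem for \<open>F\<close>, whose
    derivative is \<open>Q * \<theta>' * cis \<theta>\<close> plus
    \<open>- \<i> * Q' * cis \<theta>\<close>. The second summand is \<open>h\<close>, set to 0 on
    \<open>S\<close>, where no derivative is given.\<close>
  define F where "F = (\<lambda>x. - \<i> * Q x * cis (\<theta> x))"
  define G where "G = (\<lambda>x. Q x * of_real (\<theta>' x) * cis (\<theta> x))"
  define h where "h = (\<lambda>x. if x \<in> {a<..<b} - S then - \<i> * Q' x * cis (\<theta> x) else 0)"
  have c\<theta>: "continuous_on {a..b} \<theta>"
    by (meson DERIV_isCont \<theta> continuous_at_imp_continuous_on)
  have cF: "continuous_on {a..b} F"
    unfolding F_def cis_conv_exp using assms c\<theta> by (intro continuous_intros)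
  have cG: "continuous_on {a..b} G"
    unfolding G_def cis_conv_exp using assms c\<theta> by (intro continuous_intros)
  have "(F has_vector_derivative (G x + h x)) (at x)" if "x \<in> {a<..<b} - S" for x
  proof -
    have e: "((\<lambda>x. cis (\<theta> x)) has_vector_derivative (\<i> * of_real (\<theta>' x) * cis (\<theta> x))) (at x)"
      using has_derivative_cis[OF has_field_derivative_imp_has_derivative[OF \<theta>[of x]]] that
      by (simp add: has_vector_derivative_def scaleR_conv_of_real mult_ac)
    have "(F has_vector_derivative (- \<i> * Q x * (\<i> * of_real (\<theta>' x) * cis (\<theta> x)) + - \<i> * Q' x * cis (\<theta> x))) (at x)"
      unfolding F_def
      by (rule has_vector_derivative_mult[OF has_vector_derivative_mult_right[OF Q[OF that]] e])
    moreover have "- \<i> * Q x * (\<i> * of_real (\<theta>' x) * cis (\<theta> x)) + - \<i> * Q' x * cis (\<theta> x) = G x + h x"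
    proof -
      have "- \<i> * Q x * (\<i> * of_real (\<theta>' x) * cis (\<theta> x)) = - (\<i> * \<i>) * (Q x * of_real (\<theta>' x) * cis (\<theta> x))"
        by (simp only: mult_ac minus_mult_left[symmetric] minus_mult_right[symmetric])
      then show ?thesis
        using that by (simp add: G_def h_def)
    qed
    ultimately show ?thesis
      by simp
  qed
  then have "((\<lambda>x. G x + h x) has_integral F b - F a) {a..b}"
    by (intro fundamental_theorem_of_calculus_interior_strong[OF assms(2,1) _ cF])
  moreover have "(G has_integral integral {a..b} G) {a..b}"
    using cG integrable_continuous_real by blast
  ultimately have h: "(h has_integral (F b - F a - integral {a..b} G)) {a..b}"
    using has_integral_diff[of "\<lambda>x. G x + h x" _ "{a..b}" G] by simp
  have "norm (F b - F a - integral {a..b} G) \<le> I"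
  proof -
    have "norm (integral {a..b} h) \<le> integral {a..b} g"
      by (rule integral_norm_bound_integral)
        (use h I g g0 in \<open>auto simp: h_def norm_mult\<close>)
    then show ?thesis using h I by (simp add: integral_unique)
  qed
  then have "norm (integral {a..b} G) \<le> norm (F b) + norm (F a) + I"
    by (smt (verit) norm_minus_commute norm_triangle_ineq4 norm_triangle_sub)
  then show ?thesis
    by (simp add: G_def F_def norm_mult)
qed

section \<open>The Fresnel integral\<close>

lemma fresnel_tail:
  assumes "0 < q" "q \<le> r"
  shows "norm (integral {q..r} (\<lambda>x. cis (x\<^sup>2))) \<le> 1 / q"
proof -
  have d: "((\<lambda>x. 1 / (2 * x)) has_real_derivative (- (1 / (2 * x\<^sup>2)))) (at x)" if "x > 0" for x :: real
    using that by (auto intro!: derivative_eq_intros simp: power2_eq_square)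
  \<comment> \<open>The constant amplitude 1 is written as \<open>1 / (2 * x)\<close> times the
    phase derivative \<open>2 * x\<close>.\<close>
  have "norm (integral {q..r} (\<lambda>x. of_real (1 / (2 * x)) * of_real (2 * x) * cis (x\<^sup>2)))
     \<le> norm (of_real (1 / (2 * q)) :: complex) + norm (of_real (1 / (2 * r)) :: complex) + (1 / (2 * q) - 1 / (2 * r))"
  proof (rule norm_integral_cis_le[where S = "{}" and Q' = "\<lambda>x. of_real (- (1 / (2 * x\<^sup>2)))" and g = "\<lambda>x. 1 / (2 * x\<^sup>2)"])
    show "continuous_on {q..r} (\<lambda>x. complex_of_real (1 / (2 * x)))"
      using assms by (intro continuous_intros) auto
    show "((\<lambda>x. complex_of_real (1 / (2 * x))) has_vector_derivative complex_of_real (- (1 / (2 * x\<^sup>2)))) (at x)"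
      if "x \<in> {q<..<r} - {}" for x
      using d[of x] assms that
      by (intro has_vector_derivative_of_real) (simp add: has_real_derivative_iff_has_vector_derivative)
    have "((\<lambda>x. - (1 / (2 * x\<^sup>2))) has_integral (1 / (2 * r) - 1 / (2 * q))) {q..r}"
      using d assms by (intro fundamental_theorem_of_calculus)
        (auto simp: has_real_derivative_iff_has_vector_derivative intro: has_vector_derivative_at_within)
    from has_integral_neg[OF this]
    show "((\<lambda>x. 1 / (2 * x\<^sup>2)) has_integral (1 / (2 * q) - 1 / (2 * r))) {q..r}"
      by simp
    show "((\<lambda>x. x\<^sup>2) has_real_derivative 2 * x) (at x)" for x :: real
      by (auto intro!: derivative_eq_intros)
    show "continuous_on {q..r} (\<lambda>x. 2 * x)"
      by (intro continuous_intros)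
    show "norm (complex_of_real (- (1 / (2 * x\<^sup>2)))) \<le> 1 / (2 * x\<^sup>2)" for x
      by (simp only: norm_of_real) simp
  qed (use assms in simp_all)
  also have "integral {q..r} (\<lambda>x. of_real (1 / (2 * x)) * of_real (2 * x) * cis (x\<^sup>2)) = integral {q..r} (\<lambda>x. cis (x\<^sup>2))"
  proof (rule integral_cong)
    fix x assume "x \<in> {q..r}"
    then have "complex_of_real (1 / (2 * x)) * of_real (2 * x) = of_real 1"
      using assms unfolding of_real_mult[symmetric] by (intro arg_cong[of _ _ of_real]) simp
    then show "complex_of_real (1 / (2 * x)) * of_real (2 * x) * cis (x\<^sup>2) = cis (x\<^sup>2)"
      by (simp only: of_real_1 mult_1)
  qed
  also have "norm (of_real (1 / (2 * q)) :: complex) + norm (of_real (1 / (2 * r)) :: complex) + (1 / (2 * q) - 1 / (2 * r)) = 1 / q"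
    using assms by (simp only: norm_of_real) simp
  finally show ?thesis .
qed

text \<open>By \<open>fresnel_tail\<close> the integrals over \<open>{0..n}\<close> form a Cauchy
  sequence; reflection doubles both the limit and the error. The rate \<open>2 / q\<close> becomes
  the error of order \<open>1 / \<mu>\<close> at a saddle.\<close>

lemma fresnel:
  obtains F :: complex where "\<And>q. q > 0 \<Longrightarrow> norm (integral {-q..q} (\<lambda>x. cis (x\<^sup>2)) - F) \<le> 2 / q"
proof -
  define I where "I = (\<lambda>q. integral {0..q} (\<lambda>x. cis (x\<^sup>2)))"
  have int: "(\<lambda>x. cis (x\<^sup>2)) integrable_on {a..b}" for a b :: real
    by (intro integrable_continuous_real continuous_intros)
  have I_diff: "norm (I r - I q) \<le> 1 / q" if "0 < q" "q \<le> r" for q r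
  proof -
    have "I q + integral {q..r} (\<lambda>x. cis (x\<^sup>2)) = I r"
      unfolding I_def using that int by (intro Henstock_Kurzweil_Integration.integral_combine) auto
    then have "I r - I q = integral {q..r} (\<lambda>x. cis (x\<^sup>2))" by (simp add: algebra_simps)
    then show ?thesis using fresnel_tail[OF that] by simp
  qed
  have "Cauchy (\<lambda>n. I (real n))"
  proof (rule CauchyI')
    fix e :: real assume "e > 0"
    obtain m :: nat where m: "1 / e < real m" using reals_Archimedean2 by blast
    show "\<exists>M. \<forall>m\<ge>M. \<forall>n>m. dist (I (real m)) (I (real n)) < e"
    proof (intro exI[of _ m] allI impI)
      fix i j assume ij: "i \<ge> m" "j > i"
      have mpos: "real m > 0" using m \<open>e > 0\<close> by (smt (verit) divide_pos_pos)
      have "dist (I (real i)) (I (real j)) \<le> 1 / real i"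
        using I_diff[of "real i" "real j"] ij mpos by (simp add: dist_norm norm_minus_commute)
      also have "\<dots> \<le> 1 / real m" using ij mpos by (intro divide_left_mono) auto
      also have "\<dots> < e" using m mpos \<open>e > 0\<close> by (simp add: field_simps)
      finally show "dist (I (real i)) (I (real j)) < e" .
    qed
  qed
  then obtain L where L: "(\<lambda>n. I (real n)) \<longlonglongrightarrow> L"
    using Cauchy_convergent_iff convergentD by blast
  have IL: "norm (I q - L) \<le> 1 / q" if "q > 0" for q
  proof -
    have "(\<lambda>n. norm (I (real n) - I q)) \<longlonglongrightarrow> norm (L - I q)"
      by (intro tendsto_intros L)
    moreover have "eventually (\<lambda>n. norm (I (real n) - I q) \<le> 1 / q) sequentially"
      using eventually_ge_at_top[of "nat \<lceil>q\<rceil>"]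
    proof eventually_elim
      case (elim n)
      then have "q \<le> real n" by linarith
      then show ?case using I_diff[OF that] by blast
    qed
    ultimately have "norm (L - I q) \<le> 1 / q"
      by (rule tendsto_upperbound) auto
    then show ?thesis by (simp add: norm_minus_commute)
  qed
  show ?thesis
  proof (rule that[of "2 * L"])
    fix q :: real assume q: "q > 0"
    have "integral {-q..0} (\<lambda>x. cis (x\<^sup>2)) = I q"
    proof -
      have "integral {-q..-0} (\<lambda>x. (\<lambda>x. cis (x\<^sup>2)) (- x)) = integral {0..q} (\<lambda>x. cis (x\<^sup>2))"
        by (rule Henstock_Kurzweil_Integration.integral_reflect_real)
      then show ?thesis by (simp only: I_def power2_minus minus_zero)
    qed
    moreover have "integral {-q..0} (\<lambda>x. cis (x\<^sup>2)) + I q = integral {-q..q} (\<lambda>x. cis (x\<^sup>2))"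
      unfolding I_def using q by (intro Henstock_Kurzweil_Integration.integral_combine int) simp_all
    ultimately have "integral {-q..q} (\<lambda>x. cis (x\<^sup>2)) - 2 * L = 2 * (I q - L)"
      by (simp only: mult_2 right_diff_distrib flip: mult_2)
    then have "norm (integral {-q..q} (\<lambda>x. cis (x\<^sup>2)) - 2 * L) = norm (2 * (I q - L))"
      by (rule arg_cong)
    also have "\<dots> = 2 * norm (I q - L)"
      by (simp only: norm_mult) simp
    finally have "norm (integral {-q..q} (\<lambda>x. cis (x\<^sup>2)) - 2 * L) = 2 * norm (I q - L)" .
    then show "norm (integral {-q..q} (\<lambda>x. cis (x\<^sup>2)) - 2 * L) \<le> 2 / q"
      using IL[OF q] by simp
  qed
qed

section \<open>Stationary phase for the model phase x + 1/x\<close>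

lemma saddle_off_le:
  fixes R R' :: "real \<Rightarrow> complex" and g :: "real \<Rightarrow> real"
  assumes "0 < p" "p \<le> q" "1 \<notin> {p..q}" "finite S" "continuous_on {p..q} R" "\<mu> > 0"
    and R: "\<And>x. x \<in> {p<..<q} - S \<Longrightarrow> (R has_vector_derivative R' x) (at x)"
    and g: "\<And>x. x \<in> {p<..<q} - S \<Longrightarrow> norm (R' x) * (x\<^sup>2 / \<bar>x\<^sup>2 - 1\<bar>) + norm (R x) * (2 * x / (x\<^sup>2 - 1)\<^sup>2) \<le> g x"
    and g0: "\<And>x. x \<in> {p..q} \<Longrightarrow> 0 \<le> g x"
    and I: "(g has_integral I) {p..q}"
  shows "norm (integral {p..q} (\<lambda>x. R x * cis (\<mu> * (x + 1 / x)))) \<le>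
    (norm (R p) * (p\<^sup>2 / \<bar>p\<^sup>2 - 1\<bar>) + norm (R q) * (q\<^sup>2 / \<bar>q\<^sup>2 - 1\<bar>) + I) / \<mu>"
proof -
  \<comment> \<open>\<open>k x / \<mu>\<close> is the reciprocal of the phase derivative
    \<open>\<mu> * (1 - 1 / x\<^sup>2)\<close>. On the positive axis it is singular only at the
    saddle 1, which \<open>{p..q}\<close> avoids.\<close>
  define k where "k = (\<lambda>x::real. x\<^sup>2 / (x\<^sup>2 - 1))"
  define Q where "Q = (\<lambda>x. R x * of_real (k x / \<mu>))"
  define Q' where "Q' = (\<lambda>x. R x * of_real (- (2 * x / (x\<^sup>2 - 1)\<^sup>2) / \<mu>) + R' x * of_real (k x / \<mu>))"
  have ne: "x\<^sup>2 - 1 \<noteq> 0" "x > 0" if "x \<in> {p..q}" for x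
  proof -
    show "x > 0" using that assms by auto
    moreover have "x \<noteq> 1" using that assms by auto
    ultimately show "x\<^sup>2 - 1 \<noteq> 0" by (auto simp: power2_eq_1_iff)
  qed
  have dk: "(k has_real_derivative (- (2 * x / (x\<^sup>2 - 1)\<^sup>2))) (at x)" if "x \<in> {p..q}" for x
  proof -
    have "(k has_real_derivative ((2 * x * (x\<^sup>2 - 1) - x\<^sup>2 * (2 * x)) / ((x\<^sup>2 - 1) * (x\<^sup>2 - 1)))) (at x)"
      unfolding k_def using ne[OF that] by (auto intro!: derivative_eq_intros)
    moreover have "(2 * x * (x\<^sup>2 - 1) - x\<^sup>2 * (2 * x)) / ((x\<^sup>2 - 1) * (x\<^sup>2 - 1)) = - (2 * x / (x\<^sup>2 - 1)\<^sup>2)"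
      by (simp add: power2_eq_square algebra_simps)
    ultimately show ?thesis by simp
  qed
  have ck: "continuous_on {p..q} (\<lambda>x. k x / \<mu>)"
    unfolding k_def using ne assms(6) by (intro continuous_intros) auto
  have main: "norm (integral {p..q} (\<lambda>x. Q x * of_real (\<mu> * (1 - 1 / x\<^sup>2)) * cis (\<mu> * (x + 1 / x)))) \<le>
    norm (Q p) + norm (Q q) + I / \<mu>"
  proof (rule norm_integral_cis_le[where S = S and Q' = Q' and g = "\<lambda>x. g x / \<mu>"])
    show "continuous_on {p..q} Q"
      unfolding Q_def by (rule continuous_on_mult[OF assms(5) continuous_on_of_real[OF ck]])
    show "continuous_on {p..q} (\<lambda>x. \<mu> * (1 - 1 / x\<^sup>2))"
      using ne by (intro continuous_intros) (auto dest: ne(2))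
    show "(Q has_vector_derivative Q' x) (at x)" if "x \<in> {p<..<q} - S" for x
      unfolding Q_def Q'_def
    proof (rule has_vector_derivative_mult[OF R[OF that]])
      have "((\<lambda>x. k x / \<mu>) has_real_derivative - (2 * x / (x\<^sup>2 - 1)\<^sup>2) / \<mu>) (at x)"
        using dk[of x] that by (intro DERIV_cdivide) auto
      then show "((\<lambda>x. complex_of_real (k x / \<mu>)) has_vector_derivative complex_of_real (- (2 * x / (x\<^sup>2 - 1)\<^sup>2) / \<mu>)) (at x)"
        by (rule has_vector_derivative_of_real)
    qed
    show "((\<lambda>x. \<mu> * (x + 1 / x)) has_real_derivative \<mu> * (1 - 1 / x\<^sup>2)) (at x)" if "x \<in> {p..q}" for x
      using ne(2)[OF that] by (auto intro!: derivative_eq_intros simp: power2_eq_square)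
    show "norm (Q' x) \<le> g x / \<mu>" if "x \<in> {p<..<q} - S" for x
    proof -
      have "norm (Q' x) \<le> norm (R x) * \<bar>- (2 * x / (x\<^sup>2 - 1)\<^sup>2) / \<mu>\<bar> + norm (R' x) * \<bar>k x / \<mu>\<bar>"
        unfolding Q'_def by (intro norm_triangle_le add_mono) (simp_all only: norm_mult norm_of_real order_refl)
      also have "\<dots> = (norm (R' x) * (x\<^sup>2 / \<bar>x\<^sup>2 - 1\<bar>) + norm (R x) * (2 * x / (x\<^sup>2 - 1)\<^sup>2)) / \<mu>"
        using assms(6) ne(2)[of x] that by (simp add: k_def abs_mult abs_divide add_divide_distrib)
      also have "\<dots> \<le> g x / \<mu>"
        using g[OF that] assms(6) by (intro divide_right_mono) auto
      finally show ?thesis .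
    qed
    show "((\<lambda>x. g x / \<mu>) has_integral I / \<mu>) {p..q}"
      using I by (rule has_integral_divide)
  qed (use assms g0 in auto)
  have "integral {p..q} (\<lambda>x. R x * cis (\<mu> * (x + 1 / x))) =
    integral {p..q} (\<lambda>x. Q x * of_real (\<mu> * (1 - 1 / x\<^sup>2)) * cis (\<mu> * (x + 1 / x)))"
  proof (rule integral_cong)
    fix x assume x: "x \<in> {p..q}"
    have "k x / \<mu> * (\<mu> * (1 - 1 / x\<^sup>2)) = 1"
    proof -
      have "1 - 1 / x\<^sup>2 = (x\<^sup>2 - 1) / x\<^sup>2"
        using ne[OF x] by (simp add: diff_divide_distrib)
      then show ?thesis
        using ne[OF x] assms(6) by (simp add: k_def)
    qed
    then have "complex_of_real (k x / \<mu>) * of_real (\<mu> * (1 - 1 / x\<^sup>2)) = 1"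
      unfolding of_real_mult[symmetric] by (simp only: of_real_1)
    then show "R x * cis (\<mu> * (x + 1 / x)) = Q x * of_real (\<mu> * (1 - 1 / x\<^sup>2)) * cis (\<mu> * (x + 1 / x))"
      unfolding Q_def by (simp only: mult.assoc mult_1_left)
  qed
  also have "norm \<dots> \<le> norm (Q p) + norm (Q q) + I / \<mu>" by (rule main)
  also have "\<dots> = (norm (R p) * (p\<^sup>2 / \<bar>p\<^sup>2 - 1\<bar>) + norm (R q) * (q\<^sup>2 / \<bar>q\<^sup>2 - 1\<bar>) + I) / \<mu>"
    unfolding Q_def norm_mult norm_of_real using assms(6)
    by (simp add: k_def abs_divide add_divide_distrib abs_mult)
  finally show ?thesis .
qed

text \<open>Obtained by integrating the derivative, so that the points of \<open>S\<close> may be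
  ignored.\<close>

lemma norm_diff_le_of_derivative:
  fixes f f' :: "real \<Rightarrow> complex"
  assumes "a \<le> b" "finite S" "continuous_on {a..b} f"
    and "\<And>x. x \<in> {a<..<b} - S \<Longrightarrow> (f has_vector_derivative f' x) (at x)"
    and "\<And>x. x \<in> {a<..<b} - S \<Longrightarrow> norm (f' x) \<le> B" "0 \<le> B"
  shows "norm (f b - f a) \<le> B * (b - a)"
proof -
  define h where "h = (\<lambda>x. if x \<in> {a<..<b} - S then f' x else 0)"
  have "(h has_integral f b - f a) {a..b}"
    by (rule fundamental_theorem_of_calculus_interior_strong[OF assms(2,1) _ assms(3)])
      (use assms(4) in \<open>simp add: h_def\<close>)
  moreover have "norm (h x) \<le> B" for x
    using assms by (simp add: h_def)
  ultimately show ?thesis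
    using has_integral_bound[of B h "f b - f a" a b] assms by (simp add: content_real mult.commute)
qed

text \<open>The derivative of \<open>sqrt x - 1 / sqrt x\<close>, whose square is
  \<open>x + 1 / x - 2\<close>. With this amplitude the model integral is exactly a Fresnel
  integral, and the value at the saddle is 1, so it can be subtracted from an arbitrary
  amplitude.\<close>

definition saddle_weight :: "real \<Rightarrow> real" where
  "saddle_weight x = (x powr (-1/2) + x powr (-3/2)) / 2"

lemma saddle_weight_1: "saddle_weight 1 = 1"
  by (simp add: saddle_weight_def)

lemma continuous_on_saddle_weight: "0 < a \<Longrightarrow> continuous_on {a..b} saddle_weight"
  unfolding saddle_weight_def by (intro continuous_intros) auto

lemma saddle_weight_deriv:
  "x > 0 \<Longrightarrow> (saddle_weight has_real_derivative (- (x powr (-3/2) + 3 * x powr (-5/2)) / 4)) (at x)"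
  unfolding saddle_weight_def
  by (auto intro!: derivative_eq_intros simp: field_simps)

lemma powr_ge_half_le:
  assumes "1 / 2 \<le> x" "0 \<le> k" "k \<le> real n"
  shows "x powr (- k) \<le> 2 ^ n"
proof -
  have "x powr (- k) \<le> (1/2) powr (- k)"
    using assms by (intro powr_mono2') auto
  also have "\<dots> = 2 powr k"
    by (simp add: powr_divide powr_minus)
  also have "\<dots> \<le> 2 powr real n"
    using assms by (intro powr_mono) auto
  finally show ?thesis by (simp add: powr_realpow)
qed

text \<open>The substitution \<open>q = sqrt x - 1 / sqrt x\<close> maps \<open>{1/2..2}\<close>
  onto an interval symmetric about 0, the image of the saddle; this is why the range is cut at 1/2
  and 2. Rescaling by \<open>sqrt \<mu>\<close> leaves only the Fresnel tail,
  \<open>2 * sqrt 2 / \<mu>\<close>.\<close>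

lemma integral_saddle_weight:
  assumes F: "\<And>q. q > 0 \<Longrightarrow> norm (integral {-q..q} (\<lambda>x. cis (x\<^sup>2)) - F) \<le> 2 / q"
    and "\<mu> > 0"
  shows "norm (integral {1/2..2} (\<lambda>x. saddle_weight x *\<^sub>R cis (\<mu> * (x + 1 / x))) - F * cis (2 * \<mu>) / sqrt \<mu>) \<le> 3 / \<mu>"
proof -
  define p where "p = (\<lambda>x::real. sqrt x - 1 / sqrt x)"
  define P :: real where "P = 1 / sqrt 2"
  have s: "s - 1 / s = 1 / s" if "s * s = 2" for s :: real
  proof -
    have "s \<noteq> 0" using that by auto
    then have "s - 1 / s = (s * s - 1) / s" by (simp add: field_simps)
    then show ?thesis using that by simp
  qed
  have p2: "p 2 = P"
    using s[of "sqrt 2"] by (simp add: p_def P_def)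
  have phalf: "p (1/2) = - P"
    using s[of "sqrt 2"] by (simp add: p_def P_def real_sqrt_divide)
  have dp: "(p has_real_derivative saddle_weight x) (at x)" if "x > 0" for x
  proof -
    have "(p has_real_derivative (inverse (sqrt x) / 2 + inverse (sqrt x) / 2 / (sqrt x * sqrt x))) (at x)"
    proof -
      have d: "(sqrt has_real_derivative inverse (sqrt x) / 2) (at x)"
        using that by (rule DERIV_real_sqrt)
      have "(p has_real_derivative (inverse (sqrt x) / 2 - (0 * sqrt x - 1 * (inverse (sqrt x) / 2)) / (sqrt x * sqrt x))) (at x)"
        unfolding p_def using that by (intro DERIV_diff d DERIV_divide DERIV_const) auto
      then show ?thesis by simp
    qed
    also have "inverse (sqrt x) / 2 + inverse (sqrt x) / 2 / (sqrt x * sqrt x) = saddle_weight x"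
    proof -
      have "x powr (-1/2) = inverse (sqrt x)"
        using that by (simp add: powr_minus powr_half_sqrt)
      moreover have "x powr (-3/2) = x powr (-1/2) * x powr (-1)"
        unfolding powr_add[symmetric] by simp
      moreover have "x powr (-1) = 1 / x"
        using that by (simp add: powr_minus divide_inverse)
      ultimately show ?thesis
        using that by (simp add: saddle_weight_def)
    qed
    finally show ?thesis .
  qed
  have pm: "p (1/2) \<le> p x" "p x \<le> p 2" if "x \<in> {1/2..2}" for x
  proof -
    have "p x \<le> p y" if "0 < x" "x \<le> y" for x y
      unfolding p_def using that by (intro diff_mono divide_left_mono) auto
    then show "p (1/2) \<le> p x" "p x \<le> p 2" using that by auto
  qed
  have 1: "((\<lambda>x. saddle_weight x *\<^sub>R (\<lambda>q. cis (\<mu> * q\<^sup>2)) (p x)) has_integral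
     integral {p (1/2)..p 2} (\<lambda>q. cis (\<mu> * q\<^sup>2))) {1/2..2}"
    by (rule has_integral_substitution[of _ _ _ "p (1/2)" "p 2"])
      (use pm dp in \<open>auto intro!: continuous_intros intro: DERIV_subset has_field_derivative_at_within\<close>)
  have 2: "((\<lambda>q. sqrt \<mu> *\<^sub>R (\<lambda>q. cis (q\<^sup>2)) (sqrt \<mu> * q)) has_integral
     integral {sqrt \<mu> * (-P)..sqrt \<mu> * P} (\<lambda>q. cis (q\<^sup>2))) {-P..P}"
    by (rule has_integral_substitution[of _ _ _ "sqrt \<mu> * (-P)" "sqrt \<mu> * P"])
      (use \<open>\<mu> > 0\<close> in \<open>auto simp: P_def intro!: continuous_intros derivative_eq_intros divide_right_mono mult_left_mono\<close>)
  have sm: "sqrt \<mu> > 0" "sqrt \<mu> * sqrt \<mu> = \<mu>" using \<open>\<mu> > 0\<close> by auto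
  have 3: "integral {-P..P} (\<lambda>q. cis (\<mu> * q\<^sup>2)) = integral {- (sqrt \<mu> * P)..sqrt \<mu> * P} (\<lambda>q. cis (q\<^sup>2)) /\<^sub>R sqrt \<mu>"
  proof -
    have "((\<lambda>q. sqrt \<mu> *\<^sub>R cis (\<mu> * q\<^sup>2)) has_integral integral {- (sqrt \<mu> * P)..sqrt \<mu> * P} (\<lambda>q. cis (q\<^sup>2))) {-P..P}"
      using 2 sm by (simp add: power_mult_distrib)
    from has_integral_cmul[OF this, of "inverse (sqrt \<mu>)"] show ?thesis
      using sm by (simp add: integral_unique)
  qed
  have ph: "(p x)\<^sup>2 = x + 1 / x - 2" if "x > 0" for x
    using that by (simp add: p_def power2_diff power_divide)
  have 4: "integral {1/2..2} (\<lambda>x. saddle_weight x *\<^sub>R cis (\<mu> * (x + 1 / x))) =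
    cis (2 * \<mu>) * integral {-P..P} (\<lambda>q. cis (\<mu> * q\<^sup>2))"
  proof -
    have "((\<lambda>x. cis (2 * \<mu>) * (saddle_weight x *\<^sub>R cis (\<mu> * (p x)\<^sup>2))) has_integral
      cis (2 * \<mu>) * integral {-P..P} (\<lambda>q. cis (\<mu> * q\<^sup>2))) {1/2..2}"
      using has_integral_mult_right[OF 1] by (simp only: p2 phalf)
    then have "integral {1/2..2} (\<lambda>x. cis (2 * \<mu>) * (saddle_weight x *\<^sub>R cis (\<mu> * (p x)\<^sup>2))) =
      cis (2 * \<mu>) * integral {-P..P} (\<lambda>q. cis (\<mu> * q\<^sup>2))"
      by (rule integral_unique)
    moreover have "integral {1/2..2} (\<lambda>x. saddle_weight x *\<^sub>R cis (\<mu> * (x + 1 / x))) =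
      integral {1/2..2} (\<lambda>x. cis (2 * \<mu>) * (saddle_weight x *\<^sub>R cis (\<mu> * (p x)\<^sup>2)))"
    proof (rule integral_cong)
      fix x :: real assume "x \<in> {1/2..2}"
      then have "\<mu> * (x + 1 / x) = 2 * \<mu> + \<mu> * (p x)\<^sup>2"
        by (simp add: ph algebra_simps)
      then show "saddle_weight x *\<^sub>R cis (\<mu> * (x + 1 / x)) = cis (2 * \<mu>) * (saddle_weight x *\<^sub>R cis (\<mu> * (p x)\<^sup>2))"
        by (simp only: cis_mult[symmetric] mult_scaleR_right)
    qed
    ultimately show ?thesis by simp
  qed
  have "integral {1/2..2} (\<lambda>x. saddle_weight x *\<^sub>R cis (\<mu> * (x + 1 / x))) - F * cis (2 * \<mu>) / sqrt \<mu> =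
    cis (2 * \<mu>) * of_real (1 / sqrt \<mu>) * (integral {- (sqrt \<mu> * P)..sqrt \<mu> * P} (\<lambda>q. cis (q\<^sup>2)) - F)"
    unfolding 4 3 by (simp add: scaleR_conv_of_real divide_inverse right_diff_distrib mult_ac)
  also have "norm \<dots> = norm (integral {- (sqrt \<mu> * P)..sqrt \<mu> * P} (\<lambda>q. cis (q\<^sup>2)) - F) / sqrt \<mu>"
    unfolding norm_mult norm_of_real using sm by simp
  also have "\<dots> \<le> (2 / (sqrt \<mu> * P)) / sqrt \<mu>"
    using sm by (intro divide_right_mono F) (auto simp: P_def)
  also have "\<dots> = 2 * sqrt 2 / \<mu>"
    using sm by (simp add: P_def field_simps)
  also have "\<dots> \<le> 3 / \<mu>"
  proof -
    have "sqrt 2 \<le> 3 / 2" by (rule real_le_lsqrt) (auto simp: power2_eq_square)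
    then show ?thesis using \<open>\<mu> > 0\<close> by (intro divide_right_mono) auto
  qed
  finally show ?thesis .
qed

lemma saddle_quotient_le1:
  fixes x :: real
  assumes "0 < x" "x \<le> 2" "x \<noteq> 1"
  shows "x\<^sup>2 / \<bar>x\<^sup>2 - 1\<bar> \<le> (4/3) / \<bar>x - 1\<bar>"
proof -
  have f: "\<bar>x\<^sup>2 - 1\<bar> = \<bar>x - 1\<bar> * (x + 1)"
    using assms by (simp add: power2_eq_square square_diff_one_factored abs_mult)
  have "3 * x\<^sup>2 \<le> 4 * x + 4"
    using mult_nonneg_nonneg[of "3 * x + 2" "2 - x"] assms by (simp add: power2_eq_square algebra_simps)
  then have "x\<^sup>2 / (x + 1) \<le> 4 / 3" using assms by (simp add: field_simps)
  then have "x\<^sup>2 / (x + 1) / \<bar>x - 1\<bar> \<le> (4/3) / \<bar>x - 1\<bar>" by (rule divide_right_mono) simp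
  then show ?thesis by (simp add: f mult.commute)
qed

lemma saddle_quotient_le2:
  fixes x :: real
  assumes "0 < x" "x \<noteq> 1"
  shows "2 * x / (x\<^sup>2 - 1)\<^sup>2 \<le> 1 / \<bar>x - 1\<bar>\<^sup>2"
proof -
  have f: "(x\<^sup>2 - 1)\<^sup>2 = (x + 1)\<^sup>2 * (x - 1)\<^sup>2"
    by (simp add: power2_eq_square algebra_simps)
  have "2 * x \<le> (x + 1)\<^sup>2"
    using assms by (simp add: power2_sum)
  then have "2 * x / (x + 1)\<^sup>2 \<le> 1"
    using assms by (simp add: divide_le_eq_1)
  then have "2 * x / (x + 1)\<^sup>2 / (x - 1)\<^sup>2 \<le> 1 / (x - 1)\<^sup>2"
    by (rule divide_right_mono) simp
  then show ?thesis by (simp add: f)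
qed

text \<open>Here \<open>u\<close> and \<open>v\<close> stand for the norms of an amplitude and its
  derivative, and the left side is the integrand bound of \<open>saddle_off_le\<close>. Near 0 the
  reciprocal phase derivative is of order \<open>x\<^sup>2\<close> and compensates the growth
  allowed by \<open>c / x\<close> and \<open>c / x\<^sup>2\<close>, so the estimate is uniform in
  the lower limit of integration.\<close>

lemma saddle_low_le:
  fixes x :: real
  assumes "0 < x" "x \<le> 1 / 2" "u \<le> c / x" "v \<le> c / x\<^sup>2" "0 \<le> c"
  shows "v * (x\<^sup>2 / \<bar>x\<^sup>2 - 1\<bar>) + u * (2 * x / (x\<^sup>2 - 1)\<^sup>2) \<le> 5 * c"
proof -
  have "x\<^sup>2 \<le> (1/2)\<^sup>2" using assms by (intro power_mono) auto
  then have a: "\<bar>x\<^sup>2 - 1\<bar> = 1 - x\<^sup>2" "1 - x\<^sup>2 \<ge> 3/4" by (auto simp: power2_eq_square)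
  have "v * (x\<^sup>2 / \<bar>x\<^sup>2 - 1\<bar>) \<le> c / x\<^sup>2 * (x\<^sup>2 / \<bar>x\<^sup>2 - 1\<bar>)"
    using assms by (intro mult_right_mono) auto
  also have "\<dots> = c / (1 - x\<^sup>2)" using assms a by simp
  also have "\<dots> \<le> c / (3/4)" using a assms by (intro divide_left_mono) auto
  finally have 1: "v * (x\<^sup>2 / \<bar>x\<^sup>2 - 1\<bar>) \<le> 4/3 * c" by simp
  have "u * (2 * x / (x\<^sup>2 - 1)\<^sup>2) \<le> c / x * (2 * x / (x\<^sup>2 - 1)\<^sup>2)"
    using assms by (intro mult_right_mono) auto
  also have "\<dots> = 2 * c / (1 - x\<^sup>2)\<^sup>2" using assms by (simp add: power2_commute)
  also have "\<dots> \<le> 2 * c / (3/4)\<^sup>2"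
    using a assms by (intro divide_left_mono power_mono mult_pos_pos) auto
  also have "\<dots> = 32/9 * c" by (simp add: power2_eq_square)
  finally show ?thesis using 1 assms by linarith
qed

text \<open>The counterpart of \<open>saddle_low_le\<close> for large \<open>x\<close>: the decay
  \<open>1 / x\<^sup>2\<close> makes the integral bounded uniformly in its upper limit.\<close>

lemma saddle_high_le:
  fixes x :: real
  assumes "2 \<le> x" "u \<le> c / x" "v \<le> c / x\<^sup>2" "0 \<le> c"
  shows "v * (x\<^sup>2 / \<bar>x\<^sup>2 - 1\<bar>) + u * (2 * x / (x\<^sup>2 - 1)\<^sup>2) \<le> 3 * c * (1 / x\<^sup>2)"
proof -
  have "x\<^sup>2 \<ge> 2\<^sup>2" using assms by (intro power_mono) auto
  then have a: "\<bar>x\<^sup>2 - 1\<bar> = x\<^sup>2 - 1" "x\<^sup>2 - 1 \<ge> 3/4 * x\<^sup>2" "x\<^sup>2 > 0" "x\<^sup>2 \<ge> 4" by auto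
  have r: "x\<^sup>2 / (x\<^sup>2 - 1) \<le> 4/3" using a by (simp add: field_simps)
  have "v * (x\<^sup>2 / \<bar>x\<^sup>2 - 1\<bar>) \<le> c / x\<^sup>2 * (4/3)"
    using assms r a by (intro order_trans[OF mult_right_mono[of v "c / x\<^sup>2"]] mult_left_mono) auto
  then have 1: "v * (x\<^sup>2 / \<bar>x\<^sup>2 - 1\<bar>) \<le> 4/3 * (c * (1 / x\<^sup>2))" by simp
  have "u * (2 * x / (x\<^sup>2 - 1)\<^sup>2) \<le> c / x * (2 * x / (x\<^sup>2 - 1)\<^sup>2)"
    using assms by (intro mult_right_mono) auto
  also have "\<dots> = 2 * c / (x\<^sup>2 - 1)\<^sup>2" using assms by simp
  also have "\<dots> \<le> 2 * c / (3/4 * x\<^sup>2)\<^sup>2"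
    using a assms by (intro divide_left_mono power_mono mult_pos_pos) auto
  also have "\<dots> = 32/9 * (c * (1 / x\<^sup>2)) * (1 / x\<^sup>2)" by (simp add: power2_eq_square)
  also have "\<dots> \<le> 32/9 * (c * (1 / x\<^sup>2)) * (1 / 4)"
    using a assms by (intro mult_left_mono divide_left_mono) auto
  finally have 2: "u * (2 * x / (x\<^sup>2 - 1)\<^sup>2) \<le> 8/9 * (c * (1 / x\<^sup>2))" by simp
  have "0 \<le> c * (1 / x\<^sup>2)" using assms by simp
  then show ?thesis using 1 2 by linarith
qed

lemma saddle_low_boundary_le:
  fixes x :: real
  assumes "0 < x" "x \<le> 1 / 2" "u \<le> c / x" "0 \<le> c"
  shows "u * (x\<^sup>2 / \<bar>x\<^sup>2 - 1\<bar>) \<le> 2/3 * c"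
proof -
  have "x\<^sup>2 \<le> (1/2)\<^sup>2" using assms by (intro power_mono) auto
  then have a: "\<bar>x\<^sup>2 - 1\<bar> = 1 - x\<^sup>2" "1 - x\<^sup>2 \<ge> 3/4" by (auto simp: power2_eq_square)
  have "u * (x\<^sup>2 / \<bar>x\<^sup>2 - 1\<bar>) \<le> c / x * (x\<^sup>2 / \<bar>x\<^sup>2 - 1\<bar>)"
    using assms by (intro mult_right_mono) auto
  also have "\<dots> = c * x / (1 - x\<^sup>2)" using assms a by (simp add: power2_eq_square)
  also have "\<dots> \<le> c * (1/2) / (3/4)" using a assms by (intro frac_le mult_left_mono) auto
  finally show ?thesis by simp
qed

lemma saddle_high_boundary_le:
  fixes x :: real
  assumes "2 \<le> x" "u \<le> c / x" "0 \<le> c"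
  shows "u * (x\<^sup>2 / \<bar>x\<^sup>2 - 1\<bar>) \<le> 2/3 * c"
proof -
  have "x\<^sup>2 \<ge> 2\<^sup>2" using assms by (intro power_mono) auto
  then have a: "\<bar>x\<^sup>2 - 1\<bar> = x\<^sup>2 - 1" "x\<^sup>2 \<ge> 4" by auto
  have r: "x\<^sup>2 / \<bar>x\<^sup>2 - 1\<bar> \<le> 4/3" using a by (simp add: field_simps)
  have "c / x \<le> c / 2" using assms by (intro divide_left_mono) auto
  then have "u \<le> c / 2" using assms by linarith
  then have "u * (x\<^sup>2 / \<bar>x\<^sup>2 - 1\<bar>) \<le> c / 2 * (x\<^sup>2 / \<bar>x\<^sup>2 - 1\<bar>)"
    by (intro mult_right_mono) auto
  also have "\<dots> \<le> c / 2 * (4/3)" using r assms by (intro mult_left_mono) auto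
  finally show ?thesis by simp
qed

text \<open>Subtracting \<open>B 1 * saddle_weight\<close> leaves an amplitude \<open>R\<close> that
  vanishes at the saddle, with \<open>norm (R x)\<close> at most
  \<open>11 * c * \<bar>x - 1\<bar>\<close>. Very close to 1 this is integrated trivially; on the
  rest of \<open>{1/2..2}\<close> integration by parts leaves the integral of
  \<open>1 / \<bar>x - 1\<bar>\<close>, the source of \<open>ln \<mu>\<close>. Outside
  \<open>{1/2..2}\<close> the scale-invariant bounds \<open>c / x\<close> and
  \<open>c / x\<^sup>2\<close> suffice.\<close>

lemma stationary_phase:
  fixes B B' :: "real \<Rightarrow> complex"
  assumes F: "\<And>q. q > 0 \<Longrightarrow> norm (integral {-q..q} (\<lambda>x. cis (x\<^sup>2)) - F) \<le> 2 / q"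
    and \<mu>: "\<mu> \<ge> 4" and \<alpha>: "0 < \<alpha>" "\<alpha> \<le> 1 / 2" and b: "b \<ge> 2" and "finite S"
    and contB: "continuous_on {\<alpha>..b} B"
    and dB: "\<And>x. x \<in> {\<alpha><..<b} - S \<Longrightarrow> (B has_vector_derivative B' x) (at x)"
    and B: "\<And>x. x \<in> {\<alpha>..b} \<Longrightarrow> norm (B x) \<le> c / x"
    and B': "\<And>x. x \<in> {\<alpha><..<b} - S \<Longrightarrow> norm (B' x) \<le> c / x\<^sup>2"
  shows "norm (integral {\<alpha>..b} (\<lambda>x. B x * cis (\<mu> * (x + 1 / x))) - F * B 1 * cis (2 * \<mu>) / sqrt \<mu>)
    \<le> 100 * c * (1 + ln \<mu>) / \<mu>"
proof -
  define e where "e = (\<lambda>x. cis (\<mu> * (x + 1 / x)))"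
  \<comment> \<open>At this distance from the saddle the trivial bound \<open>c * d\<^sup>2\<close>
    has the same order \<open>c / \<mu>\<close> as the boundary terms of the integration by
    parts.\<close>
  define d where "d = 1 / sqrt \<mu>"
  define R where "R = (\<lambda>x. B x - B 1 * of_real (saddle_weight x))"
  define R' where "R' = (\<lambda>x. B' x - B 1 * of_real (- (x powr (-3/2) + 3 * x powr (-5/2)) / 4))"
  have c0: "norm (B 1) \<le> c" using B[of 1] \<alpha> b by auto
  then have c: "c \<ge> 0" by (rule order_trans[OF norm_ge_zero])
  have "sqrt \<mu> \<ge> 2" using \<mu> by (simp add: real_le_rsqrt)
  then have d: "0 < d" "d \<le> 1 / 2" and d2: "d * d = 1 / \<mu>"
    using \<mu> by (auto simp: d_def field_simps)
  have lnd: "ln d = - ln \<mu> / 2"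
    using \<mu> by (simp add: d_def ln_div ln_sqrt)
  have ln\<mu>: "ln \<mu> \<ge> 0" using \<mu> by simp
  have conte: "continuous_on {p..q} e" if "p > 0" for p q
    unfolding e_def using that by (intro continuous_intros) auto
  have contBe: "continuous_on {p..q} (\<lambda>x. B x * e x)" if "\<alpha> \<le> p" "q \<le> b" for p q
    using that \<alpha> by (intro continuous_intros continuous_on_subset[OF contB] conte) auto
  have contR: "continuous_on {p..q} R" if "\<alpha> \<le> p" "q \<le> b" for p q
    unfolding R_def using that \<alpha>
    by (intro continuous_intros continuous_on_subset[OF contB] continuous_on_saddle_weight) auto
  have contRe: "continuous_on {p..q} (\<lambda>x. R x * e x)" if "\<alpha> \<le> p" "q \<le> b" for p q
    using that \<alpha> by (intro continuous_intros contR conte) auto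
  have dR: "(R has_vector_derivative R' x) (at x)" if "x \<in> {\<alpha><..<b} - S" for x
    unfolding R_def R'_def using that \<alpha>
    by (intro has_vector_derivative_diff dB has_vector_derivative_mult_right has_vector_derivative_of_real saddle_weight_deriv) auto
  \<comment> \<open>\<open>11 = 4 + 7\<close>: for \<open>x \<ge> 1 / 2\<close> the bound on
    \<open>B'\<close> is at most \<open>4 * c\<close>, and the derivative of
    \<open>saddle_weight\<close> is at most 7.\<close>
  have R'_le: "norm (R' x) \<le> 11 * c" if "x \<in> {\<alpha><..<b} - S" "1 / 2 \<le> x" for x
  proof -
    have "c / x\<^sup>2 \<le> c / (1/2)\<^sup>2"
      using that c by (intro divide_left_mono power_mono) auto
    then have 1: "norm (B' x) \<le> 4 * c"
      using B'[OF that(1)] by (simp add: power2_eq_square)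
    have "x powr (-3/2) \<le> 2 ^ 2" "x powr (-5/2) \<le> 2 ^ 3"
      using powr_ge_half_le[OF that(2), of "3/2" 2] powr_ge_half_le[OF that(2), of "5/2" 3] by auto
    then have "(x powr (-3/2) + 3 * x powr (-5/2)) / 4 \<le> 7" by simp
    moreover have "- (x powr (-3/2) + 3 * x powr (-5/2)) / 4 \<le> 0"
    proof -
      have "0 \<le> x powr (-3/2) + 3 * x powr (-5/2)" by (intro add_nonneg_nonneg) auto
      then show ?thesis by (intro divide_nonpos_pos) (simp_all only: neg_le_0_iff_le zero_less_numeral)
    qed
    ultimately have "\<bar>- (x powr (-3/2) + 3 * x powr (-5/2)) / 4\<bar> \<le> 7"
      by (intro abs_leI) linarith+
    then have "norm (B 1 * of_real (- (x powr (-3/2) + 3 * x powr (-5/2)) / 4)) \<le> c * 7"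
      unfolding norm_mult norm_of_real by (intro mult_mono c0) (auto simp: c)
    then show ?thesis
      unfolding R'_def using 1 norm_triangle_ineq4[of "B' x" "B 1 * of_real (- (x powr (-3/2) + 3 * x powr (-5/2)) / 4)"]
      by linarith
  qed
  have R1: "R 1 = 0" by (simp add: R_def saddle_weight_1)
  have R_le: "norm (R x) \<le> 11 * c * \<bar>x - 1\<bar>" if "x \<in> {1/2..2}" for x
  proof (cases "x \<le> 1")
    case True
    have "norm (R 1 - R x) \<le> 11 * c * (1 - x)"
      by (rule norm_diff_le_of_derivative[OF True \<open>finite S\<close>, where f' = R'])
        (use that True \<alpha> b c in \<open>auto intro!: contR dR R'_le\<close>)
    then show ?thesis using True R1 by simp
  next
    case False
    then have "1 \<le> x" by simp
    have "norm (R x - R 1) \<le> 11 * c * (x - 1)"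
      by (rule norm_diff_le_of_derivative[OF \<open>1 \<le> x\<close> \<open>finite S\<close>, where f' = R'])
        (use that False \<alpha> b c in \<open>auto intro!: contR dR R'_le\<close>)
    then show ?thesis using False R1 by simp
  qed
  have I_mid: "norm (integral {1 - d..1 + d} (\<lambda>x. R x * e x)) \<le> 22 * c / \<mu>"
  proof -
    have "norm (integral {1 - d..1 + d} (\<lambda>x. R x * e x)) \<le> (11 * c * d) * ((1 + d) - (1 - d))"
    proof (rule integral_bound)
      fix x assume x: "x \<in> {1 - d..1 + d}"
      then have "norm (R x) \<le> 11 * c * \<bar>x - 1\<bar>" using d by (intro R_le) auto
      also have "\<dots> \<le> 11 * c * d" using x c by (intro mult_left_mono) auto
      finally show "norm (R x * e x) \<le> 11 * c * d" by (simp add: e_def norm_mult)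
    qed (use d \<alpha> b contRe in auto)
    also have "\<dots> = 22 * c * (d * d)" by (simp add: algebra_simps)
    finally show ?thesis by (simp add: d2)
  qed
  have sad: "x\<^sup>2 / \<bar>x\<^sup>2 - 1\<bar> \<le> (4/3) / \<bar>x - 1\<bar>" and sad2: "2 * x / (x\<^sup>2 - 1)\<^sup>2 \<le> 1 / \<bar>x - 1\<bar>\<^sup>2"
    if "0 < x" "x \<le> 2" "x \<noteq> 1" for x :: real
    using saddle_quotient_le1[OF that] saddle_quotient_le2[OF that(1,3)] by simp_all
  have bd: "norm (R x) * (x\<^sup>2 / \<bar>x\<^sup>2 - 1\<bar>) \<le> 15 * c" if "x \<in> {1/2..2}" "x \<noteq> 1" for x
  proof -
    have "norm (R x) * (x\<^sup>2 / \<bar>x\<^sup>2 - 1\<bar>) \<le> (11 * c * \<bar>x - 1\<bar>) * ((4/3) / \<bar>x - 1\<bar>)"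
      using that c by (intro mult_mono R_le sad) auto
    also have "\<dots> = 44 / 3 * c" using that by simp
    finally show ?thesis using c by linarith
  qed
  have gR: "norm (R' x) * (x\<^sup>2 / \<bar>x\<^sup>2 - 1\<bar>) + norm (R x) * (2 * x / (x\<^sup>2 - 1)\<^sup>2) \<le> 26 * c * (1 / \<bar>x - 1\<bar>)"
    if "x \<in> {1/2..2}" "x \<noteq> 1" "x \<in> {\<alpha><..<b} - S" for x
  proof -
    have "norm (R' x) * (x\<^sup>2 / \<bar>x\<^sup>2 - 1\<bar>) \<le> (11 * c) * ((4/3) / \<bar>x - 1\<bar>)"
      using that c by (intro mult_mono R'_le sad) auto
    moreover have "norm (R x) * (2 * x / (x\<^sup>2 - 1)\<^sup>2) \<le> (11 * c * \<bar>x - 1\<bar>) * (1 / \<bar>x - 1\<bar>\<^sup>2)"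
      using that c by (intro mult_mono R_le sad2) auto
    moreover have "(11 * c * \<bar>x - 1\<bar>) * (1 / \<bar>x - 1\<bar>\<^sup>2) = 11 * c * (1 / \<bar>x - 1\<bar>)"
      using that by (simp add: power2_eq_square del: abs_mult_self_eq)
    moreover have "(11 * c) * ((4/3) / \<bar>x - 1\<bar>) = 44 / 3 * c * (1 / \<bar>x - 1\<bar>)" by simp
    moreover have "44 / 3 * c * (1 / \<bar>x - 1\<bar>) \<le> 15 * c * (1 / \<bar>x - 1\<bar>)"
      using c by (intro mult_right_mono) auto
    ultimately show ?thesis by (simp only: ) (simp add: field_simps)
  qed
  have I_left: "norm (integral {1/2..1 - d} (\<lambda>x. R x * e x)) \<le> (30 * c + 13 * c * ln \<mu>) / \<mu>"
  proof -
    have "norm (integral {1/2..1 - d} (\<lambda>x. R x * e x)) \<le>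
      (norm (R (1/2)) * ((1/2)\<^sup>2 / \<bar>(1/2)\<^sup>2 - 1\<bar>) + norm (R (1 - d)) * ((1 - d)\<^sup>2 / \<bar>(1 - d)\<^sup>2 - 1\<bar>) +
        26 * c * (ln (1/2) - ln d)) / \<mu>"
      unfolding e_def
    proof (rule saddle_off_le[where S = S and R' = R' and g = "\<lambda>x. 26 * c * (1 / \<bar>x - 1\<bar>)"])
      have "((\<lambda>x. 1 / \<bar>x - 1\<bar>) has_integral - ln (1 - (1 - d)) - (- ln (1 - 1/2))) {1/2..1 - d}"
        by (rule fundamental_theorem_of_calculus)
          (use d in \<open>auto intro!: derivative_eq_intros simp: abs_if simp flip: has_real_derivative_iff_has_vector_derivative\<close>)
      from has_integral_mult_right[OF this, of "26 * c"]
      show "((\<lambda>x. 26 * c * (1 / \<bar>x - 1\<bar>)) has_integral 26 * c * (ln (1/2) - ln d)) {1/2..1 - d}"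
        by simp
      fix x assume x: "x \<in> {1/2<..<1 - d} - S"
      show "norm (R' x) * (x\<^sup>2 / \<bar>x\<^sup>2 - 1\<bar>) + norm (R x) * (2 * x / (x\<^sup>2 - 1)\<^sup>2) \<le> 26 * c * (1 / \<bar>x - 1\<bar>)"
        using x d \<alpha> b by (intro gR) auto
      show "(R has_vector_derivative R' x) (at x)"
        using x d \<alpha> b by (intro dR) auto
    qed (use d \<alpha> b c \<mu> \<open>finite S\<close> in \<open>auto intro!: contR\<close>)
    also have "\<dots> \<le> (15 * c + 15 * c + 13 * c * ln \<mu>) / \<mu>"
    proof (intro divide_right_mono add_mono bd)
      have "26 * c * (ln (1/2) - ln d) \<le> 26 * c * (ln \<mu> / 2)"
        using c by (intro mult_left_mono) (auto simp: lnd)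
      then show "26 * c * (ln (1/2) - ln d) \<le> 13 * c * ln \<mu>" by simp
    qed (use d \<mu> in auto)
    finally show ?thesis by simp
  qed
  have I_right: "norm (integral {1 + d..2} (\<lambda>x. R x * e x)) \<le> (30 * c + 13 * c * ln \<mu>) / \<mu>"
  proof -
    have "norm (integral {1 + d..2} (\<lambda>x. R x * e x)) \<le>
      (norm (R (1 + d)) * ((1 + d)\<^sup>2 / \<bar>(1 + d)\<^sup>2 - 1\<bar>) + norm (R 2) * (2\<^sup>2 / \<bar>2\<^sup>2 - 1\<bar>) +
        26 * c * (- ln d)) / \<mu>"
      unfolding e_def
    proof (rule saddle_off_le[where S = S and R' = R' and g = "\<lambda>x. 26 * c * (1 / \<bar>x - 1\<bar>)"])
      have "((\<lambda>x. 1 / \<bar>x - 1\<bar>) has_integral ln (2 - 1) - (ln (1 + d - 1))) {1 + d..2}"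
        by (rule fundamental_theorem_of_calculus)
          (use d in \<open>auto intro!: derivative_eq_intros simp: abs_if simp flip: has_real_derivative_iff_has_vector_derivative\<close>)
      from has_integral_mult_right[OF this, of "26 * c"]
      show "((\<lambda>x. 26 * c * (1 / \<bar>x - 1\<bar>)) has_integral 26 * c * (- ln d)) {1 + d..2}"
        by simp
      fix x assume x: "x \<in> {1 + d<..<2} - S"
      show "norm (R' x) * (x\<^sup>2 / \<bar>x\<^sup>2 - 1\<bar>) + norm (R x) * (2 * x / (x\<^sup>2 - 1)\<^sup>2) \<le> 26 * c * (1 / \<bar>x - 1\<bar>)"
        using x d \<alpha> b by (intro gR) auto
      show "(R has_vector_derivative R' x) (at x)"
        using x d \<alpha> b by (intro dR) auto
    qed (use d \<alpha> b c \<mu> \<open>finite S\<close> in \<open>auto intro!: contR\<close>)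
    also have "\<dots> \<le> (15 * c + 15 * c + 13 * c * ln \<mu>) / \<mu>"
      by (intro divide_right_mono add_mono bd) (use d \<mu> in \<open>auto simp: lnd\<close>)
    finally show ?thesis by simp
  qed
  have I_low: "norm (integral {\<alpha>..1/2} (\<lambda>x. B x * e x)) \<le> 4 * c / \<mu>"
  proof -
    have "norm (integral {\<alpha>..1/2} (\<lambda>x. B x * e x)) \<le>
      (norm (B \<alpha>) * (\<alpha>\<^sup>2 / \<bar>\<alpha>\<^sup>2 - 1\<bar>) + norm (B (1/2)) * ((1/2)\<^sup>2 / \<bar>(1/2)\<^sup>2 - 1\<bar>) + 5 * c * (1/2 - \<alpha>)) / \<mu>"
      unfolding e_def
    proof (rule saddle_off_le[where S = S and R' = B' and g = "\<lambda>x. 5 * c"])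
      show "((\<lambda>x. 5 * c) has_integral 5 * c * (1/2 - \<alpha>)) {\<alpha>..1/2}"
        using has_integral_const_real[of "5 * c" \<alpha> "1/2"] \<alpha> by (simp add: mult.commute)
      fix x assume x: "x \<in> {\<alpha><..<1/2} - S"
      show "norm (B' x) * (x\<^sup>2 / \<bar>x\<^sup>2 - 1\<bar>) + norm (B x) * (2 * x / (x\<^sup>2 - 1)\<^sup>2) \<le> 5 * c"
        using x \<alpha> b B[of x] B'[of x] c by (intro saddle_low_le) auto
      show "(B has_vector_derivative B' x) (at x)"
        using x d \<alpha> b by (intro dB) auto
    qed (use d \<alpha> b c \<mu> \<open>finite S\<close> in \<open>auto intro!: continuous_on_subset[OF contB]\<close>)
    also have "\<dots> \<le> (2/3 * c + 2/3 * c + 5/2 * c) / \<mu>"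
    proof (intro divide_right_mono add_mono)
      show "norm (B \<alpha>) * (\<alpha>\<^sup>2 / \<bar>\<alpha>\<^sup>2 - 1\<bar>) \<le> 2/3 * c"
        using \<alpha> b B[of \<alpha>] c by (intro saddle_low_boundary_le) auto
      show "norm (B (1/2)) * ((1/2)\<^sup>2 / \<bar>(1/2)\<^sup>2 - 1\<bar>) \<le> 2/3 * c"
        using \<alpha> b B[of "1/2"] c by (intro saddle_low_boundary_le) auto
      show "5 * c * (1/2 - \<alpha>) \<le> 5/2 * c" using c \<alpha> by (simp add: algebra_simps)
    qed (use \<mu> in auto)
    also have "\<dots> \<le> 4 * c / \<mu>" using c \<mu> by (intro divide_right_mono) auto
    finally show ?thesis .
  qed
  have I_high: "norm (integral {2..b} (\<lambda>x. B x * e x)) \<le> 3 * c / \<mu>"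
  proof -
    have "norm (integral {2..b} (\<lambda>x. B x * e x)) \<le>
      (norm (B 2) * (2\<^sup>2 / \<bar>2\<^sup>2 - 1\<bar>) + norm (B b) * (b\<^sup>2 / \<bar>b\<^sup>2 - 1\<bar>) + 3 * c * (1/2 - 1/b)) / \<mu>"
      unfolding e_def
    proof (rule saddle_off_le[where S = S and R' = B' and g = "\<lambda>x. 3 * c * (1 / x\<^sup>2)"])
      have "((\<lambda>x. 1 / x\<^sup>2) has_integral - (1 / b) - (- (1 / 2))) {2..b}"
        by (rule fundamental_theorem_of_calculus)
          (use b in \<open>auto intro!: derivative_eq_intros simp: power2_eq_square simp flip: has_real_derivative_iff_has_vector_derivative\<close>)
      from has_integral_mult_right[OF this, of "3 * c"]
      show "((\<lambda>x. 3 * c * (1 / x\<^sup>2)) has_integral 3 * c * (1/2 - 1/b)) {2..b}"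
        by simp
      fix x assume x: "x \<in> {2<..<b} - S"
      show "norm (B' x) * (x\<^sup>2 / \<bar>x\<^sup>2 - 1\<bar>) + norm (B x) * (2 * x / (x\<^sup>2 - 1)\<^sup>2) \<le> 3 * c * (1 / x\<^sup>2)"
        using x \<alpha> b B[of x] B'[of x] c by (intro saddle_high_le) auto
      show "(B has_vector_derivative B' x) (at x)"
        using x d \<alpha> b by (intro dB) auto
    qed (use d \<alpha> b c \<mu> \<open>finite S\<close> in \<open>auto intro!: continuous_on_subset[OF contB]\<close>)
    also have "\<dots> \<le> (2/3 * c + 2/3 * c + 3/2 * c) / \<mu>"
    proof (intro divide_right_mono add_mono)
      show "norm (B 2) * (2\<^sup>2 / \<bar>2\<^sup>2 - 1\<bar>) \<le> 2/3 * c"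
        using \<alpha> b B[of 2] c by (intro saddle_high_boundary_le) auto
      show "norm (B b) * (b\<^sup>2 / \<bar>b\<^sup>2 - 1\<bar>) \<le> 2/3 * c"
        using \<alpha> b B[of b] c by (intro saddle_high_boundary_le) auto
      show "3 * c * (1/2 - 1/b) \<le> 3/2 * c" using c b by (simp add: algebra_simps)
    qed (use \<mu> in auto)
    also have "\<dots> \<le> 3 * c / \<mu>" using c \<mu> by (intro divide_right_mono) auto
    finally show ?thesis .
  qed
  have I_ref: "norm (integral {1/2..2} (\<lambda>x. saddle_weight x *\<^sub>R e x) - F * cis (2 * \<mu>) / sqrt \<mu>) \<le> 3 / \<mu>"
    unfolding e_def using \<mu> by (intro integral_saddle_weight F) auto
  have cW: "continuous_on {1/2..2} (\<lambda>x. saddle_weight x *\<^sub>R e x)"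
    by (intro continuous_intros continuous_on_saddle_weight conte) auto
  have comb: "integral {p..q} f + integral {q..r} f = integral {p..r} f"
    if "continuous_on {p..r} f" "p \<le> q" "q \<le> r" for p q r :: real and f :: "real \<Rightarrow> complex"
    using that by (intro Henstock_Kurzweil_Integration.integral_combine integrable_continuous_real) auto
  have split1: "integral {\<alpha>..b} (\<lambda>x. B x * e x) =
      integral {\<alpha>..1/2} (\<lambda>x. B x * e x) + integral {1/2..2} (\<lambda>x. B x * e x) + integral {2..b} (\<lambda>x. B x * e x)"
    using comb[OF contBe, of \<alpha> b "1/2"] comb[OF contBe, of "1/2" b 2] \<alpha> b by (simp add: add.assoc)
  have split2: "integral {1/2..2} (\<lambda>x. R x * e x) =
      integral {1/2..1 - d} (\<lambda>x. R x * e x) + integral {1 - d..1 + d} (\<lambda>x. R x * e x) + integral {1 + d..2} (\<lambda>x. R x * e x)"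
    using comb[OF contRe, of "1/2" 2 "1 - d"] comb[OF contRe, of "1 - d" 2 "1 + d"] \<alpha> b d by (simp add: add.assoc)
  have split3: "integral {1/2..2} (\<lambda>x. B x * e x) =
      integral {1/2..2} (\<lambda>x. R x * e x) + B 1 * integral {1/2..2} (\<lambda>x. saddle_weight x *\<^sub>R e x)"
  proof -
    have "integral {1/2..2} (\<lambda>x. B x * e x) = integral {1/2..2} (\<lambda>x. R x * e x + B 1 * (saddle_weight x *\<^sub>R e x))"
      by (intro integral_cong) (simp add: R_def scaleR_conv_of_real algebra_simps)
    also have "\<dots> = integral {1/2..2} (\<lambda>x. R x * e x) + integral {1/2..2} (\<lambda>x. B 1 * (saddle_weight x *\<^sub>R e x))"
      using \<alpha> b by (intro Henstock_Kurzweil_Integration.integral_add integrable_continuous_real contRe continuous_intros cW) auto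
    finally show ?thesis by (simp only: integral_mult_right)
  qed
  have "integral {\<alpha>..b} (\<lambda>x. B x * e x) - F * B 1 * cis (2 * \<mu>) / sqrt \<mu> =
     integral {\<alpha>..1/2} (\<lambda>x. B x * e x) + integral {2..b} (\<lambda>x. B x * e x) +
     (integral {1/2..1 - d} (\<lambda>x. R x * e x) + integral {1 - d..1 + d} (\<lambda>x. R x * e x) + integral {1 + d..2} (\<lambda>x. R x * e x)) +
     B 1 * (integral {1/2..2} (\<lambda>x. saddle_weight x *\<^sub>R e x) - F * cis (2 * \<mu>) / sqrt \<mu>)"
    unfolding split1 split3 split2 by (simp add: algebra_simps)
  also have "norm \<dots> \<le> 4 * c / \<mu> + 3 * c / \<mu> +
      ((30 * c + 13 * c * ln \<mu>) / \<mu> + 22 * c / \<mu> + (30 * c + 13 * c * ln \<mu>) / \<mu>) + c * (3 / \<mu>)"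
    unfolding norm_mult[of "B 1"]
    by (intro norm_triangle_le add_mono I_low I_high I_left I_mid I_right order_trans[OF eq_refl[OF norm_mult] mult_mono[OF c0 I_ref c norm_ge_zero]])
  also have "\<dots> = (92 * c + 26 * (c * ln \<mu>)) / \<mu>"
    using \<mu> by (simp add: field_simps)
  also have "\<dots> \<le> 100 * c * (1 + ln \<mu>) / \<mu>"
    using \<mu> c mult_nonneg_nonneg[OF c ln\<mu>] by (intro divide_right_mono) (auto simp: algebra_simps)
  finally show ?thesis unfolding e_def .
qed

section \<open>Integrals with the phase of the hyperbolic cotangent\<close>

lemma nonneg_of_derivative_nonneg:
  fixes f f' :: "real \<Rightarrow> real"
  assumes "0 \<le> z" "f 0 = 0"
    and "\<And>x. 0 \<le> x \<Longrightarrow> x \<le> z \<Longrightarrow> (f has_real_derivative f' x) (at x)"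
    and "\<And>x. 0 \<le> x \<Longrightarrow> x \<le> z \<Longrightarrow> 0 \<le> f' x"
  shows "0 \<le> f z"
  using DERIV_nonneg_imp_nondecreasing[of 0 z f] assms by fastforce

lemma cosh_le_2: "\<bar>z\<bar> \<le> 1 \<Longrightarrow> cosh z \<le> (2::real)"
proof -
  assume "\<bar>z\<bar> \<le> 1"
  then have "exp z \<le> exp 1" "exp (-z) \<le> exp 1" by auto
  have "cosh z = cosh \<bar>z\<bar>" by (simp add: abs_if)
  also have "\<dots> \<le> cosh 1" using \<open>\<bar>z\<bar> \<le> 1\<close> by (intro cosh_real_nonneg_le_iff[THEN iffD2]) auto
  also have "cosh (1::real) \<le> 2"
  proof -
    have "exp (-1::real) \<le> 1" by simp
    then have "exp 1 + exp (-1::real) \<le> 4" using exp_le by linarith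
    then show ?thesis by (simp add: cosh_def)
  qed
  finally show ?thesis .
qed

text \<open>Each bound follows from the preceding one by integration from 0, since
  \<open>sinh\<close> and \<open>cosh\<close> are each other's derivatives. The chain of upper
  bounds starts from \<open>cosh z \<le> 2\<close> and therefore needs
  \<open>z \<le> 1\<close>.\<close>

lemma hyp_bounds:
  fixes z :: real
  assumes "0 \<le> z" "z \<le> 1"
  shows sinh_ge1: "z \<le> sinh z" and cosh_ge2: "1 + z\<^sup>2 / 2 \<le> cosh z"
    and sinh_ge3: "z + z ^ 3 / 6 \<le> sinh z" and cosh_ge4: "1 + z\<^sup>2 / 2 + z ^ 4 / 24 \<le> cosh z"
    and cosh_le_sq: "cosh z \<le> 1 + z\<^sup>2" and sinh_le3: "sinh z \<le> z + z ^ 3 / 3"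
    and cosh_le4: "cosh z \<le> 1 + z\<^sup>2 / 2 + z ^ 4 / 12" and sinh_le5: "sinh z \<le> z + z ^ 3 / 6 + z ^ 5 / 60"
proof -
  have s1: "z \<le> sinh z" if "0 \<le> z" for z :: real
  proof -
    have "0 \<le> sinh z - (z)"
    proof (rule nonneg_of_derivative_nonneg[where f = "\<lambda>z. sinh z - (z)" and f' = "\<lambda>z. cosh z - 1"])
      fix x assume "0 \<le> x" "x \<le> z"
      then show "0 \<le> (\<lambda>z. cosh z - 1) x"
        using cosh_real_ge_1[of x] that by simp
      show "((\<lambda>z. sinh z - (z)) has_real_derivative (\<lambda>z. cosh z - 1) x) (at x)"
        by (auto intro!: derivative_eq_intros)
    qed (use that in auto)
    then show ?thesis by linarith
  qed
  have c2: "1 + z\<^sup>2 / 2 \<le> cosh z" if "0 \<le> z" for z :: real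
  proof -
    have "0 \<le> cosh z - (1 + z\<^sup>2 / 2)"
    proof (rule nonneg_of_derivative_nonneg[where f = "\<lambda>z. cosh z - (1 + z\<^sup>2 / 2)" and f' = "\<lambda>z. sinh z - z"])
      fix x assume "0 \<le> x" "x \<le> z"
      then show "0 \<le> (\<lambda>z. sinh z - z) x"
        using s1[of x] that by simp
      show "((\<lambda>z. cosh z - (1 + z\<^sup>2 / 2)) has_real_derivative (\<lambda>z. sinh z - z) x) (at x)"
        by (auto intro!: derivative_eq_intros)
    qed (use that in auto)
    then show ?thesis by linarith
  qed
  have s3: "z + z ^ 3 / 6 \<le> sinh z" if "0 \<le> z" for z :: real
  proof -
    have "0 \<le> sinh z - (z + z ^ 3 / 6)"
    proof (rule nonneg_of_derivative_nonneg[where f = "\<lambda>z. sinh z - (z + z ^ 3 / 6)" and f' = "\<lambda>z. cosh z - 1 - z\<^sup>2 / 2"])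
      fix x assume "0 \<le> x" "x \<le> z"
      then show "0 \<le> (\<lambda>z. cosh z - 1 - z\<^sup>2 / 2) x"
        using c2[of x] that by simp
      show "((\<lambda>z. sinh z - (z + z ^ 3 / 6)) has_real_derivative (\<lambda>z. cosh z - 1 - z\<^sup>2 / 2) x) (at x)"
        by (auto intro!: derivative_eq_intros)
    qed (use that in auto)
    then show ?thesis by linarith
  qed
  have c4: "1 + z\<^sup>2 / 2 + z ^ 4 / 24 \<le> cosh z" if "0 \<le> z" for z :: real
  proof -
    have "0 \<le> cosh z - (1 + z\<^sup>2 / 2 + z ^ 4 / 24)"
    proof (rule nonneg_of_derivative_nonneg[where f = "\<lambda>z. cosh z - (1 + z\<^sup>2 / 2 + z ^ 4 / 24)" and f' = "\<lambda>z. sinh z - z - z ^ 3 / 6"])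
      fix x assume "0 \<le> x" "x \<le> z"
      then show "0 \<le> (\<lambda>z. sinh z - z - z ^ 3 / 6) x"
        using s3[of x] that by simp
      show "((\<lambda>z. cosh z - (1 + z\<^sup>2 / 2 + z ^ 4 / 24)) has_real_derivative (\<lambda>z. sinh z - z - z ^ 3 / 6) x) (at x)"
        by (auto intro!: derivative_eq_intros)
    qed (use that in auto)
    then show ?thesis by linarith
  qed
  have u1: "sinh z \<le> 2 * z" if "0 \<le> z" "z \<le> 1" for z :: real
  proof -
    have "0 \<le> 2 * z - (sinh z)"
    proof (rule nonneg_of_derivative_nonneg[where f = "\<lambda>z. 2 * z - (sinh z)" and f' = "\<lambda>z. 2 - cosh z"])
      fix x assume "0 \<le> x" "x \<le> z"
      then show "0 \<le> (\<lambda>z. 2 - cosh z) x"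
        using cosh_le_2[of x] that by simp
      show "((\<lambda>z. 2 * z - (sinh z)) has_real_derivative (\<lambda>z. 2 - cosh z) x) (at x)"
        by (auto intro!: derivative_eq_intros)
    qed (use that in auto)
    then show ?thesis by linarith
  qed
  have u2: "cosh z \<le> 1 + z\<^sup>2" if "0 \<le> z" "z \<le> 1" for z :: real
  proof -
    have "0 \<le> 1 + z\<^sup>2 - (cosh z)"
    proof (rule nonneg_of_derivative_nonneg[where f = "\<lambda>z. 1 + z\<^sup>2 - (cosh z)" and f' = "\<lambda>z. 2 * z - sinh z"])
      fix x assume "0 \<le> x" "x \<le> z"
      then show "0 \<le> (\<lambda>z. 2 * z - sinh z) x"
        using u1[of x] that by simp
      show "((\<lambda>z. 1 + z\<^sup>2 - (cosh z)) has_real_derivative (\<lambda>z. 2 * z - sinh z) x) (at x)"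
        by (auto intro!: derivative_eq_intros)
    qed (use that in auto)
    then show ?thesis by linarith
  qed
  have u3: "sinh z \<le> z + z ^ 3 / 3" if "0 \<le> z" "z \<le> 1" for z :: real
  proof -
    have "0 \<le> z + z ^ 3 / 3 - (sinh z)"
    proof (rule nonneg_of_derivative_nonneg[where f = "\<lambda>z. z + z ^ 3 / 3 - (sinh z)" and f' = "\<lambda>z. 1 + z\<^sup>2 - cosh z"])
      fix x assume "0 \<le> x" "x \<le> z"
      then show "0 \<le> (\<lambda>z. 1 + z\<^sup>2 - cosh z) x"
        using u2[of x] that by simp
      show "((\<lambda>z. z + z ^ 3 / 3 - (sinh z)) has_real_derivative (\<lambda>z. 1 + z\<^sup>2 - cosh z) x) (at x)"
        by (auto intro!: derivative_eq_intros)
    qed (use that in auto)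
    then show ?thesis by linarith
  qed
  have u4: "cosh z \<le> 1 + z\<^sup>2 / 2 + z ^ 4 / 12" if "0 \<le> z" "z \<le> 1" for z :: real
  proof -
    have "0 \<le> 1 + z\<^sup>2 / 2 + z ^ 4 / 12 - (cosh z)"
    proof (rule nonneg_of_derivative_nonneg[where f = "\<lambda>z. 1 + z\<^sup>2 / 2 + z ^ 4 / 12 - (cosh z)" and f' = "\<lambda>z. z + z ^ 3 / 3 - sinh z"])
      fix x assume "0 \<le> x" "x \<le> z"
      then show "0 \<le> (\<lambda>z. z + z ^ 3 / 3 - sinh z) x"
        using u3[of x] that by simp
      show "((\<lambda>z. 1 + z\<^sup>2 / 2 + z ^ 4 / 12 - (cosh z)) has_real_derivative (\<lambda>z. z + z ^ 3 / 3 - sinh z) x) (at x)"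
        by (auto intro!: derivative_eq_intros)
    qed (use that in auto)
    then show ?thesis by linarith
  qed
  have u5: "sinh z \<le> z + z ^ 3 / 6 + z ^ 5 / 60" if "0 \<le> z" "z \<le> 1" for z :: real
  proof -
    have "0 \<le> z + z ^ 3 / 6 + z ^ 5 / 60 - (sinh z)"
    proof (rule nonneg_of_derivative_nonneg[where f = "\<lambda>z. z + z ^ 3 / 6 + z ^ 5 / 60 - (sinh z)" and f' = "\<lambda>z. 1 + z\<^sup>2 / 2 + z ^ 4 / 12 - cosh z"])
      fix x assume "0 \<le> x" "x \<le> z"
      then show "0 \<le> (\<lambda>z. 1 + z\<^sup>2 / 2 + z ^ 4 / 12 - cosh z) x"
        using u4[of x] that by simp
      show "((\<lambda>z. z + z ^ 3 / 6 + z ^ 5 / 60 - (sinh z)) has_real_derivative (\<lambda>z. 1 + z\<^sup>2 / 2 + z ^ 4 / 12 - cosh z) x) (at x)"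
        by (auto intro!: derivative_eq_intros)
    qed (use that in auto)
    then show ?thesis by linarith
  qed
  show "z \<le> sinh z" "1 + z\<^sup>2 / 2 \<le> cosh z" "z + z ^ 3 / 6 \<le> sinh z" "1 + z\<^sup>2 / 2 + z ^ 4 / 24 \<le> cosh z"
    "cosh z \<le> 1 + z\<^sup>2" "sinh z \<le> z + z ^ 3 / 3" "cosh z \<le> 1 + z\<^sup>2 / 2 + z ^ 4 / 12" "sinh z \<le> z + z ^ 3 / 6 + z ^ 5 / 60"
    by (simp_all only: s1 c2 s3 c4 u2 u3 u4 u5 assms)
qed

text \<open>Multiplied by \<open>z * sinh z\<close>, the remainder is a combination of
  \<open>sinh\<close> and \<open>cosh\<close> that \<open>hyp_bounds\<close> controls up to a
  multiple of \<open>z ^ 5\<close>; the division then uses \<open>z \<le> sinh z\<close>.\<close>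

lemma coth_expansion:
  fixes z :: real
  assumes "0 < z" "z \<le> 1"
  shows "\<bar>cosh z / sinh z - 1 / z - z / 3\<bar> \<le> z ^ 3 / 10"
proof -
  note b = hyp_bounds[of z]
  have s: "sinh z \<ge> z" "sinh z > 0" using b(1) assms by auto
  have "z * cosh z - sinh z - z\<^sup>2 / 3 * sinh z \<le> z * (1 + z\<^sup>2 / 2 + z ^ 4 / 12) - (z + z ^ 3 / 6) - z\<^sup>2 / 3 * (z + z ^ 3 / 6)"
    using b assms by (intro diff_mono mult_left_mono) auto
  also have "\<dots> = z ^ 5 / 36" by (simp add: field_simps eval_nat_numeral)
  also have "\<dots> \<le> z ^ 5 / 10" using assms by simp
  finally have 1: "z * cosh z - sinh z - z\<^sup>2 / 3 * sinh z \<le> z ^ 5 / 10" .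
  have "- (z ^ 5 / 10) \<le> z * (1 + z\<^sup>2 / 2 + z ^ 4 / 24) - (z + z ^ 3 / 6 + z ^ 5 / 60) - z\<^sup>2 / 3 * (z + z ^ 3 / 3)"
  proof -
    have "z * (1 + z\<^sup>2 / 2 + z ^ 4 / 24) - (z + z ^ 3 / 6 + z ^ 5 / 60) - z\<^sup>2 / 3 * (z + z ^ 3 / 3) = - (31 / 360 * z ^ 5)"
      by (simp add: field_simps eval_nat_numeral)
    then show ?thesis using assms by simp
  qed
  also have "\<dots> \<le> z * cosh z - sinh z - z\<^sup>2 / 3 * sinh z"
    using b assms by (intro diff_mono mult_left_mono) auto
  finally have 2: "\<bar>z * cosh z - sinh z - z\<^sup>2 / 3 * sinh z\<bar> \<le> z ^ 5 / 10" using 1 by linarith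
  have "q / r - 1 / z - z / 3 = (z * q - r - z\<^sup>2 / 3 * r) / (z * r)" if "r > 0" for q r
    using that assms by (simp add: diff_divide_distrib power2_eq_square)
  from this[OF s(2)]
  have "cosh z / sinh z - 1 / z - z / 3 = (z * cosh z - sinh z - z\<^sup>2 / 3 * sinh z) / (z * sinh z)" .
  then have "\<bar>cosh z / sinh z - 1 / z - z / 3\<bar> = \<bar>z * cosh z - sinh z - z\<^sup>2 / 3 * sinh z\<bar> / (z * sinh z)"
    using assms s by (simp add: abs_divide)
  also have "\<dots> \<le> (z ^ 5 / 10) / (z * z)"
    using 2 s assms by (intro frac_le mult_left_mono) auto
  also have "\<dots> = z ^ 3 / 10" using assms by (simp add: eval_nat_numeral)
  finally show ?thesis .
qed

text \<open>The quantity is the derivative of the remainder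
  \<open>cosh z / sinh z - 1 / z - z / 3\<close> of \<open>coth_expansion\<close>; it enters through
  the derivative of \<open>phase_corr\<close>.\<close>

lemma coth_deriv_expansion:
  fixes z :: real
  assumes "0 < z" "z \<le> 1"
  shows "\<bar>1 / z\<^sup>2 - 1 / 3 - 1 / (sinh z)\<^sup>2\<bar> \<le> z\<^sup>2 / 9"
proof -
  note b = hyp_bounds[of z]
  have s: "sinh z \<ge> z" "sinh z > 0" using b(1) assms by auto
  have z: "z\<^sup>2 \<le> 1" "z ^ 4 \<le> 1" using assms by (auto intro: power_le_one)
  have f: "1 - z\<^sup>2 / 3 \<ge> 0" using z by simp
  have lo: "(z + z ^ 3 / 6)\<^sup>2 \<le> (sinh z)\<^sup>2" using b assms by (intro power_mono) auto
  have hi: "(sinh z)\<^sup>2 \<le> (z + z ^ 3 / 6 + z ^ 5 / 60)\<^sup>2" using b assms s by (intro power_mono) auto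
  define u where "u = z\<^sup>2"
  have u: "0 < u" "u \<le> 1" using assms z by (auto simp: u_def)
  have hi2: "(z + z ^ 3 / 6 + z ^ 5 / 60)\<^sup>2 \<le> u * (1 + u / 3 + u\<^sup>2 / 10)"
  proof -
    have "(z + z ^ 3 / 6 + z ^ 5 / 60)\<^sup>2 = u * (1 + u / 6 + u\<^sup>2 / 60)\<^sup>2"
      by (simp add: u_def field_simps eval_nat_numeral)
    also have "(1 + u / 6 + u\<^sup>2 / 60)\<^sup>2 = 1 + u / 3 + u\<^sup>2 * (1/36 + 1/30 + u / 180 + u\<^sup>2 / 3600)"
      by (simp add: field_simps eval_nat_numeral)
    also have "\<dots> \<le> 1 + u / 3 + u\<^sup>2 * (1/10)"
    proof -
      have "u\<^sup>2 \<le> 1" using u by (auto intro: power_le_one)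
      then show ?thesis using u by (intro add_left_mono mult_left_mono) auto
    qed
    finally show ?thesis using u by simp
  qed
  have lo2: "u * (1 + u / 3) \<le> (z + z ^ 3 / 6)\<^sup>2"
  proof -
    have "(z + z ^ 3 / 6)\<^sup>2 = u * (1 + u / 3) + u ^ 3 / 36"
      by (simp add: u_def field_simps eval_nat_numeral)
    then show ?thesis using u by simp
  qed
  have up: "(sinh z)\<^sup>2 * (1 - u / 3) - u \<le> u ^ 3 / 9"
  proof -
    have "(sinh z)\<^sup>2 * (1 - u / 3) \<le> u * (1 + u / 3 + u\<^sup>2 / 10) * (1 - u / 3)"
      using hi hi2 f by (intro mult_right_mono) (auto simp: u_def)
    also have "\<dots> = u - u ^ 3 / 90 - u ^ 4 / 30"
      by (simp add: field_simps eval_nat_numeral)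
    finally show ?thesis using u by (smt (verit) zero_le_power divide_nonneg_pos)
  qed
  have dn: "- (u ^ 3 / 9) \<le> (sinh z)\<^sup>2 * (1 - u / 3) - u"
  proof -
    have "u * (1 + u / 3) * (1 - u / 3) \<le> (sinh z)\<^sup>2 * (1 - u / 3)"
      using lo lo2 f by (intro mult_right_mono) (auto simp: u_def)
    moreover have "u * (1 + u / 3) * (1 - u / 3) = u - u ^ 3 / 9"
      by (simp add: field_simps eval_nat_numeral)
    ultimately show ?thesis by linarith
  qed
  have "1 / u - 1 / 3 - 1 / r = (r * (1 - u / 3) - u) / (u * r)" if "r > 0" for r
    using that u by (simp add: field_simps)
  from this[of "(sinh z)\<^sup>2"]
  have "1 / z\<^sup>2 - 1 / 3 - 1 / (sinh z)\<^sup>2 = ((sinh z)\<^sup>2 * (1 - u / 3) - u) / (u * (sinh z)\<^sup>2)"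
    using s by (simp add: u_def)
  then have "\<bar>1 / z\<^sup>2 - 1 / 3 - 1 / (sinh z)\<^sup>2\<bar> = \<bar>(sinh z)\<^sup>2 * (1 - u / 3) - u\<bar> / (u * (sinh z)\<^sup>2)"
    using u by (simp add: abs_divide)
  also have "\<dots> \<le> (u ^ 3 / 9) / (u * u)"
  proof (intro frac_le mult_left_mono)
    show "u \<le> (sinh z)\<^sup>2" unfolding u_def using s assms by (intro power_mono) auto
    show "\<bar>(sinh z)\<^sup>2 * (1 - u / 3) - u\<bar> \<le> u ^ 3 / 9"
      using up dn by linarith
  qed (use u in auto)
  also have "\<dots> = z\<^sup>2 / 9" using u by (simp add: eval_nat_numeral u_def)
  finally show ?thesis .
qed

text \<open>
  Substituting \<open>x = s / (exp w - 1)\<close> turns the frequency \<open>h\<close> of Poisson summation along the diagonal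
  \<open>n - m = s\<close> into \<open>2 * pi * h * x = pi * h * s * (coth (w / 2) - 1)\<close>, so that only the product
  \<open>h * s\<close> matters; summing over \<open>h\<close> and \<open>s\<close> then produces the divisor function.
\<close>

definition amp :: "real \<Rightarrow> real \<Rightarrow> real" where
  "amp G w = max 0 (1 - G * w) / (2 * sinh (w / 2))"

text \<open>The parameter \<open>c\<close> will be 0 or \<open>pi * h * s\<close> with either sign.
  As \<open>w = ln ((x + s) / x)\<close> decreases in \<open>x\<close>, the far end of a diagonal
  becomes the lower limit \<open>\<omega>\<close>, while the upper limit is the point where
  \<open>amp\<close> reaches 0.\<close>

definition osc_int :: "real \<Rightarrow> real \<Rightarrow> real \<Rightarrow> real \<Rightarrow> complex" where
  "osc_int G t c \<omega> = integral {\<omega>..1 / G} (\<lambda>w. of_real (amp G w) * cis (t * w + c * (cosh (w / 2) / sinh (w / 2))))"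

lemma coth_half_deriv:
  "w > 0 \<Longrightarrow> ((\<lambda>w. cosh (w / 2) / sinh (w / 2)) has_real_derivative (- (1 / (2 * (sinh (w / 2))\<^sup>2)))) (at (w::real))"
proof -
  assume "w > 0"
  have "((\<lambda>w. cosh (w / 2) / sinh (w / 2)) has_real_derivative
     ((sinh (w / 2) * (1/2)) * sinh (w / 2) - cosh (w / 2) * (cosh (w / 2) * (1/2))) / (sinh (w / 2) * sinh (w / 2))) (at w)"
    using \<open>w > 0\<close> by (auto intro!: derivative_eq_intros)
  also have "((sinh (w / 2) * (1/2)) * sinh (w / 2) - cosh (w / 2) * (cosh (w / 2) * (1/2))) / (sinh (w / 2) * sinh (w / 2)) =
     - (1 / (2 * (sinh (w / 2))\<^sup>2))"
    using cosh_square_eq[of "w / 2"] by (simp add: power2_eq_square field_simps)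
  finally show ?thesis .
qed

text \<open>The phase derivative is \<open>D w / (2 * (sinh (w / 2))\<^sup>2)\<close>, so
  \<open>Q\<close> is \<open>amp\<close> divided by it. The hypothesis keeps \<open>D\<close> away
  from 0 on the scale of \<open>c\<close>; then \<open>Q\<close> is at most
  \<open>2 / (G * \<bar>c\<bar>)\<close>, and \<open>Q'\<close> is at most
  \<open>14 / \<bar>c\<bar>\<close> on an interval of length at most \<open>1 / G\<close>.\<close>

lemma osc_int_nonstationary:
  assumes G: "G \<ge> 1" and \<omega>: "0 < \<omega>" "\<omega> \<le> 1 / G" and "c \<noteq> 0"
    and D: "\<And>w. w \<in> {\<omega>..1 / G} \<Longrightarrow> \<bar>c\<bar> / 2 \<le> \<bar>2 * t * (sinh (w / 2))\<^sup>2 - c\<bar>"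
  shows "norm (osc_int G t c \<omega>) \<le> 20 / (G * \<bar>c\<bar>)"
proof -
  define D where "D = (\<lambda>w. 2 * t * (sinh (w / 2))\<^sup>2 - c)"
  define Q where "Q = (\<lambda>w. (1 - G * w) * sinh (w / 2) / D w)"
  define Q' where "Q' = (\<lambda>w. ((- G * sinh (w / 2) + (1 - G * w) * (cosh (w / 2) / 2)) * D w -
      (1 - G * w) * sinh (w / 2) * (2 * t * sinh (w / 2) * cosh (w / 2))) / (D w * D w))"
  have w: "0 < w" "w \<le> 1" "G * w \<le> 1" "sinh (w / 2) > 0" "sinh (w / 2) \<le> 1 / G" "cosh (w / 2) \<le> 3 / 2"
    "D w \<noteq> 0" "\<bar>c\<bar> / 2 \<le> \<bar>D w\<bar>"
    if "w \<in> {\<omega>..1 / G}" for w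
  proof -
    show 1: "0 < w" "G * w \<le> 1" using that \<omega> G by (auto simp: field_simps)
    have "w \<le> 1 / G" using that by simp
    also have "1 / G \<le> 1" using G by simp
    finally show w1: "w \<le> 1" .
    show "sinh (w / 2) > 0" using 1 by simp
    have "sinh (w / 2) \<le> w / 2 + (w / 2) ^ 3 / 3" using 1 w1 by (intro sinh_le3) auto
    also have "\<dots> \<le> w / 2 + (w / 2) ^ 1 / 3" using 1 w1 by (intro add_left_mono divide_right_mono power_decreasing) auto
    also have "\<dots> \<le> w" using 1 by simp
    finally show "sinh (w / 2) \<le> 1 / G" using that by simp
    have "cosh (w / 2) \<le> 1 + (w / 2)\<^sup>2" using 1 w1 by (intro cosh_le_sq) auto
    also have "(w / 2)\<^sup>2 \<le> (1 / 2)\<^sup>2" using 1 w1 by (intro power_mono) auto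
    finally show "cosh (w / 2) \<le> 3 / 2" by (simp add: power2_eq_square)
    show "\<bar>c\<bar> / 2 \<le> \<bar>D w\<bar>" using D[OF that] by (simp add: D_def)
    then show "D w \<noteq> 0" using \<open>c \<noteq> 0\<close> by auto
  qed
  have contD: "continuous_on A D" for A unfolding D_def by (intro continuous_intros) auto
  have dQ: "(Q has_real_derivative Q' x) (at x)" if "x \<in> {\<omega>..1 / G}" for x
    unfolding Q_def Q'_def
  proof (rule DERIV_divide)
    show "((\<lambda>w. (1 - G * w) * sinh (w / 2)) has_real_derivative - G * sinh (x / 2) + (1 - G * x) * (cosh (x / 2) / 2)) (at x)"
      by (auto intro!: derivative_eq_intros)
    show "(D has_real_derivative 2 * t * sinh (x / 2) * cosh (x / 2)) (at x)"
      unfolding D_def by (auto intro!: derivative_eq_intros)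
    show "D x \<noteq> 0" using w that by blast
  qed
  have bQ: "\<bar>Q x\<bar> \<le> 2 / (G * \<bar>c\<bar>)" if "x \<in> {\<omega>..1 / G}" for x
  proof -
    have "\<bar>Q x\<bar> = (1 - G * x) * sinh (x / 2) / \<bar>D x\<bar>"
      using w[OF that] by (simp add: Q_def abs_mult abs_divide)
    also have "\<dots> \<le> (1 * (1 / G)) / (\<bar>c\<bar> / 2)"
      using w[OF that] \<open>c \<noteq> 0\<close> G by (intro frac_le mult_mono) auto
    finally show ?thesis by (simp add: field_simps)
  qed
  have bQ': "\<bar>Q' x\<bar> \<le> 14 / \<bar>c\<bar>" if "x \<in> {\<omega>..1 / G}" for x
  proof -
    note wx = w[OF that]
    have d0: "\<bar>D x\<bar> > 0" using wx by simp
    have 1: "\<bar>- G * sinh (x / 2) + (1 - G * x) * (cosh (x / 2) / 2)\<bar> \<le> 7 / 4"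
    proof -
      have "G * sinh (x / 2) \<le> G * (1 / G)" using wx G by (intro mult_left_mono) auto
      then have a: "G * sinh (x / 2) \<le> 1" "0 \<le> G * sinh (x / 2)" using G wx by auto
      have "(1 - G * x) * (cosh (x / 2) / 2) \<le> 1 * (3 / 2 / 2)" using wx G by (intro mult_mono) auto
      moreover have "0 \<le> (1 - G * x) * (cosh (x / 2) / 2)" using wx by auto
      ultimately show ?thesis using a by (intro abs_leI) linarith+
    qed
    have "\<bar>2 * t * (sinh (x / 2))\<^sup>2\<bar> \<le> \<bar>D x\<bar> + \<bar>c\<bar>" unfolding D_def by linarith
    also have "\<dots> \<le> 3 * \<bar>D x\<bar>" using wx by linarith
    finally have 2: "\<bar>2 * t * (sinh (x / 2))\<^sup>2\<bar> \<le> 3 * \<bar>D x\<bar>" .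
    have "\<bar>(1 - G * x) * sinh (x / 2) * (2 * t * sinh (x / 2) * cosh (x / 2))\<bar> =
      (1 - G * x) * cosh (x / 2) * \<bar>2 * t * (sinh (x / 2))\<^sup>2\<bar>"
      using wx by (simp add: abs_mult power2_eq_square)
    also have "\<dots> \<le> 1 * (3 / 2) * (3 * \<bar>D x\<bar>)"
      using wx 2 G by (intro mult_mono) auto
    finally have 3: "\<bar>(1 - G * x) * sinh (x / 2) * (2 * t * sinh (x / 2) * cosh (x / 2))\<bar> \<le> 9 / 2 * \<bar>D x\<bar>" by simp
    have "\<bar>Q' x\<bar> \<le> (7 / 4 * \<bar>D x\<bar> + 9 / 2 * \<bar>D x\<bar>) / (\<bar>D x\<bar> * \<bar>D x\<bar>)"
      unfolding Q'_def abs_divide abs_mult[of "D x" "D x"]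
    proof (intro divide_right_mono order_trans[OF abs_triangle_ineq4] add_mono 3)
      show "\<bar>(- G * sinh (x / 2) + (1 - G * x) * (cosh (x / 2) / 2)) * D x\<bar> \<le> 7 / 4 * \<bar>D x\<bar>"
        unfolding abs_mult by (intro mult_right_mono 1) auto
    qed auto
    also have "\<dots> = (25 / 4) / \<bar>D x\<bar>" using d0 by (simp add: field_simps)
    also have "\<dots> \<le> (25 / 4) / (\<bar>c\<bar> / 2)" using wx \<open>c \<noteq> 0\<close> by (intro divide_left_mono) auto
    also have "\<dots> \<le> 14 / \<bar>c\<bar>" using \<open>c \<noteq> 0\<close> by (simp add: field_simps)
    finally show ?thesis .
  qed
  have "norm (integral {\<omega>..1 / G} (\<lambda>w. of_real (Q w) * of_real (t - c / (2 * (sinh (w / 2))\<^sup>2)) *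
      cis (t * w + c * (cosh (w / 2) / sinh (w / 2)))))
    \<le> norm (of_real (Q \<omega>) :: complex) + norm (of_real (Q (1 / G)) :: complex) + 14 / \<bar>c\<bar> * (1 / G - \<omega>)"
  proof (rule norm_integral_cis_le[where S = "{}" and Q' = "\<lambda>x. of_real (Q' x)" and g = "\<lambda>_. 14 / \<bar>c\<bar>"])
    show "continuous_on {\<omega>..1 / G} (\<lambda>w. complex_of_real (Q w))"
      unfolding Q_def using w contD by (intro continuous_intros) auto
    show "continuous_on {\<omega>..1 / G} (\<lambda>w. t - c / (2 * (sinh (w / 2))\<^sup>2))"
      using w by (intro continuous_intros) (auto dest: w)
    show "((\<lambda>w. complex_of_real (Q w)) has_vector_derivative of_real (Q' x)) (at x)" if "x \<in> {\<omega><..<1 / G} - {}" for x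
      using that by (intro has_vector_derivative_of_real dQ) auto
    show "((\<lambda>w. t * w + c * (cosh (w / 2) / sinh (w / 2))) has_real_derivative t - c / (2 * (sinh (x / 2))\<^sup>2)) (at x)"
      if "x \<in> {\<omega>..1 / G}" for x
    proof -
      have "((\<lambda>w. t * w + c * (cosh (w / 2) / sinh (w / 2))) has_real_derivative t * 1 + c * (- (1 / (2 * (sinh (x / 2))\<^sup>2)))) (at x)"
        by (intro DERIV_add DERIV_cmult DERIV_ident coth_half_deriv w(1)[OF that])
      then show ?thesis by simp
    qed
    show "((\<lambda>_. 14 / \<bar>c\<bar>) has_integral 14 / \<bar>c\<bar> * (1 / G - \<omega>)) {\<omega>..1 / G}"
      using has_integral_const_real[of "14 / \<bar>c\<bar>" \<omega> "1 / G"] \<omega> by (simp add: mult.commute)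
    show "norm (complex_of_real (Q' x)) \<le> 14 / \<bar>c\<bar>" if "x \<in> {\<omega><..<1 / G} - {}" for x
      unfolding norm_of_real using that by (intro bQ') auto
  qed (use \<omega> in auto)
  also have "\<dots> \<le> 2 / (G * \<bar>c\<bar>) + 2 / (G * \<bar>c\<bar>) + 14 / \<bar>c\<bar> * (1 / G)"
    unfolding norm_of_real using \<omega> G by (intro add_mono bQ mult_left_mono) auto
  also have "\<dots> \<le> 20 / (G * \<bar>c\<bar>)"
    using G \<open>c \<noteq> 0\<close> by (simp add: field_simps)
  also have "integral {\<omega>..1 / G} (\<lambda>w. of_real (Q w) * of_real (t - c / (2 * (sinh (w / 2))\<^sup>2)) *
      cis (t * w + c * (cosh (w / 2) / sinh (w / 2)))) = osc_int G t c \<omega>"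
    unfolding osc_int_def
  proof (rule integral_cong)
    fix x assume x: "x \<in> {\<omega>..1 / G}"
    have "Q x * (t - c / (2 * (sinh (x / 2))\<^sup>2)) = amp G x"
    proof -
      have "t - c / (2 * (sinh (x / 2))\<^sup>2) = D x / (2 * (sinh (x / 2))\<^sup>2)"
        using w[OF x] by (simp add: D_def field_simps)
      then show ?thesis using w[OF x] by (simp add: Q_def amp_def power2_eq_square)
    qed
    then have "complex_of_real (Q x) * of_real (t - c / (2 * (sinh (x / 2))\<^sup>2)) = of_real (amp G x)"
      unfolding of_real_mult[symmetric] by (rule arg_cong)
    then show "of_real (Q x) * of_real (t - c / (2 * (sinh (x / 2))\<^sup>2)) * cis (t * x + c * (cosh (x / 2) / sinh (x / 2))) =
       of_real (amp G x) * cis (t * x + c * (cosh (x / 2) / sinh (x / 2)))"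
      by (simp only:)
  qed
  finally show ?thesis .
qed

text \<open>
  Since \<open>coth (w / 2) = 2 / w + w / 6 + O(w^3)\<close>, the phase is close to \<open>(t + pi * n / 6) * w + 2 * pi * n / w\<close>.
  Completing the square, \<open>t + pi * n / 6 = t * (1 + pi * n / (12 * t))^2 - pi^2 * n^2 / (144 * t)\<close>, makes the
  stationary value equal to the phase of \<open>divisor_exp_sum\<close>; what is left over is the slowly varying \<open>phase_corr\<close>.
\<close>

definition saddle_pt :: "real \<Rightarrow> real \<Rightarrow> real" where
  "saddle_pt t n = sqrt (2 * pi * n / t) / (1 + pi * n / (12 * t))"

definition saddle_phase :: "real \<Rightarrow> real \<Rightarrow> real" where
  "saddle_phase t n = sqrt (2 * pi * n * t) * (1 + pi * n / (12 * t))"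

definition phase_corr :: "real \<Rightarrow> real \<Rightarrow> real \<Rightarrow> real" where
  "phase_corr t n w = pi * n * (cosh (w / 2) / sinh (w / 2) - 2 / w - w / 6) - pi\<^sup>2 * n\<^sup>2 * w / (144 * t)"

definition phase_corr' :: "real \<Rightarrow> real \<Rightarrow> real \<Rightarrow> real" where
  "phase_corr' t n w = pi * n * (- (1 / (2 * (sinh (w / 2))\<^sup>2)) + 2 / w\<^sup>2 - 1 / 6) - pi\<^sup>2 * n\<^sup>2 / (144 * t)"

lemma saddle_pt_pos: "t > 0 \<Longrightarrow> n > 0 \<Longrightarrow> saddle_pt t n > 0"
  unfolding saddle_pt_def by (intro divide_pos_pos add_pos_pos) auto

text \<open>An exact identity: in the variable \<open>x = w / saddle_pt t n\<close> the phase is the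
  model phase \<open>\<mu> * (x + 1 / x)\<close>, and \<open>phase_corr\<close> collects everything
  else.\<close>

lemma saddle_phase_eq:
  assumes "t > 0" "n > 0" "w > 0"
  shows "t * w + pi * n * (cosh (w / 2) / sinh (w / 2)) =
    saddle_phase t n * (w / saddle_pt t n + 1 / (w / saddle_pt t n)) + phase_corr t n w"
proof -
  define k where "k = pi * n / (12 * t)"
  define s where "s = sqrt (2 * pi * n / t)"
  have k: "k > 0" using assms by (simp add: k_def)
  have s: "s > 0" "s * s = 2 * pi * n / t" using assms by (auto simp: s_def)
  have st: "sqrt (2 * pi * n * t) = s * t"
  proof -
    have "2 * pi * n * t = 2 * pi * n / t * t\<^sup>2" using assms by (simp add: power2_eq_square)
    then show ?thesis using assms by (simp only: s_def real_sqrt_mult real_sqrt_abs abs_of_pos)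
  qed
  have p: "saddle_pt t n = s / (1 + k)" "saddle_phase t n = s * t * (1 + k)"
    unfolding saddle_pt_def saddle_phase_def st by (auto simp: s_def k_def)
  have "saddle_phase t n * (w / saddle_pt t n) = t * w * (1 + k)\<^sup>2"
    using s k by (simp add: p power2_eq_square field_simps)
  also have "\<dots> = t * w + pi * n * w / 6 + pi\<^sup>2 * n\<^sup>2 * w / (144 * t)"
    using assms by (simp add: k_def power2_sum power_divide field_simps power2_eq_square)
  finally have 1: "saddle_phase t n * (w / saddle_pt t n) = t * w + pi * n * w / 6 + pi\<^sup>2 * n\<^sup>2 * w / (144 * t)" .
  have "saddle_phase t n * (1 / (w / saddle_pt t n)) = s * s * t / w"
    using k by (simp add: p)
  also have "\<dots> = 2 * pi * n / w" using assms unfolding s(2) by simp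
  finally have 2: "saddle_phase t n * (1 / (w / saddle_pt t n)) = 2 * pi * n / w" .
  show ?thesis unfolding distrib_left 1 2 phase_corr_def by (simp add: algebra_simps)
qed

lemma phase_corr_deriv: "w > 0 \<Longrightarrow> (phase_corr t n has_real_derivative phase_corr' t n w) (at w)"
proof -
  assume w: "w > 0"
  have 1: "((\<lambda>w. 2 / w) has_real_derivative - (2 / w\<^sup>2)) (at w)"
    using w by (auto intro!: derivative_eq_intros simp: power2_eq_square)
  have 2: "((\<lambda>w. w / 6) has_real_derivative 1 / 6) (at w)"
    by (auto intro!: derivative_eq_intros)
  have 3: "((\<lambda>w. pi\<^sup>2 * n\<^sup>2 * w / (144 * t)) has_real_derivative pi\<^sup>2 * n\<^sup>2 / (144 * t)) (at w)"
    using DERIV_cdivide[OF DERIV_cmult_Id[of "pi\<^sup>2 * n\<^sup>2" w UNIV], of "144 * t"] by simp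
  show ?thesis
    using DERIV_diff[OF DERIV_cmult[OF DERIV_diff[OF DERIV_diff[OF coth_half_deriv[OF w] 1] 2], of "pi * n"] 3]
    unfolding phase_corr_def phase_corr'_def by simp
qed

lemma phase_corr_coth:
  fixes w :: real
  assumes "0 < w" "w \<le> 2"
  shows "\<bar>cosh (w / 2) / sinh (w / 2) - 2 / w - w / 6\<bar> \<le> w ^ 3 / 80"
    "\<bar>- (1 / (2 * (sinh (w / 2))\<^sup>2)) + 2 / w\<^sup>2 - 1 / 6\<bar> \<le> w\<^sup>2 / 72"
proof -
  show "\<bar>cosh (w / 2) / sinh (w / 2) - 2 / w - w / 6\<bar> \<le> w ^ 3 / 80"
    using coth_expansion[of "w / 2"] assms by (simp add: power_divide)
  have "- (1 / (2 * (sinh (w / 2))\<^sup>2)) + 2 / w\<^sup>2 - 1 / 6 = (1 / (w / 2)\<^sup>2 - 1 / 3 - 1 / (sinh (w / 2))\<^sup>2) / 2"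
    by (simp add: power_divide)
  then have "\<bar>- (1 / (2 * (sinh (w / 2))\<^sup>2)) + 2 / w\<^sup>2 - 1 / 6\<bar> = \<bar>1 / (w / 2)\<^sup>2 - 1 / 3 - 1 / (sinh (w / 2))\<^sup>2\<bar> / 2"
    by (simp only: abs_divide abs_numeral)
  also have "\<dots> \<le> ((w / 2)\<^sup>2 / 9) / 2"
    using assms by (intro divide_right_mono coth_deriv_expansion) auto
  finally show "\<bar>- (1 / (2 * (sinh (w / 2))\<^sup>2)) + 2 / w\<^sup>2 - 1 / 6\<bar> \<le> w\<^sup>2 / 72"
    by (simp add: power_divide)
qed

text \<open>The factor \<open>w\<close> makes the bound scale invariant, as
  \<open>stationary_phase\<close> requires: it measures how much the correction varies when
  \<open>w\<close> changes by a constant factor.\<close>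

lemma phase_corr'_le:
  assumes "t > 0" "n \<ge> 0" "0 < w" "w \<le> 2"
  shows "\<bar>phase_corr' t n w\<bar> * w \<le> pi * n * (w ^ 3 / 72) + pi\<^sup>2 * n\<^sup>2 * w / (144 * t)"
proof -
  have "\<bar>pi * n * (- (1 / (2 * (sinh (w / 2))\<^sup>2)) + 2 / w\<^sup>2 - 1 / 6)\<bar> \<le> pi * n * (w\<^sup>2 / 72)"
    unfolding abs_mult[of "pi * n"] using assms phase_corr_coth(2) by (intro mult_mono) auto
  moreover have "\<bar>pi\<^sup>2 * n\<^sup>2 / (144 * t)\<bar> = pi\<^sup>2 * n\<^sup>2 / (144 * t)"
    using assms by simp
  ultimately have "\<bar>phase_corr' t n w\<bar> \<le> pi * n * (w\<^sup>2 / 72) + pi\<^sup>2 * n\<^sup>2 / (144 * t)"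
    unfolding phase_corr'_def by linarith
  then have "\<bar>phase_corr' t n w\<bar> * w \<le> (pi * n * (w\<^sup>2 / 72) + pi\<^sup>2 * n\<^sup>2 / (144 * t)) * w"
    using assms by (intro mult_right_mono) auto
  also have "\<dots> = pi * n * (w ^ 3 / 72) + pi\<^sup>2 * n\<^sup>2 * w / (144 * t)"
    by (simp add: algebra_simps eval_nat_numeral)
  finally show ?thesis .
qed

text \<open>At the corner \<open>G * w = 1\<close> the value 0 is a convention;
  \<open>amp_deriv\<close> excludes that point.\<close>

definition amp' :: "real \<Rightarrow> real \<Rightarrow> real" where
  "amp' G w = (if G * w < 1 then - (G / (2 * sinh (w / 2)) + (1 - G * w) * cosh (w / 2) / (4 * (sinh (w / 2))\<^sup>2)) else 0)"

lemma amp_deriv: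
  assumes "G > 0" "w > 0" "G * w \<noteq> 1"
  shows "(amp G has_real_derivative amp' G w) (at w)"
proof (cases "G * w < 1")
  case True
  have "((\<lambda>w. (1 - G * w) / (2 * sinh (w / 2))) has_real_derivative
    (- G * (2 * sinh (w / 2)) - (1 - G * w) * cosh (w / 2)) / (2 * sinh (w / 2) * (2 * sinh (w / 2)))) (at w)"
    using assms by (auto intro!: derivative_eq_intros)
  moreover have "(- G * (2 * s) - (1 - G * w) * c) / (2 * s * (2 * s)) = - (G / (2 * s) + (1 - G * w) * c / (4 * s\<^sup>2))"
    if "s > 0" for s c :: real
    using that by (simp add: power2_eq_square divide_simps)
  ultimately have "((\<lambda>w. (1 - G * w) / (2 * sinh (w / 2))) has_real_derivative amp' G w) (at w)"
    using assms True by (simp add: amp'_def)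
  then show ?thesis
  proof (rule has_field_derivative_transform_within_open[where S = "{..<1 / G}"])
    show "w \<in> {..<1 / G}" using True assms by (simp add: field_simps)
    show "(1 - G * x) / (2 * sinh (x / 2)) = amp G x" if "x \<in> {..<1 / G}" for x
      using that assms by (simp add: amp_def field_simps)
  qed auto
next
  case False
  have "((\<lambda>_. 0) has_real_derivative amp' G w) (at w)"
    using False by (simp add: amp'_def)
  then show ?thesis
  proof (rule has_field_derivative_transform_within_open[where S = "{1 / G<..}"])
    show "w \<in> {1 / G<..}" using False assms by (simp add: field_simps)
    show "0 = amp G x" if "x \<in> {1 / G<..}" for x
      using that assms by (simp add: amp_def field_simps)
  qed auto
qed

lemma sinh_ge_self: "z \<le> sinh z" if "0 \<le> z" for z :: real
proof -
  have "0 \<le> sinh z - z"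
  proof (rule nonneg_of_derivative_nonneg[where f = "\<lambda>z. sinh z - z" and f' = "\<lambda>z. cosh z - 1"])
    show "0 \<le> (\<lambda>z. cosh z - 1) x" for x :: real
      using cosh_real_ge_1[of x] by simp
  qed (use that in \<open>auto intro!: derivative_eq_intros\<close>)
  then show ?thesis by simp
qed

lemma amp_le: "0 < w \<Longrightarrow> 0 \<le> G \<Longrightarrow> amp G w \<le> 1 / w"
  unfolding amp_def using sinh_ge_self[of "w / 2"] by (intro frac_le) auto

lemma amp_nonneg: "0 < w \<Longrightarrow> 0 \<le> amp G w"
  by (simp add: amp_def)

lemma amp_eq_0: "1 \<le> G * w \<Longrightarrow> amp G w = 0"
  by (simp add: amp_def)

lemma amp'_le:
  assumes "G \<ge> 1" "0 < w"
  shows "\<bar>amp' G w\<bar> \<le> (5 / 2) / w\<^sup>2"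
proof (cases "G * w < 1")
  case True
  have w: "w \<le> 1" using True assms mult_right_mono[of 1 G w] by linarith
  have s: "w / 2 \<le> sinh (w / 2)" using assms w by (intro sinh_ge1) auto
  have c: "cosh (w / 2) \<le> 3 / 2"
  proof -
    have "cosh (w / 2) \<le> 1 + (w / 2)\<^sup>2" using assms w by (intro cosh_le_sq) auto
    also have "(w / 2)\<^sup>2 \<le> (1 / 2)\<^sup>2" using assms w by (intro power_mono) auto
    finally show ?thesis by (simp add: power2_eq_square)
  qed
  have "G / (2 * sinh (w / 2)) \<le> (1 / w) / w"
    using True assms s by (intro frac_le) (auto simp: field_simps)
  moreover have "(1 - G * w) * cosh (w / 2) / (4 * (sinh (w / 2))\<^sup>2) \<le> (1 * (3 / 2)) / (4 * (w / 2)\<^sup>2)"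
    using True assms s c by (intro frac_le mult_mono mult_left_mono power_mono) auto
  moreover have "0 \<le> G / (2 * sinh (w / 2))" "0 \<le> (1 - G * w) * cosh (w / 2) / (4 * (sinh (w / 2))\<^sup>2)"
    using True assms by auto
  moreover have "\<bar>amp' G w\<bar> = \<bar>G / (2 * sinh (w / 2)) + (1 - G * w) * cosh (w / 2) / (4 * (sinh (w / 2))\<^sup>2)\<bar>"
    using True by (simp only: amp'_def if_True abs_minus_cancel)
  moreover have "(1 / w) / w + (1 * (3 / 2)) / (4 * (w / 2)\<^sup>2) = (5 / 2) / w\<^sup>2"
    by (simp add: power_divide power2_eq_square)
  ultimately show ?thesis by linarith
qed (use assms in \<open>auto simp: amp'_def\<close>)

text \<open>In units of the saddle point this is \<open>stationary_phase\<close> with amplitude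
  \<open>amp\<close> times \<open>cis phase_corr\<close>. The bound \<open>t \<le> 2 * G ^ 5\<close>
  keeps \<open>w\<close> times the derivative of \<open>phase_corr\<close> bounded up to the cutoff,
  so the correction may be counted as part of the amplitude. If the saddle lies beyond
  \<open>1 / G\<close>, the main term is 0 because \<open>amp\<close> is.\<close>

lemma osc_int_saddle:
  assumes F: "\<And>q. q > 0 \<Longrightarrow> norm (integral {-q..q} (\<lambda>x. cis (x\<^sup>2)) - F) \<le> 2 / q"
    and G: "G \<ge> 1" and t: "t > 0" "t \<le> 2 * G ^ 5" and n: "n > 0" "n \<le> 4 * t / G\<^sup>2"
    and \<omega>: "0 < \<omega>" "\<omega> \<le> 1 / G" "\<omega> \<le> saddle_pt t n / 2" and \<mu>: "saddle_phase t n \<ge> 4"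
  shows "norm (osc_int G t (pi * n) \<omega> - F * of_real (saddle_pt t n * amp G (saddle_pt t n)) *
      cis (phase_corr t n (saddle_pt t n)) * cis (2 * saddle_phase t n) / sqrt (saddle_phase t n))
    \<le> 600 * (1 + ln (saddle_phase t n)) / saddle_phase t n"
proof -
  define w0 where "w0 = saddle_pt t n"
  define \<mu> where "\<mu> = saddle_phase t n"
  define g where "g = (\<lambda>w. complex_of_real (amp G w) * cis (phase_corr t n w))"
  define g' where "g' = (\<lambda>w. complex_of_real (amp G w) * (of_real (phase_corr' t n w) * (\<i> * cis (phase_corr t n w))) + of_real (amp' G w) * cis (phase_corr t n w))"
  define f where "f = (\<lambda>w. complex_of_real (amp G w) * cis (t * w + pi * n * (cosh (w / 2) / sinh (w / 2))))"
  define B where "B = (\<lambda>x. w0 *\<^sub>R g (w0 * x))"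
  define B' where "B' = (\<lambda>x. w0 *\<^sub>R (w0 *\<^sub>R g' (w0 * x)))"
  define \<alpha> where "\<alpha> = \<omega> / w0"
  \<comment> \<open>Integration may run past the cutoff, where \<open>amp\<close> is 0; the maximum
    secures both \<open>b \<ge> 2\<close> and that \<open>{\<omega>..1 / G}\<close> is
    covered.\<close>
  define b where "b = max 2 (1 / (G * w0))"
  have w0: "w0 > 0" using saddle_pt_pos t n by (simp add: w0_def)
  have \<alpha>: "0 < \<alpha>" "\<alpha> \<le> 1 / 2" "w0 * \<alpha> = \<omega>" using \<omega> w0 by (auto simp: \<alpha>_def w0_def[symmetric] field_simps)
  have b: "b \<ge> 2" "1 / G \<le> w0 * b" using w0 G by (auto simp: b_def max_def field_simps)
  have contA: "continuous_on {p..q} (amp G)" if "p > 0" for p q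
    unfolding amp_def using that by (intro continuous_intros) auto
  have contE: "continuous_on {p..q} (phase_corr t n)" if "p > 0" for p q
    by (rule DERIV_atLeastAtMost_imp_continuous_on) (use that in \<open>auto intro!: exI phase_corr_deriv\<close>)
  have contg: "continuous_on {p..q} g" if "p > 0" for p q
    unfolding g_def using that by (intro continuous_intros contA contE) auto
  have contf: "continuous_on {p..q} f" if "p > 0" for p q
    unfolding f_def using that by (intro continuous_intros contA) auto
  have dg: "(g has_vector_derivative g' w) (at w)" if "w > 0" "w \<noteq> 1 / G" for w
  proof -
    have "((\<lambda>w. cis (phase_corr t n w)) has_vector_derivative (of_real (phase_corr' t n w) * (\<i> * cis (phase_corr t n w)))) (at w)"
      using has_derivative_cis[OF has_field_derivative_imp_has_derivative[OF phase_corr_deriv[OF that(1)]]]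
      by (simp add: has_vector_derivative_def scaleR_conv_of_real mult_ac)
    then show ?thesis
      unfolding g_def g'_def using that G
      by (intro has_vector_derivative_mult has_vector_derivative_of_real amp_deriv) (auto simp: field_simps)
  qed
  \<comment> \<open>For \<open>n\<close> up to \<open>4 * t / G\<^sup>2\<close> and \<open>w\<close>
    up to \<open>1 / G\<close> both quantities are at most multiples of
    \<open>t / G ^ 5\<close>.\<close>
  have small: "n * w ^ 3 \<le> 8" "n\<^sup>2 * w / t \<le> 32" if "0 < w" "w \<le> 1 / G" for w
  proof -
    have "n * w ^ 3 \<le> (4 * t / G\<^sup>2) * (1 / G) ^ 3"
      using n that G by (intro mult_mono power_mono) auto
    also have "\<dots> = 4 * (t / G ^ 5)" using G by (simp add: power_divide field_simps eval_nat_numeral)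
    also have "t / G ^ 5 \<le> 2" using t G by (simp add: field_simps)
    finally show "n * w ^ 3 \<le> 8" by simp
    have "n\<^sup>2 * w \<le> (4 * t / G\<^sup>2)\<^sup>2 * (1 / G)"
      using n that G by (intro mult_mono power_mono) auto
    then have "n\<^sup>2 * w / t \<le> (4 * t / G\<^sup>2)\<^sup>2 * (1 / G) / t" using t by (intro divide_right_mono) auto
    also have "\<dots> = 16 * (t / G ^ 5)" using G t by (simp add: power_divide field_simps eval_nat_numeral)
    also have "t / G ^ 5 \<le> 2" using t G by (simp add: field_simps)
    finally show "n\<^sup>2 * w / t \<le> 32" by simp
  qed
  have pi2: "pi \<le> 3.2" "pi\<^sup>2 \<le> 10.24"
  proof -
    show "pi \<le> 3.2" using pi_approx by simp
    then have "pi\<^sup>2 \<le> 3.2\<^sup>2" by (intro power_mono) auto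
    then show "pi\<^sup>2 \<le> 10.24" by (simp add: power2_eq_square)
  qed
  \<comment> \<open>\<open>6 = 7/2 + 5/2\<close>: the variation of the phase correction and the
    bound of \<open>amp'_le\<close>.\<close>
  have bg': "norm (g' w) \<le> 6 / w\<^sup>2" if "0 < w" for w
  proof (cases "w < 1 / G")
    case True
    have "w \<le> 1" using True G by (smt (verit) divide_le_eq_1)
    have e: "\<bar>phase_corr' t n w\<bar> * w \<le> 7 / 2"
    proof -
      have "\<bar>phase_corr' t n w\<bar> * w \<le> pi * n * (w ^ 3 / 72) + pi\<^sup>2 * n\<^sup>2 * w / (144 * t)"
        using t n that \<open>w \<le> 1\<close> by (intro phase_corr'_le) auto
      also have "\<dots> = pi * (n * w ^ 3) / 72 + pi\<^sup>2 * (n\<^sup>2 * w / t) / 144" by simp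
      also have "\<dots> \<le> 3.2 * 8 / 72 + 10.24 * 32 / 144"
        using small[of w] True that pi2 t n by (intro add_mono divide_right_mono mult_mono) auto
      also have "\<dots> \<le> 7 / 2" by simp
      finally show ?thesis .
    qed
    have "norm (g' w) \<le> \<bar>amp G w\<bar> * \<bar>phase_corr' t n w\<bar> + \<bar>amp' G w\<bar>"
      unfolding g'_def by (rule norm_triangle_le) (simp add: norm_mult)
    also have "\<dots> \<le> (1 / w) * (7 / 2 / w) + (5 / 2) / w\<^sup>2"
      using e that G amp_le[of w G] amp_nonneg[of w G] by (intro add_mono mult_mono amp'_le) (auto simp: field_simps)
    also have "\<dots> = 6 / w\<^sup>2" using that by (simp add: power2_eq_square)
    finally show ?thesis .
  next
    case False
    then have "1 \<le> G * w" using G by (simp add: field_simps)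
    then show ?thesis by (simp add: g'_def amp_eq_0 amp'_def)
  qed
  have "norm (integral {\<alpha>..b} (\<lambda>x. B x * cis (\<mu> * (x + 1 / x))) - F * B 1 * cis (2 * \<mu>) / sqrt \<mu>)
    \<le> 100 * 6 * (1 + ln \<mu>) / \<mu>"
  proof (rule stationary_phase[where S = "{1 / (G * w0)}" and B' = B', OF F])
    show "continuous_on {\<alpha>..b} B"
      unfolding B_def
      by (intro continuous_intros continuous_on_compose2[OF contg[of "w0 * \<alpha>" "w0 * b"]]) (use w0 \<alpha> b in auto)
    show "(B has_vector_derivative B' x) (at x)" if x: "x \<in> {\<alpha><..<b} - {1 / (G * w0)}" for x
    proof -
      have "w0 * x \<noteq> 1 / G" "w0 * x > 0" using x w0 G \<alpha> by (auto simp: field_simps)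
      note dg[OF this(2,1)]
      moreover have "((\<lambda>x. w0 * x) has_vector_derivative w0) (at x)"
        unfolding has_real_derivative_iff_has_vector_derivative[symmetric] by (rule DERIV_cmult_Id)
      ultimately have "((\<lambda>x. g (w0 * x)) has_vector_derivative w0 *\<^sub>R g' (w0 * x)) (at x)"
        using vector_diff_chain_at[of "\<lambda>x. w0 * x" w0 x g "g' (w0 * x)"] by (simp add: o_def)
      then show ?thesis
        unfolding B_def B'_def by (rule bounded_linear.has_vector_derivative[OF bounded_linear_scaleR_right])
    qed
    show "norm (B x) \<le> 6 / x" if "x \<in> {\<alpha>..b}" for x
    proof -
      have x: "x > 0" using that \<alpha> by auto
      have "norm (B x) = w0 * amp G (w0 * x)"
        using w0 x amp_nonneg[of "w0 * x" G] by (simp add: B_def g_def norm_mult)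
      also have "\<dots> \<le> w0 * (1 / (w0 * x))"
        using w0 x G by (intro mult_left_mono amp_le) auto
      also have "\<dots> \<le> 6 / x" using w0 x by (simp add: field_simps)
      finally show ?thesis .
    qed
    show "norm (B' x) \<le> 6 / x\<^sup>2" if "x \<in> {\<alpha><..<b} - {1 / (G * w0)}" for x
    proof -
      have x: "x > 0" using that \<alpha> by auto
      have "norm (B' x) = w0 * w0 * norm (g' (w0 * x))" using w0 by (simp add: B'_def)
      also have "\<dots> \<le> w0 * w0 * (6 / (w0 * x)\<^sup>2)"
        using w0 x by (intro mult_left_mono bg') auto
      also have "\<dots> = 6 / x\<^sup>2" using w0 x by (simp add: power2_eq_square)
      finally show ?thesis .
    qed
  qed (use \<mu> \<alpha> b in \<open>auto simp: \<mu>_def\<close>)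
  moreover have "B 1 = of_real (w0 * amp G w0) * cis (phase_corr t n w0)"
    by (simp add: B_def g_def scaleR_conv_of_real)
  moreover have "integral {\<alpha>..b} (\<lambda>x. B x * cis (\<mu> * (x + 1 / x))) = osc_int G t (pi * n) \<omega>"
  proof -
    have "((\<lambda>x. w0 *\<^sub>R f (w0 * x)) has_integral integral {w0 * \<alpha>..w0 * b} f) {\<alpha>..b}"
      by (rule has_integral_substitution[of _ _ _ "w0 * \<alpha>" "w0 * b"])
        (use w0 \<alpha> b \<omega> in \<open>auto intro!: derivative_eq_intros contf mult_left_mono\<close>)
    then have "integral {\<alpha>..b} (\<lambda>x. w0 *\<^sub>R f (w0 * x)) = integral {\<omega>..w0 * b} f"
      using \<alpha>(3) by (simp only: integral_unique)
    moreover have "integral {\<alpha>..b} (\<lambda>x. B x * cis (\<mu> * (x + 1 / x))) = integral {\<alpha>..b} (\<lambda>x. w0 *\<^sub>R f (w0 * x))"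
    proof (rule integral_cong)
      fix x assume "x \<in> {\<alpha>..b}"
      then have x: "x > 0" "w0 * x > 0" "w0 * x / w0 = x" using \<alpha> w0 by auto
      have "t * (w0 * x) + pi * n * (cosh (w0 * x / 2) / sinh (w0 * x / 2)) = \<mu> * (x + 1 / x) + phase_corr t n (w0 * x)"
        using saddle_phase_eq[OF t(1) n(1) x(2)] x by (simp add: w0_def[symmetric] \<mu>_def[symmetric])
      then show "B x * cis (\<mu> * (x + 1 / x)) = w0 *\<^sub>R f (w0 * x)"
        unfolding B_def f_def g_def by (simp add: cis_mult[symmetric])
    qed
    moreover have "integral {\<omega>..1 / G} f + integral {1 / G..w0 * b} f = integral {\<omega>..w0 * b} f"
      using \<omega> b by (intro Henstock_Kurzweil_Integration.integral_combine integrable_continuous_real contf) auto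
    moreover have "integral {1 / G..w0 * b} f = integral {1 / G..w0 * b} (\<lambda>_. 0)"
      using G by (intro integral_cong) (auto simp: f_def amp_eq_0 field_simps)
    ultimately show ?thesis by (simp add: osc_int_def f_def)
  qed
  ultimately show ?thesis by (simp add: w0_def \<mu>_def mult.assoc)
qed

section \<open>Poisson summation with Fejer weights\<close>

text \<open>With Fejer weights, Poisson summation needs only a Lipschitz bound for the summand.\<close>

definition fejer :: "nat \<Rightarrow> real \<Rightarrow> real" where
  "fejer H x = 1 + (\<Sum>h\<in>{1..<H}. (1 - real h / real H) * (2 * cos (2 * pi * real h * x)))"

text \<open>The factor \<open>sin y\<close> stays on the left so that its zeros need no separate
  treatment.\<close>

lemma dirichlet_kernel:
  "(1 + (\<Sum>h\<in>{1..H}. 2 * cos (2 * (real h * y)))) * sin y = sin ((2 * real H + 1) * y)"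
proof (induction H)
  case (Suc H)
  have "sin ((2 * real (Suc H) + 1) * y) - sin ((2 * real H + 1) * y) = 2 * sin y * cos (2 * (real (Suc H) * y))"
  proof -
    have "((2 * real (Suc H) + 1) * y - (2 * real H + 1) * y) / 2 = y"
      "((2 * real (Suc H) + 1) * y + (2 * real H + 1) * y) / 2 = 2 * (real (Suc H) * y)"
      by (simp_all add: algebra_simps)
    then show ?thesis unfolding sin_diff_sin by (simp only:)
  qed
  then show ?case using Suc by (simp add: algebra_simps)
qed simp

text \<open>The Fejer kernel is a mean of Dirichlet kernels. Passing from \<open>H\<close> to
  \<open>Suc H\<close> adds one of them to the unnormalised kernel \<open>U\<close>, and
  \<open>sin (a + y)\<close> squared minus \<open>sin a\<close> squared is
  \<open>sin (2 * a + y) * sin y\<close>.\<close>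

lemma fejer_closed_form:
  assumes "H > 0"
  shows "real H * fejer H x * (sin (pi * x))\<^sup>2 = (sin (real H * (pi * x)))\<^sup>2"
proof -
  define y where "y = pi * x"
  define U where "U = (\<lambda>H. real H + (\<Sum>h\<in>{1..<H}. (real H - real h) * (2 * cos (2 * (real h * y)))))"
  have "U H * (sin y)\<^sup>2 = (sin (real H * y))\<^sup>2" for H
  proof (induction H)
    case (Suc H)
    have "(\<Sum>h\<in>{1..<Suc H}. (real (Suc H) - real h) * (2 * cos (2 * (real h * y)))) =
      (\<Sum>h\<in>{1..<Suc H}. (real H - real h) * (2 * cos (2 * (real h * y)))) + (\<Sum>h\<in>{1..<Suc H}. 2 * cos (2 * (real h * y)))"
      by (simp add: sum.distrib[symmetric] algebra_simps)
    moreover have "(\<Sum>h\<in>{1..<Suc H}. (real H - real h) * (2 * cos (2 * (real h * y)))) =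
      (\<Sum>h\<in>{1..<H}. (real H - real h) * (2 * cos (2 * (real h * y))))"
      by (cases "H = 0") (simp_all add: sum.atLeastLessThan_Suc)
    ultimately have "U (Suc H) = U H + (1 + (\<Sum>h\<in>{1..H}. 2 * cos (2 * (real h * y))))"
      unfolding U_def by (simp add: atLeastLessThanSuc_atLeastAtMost)
    then have "U (Suc H) * (sin y)\<^sup>2 = (sin (real H * y))\<^sup>2 + sin ((2 * real H + 1) * y) * sin y"
    proof -
      have "U (Suc H) * (sin y)\<^sup>2 = U H * (sin y)\<^sup>2 + ((1 + (\<Sum>h\<in>{1..H}. 2 * cos (2 * (real h * y)))) * sin y) * sin y"
        unfolding \<open>U (Suc H) = _\<close> by (simp only: distrib_right power2_eq_square mult.assoc)
      then show ?thesis unfolding dirichlet_kernel Suc .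
    qed
    also have "\<dots> = (sin (real (Suc H) * y))\<^sup>2"
    proof -
      have "sin (a + y) * sin (a + y) - sin a * sin a = sin (2 * a + y) * sin y" for a
      proof -
        have "sin (a + y) * sin (a + y) - sin a * sin a = (sin (a + y) - sin a) * (sin (a + y) + sin a)"
          by (simp add: algebra_simps)
        also have "\<dots> = (2 * sin (y / 2) * cos ((2 * a + y) / 2)) * (2 * sin ((2 * a + y) / 2) * cos (y / 2))"
          unfolding sin_diff_sin sin_plus_sin by (simp add: algebra_simps)
        also have "\<dots> = (2 * sin ((2 * a + y) / 2) * cos ((2 * a + y) / 2)) * (2 * sin (y / 2) * cos (y / 2))"
          by (simp add: algebra_simps)
        also have "\<dots> = sin (2 * a + y) * sin y"
          unfolding sin_double[symmetric] by (simp add: add_divide_distrib)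
        finally show ?thesis .
      qed
      from this[of "real H * y"] show ?thesis by (simp add: power2_eq_square algebra_simps)
    qed
    finally show ?case .
  qed (simp add: U_def)
  moreover have "U H = real H * fejer H x"
    using assms by (simp add: U_def fejer_def y_def sum_distrib_left distrib_left mult_ac)
      (intro sum.cong refl, simp add: field_simps)
  ultimately show ?thesis by (metis y_def)
qed

text \<open>Up to 1/6 the derivative \<open>pi * cos (pi * u)\<close> exceeds 1; beyond that,
  monotonicity gives at least \<open>sin (pi / 6) = 1 / 2\<close>.\<close>

lemma sin_pi_lower: "\<bar>x\<bar> \<le> 1 / 2 \<Longrightarrow> \<bar>x\<bar> \<le> \<bar>sin (pi * x)\<bar>"
proof -
  have *: "x \<le> sin (pi * x)" if "0 \<le> x" "x \<le> 1 / 2" for x :: real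
  proof -
    show ?thesis
    proof (cases "x \<le> 1 / 6")
      case True
      have "0 \<le> sin (pi * x) - x"
      proof (rule nonneg_of_derivative_nonneg[where f = "\<lambda>x. sin (pi * x) - x" and f' = "\<lambda>x. pi * cos (pi * x) - 1"])
        fix u assume u: "0 \<le> u" "u \<le> x"
        then have "pi * u \<le> pi * (1 / 3)" using True by (intro mult_left_mono) auto
        then have "cos (pi / 3) \<le> cos (pi * u)" using u by (intro cos_monotone_0_pi_le) auto
        then have "pi * (1 / 2) \<le> pi * cos (pi * u)" by (intro mult_left_mono) (auto simp: cos_60)
        then have "1 \<le> pi * cos (pi * u)" using pi_gt3 by linarith
        then show "0 \<le> (\<lambda>x. pi * cos (pi * x) - 1) u" by simp
      qed (use that in \<open>auto intro!: derivative_eq_intros\<close>)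
      then show ?thesis by simp
    next
      case False
      then have "pi * (1 / 6) \<le> pi * x" "pi * x \<le> pi * (1 / 2)" using that by (auto intro!: mult_left_mono)
      then have "sin (pi / 6) \<le> sin (pi * x)" using pi_gt_zero by (intro sin_monotone_2pi_le) auto
      then show ?thesis using that by (simp add: sin_30)
    qed
  qed
  assume "\<bar>x\<bar> \<le> 1 / 2"
  then show ?thesis using *[of x] *[of "- x"] by (cases "x \<ge> 0") auto
qed

lemma continuous_on_fejer: "continuous_on A (fejer H)"
  unfolding fejer_def by (intro continuous_intros)

lemma fejer_nonneg:
  assumes "H > 0" "\<bar>x\<bar> \<le> 1 / 2"
  shows "0 \<le> fejer H x" and fejer_le: "x\<^sup>2 * fejer H x \<le> 1 / real H"
proof -
  have s: "x\<^sup>2 \<le> (sin (pi * x))\<^sup>2"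
    using sin_pi_lower[OF assms(2)] by (simp add: abs_le_square_iff)
  have e: "real H * fejer H x * (sin (pi * x))\<^sup>2 \<le> 1"
    unfolding fejer_closed_form[OF assms(1)] by (simp add: abs_square_le_1)
  have e0: "0 \<le> real H * fejer H x * (sin (pi * x))\<^sup>2"
    unfolding fejer_closed_form[OF assms(1)] by simp
  show n: "0 \<le> fejer H x"
  proof (cases "x = 0")
    case True
    have "0 \<le> (\<Sum>h\<in>{1..<H}. (1 - real h / real H) * 2)"
      by (intro sum_nonneg) (auto simp: field_simps)
    then show ?thesis using True by (simp add: fejer_def)
  next
    case False
    then have "0 < x\<^sup>2" by simp
    then have "0 < (sin (pi * x))\<^sup>2" using s by linarith
    then show ?thesis using e0 assms by (simp add: zero_le_mult_iff)
  qed
  have "x\<^sup>2 * fejer H x \<le> (sin (pi * x))\<^sup>2 * fejer H x"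
    using s n by (intro mult_right_mono)
  also have "\<dots> \<le> 1 / real H"
    using e assms by (simp add: field_simps)
  finally show "x\<^sup>2 * fejer H x \<le> 1 / real H" .
qed

lemma cos_add_2pi_nat: "cos (a + 2 * pi * real n) = cos a"
  and sin_add_2pi_nat: "sin (a + 2 * pi * real n) = sin a"
  using cos_2npi[of n] sin_2npi[of n] by (simp_all add: cos_add sin_add mult_ac)

lemma fejer_shift: "fejer H (x - real k) = fejer H x"
proof -
  have "cos (2 * pi * real h * (x - real k)) = cos (2 * pi * real h * x)" for h
  proof -
    have "2 * pi * real h * x = 2 * pi * real h * (x - real k) + 2 * pi * real (h * k)"
      by (simp add: algebra_simps)
    then show ?thesis by (simp only: cos_add_2pi_nat)
  qed
  then show ?thesis by (simp add: fejer_def)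
qed

lemma integral_fejer: "integral {real k - 1/2..real k + 1/2} (fejer H) = 1"
proof -
  have "((\<lambda>x. cos (2 * pi * real h * x)) has_integral 0) {real k - 1/2..real k + 1/2}" if "h > 0" for h :: nat
  proof -
    define F where "F = (\<lambda>x. sin (2 * pi * real h * x) / (2 * pi * real h))"
    have "((\<lambda>x. cos (2 * pi * real h * x)) has_integral F (real k + 1/2) - F (real k - 1/2)) {real k - 1/2..real k + 1/2}"
      by (rule fundamental_theorem_of_calculus)
        (use that in \<open>auto simp: F_def intro!: derivative_eq_intros simp flip: has_real_derivative_iff_has_vector_derivative\<close>)
    moreover have "F (real k + 1/2) = F (real k - 1/2)"
    proof -
      have "2 * pi * real h * (real k + 1/2) = 2 * pi * real h * (real k - 1/2) + 2 * pi * real h"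
        by (simp add: algebra_simps)
      then show ?thesis unfolding F_def by (simp only: sin_add_2pi_nat)
    qed
    ultimately show ?thesis by simp
  qed
  then have "((\<lambda>x. 1 + (\<Sum>h\<in>{1..<H}. (1 - real h / real H) * (2 * cos (2 * pi * real h * x)))) has_integral
     1 + (\<Sum>h\<in>{1..<H}. (1 - real h / real H) * (2 * 0))) {real k - 1/2..real k + 1/2}"
    using has_integral_const_real[of "1::real" "real k - 1/2" "real k + 1/2"]
    by (intro has_integral_add has_integral_sum has_integral_mult_right) auto
  then show ?thesis unfolding fejer_def[abs_def] by (simp add: integral_unique)
qed

text \<open>Around an integer, \<open>fejer H\<close> has mass 1 and is at most
  \<open>1 / (H * u\<^sup>2)\<close> at distance \<open>u\<close>, so its first absolute moment is
  of order \<open>1 / sqrt H\<close>.\<close>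

lemma fejer_local:
  fixes f :: "real \<Rightarrow> real"
  assumes "H > 0" and cont: "continuous_on {real k - 1/2..real k + 1/2} f"
    and lip: "\<And>x. x \<in> {real k - 1/2..real k + 1/2} \<Longrightarrow> \<bar>f (real k) - f x\<bar> \<le> B * \<bar>x - real k\<bar>" and "B \<ge> 0"
  shows "\<bar>f (real k) - integral {real k - 1/2..real k + 1/2} (\<lambda>x. f x * fejer H x)\<bar> \<le> B / sqrt (real H)"
proof -
  let ?I = "{real k - 1/2..real k + 1/2}"
  \<comment> \<open>The balancing parameter in
    \<open>\<bar>u\<bar> \<le> e / 2 + u\<^sup>2 / (2 * e)\<close>: after multiplication by the
    kernel the first part has integral \<open>e / 2\<close> because the mass is 1, and the second is
    pointwise at most \<open>e / 2\<close>.\<close>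
  define e where "e = 1 / sqrt (real H)"
  have e: "e > 0" "1 / real H = e * e" using assms by (auto simp: e_def)
  have int: "(\<lambda>x. f x * fejer H x) integrable_on ?I" "fejer H integrable_on ?I"
    by (intro integrable_continuous_real continuous_intros cont continuous_on_fejer)+
  have "f (real k) - integral ?I (\<lambda>x. f x * fejer H x) = integral ?I (\<lambda>x. (f (real k) - f x) * fejer H x)"
  proof -
    have "integral ?I (\<lambda>x. f (real k) * fejer H x - f x * fejer H x) =
        integral ?I (\<lambda>x. f (real k) * fejer H x) - integral ?I (\<lambda>x. f x * fejer H x)"
      using int by (intro Henstock_Kurzweil_Integration.integral_diff integrable_on_mult_right)
    then show ?thesis by (simp only: left_diff_distrib integral_mult_right integral_fejer mult_1_right)
  qed
  also have "\<bar>\<dots>\<bar> \<le> integral ?I (\<lambda>x. B * (e / 2) * fejer H x + B * (e / 2))"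
    unfolding real_norm_def[symmetric]
  proof (rule integral_norm_bound_integral)
    show "(\<lambda>x. (f (real k) - f x) * fejer H x) integrable_on ?I"
      by (intro integrable_continuous_real continuous_intros cont continuous_on_fejer)
    show "(\<lambda>x. B * (e / 2) * fejer H x + B * (e / 2)) integrable_on ?I"
      by (intro integrable_continuous_real continuous_intros continuous_on_fejer)
    fix x assume x: "x \<in> ?I"
    define u where "u = x - real k"
    have u: "\<bar>u\<bar> \<le> 1 / 2" using x unfolding u_def by (intro abs_leI) auto
    have fe: "0 \<le> fejer H x" "u\<^sup>2 * fejer H x \<le> e * e"
      using fejer_nonneg[OF assms(1) u] fejer_le[OF assms(1) u] e by (auto simp: u_def fejer_shift)
    have "\<bar>u\<bar> \<le> e / 2 + u\<^sup>2 / (2 * e)"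
    proof -
      have "0 \<le> (\<bar>u\<bar> - e)\<^sup>2" by simp
      then have "2 * e * \<bar>u\<bar> \<le> e\<^sup>2 + u\<^sup>2" by (simp add: power2_diff mult_ac add.commute)
      then show ?thesis using e by (simp add: field_simps power2_eq_square)
    qed
    then have "\<bar>u\<bar> * fejer H x \<le> (e / 2 + u\<^sup>2 / (2 * e)) * fejer H x"
      using fe by (intro mult_right_mono)
    also have "\<dots> = e / 2 * fejer H x + u\<^sup>2 * fejer H x / (2 * e)" by (simp add: algebra_simps)
    also have "\<dots> \<le> e / 2 * fejer H x + e * e / (2 * e)"
      using e fe by (intro add_left_mono divide_right_mono) auto
    also have "e * e / (2 * e) = e / 2" using e by simp
    finally have 1: "\<bar>u\<bar> * fejer H x \<le> e / 2 * fejer H x + e / 2" .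
    have "norm ((f (real k) - f x) * fejer H x) \<le> B * \<bar>u\<bar> * fejer H x"
      using lip[OF x] fe by (simp add: abs_mult u_def mult_right_mono)
    also have "\<dots> \<le> B * (e / 2 * fejer H x + e / 2)"
      using 1 \<open>B \<ge> 0\<close> by (simp add: mult.assoc mult_left_mono)
    finally show "norm ((f (real k) - f x) * fejer H x) \<le> B * (e / 2) * fejer H x + B * (e / 2)"
      by (simp add: algebra_simps)
  qed
  also have "\<dots> = B * (e / 2) * integral ?I (fejer H) + B * (e / 2)"
    using int by (subst Henstock_Kurzweil_Integration.integral_add)
      (auto intro!: integrable_continuous_real continuous_intros continuous_on_fejer)
  also have "\<dots> = B / sqrt (real H)"
    by (simp add: integral_fejer e_def)
  finally show ?thesis .
qed

lemma continuous_on_of_lipschitz: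
  fixes f :: "real \<Rightarrow> real"
  assumes "\<And>x y. x \<in> A \<Longrightarrow> y \<in> A \<Longrightarrow> \<bar>f x - f y\<bar> \<le> B * \<bar>x - y\<bar>" "B \<ge> 0"
  shows "continuous_on A f"
  by (rule lipschitz_on_continuous_on[of B]) (use assms in \<open>auto simp: lipschitz_on_def dist_real_def\<close>)

text \<open>Expanding \<open>fejer H\<close> into cosines turns the integral into the sum over the
  frequencies \<open>h < H\<close> of Poisson's formula, with weights \<open>1 - h / H\<close>.
  Since the error decays in \<open>H\<close>, a large \<open>H\<close> makes a crude Lipschitz
  constant acceptable.\<close>

lemma fejer_sum:
  fixes f :: "real \<Rightarrow> real"
  assumes "H > 0" and lip: "\<And>x y. x \<in> {1/2..real M + 1/2} \<Longrightarrow> y \<in> {1/2..real M + 1/2} \<Longrightarrow> \<bar>f x - f y\<bar> \<le> B * \<bar>x - y\<bar>"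
    and "B \<ge> 0"
  shows "\<bar>(\<Sum>k\<in>{1..M}. f (real k)) - integral {1/2..real M + 1/2} (\<lambda>x. f x * fejer H x)\<bar> \<le> real M * (B / sqrt (real H))"
proof -
  have cont: "continuous_on {1/2..real M + 1/2} f"
    by (rule continuous_on_of_lipschitz) (use lip assms in auto)
  have "integral {1/2..real m + 1/2} (\<lambda>x. f x * fejer H x) =
     (\<Sum>k\<in>{1..m}. integral {real k - 1/2..real k + 1/2} (\<lambda>x. f x * fejer H x))" if "m \<le> M" for m
    using that
  proof (induction m)
    case (Suc m)
    have "integral {1/2..real m + 1/2} (\<lambda>x. f x * fejer H x) + integral {real m + 1/2..real (Suc m) + 1/2} (\<lambda>x. f x * fejer H x) =
      integral {1/2..real (Suc m) + 1/2} (\<lambda>x. f x * fejer H x)"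
      using Suc.prems
      by (intro Henstock_Kurzweil_Integration.integral_combine integrable_continuous_real continuous_intros
          continuous_on_fejer continuous_on_subset[OF cont]) auto
    moreover have e: "real m + 1/2 = real (Suc m) - 1/2" by simp
    moreover have "{1..Suc m} = insert (Suc m) {1..m}" by auto
    moreover have "integral {1/2..real m + 1/2} (\<lambda>x. f x * fejer H x) =
     (\<Sum>k\<in>{1..m}. integral {real k - 1/2..real k + 1/2} (\<lambda>x. f x * fejer H x))"
      using Suc by simp
    ultimately show ?case by (simp only: sum.insert[OF finite_atLeastAtMost]) (simp only: add.commute atLeastAtMost_iff, simp)
  qed simp
  then have "(\<Sum>k\<in>{1..M}. f (real k)) - integral {1/2..real M + 1/2} (\<lambda>x. f x * fejer H x) =
    (\<Sum>k\<in>{1..M}. f (real k) - integral {real k - 1/2..real k + 1/2} (\<lambda>x. f x * fejer H x))"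
    by (simp add: sum_subtractf)
  also have "\<bar>\<dots>\<bar> \<le> (\<Sum>k\<in>{1..M}. B / sqrt (real H))"
  proof (intro order_trans[OF sum_abs] sum_mono fejer_local assms)
    fix k assume k: "k \<in> {1..M}"
    show "continuous_on {real k - 1/2..real k + 1/2} f"
      using k by (intro continuous_on_subset[OF cont]) auto
    fix x assume "x \<in> {real k - 1/2..real k + 1/2}"
    then show "\<bar>f (real k) - f x\<bar> \<le> B * \<bar>x - real k\<bar>"
      using lip[of "real k" x] k by (auto simp: abs_minus_commute)
  qed
  finally show ?thesis by simp
qed

section \<open>Change of variables along a diagonal\<close>

definition xi :: "real \<Rightarrow> real \<Rightarrow> real" where
  "xi s x = ln ((x + s) / x)"

definition xinv :: "real \<Rightarrow> real \<Rightarrow> real" where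
  "xinv s w = s / 2 * (cosh (w / 2) / sinh (w / 2) - 1)"

text \<open>The summand of the diagonal form at the integers \<open>x\<close> and
  \<open>x + s\<close>, continued to real \<open>x\<close>.\<close>

definition corr_term :: "real \<Rightarrow> real \<Rightarrow> real \<Rightarrow> real \<Rightarrow> real" where
  "corr_term G t s x = 1 / sqrt (x * (x + s)) * cos (t * xi s x) * max 0 (1 - G * xi s x)"

lemma xinv_eq: "w > 0 \<Longrightarrow> xinv s w = s / (exp w - 1)"
proof -
  assume w: "w > 0"
  define a where "a = exp (w / 2)"
  have a: "a > 1" "exp w = a * a" "exp (- (w / 2)) = 1 / a"
    using w exp_add[of "w / 2" "w / 2"] exp_minus[of "w / 2"] by (simp_all add: a_def inverse_eq_divide)
  have "a * a - 1 > 0" using a mult_strict_mono[of 1 a 1 a] by simp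
  have S: "sinh (w / 2) = (a * a - 1) / (2 * a)" "cosh (w / 2) = (a * a + 1) / (2 * a)"
    using a(1) by (simp_all add: sinh_def cosh_def a(3) a_def[symmetric] diff_divide_distrib add_divide_distrib)
  have "cosh (w / 2) / sinh (w / 2) = (a * a + 1) / (a * a - 1)" using a unfolding S by simp
  also have "\<dots> = 1 + 2 / (a * a - 1)" using \<open>a * a - 1 > 0\<close> by (simp add: field_simps)
  finally show ?thesis by (simp add: xinv_def a)
qed

lemma xinv_pos: "w > 0 \<Longrightarrow> s > 0 \<Longrightarrow> xinv s w > 0"
  by (simp add: xinv_eq)

lemma xi_xinv: "w > 0 \<Longrightarrow> s > 0 \<Longrightarrow> xi s (xinv s w) = w"
proof -
  assume "w > 0" "s > 0"
  then have "exp w - 1 > 0" by simp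
  then have "(s / (exp w - 1) + s) / (s / (exp w - 1)) = exp w"
    using \<open>s > 0\<close> by (simp add: field_simps)
  then show ?thesis using \<open>w > 0\<close> by (simp add: xinv_eq xi_def)
qed

lemma xi_pos: "x > 0 \<Longrightarrow> s > 0 \<Longrightarrow> xi s x > 0"
  by (simp add: xi_def field_simps)

lemma xinv_xi: "x > 0 \<Longrightarrow> s > 0 \<Longrightarrow> xinv s (xi s x) = x"
proof -
  assume a: "x > 0" "s > 0"
  have "exp (xi s x) - 1 = (x + s) / x - 1" using a by (simp add: xi_def)
  also have "\<dots> = s / x" using a by (simp add: field_simps)
  finally show ?thesis unfolding xinv_eq[OF xi_pos[OF a]] using a by simp
qed

lemma xinv_antimono: "0 < v \<Longrightarrow> v \<le> w \<Longrightarrow> s > 0 \<Longrightarrow> xinv s w \<le> xinv s v"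
  by (simp add: xinv_eq divide_left_mono)

lemma xi_antimono: "0 < x \<Longrightarrow> x \<le> y \<Longrightarrow> s > 0 \<Longrightarrow> xi s y \<le> xi s x"
  unfolding xi_def by (intro ln_mono) (auto simp: field_simps)

lemma xinv_deriv: "w > 0 \<Longrightarrow> (xinv s has_real_derivative (- (s / (4 * (sinh (w / 2))\<^sup>2)))) (at w)"
proof -
  assume w: "w > 0"
  show ?thesis
    using DERIV_cmult[OF DERIV_diff[OF coth_half_deriv[OF w] DERIV_const[of 1]], of "s / 2"]
    unfolding xinv_def by simp
qed

lemma xi_deriv: "x > 0 \<Longrightarrow> s > 0 \<Longrightarrow> (xi s has_real_derivative (- (s / (x * (x + s))))) (at x)"
proof -
  assume a: "x > 0" "s > 0"
  have "((\<lambda>x. ln (x + s) - ln x) has_real_derivative 1 / (x + s) - 1 / x) (at x)"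
    using a by (auto intro!: derivative_eq_intros)
  moreover have "1 / (x + s) - 1 / x = - (s / (x * (x + s)))" using a by (simp add: field_simps)
  ultimately have "((\<lambda>x. ln (x + s) - ln x) has_real_derivative - (s / (x * (x + s)))) (at x)" by simp
  then show ?thesis
  proof (rule has_field_derivative_transform_within_open[where S = "{0<..}"])
    show "ln (y + s) - ln y = xi s y" if "y \<in> {0<..}" for y
      using that a by (simp add: xi_def ln_div)
  qed (use a in auto)
qed

text \<open>With \<open>x = xinv s w\<close> the product \<open>x * (x + s)\<close> is
  \<open>(s / 2)\<^sup>2\<close> times the square of \<open>cosh (w / 2) / sinh (w / 2)\<close>
  minus 1, that is \<open>(s / (2 * sinh (w / 2)))\<^sup>2\<close>.\<close>

lemma sqrt_xi:
  assumes "x > 0" "s > 0"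
  shows "1 / sqrt (x * (x + s)) = 2 * sinh (xi s x / 2) / s"
proof -
  define w where "w = xi s x"
  have w: "w > 0" using xi_pos assms by (simp add: w_def)
  have x: "x = s / 2 * (cosh (w / 2) / sinh (w / 2) - 1)"
    using xinv_xi[OF assms] by (simp add: w_def xinv_def)
  have "x * (x + s) = (s / 2)\<^sup>2 * ((cosh (w / 2) / sinh (w / 2))\<^sup>2 - 1)"
    unfolding x by (simp add: algebra_simps power2_eq_square)
  also have "(cosh (w / 2) / sinh (w / 2))\<^sup>2 - 1 = (1 / sinh (w / 2))\<^sup>2"
    using w cosh_square_eq[of "w / 2"] by (simp add: power_divide field_simps)
  also have "(s / 2)\<^sup>2 * (1 / sinh (w / 2))\<^sup>2 = (s / (2 * sinh (w / 2)))\<^sup>2"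
    by (simp add: power_mult_distrib[symmetric])
  finally have "sqrt (x * (x + s)) = s / (2 * sinh (w / 2))"
    using assms w by simp
  then show ?thesis by (simp add: w_def)
qed

lemma continuous_on_xi: "s > 0 \<Longrightarrow> A \<subseteq> {0<..} \<Longrightarrow> continuous_on A (xi s)"
  by (intro continuous_at_imp_continuous_on ballI DERIV_isCont[OF xi_deriv]) auto

lemma continuous_on_corr_term: "s > 0 \<Longrightarrow> A \<subseteq> {0<..} \<Longrightarrow> continuous_on A (corr_term G t s)"
  unfolding corr_term_def
  by (intro continuous_intros continuous_on_xi) (auto simp: subset_eq)

text \<open>In the substitution \<open>x = xinv s w\<close> the Jacobian
  \<open>s / (4 * (sinh (w / 2))\<^sup>2)\<close> meets the factor
  \<open>2 * sinh (w / 2) / s\<close> of \<open>sqrt_xi\<close>; together they form the denominator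
  of \<open>amp\<close>. The map reverses orientation, so \<open>X\<close> produces the lower
  limit.\<close>

lemma corr_term_integral:
  assumes s: "s \<ge> 1" and G: "G \<ge> 1" and X: "X \<ge> 1 / 2" and c: "continuous_on {0<..} c"
  shows "integral {1/2..X} (\<lambda>x. corr_term G t s x * c x) =
    integral {xi s X..1 / G} (\<lambda>w. amp G w * cos (t * w) * c (xinv s w))"
proof (cases "xi s X \<le> 1 / G")
  case True
  define l where "l = xinv s (1 / G)"
  have G0: "1 / G > 0" "1 / G \<le> 1" using G by auto
  have s0: "s > 0" using s by simp
  have a0: "xi s X > 0" using xi_pos X s by simp
  \<comment> \<open>Ensures that an integral starting at 1/2 loses nothing: the part below
    \<open>l\<close> vanishes anyway. The bound holds because \<open>s \<ge> 1\<close> and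
    \<open>exp (1 / G) - 1 \<le> 2\<close>.\<close>
  have l: "l \<ge> 1 / 2"
  proof -
    have "exp (1 / G) \<le> 1 + 1 / G + (1 / G)\<^sup>2" using G0 by (intro exp_bound) auto
    also have "(1 / G)\<^sup>2 \<le> 1 / G" using G0 by (simp add: power2_eq_square field_simps)
    finally have "exp (1 / G) - 1 \<le> 2" using G0(2) by linarith
    moreover have "exp (1 / G) - 1 > 0" using G0 by simp
    ultimately have "1 / 2 \<le> s / (exp (1 / G) - 1)" using s by (intro frac_le) auto
    then show ?thesis unfolding l_def xinv_eq[OF G0(1)] .
  qed
  have lX: "l \<le> X"
    using xinv_antimono[OF a0 True s0] xinv_xi[of X s] X s0 by (simp add: l_def)
  have cont: "continuous_on {u..v} (\<lambda>x. corr_term G t s x * c x)" if "u > 0" for u v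
    using that s0 by (intro continuous_intros continuous_on_corr_term continuous_on_subset[OF c]) auto
  have "((\<lambda>w. (- (s / (4 * (sinh (w / 2))\<^sup>2))) *\<^sub>R (\<lambda>x. corr_term G t s x * c x) (xinv s w)) has_integral
     integral {xinv s (xi s X)..xinv s (1 / G)} (\<lambda>x. corr_term G t s x * c x)
     - integral {xinv s (1 / G)..xinv s (xi s X)} (\<lambda>x. corr_term G t s x * c x)) {xi s X..1 / G}"
  proof (rule has_integral_substitution_general[of "{}" _ _ _ l X])
    show "xinv s ` {xi s X..1 / G} \<subseteq> {l..X}"
      using xinv_antimono[OF _ _ s0] a0 xinv_xi[of X s] X s0 by (fastforce simp: l_def)
    show "continuous_on {l..X} (\<lambda>x. corr_term G t s x * c x)" using l by (intro cont) auto
    show "(xinv s has_real_derivative - (s / (4 * (sinh (x / 2))\<^sup>2))) (at x within {xi s X..1 / G})"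
      if "x \<in> {xi s X..1 / G} - {}" for x
      using that a0 by (intro has_field_derivative_at_within[OF xinv_deriv]) auto
    show "continuous_on {xi s X..1 / G} (xinv s)"
      using a0 by (intro continuous_at_imp_continuous_on ballI DERIV_isCont[OF xinv_deriv]) auto
  qed (use True in auto)
  moreover have "integral {X..l} (\<lambda>x. corr_term G t s x * c x) = 0"
    using lX by (cases "l = X") auto
  ultimately have 1: "((\<lambda>w. (- (s / (4 * (sinh (w / 2))\<^sup>2))) * (corr_term G t s (xinv s w) * c (xinv s w))) has_integral
     - integral {l..X} (\<lambda>x. corr_term G t s x * c x)) {xi s X..1 / G}"
    using xinv_xi[of X s] X s0 by (simp add: l_def)
  have "integral {l..X} (\<lambda>x. corr_term G t s x * c x) =
    integral {xi s X..1 / G} (\<lambda>w. s / (4 * (sinh (w / 2))\<^sup>2) * (corr_term G t s (xinv s w) * c (xinv s w)))"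
    using has_integral_neg[OF 1] by (simp add: integral_unique)
  also have "\<dots> = integral {xi s X..1 / G} (\<lambda>w. amp G w * cos (t * w) * c (xinv s w))"
  proof (rule integral_cong)
    fix w assume "w \<in> {xi s X..1 / G}"
    then have w: "w > 0" using a0 by auto
    have "corr_term G t s (xinv s w) = 2 * sinh (w / 2) / s * cos (t * w) * max 0 (1 - G * w)"
      unfolding corr_term_def sqrt_xi[OF xinv_pos[OF w s0] s0] xi_xinv[OF w s0] ..
    moreover have "s / (4 * (sinh (w / 2))\<^sup>2) * (2 * sinh (w / 2) / s * cos (t * w) * max 0 (1 - G * w)) = amp G w * cos (t * w)"
    proof -
      have "sinh (w / 2) > 0" using w by simp
      then show ?thesis using s0 by (simp add: amp_def power2_eq_square)
    qed
    ultimately show "s / (4 * (sinh (w / 2))\<^sup>2) * (corr_term G t s (xinv s w) * c (xinv s w)) = amp G w * cos (t * w) * c (xinv s w)"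
      by (simp only: mult.assoc[symmetric])
  qed
  finally have 2: "integral {l..X} (\<lambda>x. corr_term G t s x * c x) = integral {xi s X..1 / G} (\<lambda>w. amp G w * cos (t * w) * c (xinv s w))" .
  have "integral {1/2..l} (\<lambda>x. corr_term G t s x * c x) = integral {1/2..l} (\<lambda>_. 0)"
  proof (rule integral_cong)
    fix x assume x: "x \<in> {1/2..l}"
    then have "xi s l \<le> xi s x" using s0 by (intro xi_antimono) auto
    then have "1 / G \<le> xi s x" using xi_xinv[OF G0(1) s0] by (simp add: l_def)
    then have "1 - G * xi s x \<le> 0" using G by (simp add: field_simps)
    then show "corr_term G t s x * c x = 0" by (simp add: corr_term_def)
  qed
  moreover have "integral {1/2..l} (\<lambda>x. corr_term G t s x * c x) + integral {l..X} (\<lambda>x. corr_term G t s x * c x) =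
    integral {1/2..X} (\<lambda>x. corr_term G t s x * c x)"
    using l lX by (intro Henstock_Kurzweil_Integration.integral_combine integrable_continuous_real cont) auto
  ultimately show ?thesis using 2 by simp
next
  case False
  have s0: "s > 0" using s by simp
  \<comment> \<open>The cutoff removes the whole diagonal, and the interval on the right side is
    empty.\<close>
  have "integral {1/2..X} (\<lambda>x. corr_term G t s x * c x) = integral {1/2..X} (\<lambda>_. 0)"
  proof (rule integral_cong)
    fix x assume x: "x \<in> {1/2..X}"
    then have "xi s X \<le> xi s x" using s0 by (intro xi_antimono) auto
    then have "1 / G \<le> xi s x" using False by simp
    then have "1 - G * xi s x \<le> 0" using G by (simp add: field_simps)
    then show "corr_term G t s x * c x = 0" by (simp add: corr_term_def)
  qed
  then show ?thesis using False by simp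
qed

lemma Re_osc_int:
  assumes "\<omega> > 0"
  shows "((\<lambda>w. amp G w * cos (t * w + c * (cosh (w / 2) / sinh (w / 2)))) has_integral Re (osc_int G t c \<omega>)) {\<omega>..1 / G}"
proof -
  have "(\<lambda>w. of_real (amp G w) * cis (t * w + c * (cosh (w / 2) / sinh (w / 2)))) integrable_on {\<omega>..1 / G}"
    unfolding amp_def using assms by (intro integrable_continuous_real continuous_intros) auto
  then have "((\<lambda>w. of_real (amp G w) * cis (t * w + c * (cosh (w / 2) / sinh (w / 2)))) has_integral osc_int G t c \<omega>) {\<omega>..1 / G}"
    unfolding osc_int_def by (rule integrable_integral)
  from has_integral_linear[OF this bounded_linear_Re] show ?thesis
    by (simp add: o_def)
qed

lemma corr_term_integral_0:
  assumes "s \<ge> 1" "G \<ge> 1" "X \<ge> 1 / 2"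
  shows "integral {1/2..X} (corr_term G t s) = Re (osc_int G t 0 (xi s X))"
proof -
  have "xi s X > 0" using assms by (intro xi_pos) auto
  then show ?thesis
    using corr_term_integral[OF assms, of "\<lambda>_. 1" t] Re_osc_int[of "xi s X" G t 0]
    by (simp add: integral_unique)
qed

text \<open>\<open>2 * pi * h * xinv s w\<close> equals \<open>pi * h * s * coth (w / 2)\<close>
  minus \<open>h * s * pi\<close>. This shift by a multiple of \<open>pi\<close> is the origin of
  the sign \<open>(- 1) ^ k\<close> in \<open>divisor_exp_sum\<close>. The product of two cosines
  then splits into the frequencies of both signs.\<close>

lemma corr_term_integral_cos:
  fixes s h :: nat
  assumes "s \<ge> 1" "G \<ge> 1" "X \<ge> 1 / 2"
  shows "integral {1/2..X} (\<lambda>x. corr_term G t s x * (2 * cos (2 * pi * real h * x))) =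
    (- 1) ^ (h * s) * (Re (osc_int G t (pi * real (h * s)) (xi s X)) + Re (osc_int G t (- (pi * real (h * s))) (xi s X)))"
proof -
  have x0: "xi s X > 0" using assms by (intro xi_pos) auto
  have "integral {1/2..X} (\<lambda>x. corr_term G t s x * (2 * cos (2 * pi * real h * x))) =
     integral {xi s X..1 / G} (\<lambda>w. amp G w * cos (t * w) * (2 * cos (2 * pi * real h * xinv s w)))"
    using assms by (intro corr_term_integral continuous_intros) auto
  also have "\<dots> = (- 1) ^ (h * s) * (Re (osc_int G t (pi * real (h * s)) (xi s X)) + Re (osc_int G t (- (pi * real (h * s))) (xi s X)))"
  proof (rule integral_unique)
    have eq: "amp G w * cos (t * w) * (2 * cos (2 * pi * real h * xinv s w)) =
      (- 1) ^ (h * s) * (amp G w * cos (t * w + pi * real (h * s) * (cosh (w / 2) / sinh (w / 2))) +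
        amp G w * cos (t * w + - (pi * real (h * s)) * (cosh (w / 2) / sinh (w / 2))))" for w
    proof -
      define a where "a = pi * real (h * s) * (cosh (w / 2) / sinh (w / 2))"
      have "2 * pi * real h * xinv s w = a - real (h * s) * pi"
        by (simp add: xinv_def a_def algebra_simps)
      then have "cos (2 * pi * real h * xinv s w) = (- 1) ^ (h * s) * cos a"
        using cos_npi[of "h * s"] sin_npi[of "h * s"] by (simp only: cos_diff) (simp add: mult.commute)
      moreover have "2 * (cos (t * w) * cos a) = cos (t * w + a) + cos (t * w + - a)"
        by (simp add: cos_add cos_diff)
      ultimately show ?thesis unfolding a_def[symmetric] minus_mult_left[symmetric]
        by (metis (no_types, lifting) a_def distrib_left mult.assoc mult.left_commute mult_minus_left)
    qed
    show "((\<lambda>w. amp G w * cos (t * w) * (2 * cos (2 * pi * real h * xinv s w))) has_integral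
      (- 1) ^ (h * s) * (Re (osc_int G t (pi * real (h * s)) (xi s X)) + Re (osc_int G t (- (pi * real (h * s))) (xi s X)))) {xi s X..1 / G}"
      unfolding eq by (intro has_integral_mult_right has_integral_add Re_osc_int x0)
  qed
  finally show ?thesis .
qed

text \<open>By \<open>sqrt_xi\<close>, \<open>corr_term\<close> is a smooth function
  \<open>P\<close> of \<open>min (xi s x) (1 / G)\<close>, divided by \<open>s\<close>; the
  truncation by \<open>max\<close> turns into this \<open>min\<close> because \<open>P\<close>
  vanishes at \<open>1 / G\<close>. The constant is the product of those of \<open>P\<close> on
  \<open>{0..1 / G}\<close> and of \<open>xi s\<close> for \<open>x \<ge> 1 / 2\<close>.\<close>

lemma corr_term_lipschitz:
  assumes s: "s \<ge> 1" and G: "G \<ge> 1" and t: "t \<ge> 0" and "x \<ge> 1 / 2" "y \<ge> 1 / 2"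
  shows "\<bar>corr_term G t s x - corr_term G t s y\<bar> \<le> (8 + 4 * t) * \<bar>x - y\<bar>"
proof -
  define P where "P = (\<lambda>w. 2 * sinh (w / 2) * cos (t * w) * (1 - G * w))"
  define P' where "P' = (\<lambda>w. cosh (w / 2) * cos (t * w) * (1 - G * w) - 2 * sinh (w / 2) * (t * sin (t * w)) * (1 - G * w)
      - 2 * sinh (w / 2) * cos (t * w) * G)"
  have s0: "s > 0" using s by simp
  have dP: "(P has_real_derivative P' w) (at w)" for w
    unfolding P_def P'_def by (auto intro!: derivative_eq_intros simp: algebra_simps)
  have bP: "\<bar>P' w\<bar> \<le> 4 + 2 * t" if "w \<in> {0..1 / G}" for w
  proof -
    have w: "0 \<le> w" "w \<le> 1 / G" "G * w \<le> 1" using that G by (auto simp: field_simps)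
    have w1: "w \<le> 1" using w G by (smt (verit) divide_le_eq_1)
    have c: "cosh (w / 2) \<le> 2" using w w1 by (intro cosh_le_2) auto
    have "sinh (w / 2) \<le> w / 2 + (w / 2) ^ 3 / 3" using w w1 by (intro sinh_le3) auto
    also have "\<dots> \<le> w / 2 + (w / 2) ^ 1 / 3" using w w1 by (intro add_left_mono divide_right_mono power_decreasing) auto
    also have "\<dots> \<le> w" using w by simp
    finally have sh: "sinh (w / 2) \<le> w" .
    have sh0: "0 \<le> sinh (w / 2)" using w by simp
    have m: "0 \<le> 1 - G * w" "1 - G * w \<le> 1" using w G by auto
    have 1: "\<bar>cosh (w / 2) * cos (t * w) * (1 - G * w)\<bar> \<le> 2 * 1 * 1"
      unfolding abs_mult using c m by (intro mult_mono) auto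
    have 2: "\<bar>2 * sinh (w / 2) * (t * sin (t * w)) * (1 - G * w)\<bar> \<le> 2 * 1 * (t * 1) * 1"
      unfolding abs_mult using sh sh0 w1 m t by (intro mult_mono) auto
    have 3: "\<bar>2 * sinh (w / 2) * cos (t * w) * G\<bar> \<le> 2 * (1 / G) * 1 * G"
      unfolding abs_mult using sh sh0 w G by (intro mult_mono) auto
    also have "\<dots> = 2" using G by simp
    finally show ?thesis unfolding P'_def using 1 2 by linarith
  qed
  have lipP: "\<bar>P v - P w\<bar> \<le> (4 + 2 * t) * \<bar>v - w\<bar>" if "v \<in> {0..1 / G}" "w \<in> {0..1 / G}" for v w
    using field_differentiable_bound[of "{0..1/G}" P P' "4 + 2 * t" v w] that bP dP
    by (auto intro: has_field_derivative_at_within)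
  have lipxi: "\<bar>xi s x - xi s y\<bar> \<le> 2 * \<bar>x - y\<bar>" if "x \<ge> 1 / 2" "y \<ge> 1 / 2" for x y
  proof -
    have "norm (xi s x - xi s y) \<le> 2 * norm (x - y)"
    proof (rule field_differentiable_bound[of "{1/2..}" _ "\<lambda>x. - (s / (x * (x + s)))"])
      fix z :: real assume z: "z \<in> {1/2..}"
      show "(xi s has_real_derivative - (s / (z * (z + s)))) (at z within {1/2..})"
        using z s0 by (intro has_field_derivative_at_within[OF xi_deriv]) auto
      have "s / (z * (z + s)) \<le> 2" using z s0 mult_mono[of "1/2" z s "z + s"] by (simp add: field_simps)
      then show "norm (- (s / (z * (z + s)))) \<le> 2" using z s0 by simp
    qed (use that in auto)
    then show ?thesis by simp
  qed
  have eq: "corr_term G t s x = P (min (xi s x) (1 / G)) / s" if "x \<ge> 1 / 2" for x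
  proof -
    have x0: "x > 0" using that by simp
    have "2 * sinh (xi s x / 2) * cos (t * xi s x) * max 0 (1 - G * xi s x) = P (min (xi s x) (1 / G))"
      using G by (auto simp: P_def min_def max_def field_simps)
    then show ?thesis unfolding corr_term_def sqrt_xi[OF x0 s0] by (simp add: field_simps)
  qed
  have "\<bar>corr_term G t s x - corr_term G t s y\<bar> = \<bar>P (min (xi s x) (1 / G)) - P (min (xi s y) (1 / G))\<bar> / s"
    using eq assms s0 by (simp add: diff_divide_distrib[symmetric])
  also have "\<dots> \<le> \<bar>P (min (xi s x) (1 / G)) - P (min (xi s y) (1 / G))\<bar> / 1"
    using s by (intro divide_left_mono) auto
  also have "\<dots> \<le> (4 + 2 * t) * \<bar>min (xi s x) (1 / G) - min (xi s y) (1 / G)\<bar>"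
    using xi_pos[of x s] xi_pos[of y s] assms G by (simp, intro lipP) auto
  also have "\<dots> \<le> (4 + 2 * t) * \<bar>xi s x - xi s y\<bar>"
    using t by (intro mult_left_mono) auto
  also have "\<dots> \<le> (4 + 2 * t) * (2 * \<bar>x - y\<bar>)"
    using t assms by (intro mult_left_mono lipxi) auto
  finally show ?thesis by (simp add: algebra_simps)
qed

section \<open>The diagonal form as a divisor sum\<close>

lemma sum_symmetric_diagonals:
  fixes f :: "nat \<Rightarrow> nat \<Rightarrow> real"
  assumes "\<And>m n. f m n = f n m"
  shows "(\<Sum>m\<in>{1..N}. \<Sum>n\<in>{1..N}. f m n) = (\<Sum>n\<in>{1..N}. f n n) + 2 * (\<Sum>s\<in>{1..N}. \<Sum>r\<in>{1..N - s}. f r (r + s))"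
proof (induction N)
  case (Suc N)
  have "(\<Sum>m\<in>{1..Suc N}. \<Sum>n\<in>{1..Suc N}. f m n) =
    (\<Sum>m\<in>{1..N}. \<Sum>n\<in>{1..N}. f m n) + 2 * (\<Sum>m\<in>{1..N}. f m (Suc N)) + f (Suc N) (Suc N)"
    using assms by (simp add: sum.distrib)
  moreover have "(\<Sum>s\<in>{1..Suc N}. \<Sum>r\<in>{1..Suc N - s}. f r (r + s)) =
    (\<Sum>s\<in>{1..N}. \<Sum>r\<in>{1..N - s}. f r (r + s)) + (\<Sum>m\<in>{1..N}. f m (Suc N))"
  proof -
    have "(\<Sum>s\<in>{1..Suc N}. \<Sum>r\<in>{1..Suc N - s}. f r (r + s)) = (\<Sum>s\<in>{1..N}. \<Sum>r\<in>{1..Suc N - s}. f r (r + s))"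
      by simp
    also have "\<dots> = (\<Sum>s\<in>{1..N}. (\<Sum>r\<in>{1..N - s}. f r (r + s)) + f (Suc N - s) (Suc N))"
    proof (rule sum.cong[OF refl])
      fix s assume "s \<in> {1..N}"
      then have "Suc N - s = Suc (N - s)" "Suc N - s + s = Suc N" by auto
      then show "(\<Sum>r\<in>{1..Suc N - s}. f r (r + s)) = (\<Sum>r\<in>{1..N - s}. f r (r + s)) + f (Suc N - s) (Suc N)"
        by (simp add: add.commute)
    qed
    also have "(\<Sum>s\<in>{1..N}. (\<Sum>r\<in>{1..N - s}. f r (r + s)) + f (Suc N - s) (Suc N)) =
       (\<Sum>s\<in>{1..N}. \<Sum>r\<in>{1..N - s}. f r (r + s)) + (\<Sum>s\<in>{1..N}. f (Suc N - s) (Suc N))"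
      by (rule sum.distrib)
    also have "(\<Sum>s\<in>{1..N}. f (Suc N - s) (Suc N)) = (\<Sum>m\<in>{1..N}. f m (Suc N))"
      by (rule sum.reindex_bij_witness[of _ "\<lambda>m. Suc N - m" "\<lambda>m. Suc N - m"]) auto
    finally show ?thesis .
  qed
  ultimately show ?case using Suc by simp
qed simp

definition pform :: "nat \<Rightarrow> real \<Rightarrow> real \<Rightarrow> real" where
  "pform N G t = (\<Sum>m\<in>{1..N}. \<Sum>n\<in>{1..N}. 1 / sqrt (real m * real n) * cos (t * ln (real n / real m)) *
     max 0 (1 - G * \<bar>ln (real n / real m)\<bar>))"

lemma pform_eq:
  "pform N G t = (\<Sum>n\<in>{1..N}. 1 / real n) +
     2 * (\<Sum>s\<in>{1..N}. \<Sum>r\<in>{1..N - s}. corr_term G t (real s) (real r))"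
proof -
  define f where "f = (\<lambda>m n. if m = 0 \<or> n = 0 then 0 else 1 / sqrt (real m * real n) * cos (t * ln (real n / real m)) *
     max 0 (1 - G * \<bar>ln (real n / real m)\<bar>))"
  have sym: "f m n = f n m" for m n
  proof (cases "m = 0 \<or> n = 0")
    case False
    then have "ln (real n / real m) = - ln (real m / real n)" by (simp add: ln_div)
    then show ?thesis using False by (simp add: f_def mult.commute)
  qed (auto simp: f_def)
  have "pform N G t = (\<Sum>m\<in>{1..N}. \<Sum>n\<in>{1..N}. f m n)"
    unfolding pform_def f_def by (intro sum.cong refl) auto
  also have "\<dots> = (\<Sum>n\<in>{1..N}. f n n) + 2 * (\<Sum>s\<in>{1..N}. \<Sum>r\<in>{1..N - s}. f r (r + s))"
    by (rule sum_symmetric_diagonals[OF sym])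
  also have "(\<Sum>n\<in>{1..N}. f n n) = (\<Sum>n\<in>{1..N}. 1 / real n)"
    by (intro sum.cong refl) (auto simp: f_def)
  also have "(\<Sum>s\<in>{1..N}. \<Sum>r\<in>{1..N - s}. f r (r + s)) = (\<Sum>s\<in>{1..N}. \<Sum>r\<in>{1..N - s}. corr_term G t (real s) (real r))"
  proof (intro sum.cong refl)
    fix s r assume "s \<in> {1..N}" "r \<in> {1..N - s}"
    then have "real r > 0" "real s > 0" by auto
    then have "xi (real s) (real r) > 0" by (rule xi_pos)
    then show "f r (r + s) = corr_term G t (real s) (real r)"
      using \<open>real r > 0\<close> by (simp add: f_def corr_term_def xi_def)
  qed
  finally show ?thesis .
qed

lemma row_sum:
  assumes "s \<ge> 1" "s \<le> N" "G \<ge> 1" "t \<ge> 0" "H > 0"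
  defines "\<omega> \<equiv> xi (real s) (real N + 1 / 2 - real s)"
  shows "\<bar>(\<Sum>r\<in>{1..N - s}. corr_term G t (real s) (real r)) - (Re (osc_int G t 0 \<omega>) +
     (\<Sum>h\<in>{1..<H}. (1 - real h / real H) * ((- 1) ^ (h * s) * (Re (osc_int G t (pi * real (h * s)) \<omega>) +
       Re (osc_int G t (- (pi * real (h * s))) \<omega>)))))\<bar> \<le> real N * ((8 + 4 * t) / sqrt (real H))"
proof -
  \<comment> \<open>Half a unit beyond the last index \<open>N - s\<close>, where the unit cells of
    \<open>fejer_sum\<close> end.\<close>
  define X where "X = real N + 1 / 2 - real s"
  have X: "X \<ge> 1 / 2" "X = real (N - s) + 1 / 2" using assms by (auto simp: X_def of_nat_diff)
  have s1: "real s \<ge> 1" using assms by simp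
  let ?f = "corr_term G t (real s)"
  have cont: "continuous_on {1/2..X} ?f"
    using assms by (intro continuous_on_corr_term) auto
  have ic: "(\<lambda>x. ?f x * (2 * cos (2 * pi * real h * x))) integrable_on {1/2..X}" for h
    by (intro integrable_continuous_real continuous_intros cont)
  have "((\<lambda>x. ?f x + (\<Sum>h\<in>{1..<H}. (1 - real h / real H) * (?f x * (2 * cos (2 * pi * real h * x))))) has_integral
     (integral {1/2..X} ?f + (\<Sum>h\<in>{1..<H}. (1 - real h / real H) * integral {1/2..X} (\<lambda>x. ?f x * (2 * cos (2 * pi * real h * x)))))) {1/2..X}"
    by (intro has_integral_add has_integral_sum has_integral_mult_right integrable_integral ic integrable_continuous_real[OF cont]) auto
  moreover have "?f x + (\<Sum>h\<in>{1..<H}. (1 - real h / real H) * (?f x * (2 * cos (2 * pi * real h * x)))) = ?f x * fejer H x" for x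
    unfolding fejer_def by (simp add: distrib_left sum_distrib_left mult_ac)
  ultimately have "integral {1/2..X} (\<lambda>x. ?f x * fejer H x) =
     (integral {1/2..X} ?f + (\<Sum>h\<in>{1..<H}. (1 - real h / real H) * integral {1/2..X} (\<lambda>x. ?f x * (2 * cos (2 * pi * real h * x)))))"
    by (simp add: integral_unique)
  also have "\<dots> = Re (osc_int G t 0 \<omega>) + (\<Sum>h\<in>{1..<H}. (1 - real h / real H) * ((- 1) ^ (h * s) * (Re (osc_int G t (pi * real (h * s)) \<omega>) +
       Re (osc_int G t (- (pi * real (h * s))) \<omega>))))"
    unfolding corr_term_integral_0[OF s1 assms(3) X(1)] corr_term_integral_cos[OF assms(1,3) X(1)]
    by (simp add: \<omega>_def X_def)
  finally have 1: "integral {1/2..X} (\<lambda>x. ?f x * fejer H x) = \<dots>" .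
  have "\<bar>(\<Sum>r\<in>{1..N - s}. ?f (real r)) - integral {1/2..real (N - s) + 1/2} (\<lambda>x. ?f x * fejer H x)\<bar>
    \<le> real (N - s) * ((8 + 4 * t) / sqrt (real H))"
    using assms s1 by (intro fejer_sum corr_term_lipschitz) auto
  also have "\<dots> \<le> real N * ((8 + 4 * t) / sqrt (real H))"
    using assms by (intro mult_right_mono) auto
  finally show ?thesis unfolding X(2)[symmetric] 1 .
qed

lemma norm_exp_diff_le:
  assumes "Re z \<ge> 0"
  shows "norm (exp (- z) - 1) \<le> norm z"
proof -
  have "norm ((\<lambda>u. exp (of_real u * (- z))) 1 - (\<lambda>u. exp (of_real u * (- z))) (0::real)) \<le> norm z * (1 - 0)"
  proof (rule norm_diff_le_of_derivative[where S = "{}" and f' = "\<lambda>u. - z * exp (of_real u * (- z))"])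
    show "((\<lambda>u. exp (of_real u * (- z))) has_vector_derivative - z * exp (of_real x * (- z))) (at x)" for x :: real
      by (rule has_vector_derivative_real_field derivative_eq_intros | simp)+
    show "norm (- z * exp (of_real x * (- z))) \<le> norm z" if "x \<in> {0<..<1} - {}" for x
      using that assms mult_left_le[of "exp (- (x * Re z))" "norm z"] by (simp add: norm_mult)
  qed (auto intro!: continuous_intros)
  then show ?thesis by simp
qed

text \<open>The antiderivative is explicit, with \<open>q = 1/2 - i * t\<close>. Its boundary term
  \<open>1 / q\<close> has size about \<open>1 / t\<close>, but its real part is only
  \<open>1 / (2 * norm q ^ 2)\<close>. This gain is essential, as the integral will be multiplied by
  a length of order \<open>T^2 / G\<close>.\<close>

lemma hyperbola_zero_integral:
  fixes G t \<omega> :: real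
  assumes G: "G \<ge> 1" and t: "t \<ge> 1" and \<omega>: "0 < \<omega>" "\<omega> \<le> 1 / G"
  shows "\<bar>integral {\<omega>..1 / G} (\<lambda>w. (1 - G * w) * exp (- (w / 2)) * cos (t * w))\<bar> \<le> 3 * G / t\<^sup>2 + \<omega>"
proof -
  define q where "q = Complex (1 / 2) (- t)"
  define E where "E = (\<lambda>w::real. exp (- (q * of_real w)))"
  define F where "F = (\<lambda>w::real. - (1 - of_real (G * w)) * E w / q + of_real G * E w / q\<^sup>2)"
  have q: "norm q \<ge> t" "q \<noteq> 0" "Re q = 1 / 2"
    using abs_Im_le_cmod[of q] t by (auto simp: q_def complex_eq_iff)
  have q2: "1 / (norm q)\<^sup>2 \<le> 1 / t\<^sup>2" using q t by (intro divide_left_mono power_mono) auto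
  have E: "E w = of_real (exp (- (w / 2))) * cis (t * w)" for w
    by (simp add: E_def q_def exp_eq_polar)
  have nE: "norm (E w) \<le> 1" if "w \<ge> 0" for w
    using that by (simp add: E norm_mult)
  have dE: "(E has_vector_derivative - q * E w) (at w)" for w
  proof -
    have "((\<lambda>z. exp (- (q * z))) has_field_derivative - q * exp (- (q * of_real w))) (at (of_real w))"
      by (auto intro!: derivative_eq_intros)
    then show ?thesis unfolding E_def by (rule has_vector_derivative_real_field)
  qed
  have dF: "(F has_vector_derivative (1 - of_real (G * w)) * E w) (at w within A)" for w A
  proof -
    have "((\<lambda>w. - (1 - of_real (G * w))) has_vector_derivative of_real G) (at w)"
      by (rule has_vector_derivative_real_field derivative_eq_intros | simp)+
    then have "(F has_vector_derivative (- (1 - of_real (G * w)) * (- q * E w) + of_real G * E w) / q + of_real G * (- q * E w) / q\<^sup>2) (at w)"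
      unfolding F_def by (intro has_vector_derivative_add has_vector_derivative_divide has_vector_derivative_mult has_vector_derivative_mult_right dE)
    also have "(- (1 - of_real (G * w)) * (- q * E w) + of_real G * E w) / q + of_real G * (- q * E w) / q\<^sup>2 = (1 - of_real (G * w)) * E w"
      using q(2) by (simp add: power2_eq_square field_simps)
    finally show ?thesis by (rule has_vector_derivative_at_within)
  qed
  have "((\<lambda>w. (1 - of_real (G * w)) * E w) has_integral F (1 / G) - F \<omega>) {\<omega>..1 / G}"
    using \<omega> dF by (intro fundamental_theorem_of_calculus) auto
  from has_integral_linear[OF this bounded_linear_Re]
  have "integral {\<omega>..1 / G} (\<lambda>w. (1 - G * w) * exp (- (w / 2)) * cos (t * w)) = Re (F (1 / G) - F \<omega>)"
    by (simp add: o_def E integral_unique mult.assoc)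
  also have "F (1 / G) - F \<omega> = of_real G * E (1 / G) / q\<^sup>2 - of_real G * E \<omega> / q\<^sup>2 + of_real (1 - G * \<omega>) * (1 / q) +
    of_real (1 - G * \<omega>) * ((E \<omega> - 1) / q)"
    using G by (simp add: F_def algebra_simps diff_divide_distrib)
  also have "\<bar>Re \<dots>\<bar> \<le> G / t\<^sup>2 + G / t\<^sup>2 + 1 / t\<^sup>2 + \<omega>"
  proof -
    have a: "\<bar>Re (of_real G * E w / q\<^sup>2)\<bar> \<le> G / t\<^sup>2" if "w \<ge> 0" for w
    proof -
      have "\<bar>Re (of_real G * E w / q\<^sup>2)\<bar> \<le> norm (of_real G * E w / q\<^sup>2)" by (rule abs_Re_le_cmod)
      also have "\<dots> = G * norm (E w) * (1 / (norm q)\<^sup>2)" using G by (simp add: norm_mult norm_divide norm_power)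
      also have "\<dots> \<le> G * 1 * (1 / t\<^sup>2)" using G nE[OF that] q2 by (intro mult_mono) auto
      finally show ?thesis by simp
    qed
    have m: "0 \<le> 1 - G * \<omega>" "1 - G * \<omega> \<le> 1" using \<omega> G by (auto simp: field_simps)
    have b: "\<bar>Re (of_real (1 - G * \<omega>) * (1 / q))\<bar> \<le> 1 / t\<^sup>2"
    proof -
      have "Re (1 / q) = (1 / 2) * (1 / (norm q)\<^sup>2)"
        by (simp add: Re_divide cmod_power2 q_def)
      moreover have "0 \<le> 1 / (norm q)\<^sup>2" by simp
      ultimately have "\<bar>Re (1 / q)\<bar> \<le> 1 / t\<^sup>2" using q2 by linarith
      then have "(1 - G * \<omega>) * \<bar>Re (1 / q)\<bar> \<le> 1 * (1 / t\<^sup>2)" using m by (intro mult_mono) auto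
      moreover have "Re (of_real a * z) = a * Re z" for a z by simp
      ultimately show ?thesis using m by (simp only: abs_mult abs_of_nonneg)
    qed
    have c: "\<bar>Re (of_real (1 - G * \<omega>) * ((E \<omega> - 1) / q))\<bar> \<le> \<omega>"
    proof -
      have "norm (E \<omega> - 1) \<le> norm (q * of_real \<omega>)"
        unfolding E_def using q \<omega> by (intro norm_exp_diff_le) auto
      then have "norm ((E \<omega> - 1) / q) \<le> \<omega>"
        using q \<omega> by (simp add: norm_mult norm_divide divide_le_eq mult.commute)
      then have "(1 - G * \<omega>) * norm ((E \<omega> - 1) / q) \<le> 1 * \<omega>" using m by (intro mult_mono) auto
      then show ?thesis using m abs_Re_le_cmod[of "of_real (1 - G * \<omega>) * ((E \<omega> - 1) / q)"]
        by (simp only: norm_mult norm_of_real)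
    qed
    show ?thesis
      using a[of "1 / G"] a[of \<omega>] b c \<omega> G unfolding plus_complex.simps minus_complex.simps by simp
  qed
  also have "\<dots> \<le> 3 * G / t\<^sup>2 + \<omega>"
    using G t by (simp add: add_divide_distrib[symmetric] divide_right_mono)
  finally show ?thesis .
qed

lemma card_le_floor:
  assumes "0 \<le> y" "y < real N + 1 / 2"
  shows "\<bar>real (card {s\<in>{1..N}. real s \<le> y}) - y\<bar> \<le> 1"
proof -
  have "nat \<lfloor>y\<rfloor> \<le> N" using assms by linarith
  then have "{s\<in>{1..N}. real s \<le> y} = {1..nat \<lfloor>y\<rfloor>}"
    using assms by (auto simp: le_nat_floor) linarith
  then show ?thesis using assms by simp linarith
qed

text \<open>The sum over \<open>s\<close> is taken inside the integral. For fixed \<open>w\<close>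
  the rows that reach \<open>w\<close> are those with \<open>s \<le> N' * (1 - exp (- w))\<close>,
  so their number is this quantity up to an error 1. The error costs the integral of
  \<open>1 / w\<close>, a logarithm. In the main part \<open>amp G w * (1 - exp (- w))\<close>
  simplifies to \<open>(1 - G * w) * exp (- (w / 2))\<close>, and
  \<open>hyperbola_zero_integral\<close> shows that it nearly cancels.\<close>

lemma zero_frequency:
  assumes N: "N \<ge> 1" and G: "G \<ge> 1" and t: "t \<ge> 1"
  shows "\<bar>\<Sum>s\<in>{1..N}. Re (osc_int G t 0 (xi (real s) (real N + 1 / 2 - real s)))\<bar>
    \<le> ln (real N + 1 / 2) + 3 + (real N + 1 / 2) * (3 * G / t\<^sup>2)"
proof -
  define N' where "N' = real N + 1 / 2"
  define \<omega> where "\<omega> = (\<lambda>s::nat. xi (real s) (N' - real s))"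
  have N': "N' \<ge> 3 / 2" using N by (simp add: N'_def)
  have \<omega>_eq: "\<omega> s = ln (N' / (N' - real s))" for s by (simp add: \<omega>_def xi_def)
  have \<omega>_le: "\<omega> s \<le> w \<longleftrightarrow> real s \<le> N' * (1 - exp (- w))" if "s \<in> {1..N}" for s w
  proof -
    have p: "N' - real s > 0" using that by (auto simp: N'_def)
    have "\<omega> s \<le> w \<longleftrightarrow> N' / (N' - real s) \<le> exp w"
      using p N' unfolding \<omega>_eq by (subst ln_le_cancel_iff[symmetric]) auto
    also have "\<dots> \<longleftrightarrow> N' \<le> exp w * (N' - real s)" using p by (simp add: divide_le_eq)
    also have "\<dots> \<longleftrightarrow> exp (- w) * N' \<le> exp (- w) * (exp w * (N' - real s))" by simp
    also have "exp (- w) * (exp w * (N' - real s)) = N' - real s" by (simp add: exp_minus)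
    also have "exp (- w) * N' \<le> N' - real s \<longleftrightarrow> real s \<le> N' * (1 - exp (- w))" by (auto simp: algebra_simps)
    finally show ?thesis .
  qed
  have \<omega>_mono: "\<omega> 1 \<le> \<omega> s" if "s \<in> {1..N}" for s
  proof -
    have "real s \<le> N' * (1 - exp (- \<omega> s))" using \<omega>_le[OF that, of "\<omega> s"] by simp
    then show ?thesis using \<omega>_le[of 1 "\<omega> s"] that N by auto
  qed
  have \<omega>1: "\<omega> 1 > 0" using xi_pos[of "N' - 1" 1] N' by (simp add: \<omega>_def)
  have \<omega>1_lo: "1 / N' \<le> \<omega> 1"
  proof -
    have "ln ((N' - 1) / N') \<le> (N' - 1) / N' - 1" using N' by (intro ln_le_minus_one) auto
    then show ?thesis using N' by (simp add: \<omega>_eq ln_div field_simps)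
  qed
  have \<omega>1_hi: "N' * \<omega> 1 \<le> 3"
  proof -
    have "\<omega> 1 \<le> N' / (N' - 1) - 1" unfolding \<omega>_eq using N' by (simp add: ln_le_minus_one)
    also have "\<dots> = 1 / (N' - 1)" using N' by (simp add: field_simps)
    finally have "N' * \<omega> 1 \<le> N' * (1 / (N' - 1))" using N' by (intro mult_left_mono) auto
    also have "\<dots> \<le> 3" using N' by (simp add: field_simps)
    finally show ?thesis .
  qed
  show ?thesis
  proof (cases "\<omega> 1 \<le> 1 / G")
    case False
    have "osc_int G t 0 (\<omega> s) = 0" if "s \<in> {1..N}" for s
      using \<omega>_mono[OF that] False by (simp add: osc_int_def)
    then have "(\<Sum>s\<in>{1..N}. Re (osc_int G t 0 (\<omega> s))) = 0" by simp
    moreover have "ln N' \<ge> 0" using N' by simp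
    ultimately show ?thesis using G N' by (simp add: \<omega>_def N'_def)
  next
    case True
    define h where "h = (\<lambda>s w. if w \<in> {\<omega> s..1 / G} then amp G w * cos (t * w) else 0)"
    define M where "M = (\<lambda>w. amp G w * cos (t * w) * (N' * (1 - exp (- w))))"
    have "(h s has_integral Re (osc_int G t 0 (\<omega> s))) {\<omega> 1..1 / G}" if "s \<in> {1..N}" for s
    proof -
      have "\<omega> s > 0" using \<omega>1 \<omega>_mono[OF that] by simp
      from Re_osc_int[OF this, of G t 0]
      have "((\<lambda>w. amp G w * cos (t * w)) has_integral Re (osc_int G t 0 (\<omega> s))) {\<omega> s..1 / G}" by simp
      then show ?thesis unfolding h_def using \<omega>_mono[OF that] by (subst has_integral_restrict) auto
    qed
    then have H: "((\<lambda>w. \<Sum>s\<in>{1..N}. h s w) has_integral (\<Sum>s\<in>{1..N}. Re (osc_int G t 0 (\<omega> s)))) {\<omega> 1..1 / G}"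
      by (intro has_integral_sum) auto
    have "continuous_on {\<omega> 1..1 / G} M"
      unfolding M_def amp_def using \<omega>1 by (intro continuous_intros) auto
    then have M: "(M has_integral integral {\<omega> 1..1 / G} M) {\<omega> 1..1 / G}"
      using integrable_continuous_real by blast
    have I: "((\<lambda>w. 1 / w) has_integral ln (1 / G) - ln (\<omega> 1)) {\<omega> 1..1 / G}"
      by (rule fundamental_theorem_of_calculus)
        (use True \<omega>1 in \<open>auto intro!: derivative_eq_intros simp flip: has_real_derivative_iff_has_vector_derivative\<close>)
    have "norm (integral {\<omega> 1..1 / G} (\<lambda>w. (\<Sum>s\<in>{1..N}. h s w) - M w)) \<le> integral {\<omega> 1..1 / G} (\<lambda>w. 1 / w)"
    proof (rule integral_norm_bound_integral)
      show "(\<lambda>w. (\<Sum>s\<in>{1..N}. h s w) - M w) integrable_on {\<omega> 1..1 / G}"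
        using has_integral_diff[OF H M] by blast
      fix w assume w: "w \<in> {\<omega> 1..1 / G}"
      then have w0: "w > 0" using \<omega>1 by auto
      define y where "y = N' * (1 - exp (- w))"
      have y: "0 \<le> y" "y < N'" using w0 N' by (auto simp: y_def)
      have "(\<Sum>s\<in>{1..N}. h s w) = (\<Sum>s\<in>{1..N}. if real s \<le> y then amp G w * cos (t * w) else 0)"
        using w by (intro sum.cong refl) (auto simp: h_def \<omega>_le y_def)
      also have "\<dots> = real (card {s\<in>{1..N}. real s \<le> y}) * (amp G w * cos (t * w))"
        by (simp add: sum.If_cases Int_def)
      finally have "(\<Sum>s\<in>{1..N}. h s w) - M w = (amp G w * cos (t * w)) * (real (card {s\<in>{1..N}. real s \<le> y}) - y)"
        by (simp add: M_def y_def algebra_simps)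
      also have "norm \<dots> \<le> ((1 / w) * 1) * 1"
        unfolding norm_mult using card_le_floor[of y N] y amp_le[OF w0, of G] amp_nonneg[OF w0, of G] G w0
        by (intro mult_mono) (auto simp: N'_def)
      finally show "norm ((\<Sum>s\<in>{1..N}. h s w) - M w) \<le> 1 / w" by simp
    qed (use I in auto)
    then have 1: "\<bar>(\<Sum>s\<in>{1..N}. Re (osc_int G t 0 (\<omega> s))) - integral {\<omega> 1..1 / G} M\<bar> \<le> ln (1 / G) - ln (\<omega> 1)"
      using has_integral_diff[OF H M] I by (simp add: integral_unique)
    have "ln (1 / N') \<le> ln (\<omega> 1)" using \<omega>1_lo \<omega>1 N' by (subst ln_le_cancel_iff) auto
    moreover have "ln (1 / G) \<le> 0" using G by (simp add: ln_div)
    ultimately have 2: "ln (1 / G) - ln (\<omega> 1) \<le> ln N'" using N' by (simp add: ln_div)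
    have "integral {\<omega> 1..1 / G} M = integral {\<omega> 1..1 / G} (\<lambda>w. N' * ((1 - G * w) * exp (- (w / 2)) * cos (t * w)))"
    proof (rule integral_cong)
      fix w assume w: "w \<in> {\<omega> 1..1 / G}"
      then have w0: "w > 0" "G * w \<le> 1" using \<omega>1 G by (auto simp: field_simps)
      have "exp (- w) = exp (- (w / 2)) * exp (- (w / 2))" by (simp flip: exp_add)
      then have "1 - exp (- w) = exp (- (w / 2)) * (2 * sinh (w / 2))"
        by (simp add: sinh_def algebra_simps flip: exp_add)
      then have "amp G w * (1 - exp (- w)) = (1 - G * w) * exp (- (w / 2))"
        using w0 by (simp add: amp_def)
      then show "M w = N' * ((1 - G * w) * exp (- (w / 2)) * cos (t * w))"
        unfolding M_def by (metis mult.assoc mult.commute)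
    qed
    also have "\<bar>\<dots>\<bar> = N' * \<bar>integral {\<omega> 1..1 / G} (\<lambda>w. (1 - G * w) * exp (- (w / 2)) * cos (t * w))\<bar>"
      using N' by (simp add: abs_mult)
    also have "\<dots> \<le> N' * (3 * G / t\<^sup>2 + \<omega> 1)"
      using N' by (intro mult_left_mono hyperbola_zero_integral G t \<omega>1 True) auto
    also have "\<dots> \<le> N' * (3 * G / t\<^sup>2) + 3" using \<omega>1_hi by (simp add: distrib_left)
    finally have "\<bar>integral {\<omega> 1..1 / G} M\<bar> \<le> N' * (3 * G / t\<^sup>2) + 3" .
    then have "\<bar>\<Sum>s\<in>{1..N}. Re (osc_int G t 0 (\<omega> s))\<bar> \<le> ln N' + 3 + N' * (3 * G / t\<^sup>2)"
      using 1 2 by linarith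
    then show ?thesis by (simp add: \<omega>_def N'_def)
  qed
qed

text \<open>The main term of \<open>osc_int_saddle\<close> for \<open>c = pi * n\<close>; it is 0
  once the saddle point passes the cutoff \<open>1 / G\<close>.\<close>

definition saddle_main :: "complex \<Rightarrow> real \<Rightarrow> real \<Rightarrow> real \<Rightarrow> complex" where
  "saddle_main F G t n = F * of_real (saddle_pt t n * amp G (saddle_pt t n)) *
      cis (phase_corr t n (saddle_pt t n)) * cis (2 * saddle_phase t n) / sqrt (saddle_phase t n)"

definition divisor_main :: "complex \<Rightarrow> real \<Rightarrow> nat \<Rightarrow> real \<Rightarrow> complex" where
  "divisor_main F G Y t = (\<Sum>n\<in>{1..Y}. (- 1) ^ n * of_nat (num_divisors n) * saddle_main F G t (real n))"

lemma harm_le: "n \<ge> 1 \<Longrightarrow> (\<Sum>k\<in>{1..n}. 1 / real k) \<le> 1 + ln (real n)"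
proof (induction n rule: nat_induct_at_least)
  case (Suc n)
  have "ln (real n / real (Suc n)) \<le> real n / real (Suc n) - 1" using Suc by (intro ln_le_minus_one) auto
  then have "1 / real (Suc n) \<le> ln (real (Suc n)) - ln (real n)"
    using Suc by (simp add: ln_div field_simps)
  then show ?case using Suc by simp
qed simp

text \<open>Pairs are grouped by their product; \<open>Y \<le> N\<close> and \<open>Y < H\<close>
  put every factorisation of every \<open>n \<le> Y\<close> inside the two ranges.\<close>

lemma divisor_double_sum:
  fixes g :: "nat \<Rightarrow> 'a::comm_semiring_1"
  assumes "Y \<le> N" "Y < H"
  shows "(\<Sum>s\<in>{1..N}. \<Sum>h\<in>{1..<H}. if h * s \<le> Y then g (h * s) else 0) = (\<Sum>n\<in>{1..Y}. of_nat (num_divisors n) * g n)"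
proof -
  have "(\<Sum>s\<in>{1..N}. \<Sum>h\<in>{1..<H}. if h * s \<le> Y then g (h * s) else 0) =
    (\<Sum>s\<in>{1..N}. \<Sum>h\<in>{1..<H}. \<Sum>n\<in>{1..Y}. if h * s = n then g n else 0)"
  proof (rule sum.cong[OF refl], rule sum.cong[OF refl])
    fix s h assume "s \<in> {1..N}" "h \<in> {1..<H}"
    then show "(if h * s \<le> Y then g (h * s) else 0) = (\<Sum>n\<in>{1..Y}. if h * s = n then g n else 0)"
      by (subst sum.delta') auto
  qed
  also have "\<dots> = (\<Sum>s\<in>{1..N}. \<Sum>n\<in>{1..Y}. \<Sum>h\<in>{1..<H}. if h * s = n then g n else 0)"
    by (rule sum.cong[OF refl], rule sum.swap)
  also have "\<dots> = (\<Sum>n\<in>{1..Y}. \<Sum>s\<in>{1..N}. \<Sum>h\<in>{1..<H}. if h * s = n then g n else 0)"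
    by (rule sum.swap)
  also have "\<dots> = (\<Sum>n\<in>{1..Y}. of_nat (num_divisors n) * g n)"
  proof (intro sum.cong refl)
    fix n assume n: "n \<in> {1..Y}"
    have "(\<Sum>h\<in>{1..<H}. if h * s = n then g n else 0) = (if s dvd n then g n else 0)" if s: "s \<in> {1..N}" for s
    proof (cases "s dvd n")
      case True
      then obtain k where k: "n = s * k" by (auto elim: dvdE)
      have "k \<ge> 1" using k n by (cases k) auto
      moreover have "k \<le> n" using k s by auto
      ultimately have kH: "k \<in> {1..<H}" using n assms by auto
      have "(\<Sum>h\<in>{1..<H}. if h * s = n then g n else 0) = (\<Sum>h\<in>{1..<H}. if h = k then g n else 0)"
        using k s by (intro sum.cong refl) (auto simp: mult.commute)
      then show ?thesis using True kH by (simp add: sum.delta)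
    next
      case False
      then have "h * s \<noteq> n" for h by auto
      then show ?thesis using False by simp
    qed
    then have "(\<Sum>s\<in>{1..N}. \<Sum>h\<in>{1..<H}. if h * s = n then g n else 0) = (\<Sum>s\<in>{1..N}. if s dvd n then g n else 0)"
      by (intro sum.cong refl) auto
    also have "\<dots> = of_nat (card {s\<in>{1..N}. s dvd n}) * g n"
      by (simp add: sum.If_cases Int_def)
    also have "{s\<in>{1..N}. s dvd n} = {s. s dvd n}"
    proof -
      have "s \<in> {1..N}" if "s dvd n" for s
      proof -
        have "s \<noteq> 0" using that n by (auto intro: ccontr)
        moreover have "s \<le> n" using that n by (intro dvd_imp_le) auto
        ultimately show ?thesis using n assms by auto
      qed
      then show ?thesis by auto
    qed
    finally show "(\<Sum>s\<in>{1..N}. \<Sum>h\<in>{1..<H}. if h * s = n then g n else 0) = of_nat (num_divisors n) * g n"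
      by (simp add: num_divisors_def)
  qed
  finally show ?thesis .
qed

text \<open>For negative \<open>c\<close> both parts of the phase derivative have the same sign. For
  \<open>n \<ge> t / G\<^sup>2\<close> the saddle lies beyond the cutoff: on the range of
  integration \<open>2 * t * (sinh (w / 2))\<^sup>2\<close> is at most \<open>n\<close>, well below
  \<open>c = pi * n\<close>.\<close>

lemma osc_int_off_saddle:
  assumes "G \<ge> 1" "\<omega> > 0" "t > 0" "n > 0" and c: "c = - (pi * n) \<or> (c = pi * n \<and> n \<ge> t / G\<^sup>2)"
  shows "norm (osc_int G t c \<omega>) \<le> 7 / n"
proof (cases "\<omega> \<le> 1 / G")
  case True
  have c0: "c \<noteq> 0" "\<bar>c\<bar> = pi * n" using c assms by auto
  have "norm (osc_int G t c \<omega>) \<le> 20 / (G * \<bar>c\<bar>)"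
  proof (rule osc_int_nonstationary[OF assms(1,2) True c0(1)])
    fix w assume w: "w \<in> {\<omega>..1 / G}"
    have s0: "0 \<le> 2 * t * (sinh (w / 2))\<^sup>2" using assms by simp
    from c show "\<bar>c\<bar> / 2 \<le> \<bar>2 * t * (sinh (w / 2))\<^sup>2 - c\<bar>"
    proof
      assume "c = - (pi * n)"
      then have "2 * t * (sinh (w / 2))\<^sup>2 - c \<ge> \<bar>c\<bar>" using s0 assms by simp
      then show ?thesis by linarith
    next
      assume c: "c = pi * n \<and> n \<ge> t / G\<^sup>2"
      have w0: "0 < w" "w \<le> 1 / G" using w assms by auto
      have w1: "w \<le> 1" using w0 assms(1) by (smt (verit) divide_le_eq_1)
      have "sinh (w / 2) \<le> w / 2 + (w / 2) ^ 3 / 3" using w0 w1 by (intro sinh_le3) auto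
      also have "(w / 2) ^ 3 = (w / 2) * (w / 2)\<^sup>2" by (simp add: eval_nat_numeral)
      also have "(w / 2) * (w / 2)\<^sup>2 \<le> (w / 2) * (1 / 2)\<^sup>2" using w0 w1 by (intro mult_left_mono power_mono) auto
      finally have "sinh (w / 2) \<le> 13 / 24 * w" by (simp add: power2_eq_square)
      also have "\<dots> \<le> 13 / 24 * (1 / G)" using w0 by (intro mult_left_mono) auto
      finally have "(sinh (w / 2))\<^sup>2 \<le> (13 / 24 * (1 / G))\<^sup>2" using w0 by (intro power_mono) auto
      then have "2 * t * (sinh (w / 2))\<^sup>2 \<le> 2 * t * (13 / 24 * (1 / G))\<^sup>2" using assms by (intro mult_left_mono) auto
      also have "\<dots> = 169 / 288 * (t / G\<^sup>2)" by (simp add: power_mult_distrib power_divide)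
      also have "\<dots> \<le> 169 / 288 * n" using c by (intro mult_left_mono) auto
      also have "\<dots> \<le> 1 * n" using assms by (intro mult_right_mono) auto
      also have "\<dots> \<le> (pi / 2) * n" using pi_gt3 assms by (intro mult_right_mono) auto
      finally show ?thesis using c c0 by simp
    qed
  qed
  also have "\<dots> \<le> 20 / (1 * (3 * n))"
    unfolding c0 using assms pi_gt3 by (intro divide_left_mono mult_mono) auto
  also have "\<dots> \<le> 7 / n" using assms by (simp add: field_simps)
  finally show ?thesis .
next
  case False
  then show ?thesis using assms by (simp add: osc_int_def)
qed

lemma sqrt_le_saddle_phase: "t > 0 \<Longrightarrow> n > 0 \<Longrightarrow> sqrt (2 * pi * n * t) \<le> saddle_phase t n"
  unfolding saddle_phase_def using mult_left_mono[of 1 "1 + pi * n / (12 * t)" "sqrt (2 * pi * n * t)"] by simp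

lemma saddle_main_le:
  assumes "t > 0" "n > 0" "G \<ge> 0" "saddle_phase t n \<ge> 1"
  shows "norm (saddle_main F G t n) \<le> norm F"
proof -
  have w: "saddle_pt t n > 0" using assms saddle_pt_pos by blast
  have a: "saddle_pt t n * amp G (saddle_pt t n) \<le> 1" "0 \<le> saddle_pt t n * amp G (saddle_pt t n)"
    using amp_le[OF w assms(3)] amp_nonneg[OF w, of G] w by (auto simp: field_simps)
  have "norm (saddle_main F G t n) = norm F * (saddle_pt t n * amp G (saddle_pt t n)) / sqrt (saddle_phase t n)"
    unfolding saddle_main_def using a assms(4) by (simp only: norm_mult norm_divide norm_of_real norm_cis) simp
  also have "\<dots> \<le> norm F * 1 / 1" using a assms by (intro frac_le mult_left_mono) auto
  finally show ?thesis by simp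
qed

text \<open>\<open>F\<close> is the value of the Fresnel integral over the real line.\<close>

context
  fixes T G t :: real and F :: complex
  assumes F: "\<And>q. q > 0 \<Longrightarrow> norm (integral {-q..q} (\<lambda>x. cis (x\<^sup>2)) - F) \<le> 2 / q"
    and T: "T \<ge> 100" and G: "G \<ge> 1" "T \<le> G ^ 5" "G \<le> T" and t: "T \<le> t" "t \<le> 2 * T"
begin

lemma saddle_phase_bounds:
  assumes "n \<ge> 1" "n \<le> 2 * T / G\<^sup>2"
  shows "sqrt (n * T) \<le> saddle_phase t n" "4 \<le> saddle_phase t n" "ln (saddle_phase t n) \<le> 2 * ln T"
proof -
  have "n * T \<le> 2 * pi * n * t"
  proof -
    have "1 * (n * T) \<le> (2 * pi) * (n * t)" using assms T t pi_gt3 by (intro mult_mono) auto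
    then show ?thesis by (simp add: mult_ac)
  qed
  then have 1: "sqrt (n * T) \<le> sqrt (2 * pi * n * t)" by simp
  also have "\<dots> \<le> saddle_phase t n" using assms T t by (intro sqrt_le_saddle_phase) auto
  finally show a: "sqrt (n * T) \<le> saddle_phase t n" .
  have "4 \<le> sqrt (1 * T)" using T by (intro real_le_rsqrt) auto
  also have "\<dots> \<le> sqrt (n * T)" using assms T by (intro real_sqrt_le_mono mult_right_mono) auto
  finally show 4: "4 \<le> saddle_phase t n" using a by simp
  have "2 * T / G\<^sup>2 \<le> 2 * T / 1" using G T by (intro divide_left_mono) (auto simp: one_le_power)
  then have n2: "n \<le> 2 * T" using assms by simp
  have "sqrt (2 * pi * n * t) \<le> 6 * T"
  proof (rule real_le_lsqrt)
    have "2 * pi * n * t \<le> 2 * 4 * (2 * T) * (2 * T)" using n2 assms t T pi_less_4 by (intro mult_mono) auto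
    also have "\<dots> \<le> (6 * T)\<^sup>2" by (simp add: power2_eq_square)
    finally show "2 * pi * n * t \<le> (6 * T)\<^sup>2" .
  qed (use T in auto)
  moreover have "1 + pi * n / (12 * t) \<le> 2"
  proof -
    have "pi * n \<le> 4 * (2 * T)" using n2 assms pi_less_4 by (intro mult_mono) auto
    also have "\<dots> \<le> 12 * t" using t T by simp
    finally show ?thesis using t T by (simp add: divide_le_eq)
  qed
  ultimately have "saddle_phase t n \<le> (6 * T) * 2"
    unfolding saddle_phase_def using assms T t by (intro mult_mono) auto
  also have "\<dots> \<le> T * T" using T by simp
  finally have "ln (saddle_phase t n) \<le> ln (T * T)" using 4 T by (subst ln_le_cancel_iff) auto
  then show "ln (saddle_phase t n) \<le> 2 * ln T" using T by (simp add: ln_mult)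
qed

text \<open>The length \<open>N \<ge> T\<^sup>2 / G\<close> makes the lower limit at most
  \<open>2 * s * G / T\<^sup>2\<close>, which is below half of the saddle point, itself of order
  \<open>sqrt (n / T)\<close>. The error of order \<open>ln T / sqrt (n * T)\<close> is weakened to
  \<open>ln T / n\<close>, possible as \<open>n \<le> 2 * T\<close>, because
  \<open>1 / (h * s)\<close> can be summed over \<open>h\<close> and \<open>s\<close>
  separately.\<close>

lemma osc_int_near_saddle:
  fixes s h N :: nat
  assumes N: "real N \<ge> T\<^sup>2 / G" and s: "s \<ge> 1" "h \<ge> 1" and n: "real (h * s) \<le> 2 * T / G\<^sup>2"
  shows "norm (osc_int G t (pi * real (h * s)) (xi (real s) (real N + 1 / 2 - real s)) - saddle_main F G t (real (h * s)))
    \<le> 1800 * (1 + ln T) / real (h * s)"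
proof -
  define n where "n = real (h * s)"
  define \<omega> where "\<omega> = xi (real s) (real N + 1 / 2 - real s)"
  have n1: "n \<ge> 1" "n \<le> 2 * T / G\<^sup>2" "real s \<le> n"
  proof -
    have "1 \<le> h * s" "s \<le> h * s" using s by auto
    then have "real 1 \<le> real (h * s)" "real s \<le> real (h * s)" unfolding of_nat_le_iff by auto
    then show "n \<ge> 1" "real s \<le> n" by (auto simp: n_def)
  qed (use n in \<open>auto simp: n_def\<close>)
  note ph = saddle_phase_bounds[OF n1(1,2)]
  have GG: "G\<^sup>2 \<ge> 1" "G\<^sup>2 \<ge> G" using G mult_mono[of 1 G 1 G] by (auto simp: power2_eq_square)
  have "2 * T / G\<^sup>2 \<le> 2 * T / G" using GG G T by (intro divide_left_mono) auto
  then have sTG: "real s \<le> 2 * T / G" using n1 by linarith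
  have TG: "2 * (2 * T / G) \<le> T\<^sup>2 / G" using T G by (simp add: power2_eq_square field_simps)
  have sN: "2 * real s \<le> real N" using sTG TG N by linarith
  have \<omega>0: "\<omega> > 0" unfolding \<omega>_def using sN s by (intro xi_pos) auto
  have \<omega>_hi: "\<omega> \<le> 2 * real s * G / T\<^sup>2"
  proof -
    have "\<omega> \<le> (real N + 1 / 2) / (real N + 1 / 2 - real s) - 1"
      unfolding \<omega>_def xi_def using sN s by (intro order_trans[OF ln_le_minus_one]) auto
    also have "\<dots> = real s / (real N + 1 / 2 - real s)" using sN s by (simp add: field_simps)
    also have "\<dots> \<le> real s / (T\<^sup>2 / G / 2)" using sN N T G by (intro divide_left_mono) auto
    finally show ?thesis by (simp add: field_simps)
  qed
  have \<omega>_1: "\<omega> \<le> 1 / G"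
  proof -
    have "2 * real s * G \<le> 2 * (2 * T / G) * G" using sTG G by (intro mult_right_mono mult_left_mono) auto
    then have "2 * real s * G / T\<^sup>2 \<le> 4 * T / T\<^sup>2" using G by (intro divide_right_mono) auto
    also have "\<dots> = 4 / T" using T by (simp add: power2_eq_square)
    finally have a: "\<omega> \<le> 4 / T" using \<omega>_hi by simp
    have "2 * real s * G * G \<le> 2 * (2 * T / G\<^sup>2) * G * G" using n1 G by (intro mult_right_mono mult_left_mono) auto
    also have "\<dots> = 4 * T" using G by (simp add: power2_eq_square)
    also have "\<dots> \<le> T\<^sup>2" using T by (simp add: power2_eq_square)
    finally have "2 * real s * G / T\<^sup>2 \<le> 1 / G" using T G by (simp add: field_simps)
    then show ?thesis using \<omega>_hi by simp
  qed
  have \<omega>_2: "\<omega> \<le> saddle_pt t n / 2"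
  proof -
    have "2 * T / G\<^sup>2 \<le> 2 * T / 1" using G T by (intro divide_left_mono) (auto simp: one_le_power)
    then have n2: "n \<le> 2 * T" using n1 by simp
    have k: "1 + pi * n / (12 * t) \<le> 2"
    proof -
      have "pi * n \<le> 4 * (2 * T)" using n2 n1 pi_less_4 by (intro mult_mono) auto
      also have "\<dots> \<le> 12 * t" using t T by simp
      finally show ?thesis using t T by (simp add: divide_le_eq)
    qed
    have "4 * (2 * real s * G / T\<^sup>2) \<le> sqrt (2 * pi * n / t)"
    proof (rule real_le_rsqrt)
      have "(4 * (2 * real s * G / T\<^sup>2))\<^sup>2 = 64 * (real s) * (real s * G\<^sup>2) / T ^ 4"
        by (simp add: power2_eq_square eval_nat_numeral mult_ac)
      also have "\<dots> \<le> 64 * n * (2 * T) / T ^ 4"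
      proof -
        have "real s \<le> 2 * T / G\<^sup>2" using n1 by linarith
        then have "real s * G\<^sup>2 \<le> 2 * T" using G GG by (simp add: field_simps)
        moreover have "64 * real s * (real s * G\<^sup>2) \<le> 64 * n * (real s * G\<^sup>2)"
          using n1 by (intro mult_right_mono) auto
        moreover have "64 * n * (real s * G\<^sup>2) \<le> 64 * n * (2 * T)"
          using n1 calculation(1) by (intro mult_left_mono) auto
        ultimately show ?thesis by (intro divide_right_mono) auto
      qed
      also have "\<dots> = n / T * (128 / T\<^sup>2)" using T by (simp add: eval_nat_numeral)
      also have "\<dots> \<le> n / T * 1"
      proof -
        have "128 / T\<^sup>2 \<le> 1" using T mult_mono[of 100 T 100 T] by (simp add: power2_eq_square)
        then show ?thesis using n1 T by (intro mult_left_mono) auto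
      qed
      also have "\<dots> = 2 * n / (2 * T)" by simp
      also have "\<dots> \<le> 2 * pi * n / t" using n1 T t pi_gt3 by (intro frac_le) auto
      finally show "(4 * (2 * real s * G / T\<^sup>2))\<^sup>2 \<le> 2 * pi * n / t" .
    qed
    moreover have "sqrt (2 * pi * n / t) / 2 \<le> saddle_pt t n"
      unfolding saddle_pt_def using k n1 t T by (intro divide_left_mono mult_pos_pos add_pos_pos) auto
    ultimately show ?thesis using \<omega>_hi by linarith
  qed
  have n4: "n \<le> 4 * t / G\<^sup>2"
  proof -
    have "2 * T / G\<^sup>2 \<le> 4 * t / G\<^sup>2" using t T by (intro divide_right_mono) auto
    then show ?thesis using n1 by simp
  qed
  have "norm (osc_int G t (pi * n) \<omega> - saddle_main F G t n) \<le> 600 * (1 + ln (saddle_phase t n)) / saddle_phase t n"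
    unfolding saddle_main_def
    by (rule osc_int_saddle[OF F]) (use G T t n1 n4 \<omega>0 \<omega>_1 \<omega>_2 ph in auto)
  also have "\<dots> \<le> 600 * (2 * (1 + ln T)) / sqrt (n * T)"
    using ph n1 T by (intro frac_le mult_left_mono) auto
  also have "\<dots> \<le> 600 * (2 * (1 + ln T)) * (3 / 2 / n)"
  proof -
    have "2 * n \<le> 3 * sqrt (n * T)"
    proof -
      have "2 * T / G\<^sup>2 \<le> 2 * T / 1" using GG T by (intro divide_left_mono) auto
      then have "4 * n \<le> 9 * T" using n1 T by simp
      then have "(4 * n) * n \<le> (9 * T) * n" using n1 by (intro mult_right_mono) auto
      then have "(2 * n)\<^sup>2 \<le> (3 * sqrt (n * T))\<^sup>2" using n1 T by (simp add: power_mult_distrib power2_eq_square mult_ac)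
      then show ?thesis by (rule power2_le_imp_le) (use n1 T in auto)
    qed
    then have "1 / sqrt (n * T) \<le> 3 / 2 / n" using n1 T by (simp add: field_simps)
    moreover have "0 \<le> 600 * (2 * (1 + ln T))" using T by simp
    ultimately have "600 * (2 * (1 + ln T)) * (1 / sqrt (n * T)) \<le> 600 * (2 * (1 + ln T)) * (3 / 2 / n)"
      by (intro mult_left_mono)
    then show ?thesis by simp
  qed
  also have "\<dots> = 1800 * (1 + ln T) / n"
  proof -
    have "600 * (2 * x) * (3 / 2 / n) = 1800 * x / n" for x :: real by simp
    then show ?thesis .
  qed
  finally show ?thesis by (simp add: n_def \<omega>_def)
qed

text \<open>Each pair \<open>(h, s)\<close> is replaced by its main term, or by 0 when
  \<open>h * s > Y\<close>, with an error \<open>K / (h * s)\<close>. The two harmonic sums cost a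
  squared logarithm and \<open>K\<close> a third one. Frequency 0 and the error of the Fejer weights
  are of lower order.\<close>

lemma pform_le:
  assumes N: "N = nat \<lceil>T\<^sup>2 / G\<rceil>" and Y: "Y = nat \<lfloor>2 * T / G\<^sup>2\<rfloor>"
  shows "pform N G t \<le> 100000 * (1 + norm F) * (1 + ln T) ^ 3 + 2 * norm (divisor_main F G Y t)"
proof -
  define L where "L = 1 + ln T"
  \<comment> \<open>Large enough that the Fejer error, of order
    \<open>N\<^sup>2 * T / sqrt H\<close> with \<open>N\<close> at most about
    \<open>T\<^sup>2\<close>, is \<open>O(1 / T)\<close>, while \<open>ln H\<close> remains of order
    \<open>ln T\<close>.\<close>
  define H where "H = nat \<lceil>T ^ 12\<rceil>"
  define \<omega> where "\<omega> = (\<lambda>s::nat. xi (real s) (real N + 1 / 2 - real s))"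
  define op where "op = (\<lambda>s n::nat. osc_int G t (pi * real n) (\<omega> s))"
  define om where "om = (\<lambda>s n::nat. osc_int G t (- (pi * real n)) (\<omega> s))"
  define m where "m = (\<lambda>n::nat. if n \<le> Y then (- 1) ^ n * saddle_main F G t (real n) else 0)"
  have lnT: "ln T \<ge> 1"
  proof -
    have "exp 1 \<le> T" using exp_le T by linarith
    then show ?thesis using T by (subst ln_ge_iff) auto
  qed
  have L: "L \<ge> 2" using lnT by (simp add: L_def)
  have TG: "T \<le> T\<^sup>2 / G" "T\<^sup>2 / G \<le> T\<^sup>2"
    using G T by (auto simp: power2_eq_square field_simps mult_left_mono)
  have NT: "real N \<ge> T\<^sup>2 / G" "real N \<le> T\<^sup>2 / G + 1"
    using TG T unfolding N by linarith+
  have N1: "real N \<ge> T" "N \<ge> 1" using NT TG T by linarith+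
  have TT: "T * 100 \<le> T\<^sup>2" using T by (simp add: power2_eq_square)
  have NTT: "real N + 1 / 2 \<le> 2 * T\<^sup>2" using NT TG TT T by linarith
  have H: "real H \<ge> T ^ 12" "real H \<le> 2 * T ^ 12" "H > 0"
  proof -
    have p: "T ^ 12 \<ge> 1" using T by (simp add: one_le_power)
    then show "real H \<ge> T ^ 12" "real H \<le> 2 * T ^ 12" unfolding H_def by linarith+
    then show "H > 0" using p by linarith
  qed
  have GG: "G\<^sup>2 \<ge> 1" "G\<^sup>2 \<ge> G" using G mult_mono[of 1 G 1 G] by (auto simp: power2_eq_square)
  have Yr: "real Y \<le> 2 * T / G\<^sup>2" "real Y + 1 > 2 * T / G\<^sup>2"
  proof -
    have "0 \<le> 2 * T / G\<^sup>2" using T by simp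
    then show "real Y \<le> 2 * T / G\<^sup>2" "real Y + 1 > 2 * T / G\<^sup>2" unfolding Y by linarith+
  qed
  have YT: "real Y \<le> 2 * T"
  proof -
    have "2 * T / G\<^sup>2 \<le> 2 * T / 1" using GG T by (intro divide_left_mono) auto
    then show ?thesis using Yr by simp
  qed
  have YN: "Y \<le> N"
  proof -
    have "2 * T / G\<^sup>2 \<le> 2 * T / G" using GG G T by (intro divide_left_mono) auto
    also have "\<dots> \<le> T\<^sup>2 / G" using TT T G by (intro divide_right_mono) auto
    finally have "real Y \<le> real N" using Yr NT by linarith
    then show ?thesis by simp
  qed
  have T12: "T ^ 12 = T ^ 3 * T ^ 9" "T ^ 9 \<ge> 8" "T ^ 3 \<ge> T"
  proof -
    show "T ^ 12 = T ^ 3 * T ^ 9" by (simp flip: power_add)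
    have "T ^ 1 \<le> T ^ 9" "T ^ 1 \<le> T ^ 3" using T by (intro power_increasing; simp)+
    then show "T ^ 9 \<ge> 8" "T ^ 3 \<ge> T" using T by auto
  qed
  \<comment> \<open>Used to drop the Fejer weight from the main terms: for
    \<open>n = h * s \<le> Y\<close> one has \<open>n * h \<le> Y\<^sup>2 \<le> H\<close>, hence
    \<open>h / H \<le> 1 / n\<close>.\<close>
  have YYH: "real Y * real Y * (1 / real H) \<le> 1"
  proof -
    have "real Y * real Y \<le> (2 * T) * (2 * T)" using YT by (intro mult_mono) auto
    also have "\<dots> \<le> T ^ 3" using T by (simp add: eval_nat_numeral)
    also have "\<dots> \<le> T ^ 3 * T ^ 9" using T12(2) T by simp
    finally have "real Y * real Y \<le> real H" using H T12 by linarith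
    then show ?thesis using H by (simp add: field_simps)
  qed
  have YH: "Y < H"
  proof -
    have "2 * T < T * 8" using T by simp
    also have "\<dots> \<le> T ^ 3 * T ^ 9" using T12 T by (intro mult_mono) auto
    finally show ?thesis using YT H T12 by linarith
  qed
  have harmN: "(\<Sum>n\<in>{1..N}. 1 / real n) \<le> 2 * L"
  proof -
    have "ln (real N) \<le> ln (2 * T\<^sup>2)" using NTT N1 by (subst ln_le_cancel_iff) auto
    also have "\<dots> = ln 2 + 2 * ln T" using T by (simp add: ln_mult ln_realpow)
    also have "ln 2 \<le> (1::real)" using ln_2_less_1 by simp
    finally show ?thesis using harm_le[OF N1(2)] by (simp add: L_def)
  qed
  have harmH: "(\<Sum>h\<in>{1..<H}. 1 / real h) \<le> 12 * L"
  proof -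
    have "(\<Sum>h\<in>{1..<H}. 1 / real h) \<le> (\<Sum>h\<in>{1..H}. 1 / real h)" by (intro sum_mono2) auto
    also have "\<dots> \<le> 1 + ln (real H)" using H by (intro harm_le) auto
    also have "ln (real H) \<le> ln (2 * T ^ 12)" using H by (subst ln_le_cancel_iff) auto
    also have "\<dots> = ln 2 + 12 * ln T" using T by (simp add: ln_mult ln_realpow)
    also have "ln 2 \<le> (1::real)" using ln_2_less_1 by simp
    finally show ?thesis by (simp add: L_def)
  qed
  have hs1: "h * s \<ge> 1" "real (h * s) > 0" if "s \<in> {1..N}" "h \<in> {1..<H}" for s h
  proof -
    have "1 * 1 \<le> h * s" using that by (intro mult_le_mono) auto
    then show "h * s \<ge> 1" "real (h * s) > 0" by auto
  qed
  have \<omega>0: "\<omega> s > 0" if "s \<in> {1..N}" for s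
    unfolding \<omega>_def using that by (intro xi_pos) auto
  \<comment> \<open>1800 from \<open>osc_int_near_saddle\<close>, twice 7 from
    \<open>osc_int_off_saddle\<close>, and \<open>norm F\<close> for the dropped Fejer
    weight.\<close>
  define K where "K = 1814 * L + norm F"
  have pair: "\<bar>(1 - real h / real H) * ((- 1) ^ (h * s) * (Re (op s (h * s)) + Re (om s (h * s)))) - Re (m (h * s))\<bar>
      \<le> K * (1 / real s * (1 / real h))" if s: "s \<in> {1..N}" and h: "h \<in> {1..<H}" for s h
  proof -
    define n where "n = h * s"
    define q where "q = real h / real H"
    have n: "n \<ge> 1" "real n > 0" using hs1[OF s h] by (auto simp: n_def)
    have q: "0 \<le> q" "q \<le> 1" using h by (auto simp: q_def)
    have om: "norm (om s n) \<le> 7 / real n"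
      unfolding om_def using \<omega>0[OF s] n T t G by (intro osc_int_off_saddle) auto
    have L1: "1800 * L / real n \<ge> 0" using L by simp
    have main: "norm (op s n - (- 1) ^ n * m n) \<le> 1800 * L / real n + 7 / real n \<and> q * norm (m n) \<le> norm F / real n"
    proof (cases "n \<le> Y")
      case True
      then have nr: "real n \<le> 2 * T / G\<^sup>2" using Yr by linarith
      have ph: "4 \<le> saddle_phase t (real n)"
        using saddle_phase_bounds(2)[of "real n"] n nr by simp
      have "norm (op s n - saddle_main F G t (real n)) \<le> 1800 * (1 + ln T) / real n"
        unfolding op_def n_def \<omega>_def
        by (rule osc_int_near_saddle[OF NT(1)]) (use s h nr in \<open>auto simp: n_def\<close>)
      moreover have "(- 1) ^ n * m n = saddle_main F G t (real n)"
        using True by (simp add: m_def flip: mult.assoc power_mult_distrib)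
      moreover have "q * norm (m n) \<le> norm F / real n"
      proof -
        have "norm (m n) \<le> norm F"
          using True saddle_main_le[of t "real n" G F] n T t G ph by (simp add: m_def norm_mult norm_power)
        moreover have "q \<le> 1 / real n"
        proof -
          have "h \<le> Y"
          proof -
            have "h * 1 \<le> h * s" using s by (intro mult_le_mono) auto
            then show ?thesis using True unfolding n_def by linarith
          qed
          then have "real n * real h \<le> real Y * real Y" using True by (intro mult_mono) auto
          then have "real n * q \<le> real Y * real Y * (1 / real H)"
            unfolding q_def by (simp add: divide_right_mono)
          then show ?thesis using YYH n by (simp add: field_simps)
        qed
        ultimately have "q * norm (m n) \<le> 1 / real n * norm F" using q n by (intro mult_mono) auto
        then show ?thesis by simp
      qed
      ultimately show ?thesis using n by (simp add: L_def add_increasing2)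
    next
      case False
      then have "real n > 2 * T / G\<^sup>2" using Yr by linarith
      moreover have "t / G\<^sup>2 \<le> 2 * T / G\<^sup>2" using t by (intro divide_right_mono) auto
      ultimately have "norm (op s n) \<le> 7 / real n"
        unfolding op_def using \<omega>0[OF s] n T t G by (intro osc_int_off_saddle) auto
      then show ?thesis using False L1 by (simp add: m_def)
    qed
    have sg: "\<bar>(- 1) ^ n * x\<bar> = \<bar>x\<bar>" for x :: real by (simp add: abs_mult power_abs)
    have sg2: "Re ((- 1) ^ n * z) = (- 1) ^ n * Re z" for z
      by (cases "even n") auto
    have "(1 - q) * ((- 1) ^ n * (Re (op s n) + Re (om s n))) - Re (m n) =
      (1 - q) * ((- 1) ^ n * (Re (op s n - (- 1) ^ n * m n))) + (1 - q) * ((- 1) ^ n * Re (om s n)) - q * Re (m n)"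
    proof -
      have "(- 1) ^ n * ((- 1) ^ n * Re (m n)) = Re (m n)" by (simp flip: mult.assoc power_mult_distrib)
      then show ?thesis by (simp add: sg2 algebra_simps)
    qed
    also have "\<bar>\<dots>\<bar> \<le> 1 * (1800 * L / real n + 7 / real n) + 1 * (7 / real n) + norm F / real n"
    proof -
      have a: "\<bar>(1 - q) * ((- 1) ^ n * (Re (op s n - (- 1) ^ n * m n)))\<bar> \<le> 1 * (1800 * L / real n + 7 / real n)"
        unfolding abs_mult[of "1 - q"] sg
        using q main abs_Re_le_cmod[of "op s n - (- 1) ^ n * m n"] by (intro mult_mono) auto
      have b: "\<bar>(1 - q) * ((- 1) ^ n * Re (om s n))\<bar> \<le> 1 * (7 / real n)"
        unfolding abs_mult[of "1 - q"] sg
        using q om abs_Re_le_cmod[of "om s n"] by (intro mult_mono) auto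
      have "q * \<bar>Re (m n)\<bar> \<le> q * norm (m n)" using q abs_Re_le_cmod[of "m n"] by (intro mult_left_mono)
      then have c: "\<bar>q * Re (m n)\<bar> \<le> norm F / real n" using main q by (simp add: abs_mult)
      show ?thesis using a b c by linarith
    qed
    also have "\<dots> = (1800 * L + 14 + norm F) / real n" by (simp add: add_divide_distrib)
    also have "\<dots> \<le> K / real n" using L n by (intro divide_right_mono) (auto simp: K_def)
    also have "\<dots> = K * (1 / real s * (1 / real h))" by (simp add: n_def)
    finally show ?thesis by (simp add: n_def q_def)
  qed
  have K0: "K \<ge> 0" using L by (simp add: K_def)
  have double: "\<bar>(\<Sum>s\<in>{1..N}. \<Sum>h\<in>{1..<H}. (1 - real h / real H) * ((- 1) ^ (h * s) * (Re (op s (h * s)) + Re (om s (h * s))))) -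
      (\<Sum>s\<in>{1..N}. \<Sum>h\<in>{1..<H}. Re (m (h * s)))\<bar> \<le> K * (24 * L\<^sup>2)"
  proof -
    have "\<bar>(\<Sum>s\<in>{1..N}. \<Sum>h\<in>{1..<H}. (1 - real h / real H) * ((- 1) ^ (h * s) * (Re (op s (h * s)) + Re (om s (h * s))))) -
      (\<Sum>s\<in>{1..N}. \<Sum>h\<in>{1..<H}. Re (m (h * s)))\<bar> \<le> (\<Sum>s\<in>{1..N}. \<Sum>h\<in>{1..<H}. K * (1 / real s * (1 / real h)))"
      unfolding sum_subtractf[symmetric]
      by (intro order_trans[OF sum_abs] sum_mono) (intro pair)
    also have "\<dots> = K * ((\<Sum>s\<in>{1..N}. 1 / real s) * (\<Sum>h\<in>{1..<H}. 1 / real h))"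
      unfolding sum_product by (simp only: sum_distrib_left)
    also have "\<dots> \<le> K * ((2 * L) * (12 * L))"
      using harmN harmH K0 L by (intro mult_left_mono mult_mono sum_nonneg) auto
    finally show ?thesis by (simp add: power2_eq_square algebra_simps)
  qed
  have mainsum: "(\<Sum>s\<in>{1..N}. \<Sum>h\<in>{1..<H}. Re (m (h * s))) = Re (divisor_main F G Y t)"
  proof -
    have "(\<Sum>s\<in>{1..N}. \<Sum>h\<in>{1..<H}. m (h * s)) = (\<Sum>n\<in>{1..Y}. of_nat (num_divisors n) * ((- 1) ^ n * saddle_main F G t (real n)))"
      unfolding m_def using divisor_double_sum[OF YN YH, of "\<lambda>n. (- 1) ^ n * saddle_main F G t (real n)"] by simp
    also have "\<dots> = divisor_main F G Y t"
      unfolding divisor_main_def by (simp add: mult_ac)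
    finally show ?thesis by (simp flip: Re_sum)
  qed
  have rows: "\<bar>(\<Sum>s\<in>{1..N}. \<Sum>r\<in>{1..N - s}. corr_term G t (real s) (real r)) - ((\<Sum>s\<in>{1..N}. Re (osc_int G t 0 (\<omega> s))) +
     (\<Sum>s\<in>{1..N}. \<Sum>h\<in>{1..<H}. (1 - real h / real H) * ((- 1) ^ (h * s) * (Re (op s (h * s)) + Re (om s (h * s))))))\<bar> \<le> 1"
  proof -
    have "\<bar>(\<Sum>s\<in>{1..N}. \<Sum>r\<in>{1..N - s}. corr_term G t (real s) (real r)) - ((\<Sum>s\<in>{1..N}. Re (osc_int G t 0 (\<omega> s))) +
     (\<Sum>s\<in>{1..N}. \<Sum>h\<in>{1..<H}. (1 - real h / real H) * ((- 1) ^ (h * s) * (Re (op s (h * s)) + Re (om s (h * s))))))\<bar>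
     \<le> (\<Sum>s\<in>{1..N}. real N * ((8 + 4 * t) / sqrt (real H)))"
      unfolding sum.distrib[symmetric] sum_subtractf[symmetric] op_def om_def \<omega>_def
      using G t T H by (intro order_trans[OF sum_abs] sum_mono row_sum) auto
    also have "\<dots> = real N * real N * (8 + 4 * t) / sqrt (real H)" by simp
    also have "\<dots> \<le> (2 * T\<^sup>2) * (2 * T\<^sup>2) * (9 * T) / T ^ 6"
    proof (intro frac_le mult_mono)
      show "T ^ 6 \<le> sqrt (real H)"
        using H(1) by (intro real_le_rsqrt) (simp flip: power_mult)
    qed (use NTT t T in auto)
    also have "\<dots> = 36 / T" using T by (simp add: eval_nat_numeral)
    also have "\<dots> \<le> 1" using T by simp
    finally show ?thesis .
  qed
  have zero: "\<bar>\<Sum>s\<in>{1..N}. Re (osc_int G t 0 (\<omega> s))\<bar> \<le> 10 * L"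
  proof -
    have "\<bar>\<Sum>s\<in>{1..N}. Re (osc_int G t 0 (\<omega> s))\<bar> \<le> ln (real N + 1 / 2) + 3 + (real N + 1 / 2) * (3 * G / t\<^sup>2)"
      unfolding \<omega>_def using N1 G t T by (intro zero_frequency) auto
    moreover have "ln (real N + 1 / 2) \<le> 2 * L"
    proof -
      have "ln (real N + 1 / 2) \<le> ln (2 * T\<^sup>2)" using NTT N1 by (subst ln_le_cancel_iff) auto
      also have "\<dots> = ln 2 + 2 * ln T" using T by (simp add: ln_mult ln_realpow)
      also have "ln 2 \<le> (1::real)" using ln_2_less_1 by simp
      finally show ?thesis by (simp add: L_def)
    qed
    moreover have "(real N + 1 / 2) * (3 * G / t\<^sup>2) \<le> (2 * (T\<^sup>2 / G)) * (3 * G / T\<^sup>2)"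
      using NT TG T t G by (intro mult_mono divide_left_mono power_mono) auto
    moreover have "(2 * (T\<^sup>2 / G)) * (3 * G / T\<^sup>2) = 6" using T G by simp
    ultimately show ?thesis using L by linarith
  qed
  have "(\<Sum>s\<in>{1..N}. \<Sum>r\<in>{1..N - s}. corr_term G t (real s) (real r)) \<le> 10 * L + 1 + K * (24 * L\<^sup>2) + norm (divisor_main F G Y t)"
    using rows double zero mainsum abs_Re_le_cmod[of "divisor_main F G Y t"] by linarith
  then have "pform N G t \<le> 2 * L + 2 * (10 * L + 1 + K * (24 * L\<^sup>2) + norm (divisor_main F G Y t))"
  proof -
    have "b \<le> k \<Longrightarrow> a \<le> l \<Longrightarrow> a + 2 * b \<le> l + 2 * k" for a b k l :: real by linarith
    from this[OF \<open>(\<Sum>s\<in>{1..N}. \<Sum>r\<in>{1..N - s}. corr_term G t (real s) (real r)) \<le> _\<close> harmN]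
    show ?thesis unfolding pform_eq .
  qed
  moreover have "2 * L + 2 * (10 * L + 1 + K * (24 * L\<^sup>2)) \<le> 100000 * (1 + norm F) * L ^ 3"
  proof -
    have L3: "L \<le> L ^ 3" "1 \<le> L ^ 3" "L\<^sup>2 \<le> L ^ 3" "L * L\<^sup>2 = L ^ 3"
      using L power_increasing[of 1 3 L] power_increasing[of 2 3 L] one_le_power[of L 3] by (auto simp: eval_nat_numeral)
    have "norm F * L\<^sup>2 \<le> norm F * L ^ 3" using L3 by (intro mult_left_mono) auto
    moreover have "K * (24 * L\<^sup>2) = 43536 * L ^ 3 + 24 * (norm F * L\<^sup>2)"
      using L3(4) by (simp add: K_def algebra_simps)
    moreover have "0 \<le> norm F * L ^ 3" using L by simp
    moreover have "100000 * (1 + norm F) * L ^ 3 = 100000 * L ^ 3 + 100000 * (norm F * L ^ 3)"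
      by (simp add: algebra_simps)
    moreover have "x \<le> y \<Longrightarrow> k = 43536 * c + 24 * x \<Longrightarrow> 0 \<le> y \<Longrightarrow> r = 100000 * c + 100000 * y \<Longrightarrow> l \<le> c \<Longrightarrow> 1 \<le> c \<Longrightarrow>
      2 * l + 2 * (10 * l + 1 + k) \<le> r" for x y k c r l :: real
      by simp
    ultimately show ?thesis using L3(1,2) by blast
  qed
  moreover have "p \<le> a + 2 * (b + d) \<Longrightarrow> a + 2 * b \<le> r \<Longrightarrow> p \<le> r + 2 * d" for p a b d r :: real by simp
  ultimately show ?thesis unfolding L_def[symmetric] by blast
qed

end

section \<open>Moments of the divisor sum\<close>

text \<open>
  The coefficient of \<open>n powr (- 1 / 4)\<close> in \<open>saddle_main\<close>. It is of size \<open>T powr (- 1 / 4)\<close> and varies slowly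
  with \<open>n\<close> as long as \<open>T \<le> G ^ 5\<close>, which is where the exponent \<open>1 / 10\<close> in the theorem comes from.
\<close>

definition saddle_wt :: "complex \<Rightarrow> real \<Rightarrow> real \<Rightarrow> real \<Rightarrow> complex" where
  "saddle_wt F G t x = F * of_real ((2 * pi * t) powr (- 1 / 4)) *
     (of_real (max 0 (1 - G * saddle_pt t x)) * of_real (saddle_pt t x / 2 / sinh (saddle_pt t x / 2)) *
      of_real ((1 + pi * x / (12 * t)) powr (- 1 / 2)) * cis (phase_corr t x (saddle_pt t x)))"

text \<open>The powers \<open>x powr (- 1 / 4)\<close> and
  \<open>(2 * pi * t) powr (- 1 / 4)\<close> both come from
  \<open>1 / sqrt (saddle_phase t x)\<close>, whose leading part is the fourth root of
  \<open>2 * pi * x * t\<close> in the denominator.\<close>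

lemma saddle_main_eq:
  assumes "t > 0" "x > 0"
  shows "saddle_main F G t x = of_real (x powr (- 1 / 4)) * saddle_wt F G t x * cis (2 * saddle_phase t x)"
proof -
  define k where "k = 1 + pi * x / (12 * t)"
  have k: "k > 0" using assms by (simp add: k_def add_pos_nonneg)
  have q: "sqrt (sqrt (2 * pi * x * t)) = (2 * pi * x * t) powr (1 / 4)"
    using assms powr_powr[of "2 * pi * x * t" "1 / 2" "1 / 2"] by (simp add: powr_half_sqrt)
  have "sqrt (saddle_phase t x) = (2 * pi * x * t) powr (1 / 4) * k powr (1 / 2)"
    unfolding saddle_phase_def k_def[symmetric] using assms k
    unfolding real_sqrt_mult[of _ k] q using k by (simp add: powr_half_sqrt)
  also have "(2 * pi * x * t) powr (1 / 4) = (2 * pi * t) powr (1 / 4) * x powr (1 / 4)"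
    using assms powr_mult[of "2 * pi * t" x "1 / 4"] by (simp only: mult_ac)
  finally have r: "1 / sqrt (saddle_phase t x) = (2 * pi * t) powr (- 1 / 4) * x powr (- 1 / 4) * k powr (- 1 / 2)"
    using assms k by (simp add: powr_minus_divide[of _ "1 / 4"] powr_minus_divide[of _ "1 / 2"] minus_divide_left[symmetric] field_simps)
  have a: "saddle_pt t x * amp G (saddle_pt t x) = max 0 (1 - G * saddle_pt t x) * (saddle_pt t x / 2 / sinh (saddle_pt t x / 2))"
    by (simp add: amp_def)
  have "saddle_main F G t x = F * of_real (saddle_pt t x * amp G (saddle_pt t x)) *
      cis (phase_corr t x (saddle_pt t x)) * cis (2 * saddle_phase t x) * of_real (1 / sqrt (saddle_phase t x))"
    unfolding saddle_main_def by simp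
  then show ?thesis
    unfolding r a k_def saddle_wt_def of_real_mult by (simp only: mult_ac)
qed

text \<open>With \<open>k = 1 + pi * x / (12 * t) \<ge> 1\<close> the derivative is
  \<open>saddle_pt t x / (2 * x)\<close> times \<open>2 / k - 1\<close>.\<close>

lemma saddle_pt_deriv:
  assumes "t > 0" "x > 0"
  obtains D where "(saddle_pt t has_real_derivative D) (at x)" "\<bar>D\<bar> \<le> saddle_pt t x / (2 * x)"
proof -
  define k where "k = 1 + pi * x / (12 * t)"
  define s where "s = sqrt (2 * pi * x / t)"
  have k: "k > 0" using assms by (simp add: k_def add_pos_nonneg)
  have s: "s > 0" "s * s = 2 * pi * x / t" using assms by (auto simp: s_def)
  have ds: "((\<lambda>x. sqrt (2 * pi * x / t)) has_real_derivative s / (2 * x)) (at x)"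
  proof -
    have "((\<lambda>x. sqrt (2 * pi * x / t)) has_real_derivative inverse (sqrt (2 * pi * x / t)) / 2 * (2 * pi / t)) (at x)"
      using assms by (intro DERIV_chain2[of sqrt, OF DERIV_real_sqrt] DERIV_cdivide) (auto intro!: derivative_eq_intros)
    moreover have "inverse s / 2 * (2 * pi / t) = s / (2 * x)"
      using s assms by (simp add: field_simps)
    ultimately show ?thesis by (simp add: s_def)
  qed
  have dk: "((\<lambda>x. 1 + pi * x / (12 * t)) has_real_derivative pi / (12 * t)) (at x)"
    using assms by (auto intro!: derivative_eq_intros)
  define D where "D = (s / (2 * x) * k - s * (pi / (12 * t))) / (k * k)"
  have 1: "(saddle_pt t has_real_derivative D) (at x)"
    unfolding saddle_pt_def[abs_def] D_def s_def k_def using k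
    by (intro DERIV_divide[OF ds[unfolded s_def] dk]) (simp add: k_def)
  have "D = s / k / (2 * x) * (2 / k - 1)"
  proof -
    have "pi / (12 * t) = (k - 1) / x" using assms by (simp add: k_def)
    moreover have "(s / (2 * x) * k - s * ((k - 1) / x)) / (k * k) = s / k / (2 * x) * (2 / k - 1)"
      using k assms by (simp add: field_simps)
    ultimately show ?thesis by (simp add: D_def)
  qed
  moreover have "\<bar>2 / k - 1\<bar> \<le> 1"
  proof -
    have "1 \<le> k" using assms by (simp add: k_def)
    then show ?thesis by (simp add: abs_le_iff field_simps)
  qed
  ultimately have "\<bar>D\<bar> \<le> s / k / (2 * x) * 1"
    using s k assms unfolding \<open>D = s / k / (2 * x) * (2 / k - 1)\<close> abs_mult[of "s / k / (2 * x)"] by (intro mult_mono) auto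
  then show ?thesis using 1 that by (simp add: saddle_pt_def s_def k_def)
qed

lemma ge_2_of_le_power5: "2 \<le> G" if "T \<ge> 100" "1 \<le> G" "T \<le> G ^ 5" for T G :: real
proof (rule ccontr)
  assume "\<not> 2 \<le> G"
  then have "G ^ 5 \<le> 2 ^ 5" using that by (intro power_mono) auto
  then show False using that by simp
qed

lemma norm_mult4_diff_le:
  fixes a b c d a' b' c' d' :: complex
  assumes "norm a \<le> 1" "norm b \<le> 1" "norm c \<le> 1" "norm d \<le> 1" "norm a' \<le> 1" "norm b' \<le> 1" "norm c' \<le> 1" "norm d' \<le> 1"
  shows "norm (a * b * c * d - a' * b' * c' * d') \<le> norm (a - a') + norm (b - b') + norm (c - c') + norm (d - d')"
proof -
  have two: "norm (x * y - x' * y') \<le> norm (x - x') + norm (y - y')" if "norm y \<le> 1" "norm x' \<le> 1" for x y x' y' :: complex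
  proof -
    have "x * y - x' * y' = (x - x') * y + x' * (y - y')" by (simp add: algebra_simps)
    also have "norm \<dots> \<le> norm (x - x') * norm y + norm x' * norm (y - y')"
      by (rule norm_triangle_le) (simp add: norm_mult)
    also have "\<dots> \<le> norm (x - x') * 1 + 1 * norm (y - y')"
      using that by (intro add_mono mult_mono) auto
    finally show ?thesis by simp
  qed
  have m: "norm (x * y) \<le> 1" if "norm x \<le> 1" "norm y \<le> 1" for x y :: complex
    using mult_mono[OF that] by (simp add: norm_mult)
  have "norm (a * b * c * d - a' * b' * c' * d') \<le> norm (a * b * c - a' * b' * c') + norm (d - d')"
    using assms by (intro two m)
  also have "norm (a * b * c - a' * b' * c') \<le> norm (a * b - a' * b') + norm (c - c')"
    using assms by (intro two m)
  also have "norm (a * b - a' * b') \<le> norm (a - a') + norm (b - b')"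
    using assms by (intro two m)
  finally show ?thesis by simp
qed

lemma norm_cis_diff_le: "norm (cis a - cis b) \<le> \<bar>a - b\<bar>"
proof -
  have "norm (cis a - cis b) = norm (exp (\<i> * of_real (a - b)) - 1)"
  proof -
    have "cis a - cis b = cis b * (cis (a - b) - 1)" by (simp add: cis_mult algebra_simps)
    then show ?thesis by (simp add: norm_mult cis_conv_exp)
  qed
  also have "\<dots> \<le> norm (- (\<i> * of_real (a - b)))"
    using norm_exp_diff_le[of "- (\<i> * of_real (a - b))"] by simp
  also have "\<dots> = \<bar>a - b\<bar>" by (simp only: norm_minus_cancel norm_mult norm_of_real norm_ii mult_1_left)
  finally show ?thesis by simp
qed

context
  fixes T G t :: real
  assumes T: "T \<ge> 100" and G: "G \<ge> 1" "T \<le> G ^ 5" and t: "T \<le> t" "t \<le> 2 * T"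
begin

text \<open>In the range of the divisor sum the saddle point is \<open>O(1 / G)\<close>, so
  \<open>x * w ^ 3\<close> and \<open>x\<^sup>2 * w / t\<close> are \<open>O(t / G ^ 5)\<close>.
  These two quantities govern \<open>phase_corr\<close>; the bound \<open>w \<le> 2\<close> is the
  range in which its estimates are valid.\<close>

lemma saddle_pt_small:
  assumes "0 < x" "x \<le> 2 * T / G\<^sup>2"
  shows "0 < saddle_pt t x" "saddle_pt t x \<le> (18 / 5) / G" "saddle_pt t x \<le> 2"
    "x * saddle_pt t x ^ 3 \<le> 188" "x\<^sup>2 * saddle_pt t x / t \<le> 29" "x \<le> 2 * t"
proof -
  have t0: "t > 0" using T t by simp
  show p: "0 < saddle_pt t x" using assms t0 by (intro saddle_pt_pos) auto
  have "saddle_pt t x \<le> sqrt (2 * pi * x / t) / 1"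
    unfolding saddle_pt_def using assms t0 by (intro divide_left_mono) (auto intro!: add_pos_nonneg)
  also have "\<dots> \<le> (18 / 5) / G"
  proof -
    have "2 * pi * x / t \<le> 2 * pi * (2 * T / G\<^sup>2) / T"
      using assms T t by (intro frac_le mult_left_mono) auto
    also have "\<dots> = 4 * pi / G\<^sup>2" using T by simp
    also have "\<dots> \<le> (18 / 5)\<^sup>2 / G\<^sup>2"
      using pi_approx by (intro divide_right_mono) (auto simp: power2_eq_square)
    also have "\<dots> = ((18 / 5) / G)\<^sup>2" by (simp add: power_divide)
    finally show ?thesis using G by (simp add: real_le_lsqrt)
  qed
  finally show w: "saddle_pt t x \<le> (18 / 5) / G" .
  also have "\<dots> \<le> (18 / 5) / 2" using ge_2_of_le_power5[OF T G] by (intro divide_left_mono) auto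
  finally show "saddle_pt t x \<le> 2" by simp
  have tG: "t / G ^ 5 \<le> 2" using t G by (simp add: divide_le_eq)
  have xt: "x \<le> 2 * t / G\<^sup>2"
  proof -
    have "2 * T / G\<^sup>2 \<le> 2 * t / G\<^sup>2" using t by (intro divide_right_mono) auto
    then show ?thesis using assms by simp
  qed
  have "x * saddle_pt t x ^ 3 \<le> (2 * t / G\<^sup>2) * ((18 / 5) / G) ^ 3"
    using xt w p assms t0 by (intro mult_mono power_mono) auto
  also have "\<dots> = 11664 / 125 * (t / G ^ 5)" using G by (simp add: power_divide field_simps eval_nat_numeral)
  also have "\<dots> \<le> 11664 / 125 * 2" using tG by (intro mult_left_mono) auto
  finally show "x * saddle_pt t x ^ 3 \<le> 188" by simp
  have "x\<^sup>2 * saddle_pt t x / t \<le> (2 * t / G\<^sup>2)\<^sup>2 * ((18 / 5) / G) / t"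
    using xt w p assms t0 by (intro divide_right_mono mult_mono power_mono) auto
  also have "\<dots> = 72 / 5 * (t / G ^ 5)" using G t0 by (simp add: power_divide field_simps eval_nat_numeral)
  also have "\<dots> \<le> 72 / 5 * 2" using tG by (intro mult_left_mono) auto
  finally have "x\<^sup>2 * saddle_pt t x / t \<le> 72 / 5 * 2" .
  then show "x\<^sup>2 * saddle_pt t x / t \<le> 29" by (rule order_trans) simp
  have "2 * t / G\<^sup>2 \<le> 2 * t / 1" using G t0 by (intro divide_left_mono) (auto simp: one_le_power)
  then show "x \<le> 2 * t" using xt by simp
qed

lemma saddle_wt_factors_le:
  assumes "x > 0"
  shows "\<bar>max 0 (1 - G * saddle_pt t x)\<bar> \<le> 1" "\<bar>saddle_pt t x / 2 / sinh (saddle_pt t x / 2)\<bar> \<le> 1"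
    "\<bar>(1 + pi * x / (12 * t)) powr (- 1 / 2)\<bar> \<le> 1" "norm (cis (phase_corr t x (saddle_pt t x))) \<le> 1"
    "\<bar>(2 * pi * t) powr (- 1 / 4)\<bar> \<le> T powr (- 1 / 4)"
proof -
  have t0: "t > 0" using T t by simp
  have p: "0 < saddle_pt t x" using assms t0 by (intro saddle_pt_pos) auto
  show "\<bar>max 0 (1 - G * saddle_pt t x)\<bar> \<le> 1" using p G by simp
  have 2: "saddle_pt t x / 2 / sinh (saddle_pt t x / 2) \<le> 1" "0 \<le> saddle_pt t x / 2 / sinh (saddle_pt t x / 2)"
    using sinh_ge_self[of "saddle_pt t x / 2"] p by (auto simp: divide_le_eq)
  then show "\<bar>saddle_pt t x / 2 / sinh (saddle_pt t x / 2)\<bar> \<le> 1" by linarith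
  have "(1 + pi * x / (12 * t)) powr (- 1 / 2) \<le> 1 powr (- 1 / 2)"
    using assms t0 by (intro powr_mono2') auto
  then show "\<bar>(1 + pi * x / (12 * t)) powr (- 1 / 2)\<bar> \<le> 1" by simp
  have "(2 * pi * t) powr (- 1 / 4) \<le> T powr (- 1 / 4)"
  proof (intro powr_mono2')
    have "1 * t \<le> (2 * pi) * t" using t0 pi_gt3 by (intro mult_right_mono) auto
    then show "T \<le> 2 * pi * t" using t by simp
  qed (use T in auto)
  then show "\<bar>(2 * pi * t) powr (- 1 / 4)\<bar> \<le> T powr (- 1 / 4)" by simp
qed simp

lemma saddle_wt_le:
  assumes "x > 0"
  shows "norm (saddle_wt F G t x) \<le> norm F * T powr (- 1 / 4)"
proof -
  have "norm (saddle_wt F G t x) \<le> norm F * T powr (- 1 / 4) * (1 * 1 * 1 * 1)"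
    unfolding saddle_wt_def norm_mult norm_of_real
    using saddle_wt_factors_le[OF assms] by (intro mult_mono mult_nonneg_nonneg) auto
  then show ?thesis by simp
qed

text \<open>Each of the four factors has a derivative \<open>O(1 / x)\<close>, hence changes by
  \<open>O(1 / n)\<close> from \<open>n\<close> to \<open>n + 1\<close>;
  \<open>25 = 2 + 2 + 1 + 20\<close>. The 20 belongs to the phase correction and relies on the
  bounds of \<open>saddle_pt_small\<close>.\<close>

lemma saddle_wt_diff_le:
  assumes n: "n \<ge> 1" "n + 1 \<le> 2 * T / G\<^sup>2"
  shows "norm (saddle_wt F G t n - saddle_wt F G t (n + 1)) \<le> norm F * T powr (- 1 / 4) * (25 / n)"
proof -
  have t0: "t > 0" using T t by simp
  define w where "w = saddle_pt t"
  have x: "0 < x" "x \<le> 2 * T / G\<^sup>2" "1 / x \<le> 1 / n" if "x \<in> {n..n + 1}" for x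
    using that n by (auto simp: frac_le)
  note small = saddle_pt_small[OF x(1,2), folded w_def]
  have lip: "\<bar>f n - f (n + 1)\<bar> \<le> K / n" if K: "K \<ge> 0" and ex: "\<And>x. x \<in> {n..n + 1} \<Longrightarrow> \<exists>D. (f has_real_derivative D) (at x) \<and> \<bar>D\<bar> \<le> K / x"
    for f K
  proof -
    obtain D where D: "\<And>x. x \<in> {n..n + 1} \<Longrightarrow> (f has_real_derivative D x) (at x) \<and> \<bar>D x\<bar> \<le> K / x"
      using ex by metis
    have "norm (f n - f (n + 1)) \<le> K / n * norm (n - (n + 1))"
    proof (rule field_differentiable_bound[of "{n..n + 1}" f D])
      fix z assume z: "z \<in> {n..n + 1}"
      show "(f has_real_derivative D z) (at z within {n..n + 1})"
        using D[OF z] by (auto intro: has_field_derivative_at_within)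
      have "K / z \<le> K / n" using K z n by (intro divide_left_mono) auto
      then show "norm (D z) \<le> K / n" using D[OF z] by simp
    qed auto
    then show ?thesis by simp
  qed
  have dw: "\<exists>D. (w has_real_derivative D) (at x) \<and> \<bar>D\<bar> \<le> w x / (2 * x)" if "x \<in> {n..n + 1}" for x
    using saddle_pt_deriv[OF t0 x(1)[OF that]] unfolding w_def by metis
  have pi2: "pi \<le> 3.2" "pi\<^sup>2 \<le> 10.24"
  proof -
    show "pi \<le> 3.2" using pi_approx by simp
    then have "pi\<^sup>2 \<le> 3.2\<^sup>2" by (intro power_mono) auto
    then show "pi\<^sup>2 \<le> 10.24" by (simp add: power2_eq_square)
  qed
  \<comment> \<open>It suffices to treat \<open>G * w\<close> itself, since truncation at 0 does not
    increase distances.\<close>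
  have d1: "\<bar>max 0 (1 - G * w n) - max 0 (1 - G * w (n + 1))\<bar> \<le> 2 / n"
  proof -
    have "\<bar>G * w n - G * w (n + 1)\<bar> \<le> 2 / n"
    proof (rule lip)
      fix x assume xx: "x \<in> {n..n + 1}"
      obtain D where D: "(w has_real_derivative D) (at x)" "\<bar>D\<bar> \<le> w x / (2 * x)" using dw[OF xx] by blast
      have "((\<lambda>x. G * w x) has_real_derivative G * D) (at x)" using D by (intro DERIV_cmult)
      moreover have "\<bar>G * D\<bar> \<le> 2 / x"
      proof -
        have "\<bar>G * D\<bar> \<le> G * (((18 / 5) / G) / (2 * x))"
          unfolding abs_mult using G D small(2)[OF xx xx] x[OF xx] by (intro mult_mono order_trans[OF D(2)] divide_right_mono) auto
        also have "\<dots> \<le> 2 / x" using G x[OF xx] by (simp add: field_simps)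
        finally show ?thesis .
      qed
      ultimately show "\<exists>D. ((\<lambda>x. G * w x) has_real_derivative D) (at x) \<and> \<bar>D\<bar> \<le> 2 / x" by blast
    qed auto
    then show ?thesis by linarith
  qed
  have d2: "\<bar>w n / 2 / sinh (w n / 2) - w (n + 1) / 2 / sinh (w (n + 1) / 2)\<bar> \<le> 2 / n"
  proof (rule lip)
    fix x assume xx: "x \<in> {n..n + 1}"
    obtain D where D: "(w has_real_derivative D) (at x)" "\<bar>D\<bar> \<le> w x / (2 * x)" using dw[OF xx] by blast
    define z where "z = w x / 2"
    have z: "0 < z" "z \<le> 1" using small(1,3)[OF xx xx] by (auto simp: z_def)
    have sz: "z \<le> sinh z" "0 < sinh z" using sinh_ge_self[of z] z by auto
    have cz: "cosh z \<le> 2" "0 \<le> cosh z" using z by (auto intro: cosh_le_2)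
    have "((\<lambda>x. w x / 2 / sinh (w x / 2)) has_real_derivative
       ((D / 2) * sinh z - (w x / 2) * (cosh z * (D / 2))) / (sinh z * sinh z)) (at x)"
      unfolding z_def
    proof (rule DERIV_divide)
      show "((\<lambda>x. w x / 2) has_real_derivative D / 2) (at x)" using D by (intro DERIV_cdivide)
      then show "((\<lambda>x. sinh (w x / 2)) has_real_derivative cosh (w x / 2) * (D / 2)) (at x)"
        by (rule DERIV_chain2[of sinh, OF has_field_derivative_sinh[OF DERIV_ident, simplified]])
    qed (use z in \<open>auto simp: z_def\<close>)
    moreover have "\<bar>((D / 2) * sinh z - (w x / 2) * (cosh z * (D / 2))) / (sinh z * sinh z)\<bar> \<le> 2 / x"
    proof -
      have eq: "((D / 2) * sinh z - (w x / 2) * (cosh z * (D / 2))) / (sinh z * sinh z) = (D / 2) * (1 / sinh z - z * cosh z / (sinh z * sinh z))"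
        using sz by (simp add: z_def[symmetric] field_simps)
      have a: "1 / sinh z \<le> 1 / z" using z sz by (intro divide_left_mono) auto
      have b: "z * cosh z / (sinh z * sinh z) \<le> z * 2 / (z * z)"
        using z sz cz by (intro frac_le mult_mono mult_left_mono) auto
      have "\<bar>1 / sinh z - z * cosh z / (sinh z * sinh z)\<bar> \<le> 2 / z"
      proof (rule abs_leI)
        have "0 \<le> z * cosh z / (sinh z * sinh z)" using z sz cz by (intro divide_nonneg_pos mult_nonneg_nonneg mult_pos_pos) auto
        moreover have "1 / z \<le> 2 / z" using z by (intro divide_right_mono) auto
        ultimately show "1 / sinh z - z * cosh z / (sinh z * sinh z) \<le> 2 / z" using a by linarith
        have "0 \<le> 1 / sinh z" using sz by simp
        moreover have "z * 2 / (z * z) = 2 / z" using z by simp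
        ultimately show "- (1 / sinh z - z * cosh z / (sinh z * sinh z)) \<le> 2 / z" using b by linarith
      qed
      moreover have "\<bar>D / 2\<bar> \<le> z / (2 * x)" using D by (simp add: z_def abs_divide)
      ultimately have "\<bar>(D / 2) * (1 / sinh z - z * cosh z / (sinh z * sinh z))\<bar> \<le> z / (2 * x) * (2 / z)"
        unfolding abs_mult using z x[OF xx] by (intro mult_mono) auto
      also have "\<dots> \<le> 2 / x" using z x[OF xx] by (simp add: field_simps)
      finally show ?thesis unfolding eq .
    qed
    ultimately show "\<exists>D. ((\<lambda>x. w x / 2 / sinh (w x / 2)) has_real_derivative D) (at x) \<and> \<bar>D\<bar> \<le> 2 / x" by blast
  qed auto
  have d3: "\<bar>(1 + pi * n / (12 * t)) powr (- 1 / 2) - (1 + pi * (n + 1) / (12 * t)) powr (- 1 / 2)\<bar> \<le> 1 / n"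
  proof (rule lip)
    fix x assume xx: "x \<in> {n..n + 1}"
    define k where "k = 1 + pi * x / (12 * t)"
    have k: "k \<ge> 1" using x(1)[OF xx] t0 by (simp add: k_def)
    have "((\<lambda>x. (1 + pi * x / (12 * t)) powr (- 1 / 2)) has_real_derivative ((- 1 / 2) * k powr (- 1 / 2 - 1) * (pi / (12 * t)))) (at x)"
      unfolding k_def using k t0 by (auto intro!: derivative_eq_intros simp: k_def)
    moreover have "\<bar>(- 1 / 2) * k powr (- 1 / 2 - 1) * (pi / (12 * t))\<bar> \<le> 1 / x"
    proof -
      have "k powr (- 1 / 2 - 1) \<le> 1 powr (- 1 / 2 - 1)" using k by (intro powr_mono2') auto
      then have kp: "k powr (- 1 / 2 - 1) \<le> 1" by simp
      have "\<bar>(- 1 / 2) * k powr (- 1 / 2 - 1) * (pi / (12 * t))\<bar> = (1 / 2) * k powr (- 1 / 2 - 1) * (pi / (12 * t))"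
        using t0 by (simp add: abs_mult)
      also have "\<dots> \<le> (1 / 2) * 1 * (4 / (12 * t))"
        using kp t0 pi_less_4 by (intro mult_mono divide_right_mono) auto
      also have "\<dots> = 1 / (6 * t)" by simp
      also have "\<dots> \<le> 1 / x" using small(6)[OF xx xx] x[OF xx] t0 by (intro divide_left_mono) auto
      finally show ?thesis .
    qed
    ultimately show "\<exists>D. ((\<lambda>x. (1 + pi * x / (12 * t)) powr (- 1 / 2)) has_real_derivative D) (at x) \<and> \<bar>D\<bar> \<le> 1 / x" by blast
  qed auto
  have d4: "\<bar>phase_corr t n (w n) - phase_corr t (n + 1) (w (n + 1))\<bar> \<le> 20 / n"
  proof (rule lip)
    fix x assume xx: "x \<in> {n..n + 1}"
    obtain D where D: "(w has_real_derivative D) (at x)" "\<bar>D\<bar> \<le> w x / (2 * x)" using dw[OF xx] by blast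
    note sm = small[OF xx xx]
    define \<kappa> where "\<kappa> = (\<lambda>w::real. cosh (w / 2) / sinh (w / 2) - 2 / w - w / 6)"
    define \<kappa>' where "\<kappa>' = - (1 / (2 * (sinh (w x / 2))\<^sup>2)) + 2 / (w x)\<^sup>2 - 1 / 6"
    have d\<kappa>: "(\<kappa> has_real_derivative \<kappa>') (at (w x))"
    proof -
      have "((\<lambda>w. 2 / w) has_real_derivative - (2 / (w x)\<^sup>2)) (at (w x))"
        using sm(1) by (auto intro!: derivative_eq_intros simp: power2_eq_square)
      moreover have "((\<lambda>w. w / 6) has_real_derivative 1 / 6) (at (w x))"
        by (auto intro!: derivative_eq_intros)
      ultimately show ?thesis
        using DERIV_diff[OF DERIV_diff[OF coth_half_deriv[OF sm(1)]]] unfolding \<kappa>_def \<kappa>'_def by fastforce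
    qed
    have e: "phase_corr t x v = pi * x * \<kappa> v - pi\<^sup>2 * x\<^sup>2 * v / (144 * t)" for x v
      by (simp add: phase_corr_def \<kappa>_def)
    have p2: "((\<lambda>x. pi\<^sup>2 * x\<^sup>2) has_real_derivative pi\<^sup>2 * (2 * x)) (at x)"
      by (auto intro!: derivative_eq_intros)
    have p1: "((\<lambda>x. pi * x) has_real_derivative pi) (at x)"
      by (auto intro!: derivative_eq_intros)
    define E where "E = pi * \<kappa> (w x) + \<kappa>' * D * (pi * x) - (pi\<^sup>2 * (2 * x) * w x + D * (pi\<^sup>2 * x\<^sup>2)) / (144 * t)"
    have "((\<lambda>x. pi * x * \<kappa> (w x) - pi\<^sup>2 * x\<^sup>2 * w x / (144 * t)) has_real_derivative E) (at x)"
      unfolding E_def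
      by (rule DERIV_diff[OF DERIV_mult[OF p1 DERIV_chain2[OF d\<kappa> D(1)]] DERIV_cdivide[OF DERIV_mult[OF p2 D(1)]]])
    then have "((\<lambda>x. phase_corr t x (w x)) has_real_derivative E) (at x)" by (simp only: e)
    moreover have "\<bar>E\<bar> \<le> 20 / x"
    proof -
      have x0: "x > 0" using x(1)[OF xx] .
      define W where "W = w x"
      have W: "0 < W" "W \<le> 2" "x * W ^ 3 \<le> 188" "x\<^sup>2 * W / t \<le> 29" using sm by (auto simp: W_def)
      have k1: "\<bar>\<kappa> W\<bar> \<le> W ^ 3 / 80" using phase_corr_coth(1)[OF W(1,2)] unfolding \<kappa>_def .
      have k2: "\<bar>\<kappa>'\<bar> \<le> W\<^sup>2 / 72" using phase_corr_coth(2)[OF W(1,2)] unfolding \<kappa>'_def W_def[symmetric] .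
      have DW: "\<bar>D\<bar> \<le> W / (2 * x)" using D(2) by (simp add: W_def)
      have "\<bar>pi * \<kappa> W\<bar> \<le> 3.2 * (W ^ 3 / 80)"
        unfolding abs_mult using k1 pi2 by (intro mult_mono) auto
      also have "\<dots> = (3.2 / 80) * (x * W ^ 3) / x" using x0 by simp
      also have "\<dots> \<le> (3.2 / 80) * 188 / x" using W x0 by (intro divide_right_mono mult_left_mono) auto
      finally have b1: "\<bar>pi * \<kappa> W\<bar> \<le> 7.52 / x" by simp
      have "\<bar>\<kappa>' * D * (pi * x)\<bar> \<le> (W\<^sup>2 / 72) * (W / (2 * x)) * (3.2 * x)"
        unfolding abs_mult using k2 DW pi2 x0 W by (intro mult_mono) auto
      also have "\<dots> = (3.2 / 144) * (x * W ^ 3) / x" using x0 by (simp add: eval_nat_numeral)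
      also have "\<dots> \<le> (3.2 / 144) * 188 / x" using W x0 by (intro divide_right_mono mult_left_mono) auto
      finally have b2: "\<bar>\<kappa>' * D * (pi * x)\<bar> \<le> (3.2 / 144) * 188 / x" .
      have "\<bar>pi\<^sup>2 * (2 * x) * W + D * (pi\<^sup>2 * x\<^sup>2)\<bar> \<le> 10.24 * (2 * x) * W + W / (2 * x) * (10.24 * x\<^sup>2)"
        using DW pi2 x0 W by (intro order_trans[OF abs_triangle_ineq] add_mono) (auto simp only: abs_mult abs_of_pos abs_power2 intro!: mult_mono, auto)
      also have "\<dots> = 25.6 * (x * W)" using x0 by (simp add: power2_eq_square)
      finally have "\<bar>(pi\<^sup>2 * (2 * x) * W + D * (pi\<^sup>2 * x\<^sup>2)) / (144 * t)\<bar> \<le> 25.6 * (x * W) / (144 * t)"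
        using t0 W x0 unfolding abs_divide by (intro frac_le) auto
      also have "\<dots> = (25.6 / 144) * (x\<^sup>2 * W / t) / x" using x0 by (simp add: power2_eq_square)
      also have "\<dots> \<le> (25.6 / 144) * 29 / x" using W x0 by (intro divide_right_mono mult_left_mono) auto
      finally have b3: "\<bar>(pi\<^sup>2 * (2 * x) * W + D * (pi\<^sup>2 * x\<^sup>2)) / (144 * t)\<bar> \<le> (25.6 / 144) * 29 / x" .
      have "\<bar>E\<bar> \<le> 7.52 / x + (3.2 / 144) * 188 / x + (25.6 / 144) * 29 / x"
        unfolding E_def W_def[symmetric] using b1 b2 b3 by (intro order_trans[OF abs_triangle_ineq4] add_mono order_trans[OF abs_triangle_ineq]) auto
      also have "\<dots> = (7.52 + (3.2 / 144) * 188 + (25.6 / 144) * 29) / x" by (simp add: add_divide_distrib)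
      also have "\<dots> \<le> 20 / x" using x0 by (intro divide_right_mono) auto
      finally show ?thesis .
    qed
    ultimately show "\<exists>D. ((\<lambda>x. phase_corr t x (w x)) has_real_derivative D) (at x) \<and> \<bar>D\<bar> \<le> 20 / x" by blast
  qed auto
  have n1: "n > 0" "n + 1 > 0" using n by auto
  have fac: "norm (of_real (max 0 (1 - G * w y)) :: complex) \<le> 1" "norm (of_real (w y / 2 / sinh (w y / 2)) :: complex) \<le> 1"
      "norm (of_real ((1 + pi * y / (12 * t)) powr (- 1 / 2)) :: complex) \<le> 1" "norm (cis (phase_corr t y (w y))) \<le> 1"
    if "y > 0" for y
    using saddle_wt_factors_le[OF that] by (simp_all only: w_def norm_of_real norm_cis)
  have "saddle_wt F G t n - saddle_wt F G t (n + 1) = F * of_real ((2 * pi * t) powr (- 1 / 4)) *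
     (of_real (max 0 (1 - G * w n)) * of_real (w n / 2 / sinh (w n / 2)) *
      of_real ((1 + pi * n / (12 * t)) powr (- 1 / 2)) * cis (phase_corr t n (w n)) -
      of_real (max 0 (1 - G * w (n + 1))) * of_real (w (n + 1) / 2 / sinh (w (n + 1) / 2)) *
      of_real ((1 + pi * (n + 1) / (12 * t)) powr (- 1 / 2)) * cis (phase_corr t (n + 1) (w (n + 1))))"
    unfolding saddle_wt_def w_def by (rule right_diff_distrib[symmetric])
  also have "norm \<dots> \<le> norm F * T powr (- 1 / 4) * (2 / n + 2 / n + 1 / n + 20 / n)"
    unfolding norm_mult[of "F * _"] norm_mult[of F]
  proof (intro mult_mono order_trans[OF norm_mult4_diff_le[OF fac[OF n1(1)] fac[OF n1(2)]]] add_mono)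
    show "norm (of_real ((2 * pi * t) powr (- 1 / 4)) :: complex) \<le> T powr (- 1 / 4)"
      using saddle_wt_factors_le(5)[OF n1(1)] by (simp only: norm_of_real)
  qed (use d1 d2 d3 order_trans[OF norm_cis_diff_le d4] in \<open>auto simp only: of_real_diff[symmetric] norm_of_real intro: order_refl norm_ge_zero powr_ge_zero mult_nonneg_nonneg\<close>)
  also have "2 / n + 2 / n + 1 / n + 20 / n = 25 / n" by (simp add: add_divide_distrib[symmetric])
  finally show ?thesis .
qed

end

section \<open>Partial summation over dyadic blocks\<close>

definition divisor_exp_term :: "nat \<Rightarrow> real \<Rightarrow> complex" where
  "divisor_exp_term k t = (- 1) ^ k * of_nat (num_divisors k) * of_real (real k powr (- 1 / 4)) *
        exp (2 * \<i> * of_real (sqrt (2 * pi * real k * t)) +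
             of_real (sqrt (2 * pi ^ 3) / 6) * \<i> * of_real (real k powr (3 / 2) * t powr (- 1 / 2)))"

lemma divisor_exp_sum_nat: "divisor_exp_sum (real m) (real l) t = (\<Sum>k\<in>{m..l}. divisor_exp_term k t)"
proof -
  have "{k. real m \<le> real k \<and> real k \<le> real l} = {m..l}" by auto
  then show ?thesis by (simp only: divisor_exp_sum_def divisor_exp_term_def)
qed

text \<open>The origin of the constant in the theorem: the second part of
  \<open>saddle_phase\<close> contributes \<open>2 * sqrt (2 * pi) * pi / 12\<close>, which is
  \<open>sqrt (2 * pi ^ 3) / 6\<close>.\<close>

lemma saddle_phase_expand:
  assumes "t > 0" "x > 0"
  shows "2 * saddle_phase t x = 2 * sqrt (2 * pi * x * t) + sqrt (2 * pi ^ 3) / 6 * (x powr (3 / 2) * t powr (- 1 / 2))"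
proof -
  have 1: "sqrt (2 * pi ^ 3) = pi * sqrt (2 * pi)"
    by (rule real_sqrt_unique) (auto simp: power_mult_distrib eval_nat_numeral)
  have "x powr (1 + 1 / 2) = x * sqrt x"
    unfolding powr_add using assms by (simp add: powr_half_sqrt)
  then have 2: "x powr (3 / 2) = x * sqrt x" by simp
  have "t powr (1 / 2 - 1) = sqrt t / t"
    unfolding powr_diff using assms by (simp add: powr_half_sqrt)
  then have 3: "t powr (- 1 / 2) = sqrt t / t" by simp
  have 4: "sqrt (2 * pi * x * t) = sqrt (2 * pi) * sqrt x * sqrt t" by (simp add: real_sqrt_mult)
  have "2 * (a * b * c * (1 + pi * x / (12 * t))) = 2 * (a * b * c) + pi * a / 6 * (x * b * (c / t))" for a b c
    using assms by (simp add: field_simps)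
  then show ?thesis unfolding saddle_phase_def 1 2 3 4 .
qed

lemma divisor_main_eq:
  assumes "t > 0"
  shows "divisor_main F G Y t = (\<Sum>n\<in>{1..Y}. divisor_exp_term n t * saddle_wt F G t (real n))"
  unfolding divisor_main_def
proof (intro sum.cong refl)
  fix n assume "n \<in> {1..Y}"
  then have n: "real n > 0" by simp
  have "cis (2 * saddle_phase t (real n)) = exp (2 * \<i> * of_real (sqrt (2 * pi * real n * t)) +
             of_real (sqrt (2 * pi ^ 3) / 6) * \<i> * of_real (real n powr (3 / 2) * t powr (- 1 / 2)))"
    unfolding saddle_phase_expand[OF assms n] cis_conv_exp by (simp add: algebra_simps)
  then show "(- 1) ^ n * of_nat (num_divisors n) * saddle_main F G t (real n) = divisor_exp_term n t * saddle_wt F G t (real n)"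
    unfolding saddle_main_eq[OF assms n] divisor_exp_term_def by (simp only: mult_ac)
qed

lemma summation_by_parts:
  fixes a b :: "nat \<Rightarrow> complex"
  assumes "m \<le> l"
  shows "(\<Sum>n\<in>{m..l}. a n * b n) = (\<Sum>n\<in>{m..l}. a n) * b l + (\<Sum>k\<in>{m..<l}. (\<Sum>n\<in>{m..k}. a n) * (b k - b (Suc k)))"
  using assms
proof (induction l rule: dec_induct)
  case base
  show ?case by simp
next
  case (step l)
  then show ?case by (simp add: algebra_simps)
qed

text \<open>Partial summation with the boundary term counted as one more partial sum, of weight 1;
  thus all terms form a single family to which \<open>weighted_power_mean\<close> applies.\<close>

lemma norm_weighted_sum_le:
  fixes a b :: "nat \<Rightarrow> complex"
  assumes "m \<le> l" "norm (b l) \<le> B" "\<And>k. m \<le> k \<Longrightarrow> k < l \<Longrightarrow> norm (b k - b (Suc k)) \<le> B * c k"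
  shows "norm (\<Sum>n\<in>{m..l}. a n * b n) \<le> B * (\<Sum>k\<in>{m..l}. (if k = l then 1 else c k) * norm (\<Sum>n\<in>{m..k}. a n))"
proof -
  have "norm (\<Sum>n\<in>{m..l}. a n * b n) \<le> norm (\<Sum>n\<in>{m..l}. a n) * B + (\<Sum>k\<in>{m..<l}. norm (\<Sum>n\<in>{m..k}. a n) * (B * c k))"
    unfolding summation_by_parts[OF assms(1)]
    by (rule norm_triangle_le, rule add_mono) (auto simp: norm_mult intro!: sum_norm_le mult_left_mono assms)
  also have "\<dots> = B * (\<Sum>k\<in>insert l {m..<l}. (if k = l then 1 else c k) * norm (\<Sum>n\<in>{m..k}. a n))"
    by (subst sum.insert) (auto simp: sum_distrib_left algebra_simps intro!: sum.cong)
  also have "insert l {m..<l} = {m..l}" using assms(1) by auto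
  finally show ?thesis .
qed

lemma sum_dyadic:
  fixes f :: "nat \<Rightarrow> 'a::comm_monoid_add"
  assumes "2 ^ J \<le> Y" "Y < 2 ^ Suc J"
  shows "(\<Sum>n\<in>{1..Y}. f n) = (\<Sum>i\<le>J. \<Sum>n\<in>{2 ^ i..min (2 ^ Suc i - 1) Y}. f n)"
  using assms
proof (induction J arbitrary: Y)
  case 0
  then have "Y = 1" by simp
  then show ?case by simp
next
  case (Suc J)
  have 1: "(2::nat) ^ J \<le> 2 ^ Suc J - 1" "(2::nat) ^ Suc J - 1 < 2 ^ Suc J" by (auto simp: Suc_leI)
  have pos: "(0::nat) < 2 ^ Suc J" by simp
  have "{1..Y} = {1..2 ^ Suc J - 1} \<union> {2 ^ Suc J..min (2 ^ Suc (Suc J) - 1) Y}"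
    using Suc.prems pos by auto
  then have "(\<Sum>n\<in>{1..Y}. f n) = (\<Sum>n\<in>{1..2 ^ Suc J - 1}. f n) + (\<Sum>n\<in>{2 ^ Suc J..min (2 ^ Suc (Suc J) - 1) Y}. f n)"
    using pos by (simp only:) (rule sum.union_disjoint, auto)
  also have "(\<Sum>n\<in>{1..2 ^ Suc J - 1}. f n) = (\<Sum>i\<le>J. \<Sum>n\<in>{2 ^ i..min (2 ^ Suc i - 1) (2 ^ Suc J - 1)}. f n)"
    using 1 by (rule Suc.IH)
  also have "\<dots> = (\<Sum>i\<le>J. \<Sum>n\<in>{2 ^ i..min (2 ^ Suc i - 1) Y}. f n)"
  proof (intro sum.cong refl)
    fix i assume "i \<in> {..J}"
    then have "(2::nat) ^ Suc i \<le> 2 ^ Suc J" by (intro power_increasing) auto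
    moreover from this have "2 ^ Suc i - 1 \<le> Y" using Suc.prems by linarith
    ultimately show "{2 ^ i..min (2 ^ Suc i - 1) (2 ^ Suc J - 1)} = {2 ^ i..min (2 ^ Suc i - 1) Y}"
      by (simp add: diff_le_mono)
  qed
  finally show ?case by simp
qed

text \<open>Jensen's inequality for \<open>x ^ Suc k\<close> with the weights divided by their sum,
  which may then be replaced by any upper bound \<open>W\<close>.\<close>

lemma weighted_power_mean:
  fixes c x :: "'a \<Rightarrow> real"
  assumes "finite P" "\<And>p. p \<in> P \<Longrightarrow> 0 \<le> c p" "\<And>p. p \<in> P \<Longrightarrow> 0 \<le> x p" "sum c P \<le> W"
  shows "(\<Sum>p\<in>P. c p * x p) ^ Suc k \<le> W ^ k * (\<Sum>p\<in>P. c p * x p ^ Suc k)"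
proof (cases "sum c P = 0")
  case True
  then have "\<And>p. p \<in> P \<Longrightarrow> c p = 0" using assms by (simp add: sum_nonneg_eq_0_iff)
  then show ?thesis by simp
next
  case False
  define C where "C = sum c P"
  have C: "C > 0" using False assms sum_nonneg[of P c] by (simp add: C_def less_le)
  have "P \<noteq> {}" using False by auto
  have conv: "convex_on {0::real..} (\<lambda>x. x ^ Suc k)"
  proof (cases "even (Suc k)")
    case True
    then show ?thesis by (rule convex_on_subset[OF convex_power_even]) (auto simp: convex_real_interval)
  qed (rule convex_power_odd)
  have "(\<Sum>p\<in>P. (c p / C) *\<^sub>R x p) ^ Suc k \<le> (\<Sum>p\<in>P. (c p / C) * x p ^ Suc k)"
    by (rule convex_on_sum[OF assms(1) \<open>P \<noteq> {}\<close> conv])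
      (use C assms in \<open>auto simp: sum_divide_distrib[symmetric] C_def\<close>)
  moreover have "(\<Sum>p\<in>P. (c p / C) *\<^sub>R x p) = (\<Sum>p\<in>P. c p * x p) / C" by (simp add: sum_divide_distrib)
  moreover have "(\<Sum>p\<in>P. (c p / C) * x p ^ Suc k) = (\<Sum>p\<in>P. c p * x p ^ Suc k) / C" by (simp add: sum_divide_distrib)
  ultimately have "((\<Sum>p\<in>P. c p * x p) / C) ^ Suc k \<le> (\<Sum>p\<in>P. c p * x p ^ Suc k) / C" by simp
  then have "(\<Sum>p\<in>P. c p * x p) ^ Suc k \<le> C ^ k * (\<Sum>p\<in>P. c p * x p ^ Suc k)"
    using C by (simp add: power_divide field_simps)
  also have "\<dots> \<le> W ^ k * (\<Sum>p\<in>P. c p * x p ^ Suc k)"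
    using assms C by (intro mult_right_mono power_mono sum_nonneg) (auto simp: C_def)
  finally show ?thesis .
qed

lemma max_moment_nonneg: "max_moment M T \<phi> X \<ge> 0"
  unfolding max_moment_def using finite_moments[of M T \<phi> X] by (intro Max_ge) auto

lemma continuous_on_divisor_exp_sum: "continuous_on {0<..} (divisor_exp_sum K K')"
proof -
  have "continuous_on {0<..} (\<lambda>t. (- 1) ^ k * of_nat (num_divisors k) * of_real (real k powr (- 1 / 4)) *
        exp (2 * \<i> * of_real (sqrt (2 * pi * real k * t)) +
             of_real (sqrt (2 * pi ^ 3) / 6) * \<i> * of_real (real k powr (3 / 2) * t powr (- 1 / 2))))" for k
    by (intro continuous_intros) auto
  then show ?thesis unfolding divisor_exp_sum_def[abs_def] by (intro continuous_on_sum)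
qed

lemma moment_le_max_moment:
  assumes sw: "smooth_weight A T \<phi>" and T: "T > 0" and K: "1 \<le> K" "K \<le> X" "K \<le> K'" "K' \<le> 2 * K"
  shows "integral {T..2 * T} (\<lambda>t. norm (divisor_exp_sum K K' t) ^ (2 * M)) \<le> max_moment M T \<phi> X"
proof -
  have cont: "continuous_on {T / 2..5 * T / 2} (\<lambda>t. norm (divisor_exp_sum K K' t) ^ (2 * M))"
    by (intro continuous_intros continuous_on_subset[OF continuous_on_divisor_exp_sum]) (use T in auto)
  have "\<phi> field_differentiable at t" for t
    using sw[unfolded smooth_weight_def, THEN conjunct1, rule_format, of 0 t] by simp
  then have "continuous_on UNIV \<phi>"
    by (intro continuous_at_imp_continuous_on ballI field_differentiable_imp_continuous_at)
  then have cont2: "continuous_on {T / 2..5 * T / 2} (\<lambda>t. \<phi> t * norm (divisor_exp_sum K K' t) ^ (2 * M))"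
    by (intro continuous_on_mult cont) (auto intro: continuous_on_subset)
  have "integral {T..2 * T} (\<lambda>t. norm (divisor_exp_sum K K' t) ^ (2 * M)) =
    integral {T..2 * T} (\<lambda>t. \<phi> t * norm (divisor_exp_sum K K' t) ^ (2 * M))"
    using sw by (intro Henstock_Kurzweil_Integration.integral_cong) (simp add: smooth_weight_def)
  also have "\<dots> \<le> weighted_moment M T \<phi> K K'"
    unfolding weighted_moment_def
  proof (rule integral_subset_le)
    show "(\<lambda>t. \<phi> t * norm (divisor_exp_sum K K' t) ^ (2 * M)) integrable_on {T..2 * T}"
      by (rule integrable_continuous_real[OF continuous_on_subset[OF cont2]]) (use T in auto)
    show "(\<lambda>t. \<phi> t * norm (divisor_exp_sum K K' t) ^ (2 * M)) integrable_on {T / 2..5 * T / 2}"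
      by (rule integrable_continuous_real[OF cont2])
  qed (use T sw in \<open>auto simp: smooth_weight_def\<close>)
  also have "\<dots> \<le> max_moment M T \<phi> X"
    unfolding max_moment_def using finite_moments[of M T \<phi> X] K by (intro Max_ge) auto
  finally show ?thesis .
qed

text \<open>Partial summation on each dyadic block bounds \<open>divisor_main\<close> by a weighted
  sum of the partial sums \<open>divisor_exp_sum (2 ^ i) k\<close>, all admissible in
  \<open>max_moment\<close>; \<open>weighted_power_mean\<close> carries this over to the
  \<open>2 * M\<close>-th powers. The resulting continuous majorant \<open>H\<close> is what
  \<open>covering_integral\<close> integrates. The factor \<open>T powr (- M / 2)\<close> is the
  \<open>2 * M\<close>-th power of the size \<open>T powr (- 1 / 4)\<close> of the
  coefficients.\<close>

lemma divisor_main_moment: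
  fixes F :: complex and T G X :: real
  assumes M: "M \<ge> 1" and T: "T \<ge> 100" and G: "G \<ge> 1" "T \<le> G ^ 5" and sw: "smooth_weight A T \<phi>"
    and X: "2 * T / G\<^sup>2 \<le> X" and Y: "Y = nat \<lfloor>2 * T / G\<^sup>2\<rfloor>"
  obtains H where "continuous_on {T..2 * T} H" "\<And>t. t \<in> {T..2 * T} \<Longrightarrow> norm (divisor_main F G Y t) ^ (2 * M) \<le> H t"
    "integral {T..2 * T} H \<le> (norm F * (26 * (1 + 2 * ln T))) ^ (2 * M) * T powr (- (real M / 2)) * max_moment M T \<phi> X"
proof (cases "Y = 0")
  case True
  show ?thesis
  proof (rule that[of "\<lambda>_. 0"])
    show "norm (divisor_main F G Y t) ^ (2 * M) \<le> 0" for t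
      using M by (simp add: True divisor_main_def power_0_left)
    have "0 \<le> ln T" using T by simp
    then show "integral {T..2 * T} (\<lambda>_. 0) \<le> (norm F * (26 * (1 + 2 * ln T))) ^ (2 * M) * T powr (- (real M / 2)) * max_moment M T \<phi> X"
      using max_moment_nonneg by (simp add: zero_le_mult_iff)
  qed simp
next
  case False
  have Yle: "real Y \<le> 2 * T / G\<^sup>2" using T G by (simp add: Y)
  obtain J where J: "2 ^ J \<le> Y" "Y < 2 ^ Suc J"
    using ex_power_ivl1[of 2 Y] False by auto
  define L where "L i = min (2 ^ Suc i - 1) Y" for i
  have L: "2 ^ i \<le> L i" "L i < 2 ^ Suc i" "L i \<le> Y" if "i \<le> J" for i
  proof -
    have "(2::nat) ^ i \<le> 2 ^ J" using that by (intro power_increasing) auto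
    moreover have "(2::nat) ^ i \<le> 2 ^ Suc i - 1" by (simp add: Suc_leI)
    ultimately show "2 ^ i \<le> L i" using order_trans[OF _ J(1)] unfolding L_def by (intro min.boundedI)
    have "(2::nat) ^ Suc i - 1 < 2 ^ Suc i" by simp
    then show "L i < 2 ^ Suc i" unfolding L_def by (rule le_less_trans[OF min.cobounded1])
  qed (simp add: L_def)
  define P where "P = (SIGMA i:{..J}. {2 ^ i..L i})"
  define c where "c = (\<lambda>(i, k). if k = L i then 1 else 25 / real k)"
  define E where "E = (\<lambda>(i, k::nat). divisor_exp_sum (2 ^ i) (real k))"
  \<comment> \<open>The weights of one block sum to at most 26: 1 for the last index and at most
    \<open>25 / 2 ^ i\<close> for each of fewer than \<open>2 ^ i\<close> others. There are at most
    \<open>1 + 2 * ln T\<close> blocks.\<close>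
  define W where "W = 26 * (1 + 2 * ln T)"
  define B where "B = norm F * T powr (- 1 / 4)"
  have finP: "finite P" by (simp add: P_def)
  have c0: "c p \<ge> 0" for p by (auto simp: c_def split: prod.split)
  have "sum c P = (\<Sum>i\<le>J. \<Sum>k\<in>{2 ^ i..L i}. c (i, k))"
    unfolding P_def by (subst sum.Sigma) auto
  also have "\<dots> \<le> (\<Sum>i\<le>J. 26)"
  proof (intro sum_mono)
    fix i assume i: "i \<in> {..J}"
    have "(\<Sum>k\<in>{2 ^ i..L i}. c (i, k)) = c (i, L i) + (\<Sum>k\<in>{2 ^ i..<L i}. c (i, k))"
      using L(1)[of i] i by (simp add: sum.last_plus)
    also have "\<dots> \<le> 1 + (\<Sum>k\<in>{2 ^ i..<L i}. 25 / 2 ^ i)"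
    proof (intro add_mono sum_mono)
      fix k assume k: "k \<in> {2 ^ i..<L i}"
      then have "real (2 ^ i) \<le> real k" by (simp only: of_nat_le_iff atLeastLessThan_iff)
      then have "25 / real k \<le> 25 / real (2 ^ i)" by (intro frac_le) simp_all
      moreover have "c (i, k) = 25 / real k" using k by (simp add: c_def)
      ultimately show "c (i, k) \<le> 25 / 2 ^ i" by simp
    qed (simp add: c_def)
    also have "\<dots> = 1 + 25 * (real (L i - 2 ^ i) / 2 ^ i)" by simp
    also have "\<dots> \<le> 1 + 25 * 1"
    proof -
      have "L i - 2 ^ i \<le> 2 ^ i" using L(2)[of i] i by simp
      then have "real (L i - 2 ^ i) \<le> 2 ^ i" by (metis of_nat_le_iff of_nat_numeral of_nat_power)
      then have "real (L i - 2 ^ i) / 2 ^ i \<le> 1" by simp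
      then show ?thesis by (intro add_left_mono mult_left_mono) auto
    qed
    finally show "(\<Sum>k\<in>{2 ^ i..L i}. c (i, k)) \<le> 26" by simp
  qed
  also have "\<dots> = 26 * (1 + real J)" by simp
  also have "\<dots> \<le> W"
  proof -
    have "(2::real) ^ J \<le> real Y" using J(1) by (metis of_nat_le_iff of_nat_numeral of_nat_power)
    also have "\<dots> \<le> 2 * T / G\<^sup>2" by (rule Yle)
    also have "\<dots> \<le> T"
    proof -
      have "2 \<le> G" by (rule ge_2_of_le_power5[OF T G])
      then have "4 \<le> G\<^sup>2" using power_mono[of 2 G 2] by simp
      then have "2 * T / G\<^sup>2 \<le> 2 * T / 4" using T by (intro divide_left_mono) auto
      then show ?thesis using T by simp
    qed
    finally have "ln ((2::real) ^ J) \<le> ln T" using T by (subst ln_le_cancel_iff) auto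
    then have "real J * ln 2 \<le> ln T" by (simp add: ln_realpow)
    moreover have "real J * (1 / 2) \<le> real J * ln 2" using ln2_ge_two_thirds by (intro mult_left_mono) auto
    ultimately show ?thesis by (simp add: W_def)
  qed
  finally have cW: "sum c P \<le> W" .
  have W0: "W \<ge> 0" using cW sum_nonneg[of P c] c0 by (meson order_trans)
  have B0: "B \<ge> 0" by (simp add: B_def)
  define H where "H t = B ^ (2 * M) * (W ^ (2 * M - 1) * (\<Sum>p\<in>P. c p * norm (E p t) ^ (2 * M)))" for t
  have sM: "Suc (2 * M - 1) = 2 * M" using M by simp
  have contE: "continuous_on {T..2 * T} (\<lambda>t. norm (E p t) ^ (2 * M))" for p
    unfolding E_def case_prod_beta
    by (intro continuous_intros continuous_on_subset[OF continuous_on_divisor_exp_sum]) (use T in auto)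
  show ?thesis
  proof (rule that[of H])
    show "continuous_on {T..2 * T} H"
      unfolding H_def[abs_def] by (intro continuous_on_mult continuous_on_sum continuous_on_const contE)
  next
    fix t assume "t \<in> {T..2 * T}"
    then have t: "T \<le> t" "t \<le> 2 * T" by auto
    then have t0: "t > 0" using T by simp
    note wt = saddle_wt_le[OF T G t] saddle_wt_diff_le[OF T G t]
    have "norm (divisor_main F G Y t) \<le> (\<Sum>i\<le>J. norm (\<Sum>n\<in>{2 ^ i..L i}. divisor_exp_term n t * saddle_wt F G t (real n)))"
      unfolding divisor_main_eq[OF t0] sum_dyadic[OF J] L_def by (rule norm_sum)
    also have "\<dots> \<le> (\<Sum>i\<le>J. B * (\<Sum>k\<in>{2 ^ i..L i}. c (i, k) * norm (E (i, k) t)))"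
    proof (intro sum_mono)
      fix i assume i: "i \<in> {..J}"
      have pos: "(0::nat) < 2 ^ i" by simp
      have "norm (\<Sum>n\<in>{2 ^ i..L i}. divisor_exp_term n t * saddle_wt F G t (real n)) \<le>
        B * (\<Sum>k\<in>{2 ^ i..L i}. (if k = L i then 1 else 25 / real k) * norm (\<Sum>n\<in>{2 ^ i..k}. divisor_exp_term n t))"
      proof (rule norm_weighted_sum_le)
        show "2 ^ i \<le> L i" using L i by simp
        then have "0 < L i" using pos by linarith
        then show "norm (saddle_wt F G t (real (L i))) \<le> B" unfolding B_def by (intro wt) simp
        fix k assume k: "2 ^ i \<le> k" "k < L i"
        have k1: "1 \<le> k" using k pos by linarith
        have "Suc k \<le> Y" using k L(3)[of i] i by simp
        then have "real (Suc k) \<le> real Y" by (simp only: of_nat_le_iff)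
        then have "real k + 1 \<le> 2 * T / G\<^sup>2" using Yle by simp
        then show "norm (saddle_wt F G t (real k) - saddle_wt F G t (real (Suc k))) \<le> B * (25 / real k)"
          using wt(2)[of "real k" F] k1 by (simp add: B_def add.commute)
      qed
      also have "\<dots> = B * (\<Sum>k\<in>{2 ^ i..L i}. c (i, k) * norm (E (i, k) t))"
        using divisor_exp_sum_nat[of "2 ^ i"] by (simp add: c_def E_def)
      finally show "norm (\<Sum>n\<in>{2 ^ i..L i}. divisor_exp_term n t * saddle_wt F G t (real n)) \<le> B * (\<Sum>k\<in>{2 ^ i..L i}. c (i, k) * norm (E (i, k) t))" .
    qed
    also have "\<dots> = B * (\<Sum>p\<in>P. c p * norm (E p t))"
      unfolding P_def sum_distrib_left[symmetric] by (subst sum.Sigma) (auto simp: case_prod_beta)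
    finally have "norm (divisor_main F G Y t) ^ (2 * M) \<le> (B * (\<Sum>p\<in>P. c p * norm (E p t))) ^ (2 * M)"
      by (intro power_mono) auto
    also have "\<dots> = B ^ (2 * M) * (\<Sum>p\<in>P. c p * norm (E p t)) ^ Suc (2 * M - 1)"
      unfolding sM by (rule power_mult_distrib)
    also have "\<dots> \<le> B ^ (2 * M) * (W ^ (2 * M - 1) * (\<Sum>p\<in>P. c p * norm (E p t) ^ Suc (2 * M - 1)))"
      using B0 c0 cW finP by (intro mult_left_mono weighted_power_mean) auto
    finally show "norm (divisor_main F G Y t) ^ (2 * M) \<le> H t" unfolding H_def sM .
  next
    have "integral {T..2 * T} H = B ^ (2 * M) * (W ^ (2 * M - 1) * (\<Sum>p\<in>P. c p * integral {T..2 * T} (\<lambda>t. norm (E p t) ^ (2 * M))))"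
      unfolding H_def integral_mult_right
      by (subst Henstock_Kurzweil_Integration.integral_sum) (auto simp: finP intro!: integrable_continuous_real continuous_on_mult contE)
    also have "\<dots> \<le> B ^ (2 * M) * (W ^ (2 * M - 1) * (\<Sum>p\<in>P. c p * max_moment M T \<phi> X))"
    proof (intro mult_left_mono sum_mono)
      fix p assume p: "p \<in> P"
      obtain i k where ik: "p = (i, k)" "i \<le> J" "2 ^ i \<le> k" "k \<le> L i"
        using p by (cases p) (auto simp: P_def)
      have "k \<le> 2 * 2 ^ i" using ik L(2)[of i] by simp
      then have k2: "real k \<le> 2 * 2 ^ i" using of_nat_le_iff[of k "2 * 2 ^ i", where ?'a = real] by simp
      have "real (2 ^ i) \<le> real k" using ik(3) by (simp only: of_nat_le_iff)
      then have k1: "2 ^ i \<le> real k" by simp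
      have "real k \<le> real Y" using ik L(3)[of i] by simp
      then show "integral {T..2 * T} (\<lambda>t. norm (E p t) ^ (2 * M)) \<le> max_moment M T \<phi> X"
        unfolding ik(1) E_def prod.case using k1 k2 T order_trans[OF order_trans[OF k1] order_trans[OF Yle X]]
        by (intro moment_le_max_moment[OF sw]) auto
    qed (use B0 W0 c0 in auto)
    also have "\<dots> = B ^ (2 * M) * (W ^ (2 * M - 1) * (sum c P * max_moment M T \<phi> X))"
      by (simp add: sum_distrib_right)
    also have "\<dots> \<le> B ^ (2 * M) * (W ^ (2 * M - 1) * (W * max_moment M T \<phi> X))"
      using B0 W0 cW max_moment_nonneg by (intro mult_left_mono mult_right_mono) auto
    also have "\<dots> = B ^ (2 * M) * (W ^ Suc (2 * M - 1) * max_moment M T \<phi> X)" by simp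
    also have "B ^ (2 * M) = norm F ^ (2 * M) * T powr (- (real M / 2))"
      using T by (simp add: B_def power_mult_distrib powr_power)
    finally show "integral {T..2 * T} H \<le> (norm F * (26 * (1 + 2 * ln T))) ^ (2 * M) * T powr (- (real M / 2)) * max_moment M T \<phi> X"
      unfolding sM W_def[symmetric] by (simp add: power_mult_distrib mult_ac)
  qed
qed

section \<open>Mean squares of Dirichlet polynomials over clusters\<close>

lemma integrable_cauchy: "integrable lborel (\<lambda>v::real. 1 / (1 + v\<^sup>2))"
proof -
  have pos: "1 + v\<^sup>2 > 0" for v :: real by (simp add: add_pos_nonneg)
  have "(\<integral>\<^sup>+x. ennreal (1 / (1 + x\<^sup>2)) * indicator {0..} x \<partial>lborel) = ennreal (pi / 2 - arctan 0)"
  proof (rule nn_integral_FTC_atLeast[where F = arctan])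
    show "(arctan has_real_derivative 1 / (1 + x\<^sup>2)) (at x)" for x
      using DERIV_arctan[of x] by (simp add: divide_inverse)
    show "(arctan \<longlongrightarrow> pi / 2) at_top" by (rule tendsto_arctan_at_top)
  qed (use pos in \<open>auto simp: less_imp_le\<close>)
  moreover have "ennreal (1 / (1 + x\<^sup>2)) * indicator {0..} x = ennreal (1 / (1 + x\<^sup>2) * indicator {0..} x)" for x :: real
    by (simp split: split_indicator)
  ultimately have 1: "integrable lborel (\<lambda>x. 1 / (1 + x\<^sup>2) * indicator {0..} x :: real)"
    using pos by (intro integrableI_nonneg) (auto simp: less_imp_le simp del: times_divide_eq_left)
  then have 2: "integrable lborel (\<lambda>x. 1 / (1 + x\<^sup>2) * indicator {0..} (- x) :: real)"
    using lborel_integrable_real_affine[OF 1, of "-1" 0] by simp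
  show ?thesis
    by (rule Bochner_Integration.integrable_bound[OF Bochner_Integration.integrable_add[OF 1 2]])
      (use pos in \<open>auto simp: indicator_def less_imp_le intro!: AE_I2\<close>)
qed

text \<open>The Fejer kernel of the real line up to a constant factor; its Fourier transform is a
  multiple of the triangle \<open>max 0 (c - \<bar>\<xi>\<bar>)\<close>. At \<open>v = 0\<close>
  division by zero gives 0 instead of the limit \<open>c\<^sup>2 / 2\<close>, which is invisible to
  integrals.\<close>

definition sqk :: "real \<Rightarrow> real \<Rightarrow> real" where
  "sqk c v = (1 - cos (c * v)) / v\<^sup>2"

lemma one_minus_cos_le: "1 - cos x \<le> x\<^sup>2 / (2::real)"
proof -
  have "\<bar>sin (x / 2)\<bar> \<le> \<bar>x / 2\<bar>" by (rule abs_sin_x_le_abs_x)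
  then have "(sin (x / 2))\<^sup>2 \<le> (x / 2)\<^sup>2" by (simp only: abs_le_square_iff)
  moreover have "cos x = 1 - 2 * (sin (x / 2))\<^sup>2" using cos_double_sin[of "x / 2"] by simp
  ultimately show ?thesis by (simp add: power_divide)
qed

lemma sqk_nonneg: "sqk c v \<ge> 0"
  by (simp add: sqk_def)

lemma sqk_le: "sqk c v \<le> (c\<^sup>2 / 2 + 2) * (1 / (1 + v\<^sup>2))"
proof -
  have p: "1 + v\<^sup>2 > 0" by (simp add: add_pos_nonneg)
  have "sqk c v * (1 + v\<^sup>2) \<le> c\<^sup>2 / 2 + 2"
  proof (cases "v = 0")
    case False
    have a: "sqk c v \<le> c\<^sup>2 / 2"
      using one_minus_cos_le[of "c * v"] False by (simp add: sqk_def power_mult_distrib divide_le_eq)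
    have "sqk c v * v\<^sup>2 = 1 - cos (c * v)" using False by (simp add: sqk_def)
    also have "\<dots> \<le> 2" using cos_ge_minus_one[of "c * v"] by linarith
    finally show ?thesis using a by (simp add: distrib_left)
  qed (simp add: sqk_def)
  then show ?thesis using p by (simp add: field_simps)
qed

lemma sqk_measurable [measurable]: "sqk c \<in> borel_measurable borel"
  unfolding sqk_def by measurable

lemma integrable_times_sqk:
  fixes f :: "real \<Rightarrow> real"
  assumes [measurable]: "f \<in> borel_measurable borel" and "\<And>v. \<bar>f v\<bar> \<le> B"
  shows "integrable lborel (\<lambda>v. f v * sqk c v)"
proof (rule Bochner_Integration.integrable_bound)
  show "integrable lborel (\<lambda>v::real. B * (c\<^sup>2 / 2 + 2) * (1 / (1 + v\<^sup>2)))"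
    by (intro integrable_mult_right integrable_cauchy)
  have "B \<ge> 0" using assms(2)[of 0] by linarith
  have "\<bar>f v * sqk c v\<bar> \<le> \<bar>B * (c\<^sup>2 / 2 + 2) * (1 / (1 + v\<^sup>2))\<bar>" for v
  proof -
    have "\<bar>f v\<bar> * \<bar>sqk c v\<bar> \<le> B * ((c\<^sup>2 / 2 + 2) * (1 / (1 + v\<^sup>2)))"
      using sqk_le[of c v] sqk_nonneg[of c v] assms(2)[of v] \<open>B \<ge> 0\<close> by (intro mult_mono) auto
    then show ?thesis
      unfolding abs_mult[of "f v"] mult.assoc by (rule order_trans) (rule abs_ge_self)
  qed
  then show "AE v in lborel. norm (f v * sqk c v) \<le> norm (B * (c\<^sup>2 / 2 + 2) * (1 / (1 + v\<^sup>2)))"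
    by (intro AE_I2) (simp only: real_norm_def)
qed simp

lemma integrable_sqk: "integrable lborel (sqk c)"
  using integrable_times_sqk[of "\<lambda>_. 1" 1 c] by simp

text \<open>The number \<open>pi\<close>, kept symbolic and accessed through
  \<open>fejer_const_pos\<close>.\<close>

definition fejer_const :: real where "fejer_const = (LBINT v. sqk 1 v)"

lemma integral_sqk: "(LBINT v. sqk c v) = fejer_const * \<bar>c\<bar>"
proof (cases "c = 0")
  case False
  have "fejer_const = \<bar>c\<bar> * (LBINT v. sqk 1 (c * v))"
    unfolding fejer_const_def using lborel_integral_real_affine[OF False, of "sqk 1" 0] by simp
  also have "(\<lambda>v. sqk 1 (c * v)) = (\<lambda>v. sqk c v / c\<^sup>2)"
    by (auto simp: sqk_def power_mult_distrib)
  finally have "fejer_const = \<bar>c\<bar> * ((LBINT v. sqk c v) / (\<bar>c\<bar> * \<bar>c\<bar>))"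
    by (simp add: power2_eq_square)
  moreover have "a > 0 \<Longrightarrow> f = a * (x / (a * a)) \<Longrightarrow> x = f * a" for a f x :: real by simp
  ultimately show ?thesis using False by (metis zero_less_abs_iff)
qed (simp add: sqk_def)

lemma fejer_const_pos: "fejer_const > 0"
proof -
  define d where "d = (1 - cos 1) / (4::real)"
  have "cos 1 < cos (0::real)" using pi_gt3 by (intro cos_monotone_0_pi) auto
  then have d: "d > 0" by (simp add: d_def)
  have "(LBINT v::real. d * indicator {1..2} v) \<le> (LBINT v. sqk 1 v)"
  proof (rule Bochner_Integration.integral_mono)
    show "integrable lborel (\<lambda>v::real. d * indicator {1..2} v)"
      by (intro integrable_mult_right integrable_real_indicator) (auto simp: ennreal_less_top)
    show "integrable lborel (sqk 1)" by (rule integrable_sqk)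
    fix v :: real
    show "d * indicator {1..2} v \<le> sqk 1 v"
    proof (cases "v \<in> {1..2}")
      case True
      have "cos v \<le> cos 1" using True pi_gt3 by (intro cos_monotone_0_pi_le) auto
      moreover have "v\<^sup>2 \<le> 2\<^sup>2" using True by (intro power_mono) auto
      ultimately have "(1 - cos 1) / 4 \<le> (1 - cos v) / v\<^sup>2"
        using True by (intro frac_le) auto
      then show ?thesis using True by (simp add: d_def sqk_def)
    qed (auto simp: sqk_nonneg)
  qed
  moreover have "(LBINT v::real. d * indicator {1..2} v) = d" by simp
  ultimately show ?thesis using d by (simp add: fejer_const_def)
qed

text \<open>The product \<open>cos (\<xi> * v) * (1 - cos (c * v))\<close> is a combination of three
  expressions \<open>1 - cos\<close>, each integrated by scaling in \<open>integral_sqk\<close>; the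
  absolute values combine to the triangle.\<close>

lemma integral_sqk_cos: "c \<ge> 0 \<Longrightarrow> (LBINT v. cos (\<xi> * v) * sqk c v) = fejer_const * max 0 (c - \<bar>\<xi>\<bar>)"
proof -
  assume c: "c \<ge> 0"
  have "cos (\<xi> * v) * sqk c v = sqk (c + \<xi>) v / 2 + sqk (c - \<xi>) v / 2 - sqk \<xi> v" for v
  proof -
    have "cos (\<xi> * v) * (1 - cos (c * v)) = (1 - cos ((c + \<xi>) * v)) / 2 + (1 - cos ((c - \<xi>) * v)) / 2 - (1 - cos (\<xi> * v))"
      by (simp add: distrib_right left_diff_distrib cos_add cos_diff field_simps)
    then show ?thesis
      unfolding sqk_def times_divide_eq_right by (simp add: diff_divide_distrib add_divide_distrib)
  qed
  then have "(LBINT v. cos (\<xi> * v) * sqk c v) = (LBINT v. sqk (c + \<xi>) v / 2 + sqk (c - \<xi>) v / 2 - sqk \<xi> v)"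
    by simp
  also have "\<dots> = fejer_const * \<bar>c + \<xi>\<bar> / 2 + fejer_const * \<bar>c - \<xi>\<bar> / 2 - fejer_const * \<bar>\<xi>\<bar>"
    using integrable_sqk by (simp add: integral_sqk)
  also have "\<dots> = fejer_const * (\<bar>c + \<xi>\<bar> / 2 + \<bar>c - \<xi>\<bar> / 2 - \<bar>\<xi>\<bar>)"
    by (simp add: algebra_simps)
  also have "\<bar>c + \<xi>\<bar> / 2 + \<bar>c - \<xi>\<bar> / 2 - \<bar>\<xi>\<bar> = max 0 (c - \<bar>\<xi>\<bar>)"
    using c by (auto simp: abs_if max_def field_simps)
  finally show ?thesis .
qed

lemma integral_sqk_sin: "(LBINT v. sin (\<xi> * v) * sqk c v) = 0"
proof -
  have "(LBINT v. sin (\<xi> * v) * sqk c v) = (LBINT v. sin (\<xi> * (- v)) * sqk c (- v))"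
    using lborel_integral_real_affine[of "-1" "\<lambda>v. sin (\<xi> * v) * sqk c v" 0] by simp
  also have "(\<lambda>v. sin (\<xi> * (- v)) * sqk c (- v)) = (\<lambda>v. - (sin (\<xi> * v) * sqk c v))"
    by (auto simp: sqk_def)
  finally show ?thesis by simp
qed

lemma integral_sqk_cos_shift:
  assumes "c \<ge> 0"
  shows "integrable lborel (\<lambda>v. cos (a + \<xi> * v) * sqk c v)"
    and "(LBINT v. cos (a + \<xi> * v) * sqk c v) = cos a * (fejer_const * max 0 (c - \<bar>\<xi>\<bar>))"
proof -
  have i: "integrable lborel (\<lambda>v. cos (\<xi> * v) * sqk c v)" "integrable lborel (\<lambda>v. sin (\<xi> * v) * sqk c v)"
    by (rule integrable_times_sqk[of _ 1]; simp)+
  show "integrable lborel (\<lambda>v. cos (a + \<xi> * v) * sqk c v)"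
    by (rule integrable_times_sqk[of _ 1]; simp)
  have "(LBINT v. cos (a + \<xi> * v) * sqk c v) =
     (LBINT v. cos a * (cos (\<xi> * v) * sqk c v) - sin a * (sin (\<xi> * v) * sqk c v))"
    by (simp add: cos_add algebra_simps)
  also have "\<dots> = cos a * (fejer_const * max 0 (c - \<bar>\<xi>\<bar>))"
    using i by (simp add: integral_sqk_cos[OF assms] integral_sqk_sin)
  finally show "(LBINT v. cos (a + \<xi> * v) * sqk c v) = cos a * (fejer_const * max 0 (c - \<bar>\<xi>\<bar>))" .
qed

text \<open>The first \<open>N\<close> terms of the Dirichlet series of \<open>zeta\<close> at
  \<open>1 / 2 + \<i> * u\<close>, see \<open>zeta_poly_powr\<close>.\<close>

definition zeta_poly :: "nat \<Rightarrow> real \<Rightarrow> complex" where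
  "zeta_poly N u = (\<Sum>n\<in>{1..N}. of_real (1 / sqrt (real n)) * cis (- (u * ln (real n))))"

lemma continuous_on_zeta_poly: "continuous_on A (zeta_poly N)"
  unfolding zeta_poly_def by (intro continuous_intros)

lemma zeta_poly_measurable [measurable]: "zeta_poly N \<in> borel_measurable borel"
  by (intro borel_measurable_continuous_onI continuous_on_zeta_poly)

lemma norm_zeta_poly_le: "norm (zeta_poly N u) \<le> real N"
proof -
  have "norm (zeta_poly N u) \<le> (\<Sum>n\<in>{1..N}. 1)"
    unfolding zeta_poly_def
  proof (intro order_trans[OF norm_sum] sum_mono)
    fix n assume n: "n \<in> {1..N}"
    then have "1 / sqrt (real n) \<le> 1" by simp
    then show "norm (of_real (1 / sqrt (real n)) * cis (- (u * ln (real n)))) \<le> 1"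
      unfolding norm_mult norm_of_real by simp
  qed
  then show ?thesis by simp
qed

lemma norm_zeta_poly_square:
  "(norm (zeta_poly N u))\<^sup>2 = (\<Sum>m\<in>{1..N}. \<Sum>n\<in>{1..N}. 1 / sqrt (real m * real n) * cos (u * ln (real n / real m)))"
proof -
  have "(norm (zeta_poly N u))\<^sup>2 = Re (zeta_poly N u * cnj (zeta_poly N u))"
    by (simp add: complex_norm_square[symmetric])
  also have "\<dots> = (\<Sum>m\<in>{1..N}. \<Sum>n\<in>{1..N}. Re (of_real (1 / sqrt (real m)) * cis (- (u * ln (real m))) *
      cnj (of_real (1 / sqrt (real n)) * cis (- (u * ln (real n))))))"
    by (simp only: zeta_poly_def cnj_sum sum_product Re_sum)
  also have "\<dots> = (\<Sum>m\<in>{1..N}. \<Sum>n\<in>{1..N}. 1 / sqrt (real m * real n) * cos (u * ln (real n / real m)))"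
  proof (rule sum.cong[OF refl], rule sum.cong[OF refl])
    fix m n assume "m \<in> {1..N}" "n \<in> {1..N}"
    then have "u * ln (real n / real m) = u * ln (real n) - u * ln (real m)"
      by (simp add: ln_div right_diff_distrib)
    then show "Re (of_real (1 / sqrt (real m)) * cis (- (u * ln (real m))) * cnj (of_real (1 / sqrt (real n)) * cis (- (u * ln (real n))))) =
      1 / sqrt (real m * real n) * cos (u * ln (real n / real m))"
      by (simp only: cos_diff) (simp add: real_sqrt_mult algebra_simps add_divide_distrib)
  qed
  finally show ?thesis .
qed

text \<open>Expanding the square, each pair \<open>(m, n)\<close> oscillates with frequency
  \<open>ln (n / m)\<close>, and the kernel multiplies it by the triangle weight of
  \<open>pform\<close>. In particular \<open>pform\<close> is a mean square and hence
  nonnegative.\<close>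

lemma zeta_poly_sqk:
  assumes "G > 0"
  shows "integrable lborel (\<lambda>v. (norm (zeta_poly N (t + v)))\<^sup>2 * sqk (1 / G) v)"
    and "(LBINT v. (norm (zeta_poly N (t + v)))\<^sup>2 * sqk (1 / G) v) = fejer_const / G * pform N G t"
proof -
  let ?x = "\<lambda>m n. ln (real n / real m)"
  have eq: "(norm (zeta_poly N (t + v)))\<^sup>2 * sqk (1 / G) v =
    (\<Sum>m\<in>{1..N}. \<Sum>n\<in>{1..N}. 1 / sqrt (real m * real n) * (cos (t * ?x m n + ?x m n * v) * sqk (1 / G) v))" for v
    unfolding norm_zeta_poly_square sum_distrib_right
    by (rule sum.cong[OF refl], rule sum.cong[OF refl]) (simp add: distrib_right mult.commute[of v])
  have "has_bochner_integral lborel (\<lambda>v. (norm (zeta_poly N (t + v)))\<^sup>2 * sqk (1 / G) v)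
    (\<Sum>m\<in>{1..N}. \<Sum>n\<in>{1..N}. 1 / sqrt (real m * real n) * (cos (t * ?x m n) * (fejer_const * max 0 (1 / G - \<bar>?x m n\<bar>))))"
    unfolding eq
  proof (intro has_bochner_integral_sum has_bochner_integral_mult_right)
    show "has_bochner_integral lborel (\<lambda>v. cos (t * ?x m n + ?x m n * v) * sqk (1 / G) v)
        (cos (t * ?x m n) * (fejer_const * max 0 (1 / G - \<bar>?x m n\<bar>)))" for m n
      using assms integral_sqk_cos_shift[of "1 / G" "t * ?x m n" "?x m n"] by (simp add: has_bochner_integral_iff)
  qed
  moreover have "(\<Sum>m\<in>{1..N}. \<Sum>n\<in>{1..N}. 1 / sqrt (real m * real n) * (cos (t * ?x m n) * (fejer_const * max 0 (1 / G - \<bar>?x m n\<bar>))))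
      = fejer_const / G * pform N G t"
    unfolding pform_def sum_distrib_left
  proof (rule sum.cong[OF refl], rule sum.cong[OF refl])
    fix m n
    have "max 0 (1 / G - \<bar>?x m n\<bar>) = max 0 (1 - G * \<bar>?x m n\<bar>) / G"
      using assms by (auto simp: max_def field_simps)
    then show "1 / sqrt (real m * real n) * (cos (t * ?x m n) * (fejer_const * max 0 (1 / G - \<bar>?x m n\<bar>))) =
      fejer_const / G * (1 / sqrt (real m * real n) * cos (t * ?x m n) * max 0 (1 - G * \<bar>?x m n\<bar>))"
      by (simp add: mult_ac)
  qed
  ultimately show "integrable lborel (\<lambda>v. (norm (zeta_poly N (t + v)))\<^sup>2 * sqk (1 / G) v)"
    "(LBINT v. (norm (zeta_poly N (t + v)))\<^sup>2 * sqk (1 / G) v) = fejer_const / G * pform N G t"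
    by (simp_all add: has_bochner_integral_iff)
qed

text \<open>A Dirichlet polynomial with frequencies in \<open>{0..\<Lambda>}\<close> is reproduced
  by a kernel of size \<open>O(\<Lambda>)\<close> times \<open>1 / (1 + v\<^sup>2)\<close>;
  Cauchy-Schwarz then bounds a single value by a mean square over a unit scale, at the cost of a
  squared logarithm.\<close>

lemma zeta_poly_pointwise:
  assumes \<Lambda>: "\<Lambda> \<ge> 1" "ln (real N) \<le> \<Lambda>"
  shows "(norm (zeta_poly N t))\<^sup>2 \<le> (7 * \<Lambda> / fejer_const)\<^sup>2 * (LBINT v. 1 / (1 + v\<^sup>2)) *
     (LBINT v. (norm (zeta_poly N (t + v)))\<^sup>2 * (1 / (1 + v\<^sup>2)))"
proof (cases "zeta_poly N t = 0")
  case False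
  define x where "x = norm (zeta_poly N t)"
  \<comment> \<open>The rotation that makes the value at \<open>t\<close> positive, so that a real
    kernel identity for the real part \<open>r\<close> is enough.\<close>
  define \<theta> where "\<theta> = - Arg (zeta_poly N t)"
  \<comment> \<open>De la Vallee Poussin's kernel: the difference of two triangles is constant on
    the frequencies up to \<open>\<Lambda>\<close>, which include every \<open>ln n\<close> with
    \<open>n \<le> N\<close>, so integration against \<open>\<kappa>\<close> reproduces
    \<open>r\<close>.\<close>
  define \<kappa> where "\<kappa> = (\<lambda>v. (sqk (2 * \<Lambda>) v - sqk \<Lambda> v) / (\<Lambda> * fejer_const))"
  define r where "r = (\<lambda>u. \<Sum>n\<in>{1..N}. 1 / sqrt (real n) * cos (- \<theta> + u * ln (real n)))"
  define w where "w = (\<lambda>v::real. 1 / (1 + v\<^sup>2))"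
  define b where "b = 7 * \<Lambda> / fejer_const"
  define c1 where "c1 = (LBINT v. w v)"
  define Q where "Q = (LBINT v. (norm (zeta_poly N (t + v)))\<^sup>2 * w v)"
  note C0 = fejer_const_pos
  have x: "x > 0" using False by (simp add: x_def)
  have r_eq: "r u = Re (cis \<theta> * zeta_poly N u)" for u
    unfolding r_def zeta_poly_def sum_distrib_left Re_sum
    by (rule sum.cong[OF refl]) (simp add: cis_mult mult.left_commute[of "cis \<theta>"] flip: of_real_divide, simp add: cos_diff cos_add)
  have r_le: "\<bar>r u\<bar> \<le> norm (zeta_poly N u)" for u
    using abs_Re_le_cmod[of "cis \<theta> * zeta_poly N u"] by (simp add: r_eq norm_mult)
  have rt: "r t = x"
  proof -
    have "zeta_poly N t = of_real x * cis (Arg (zeta_poly N t))"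
      using False by (simp add: x_def cis_Arg complex_sgn_def scaleR_conv_of_real)
    then have "cis \<theta> * zeta_poly N t = of_real x"
      by (metis \<theta>_def cis_mult cis_zero add.left_inverse mult.left_commute mult.right_neutral)
    then show ?thesis by (simp add: r_eq)
  qed
  have \<kappa>_le: "\<bar>\<kappa> v\<bar> \<le> b * w v" for v
  proof -
    have "\<bar>sqk (2 * \<Lambda>) v - sqk \<Lambda> v\<bar> \<le> sqk (2 * \<Lambda>) v + sqk \<Lambda> v"
      using sqk_nonneg[of "2 * \<Lambda>" v] sqk_nonneg[of \<Lambda> v] by linarith
    also have "\<dots> \<le> ((2 * \<Lambda>)\<^sup>2 / 2 + 2) * w v + (\<Lambda>\<^sup>2 / 2 + 2) * w v"
      unfolding w_def by (intro add_mono sqk_le)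
    also have "\<dots> = (5 / 2 * \<Lambda>\<^sup>2 + 4) * w v" by (simp add: algebra_simps power2_eq_square)
    also have "\<dots> \<le> (7 * \<Lambda>\<^sup>2) * w v"
    proof -
      have "1 \<le> \<Lambda>\<^sup>2" using \<Lambda> by (simp add: one_le_power)
      moreover have "0 \<le> w v" by (simp add: w_def add_nonneg_nonneg)
      ultimately show ?thesis by (intro mult_right_mono) auto
    qed
    finally have "\<bar>\<kappa> v\<bar> \<le> (7 * \<Lambda>\<^sup>2) * w v / (\<Lambda> * fejer_const)"
      unfolding \<kappa>_def abs_divide using C0 \<Lambda> by (simp add: divide_right_mono)
    also have "\<dots> = b * w v" using \<Lambda> by (simp add: b_def power2_eq_square)
    finally show ?thesis .
  qed
  have w0: "w v \<ge> 0" for v by (simp add: w_def add_nonneg_nonneg)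
  have iw: "integrable lborel w" unfolding w_def by (rule integrable_cauchy)
  have [measurable]: "w \<in> borel_measurable borel" unfolding w_def by measurable
  have iQ: "integrable lborel (\<lambda>v. (norm (zeta_poly N (t + v)))\<^sup>2 * w v)"
  proof (rule Bochner_Integration.integrable_bound)
    show "integrable lborel (\<lambda>v. (real N)\<^sup>2 * w v)" using iw by (intro integrable_mult_right)
    show "AE v in lborel. norm ((norm (zeta_poly N (t + v)))\<^sup>2 * w v) \<le> norm ((real N)\<^sup>2 * w v)"
      using w0 by (intro AE_I2) (auto simp: abs_mult intro!: mult_right_mono power_mono norm_zeta_poly_le)
  qed measurable
  have repr: "has_bochner_integral lborel (\<lambda>v. \<kappa> v * r (t + v)) (r t)"
  proof -
    have eq: "\<kappa> v * r (t + v) = (\<Sum>n\<in>{1..N}. 1 / sqrt (real n) * ((cos ((- \<theta> + t * ln (real n)) + ln (real n) * v) * sqk (2 * \<Lambda>) v -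
         cos ((- \<theta> + t * ln (real n)) + ln (real n) * v) * sqk \<Lambda> v) / (\<Lambda> * fejer_const)))" for v
      unfolding r_def sum_distrib_left
    proof (rule sum.cong[OF refl])
      fix n
      have "- \<theta> + (t + v) * ln (real n) = (- \<theta> + t * ln (real n)) + ln (real n) * v" by (simp add: algebra_simps)
      then show "\<kappa> v * (1 / sqrt (real n) * cos (- \<theta> + (t + v) * ln (real n))) =
        1 / sqrt (real n) * ((cos ((- \<theta> + t * ln (real n)) + ln (real n) * v) * sqk (2 * \<Lambda>) v -
         cos ((- \<theta> + t * ln (real n)) + ln (real n) * v) * sqk \<Lambda> v) / (\<Lambda> * fejer_const))"
        by (simp only: \<kappa>_def) (simp add: algebra_simps diff_divide_distrib)
    qed
    have "has_bochner_integral lborel (\<lambda>v. \<kappa> v * r (t + v))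
      (\<Sum>n\<in>{1..N}. 1 / sqrt (real n) * ((cos (- \<theta> + t * ln (real n)) * (fejer_const * max 0 (2 * \<Lambda> - \<bar>ln (real n)\<bar>)) -
         cos (- \<theta> + t * ln (real n)) * (fejer_const * max 0 (\<Lambda> - \<bar>ln (real n)\<bar>))) / (\<Lambda> * fejer_const)))"
      unfolding eq
    proof (intro has_bochner_integral_sum has_bochner_integral_mult_right has_bochner_integral_divide has_bochner_integral_diff)
      show "has_bochner_integral lborel (\<lambda>v. cos (a + \<xi> * v) * sqk (2 * \<Lambda>) v) (cos a * (fejer_const * max 0 (2 * \<Lambda> - \<bar>\<xi>\<bar>)))" for a \<xi>
        using integral_sqk_cos_shift[of "2 * \<Lambda>" a \<xi>] \<Lambda> by (simp add: has_bochner_integral_iff)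
      show "has_bochner_integral lborel (\<lambda>v. cos (a + \<xi> * v) * sqk \<Lambda> v) (cos a * (fejer_const * max 0 (\<Lambda> - \<bar>\<xi>\<bar>)))" for a \<xi>
        using integral_sqk_cos_shift[of "\<Lambda>" a \<xi>] \<Lambda> by (simp add: has_bochner_integral_iff)
    qed
    moreover have "(\<Sum>n\<in>{1..N}. 1 / sqrt (real n) * ((cos (- \<theta> + t * ln (real n)) * (fejer_const * max 0 (2 * \<Lambda> - \<bar>ln (real n)\<bar>)) -
         cos (- \<theta> + t * ln (real n)) * (fejer_const * max 0 (\<Lambda> - \<bar>ln (real n)\<bar>))) / (\<Lambda> * fejer_const))) = r t"
      unfolding r_def
    proof (rule sum.cong[OF refl])
      fix n assume n: "n \<in> {1..N}"
      then have "0 \<le> ln (real n)" "ln (real n) \<le> ln (real N)" by auto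
      then have m: "max 0 (2 * \<Lambda> - \<bar>ln (real n)\<bar>) = 2 * \<Lambda> - ln (real n)" "max 0 (\<Lambda> - \<bar>ln (real n)\<bar>) = \<Lambda> - ln (real n)"
        using \<Lambda> by auto
      have "(c * (f * (2 * \<Lambda> - l)) - c * (f * (\<Lambda> - l))) / (\<Lambda> * f) = c" if "f > 0" for c f l :: real
        using that \<Lambda> by (simp add: field_simps)
      from this[OF C0] show "1 / sqrt (real n) * ((cos (- \<theta> + t * ln (real n)) * (fejer_const * max 0 (2 * \<Lambda> - \<bar>ln (real n)\<bar>)) -
         cos (- \<theta> + t * ln (real n)) * (fejer_const * max 0 (\<Lambda> - \<bar>ln (real n)\<bar>))) / (\<Lambda> * fejer_const)) =
         1 / sqrt (real n) * cos (- \<theta> + t * ln (real n))" unfolding m by simp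
    qed
    ultimately show ?thesis by simp
  qed
  have c1: "c1 \<ge> 0" unfolding c1_def using w0 by simp
  have b: "b > 0" using C0 \<Lambda> by (simp add: b_def)
  have amgm: "y \<le> e * y\<^sup>2 / 2 + 1 / (2 * e)" if "e > 0" for y e :: real
  proof -
    have "0 \<le> (e * y - 1)\<^sup>2" by simp
    then have "2 * e * y \<le> e\<^sup>2 * y\<^sup>2 + 1" by (simp add: power2_diff power_mult_distrib)
    then show ?thesis using that by (simp add: field_simps power2_eq_square)
  qed
  \<comment> \<open>Cauchy-Schwarz in the form of the inequality of means, with a parameter
    \<open>e\<close> that is optimised afterwards.\<close>
  have key: "x \<le> b * (e * Q / 2 + c1 / (2 * e))" if e: "e > 0" for e
  proof -
    have "x = (LBINT v. \<kappa> v * r (t + v))" using repr rt by (simp add: has_bochner_integral_iff)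
    also have "\<dots> \<le> (LBINT v. b * (e / 2 * ((norm (zeta_poly N (t + v)))\<^sup>2 * w v) + 1 / (2 * e) * w v))"
    proof (rule Bochner_Integration.integral_mono)
      show "integrable lborel (\<lambda>v. \<kappa> v * r (t + v))" using repr by (simp add: has_bochner_integral_iff)
      show "integrable lborel (\<lambda>v. b * (e / 2 * ((norm (zeta_poly N (t + v)))\<^sup>2 * w v) + 1 / (2 * e) * w v))"
        using iQ iw by (intro integrable_mult_right Bochner_Integration.integrable_add)
      fix v
      have "\<kappa> v * r (t + v) \<le> \<bar>\<kappa> v\<bar> * \<bar>r (t + v)\<bar>" by (metis abs_ge_self abs_mult)
      also have "\<dots> \<le> (b * w v) * norm (zeta_poly N (t + v))"
        using \<kappa>_le[of v] r_le[of "t + v"] by (intro mult_mono) auto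
      also have "\<dots> \<le> (b * w v) * (e * (norm (zeta_poly N (t + v)))\<^sup>2 / 2 + 1 / (2 * e))"
        using amgm[OF e] b w0 by (intro mult_left_mono) auto
      also have "\<dots> = b * (e / 2 * ((norm (zeta_poly N (t + v)))\<^sup>2 * w v) + 1 / (2 * e) * w v)"
        by (simp add: algebra_simps)
      finally show "\<kappa> v * r (t + v) \<le> b * (e / 2 * ((norm (zeta_poly N (t + v)))\<^sup>2 * w v) + 1 / (2 * e) * w v)" .
    qed
    also have "\<dots> = b * (e / 2 * Q + 1 / (2 * e) * c1)"
      unfolding Q_def c1_def using iQ iw by simp
    finally show ?thesis by simp
  qed
  have "x\<^sup>2 \<le> b\<^sup>2 * c1 * Q"
  \<comment> \<open>The optimal parameter is \<open>e = b * c1 / x\<close>. If \<open>c1\<close>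
    were 0, the choice \<open>e = x / (b * (Q + 1))\<close> would make the right side of
    \<open>key\<close> smaller than \<open>x\<close>.\<close>
  proof (cases "c1 = 0")
    case True
    have Q0: "Q \<ge> 0" unfolding Q_def using w0 by simp
    have h: "x \<le> b * (e * Q / 2)" if "e > 0" for e using key[OF that] True by simp
    have "x \<le> b * (x / (b * (Q + 1)) * Q / 2)"
      using b x Q0 by (intro h) auto
    also have "\<dots> = x * (Q / (2 * (Q + 1)))" using b Q0 by simp
    finally have "x \<le> x * (Q / (2 * (Q + 1)))" .
    moreover have "Q / (2 * (Q + 1)) < 1" using Q0 by (simp add: field_simps)
    ultimately show ?thesis using x mult_strict_left_mono[of "Q / (2 * (Q + 1))" 1 x] by simp
  next
    case False
    then have c1: "c1 > 0" using c1 by simp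
    have "x \<le> b * ((b * c1 / x) * Q / 2 + c1 / (2 * (b * c1 / x)))"
      using b c1 x by (intro key) auto
    also have "\<dots> = b\<^sup>2 * c1 * Q / (2 * x) + x / 2"
      using b c1 x by (simp add: field_simps power2_eq_square)
    finally have "x \<le> b\<^sup>2 * c1 * Q / (2 * x) + x / 2" .
    moreover have "y / 2 \<le> A" if "y \<le> A + y / 2" for y A :: real using that by simp
    ultimately have "x / 2 \<le> b\<^sup>2 * c1 * Q / (2 * x)" by blast
    then show ?thesis using x by (simp add: field_simps power2_eq_square)
  qed
  then show ?thesis unfolding x_def b_def c1_def Q_def w_def .
qed auto

section \<open>Separated points in a cluster\<close>

lemma sum_inverse_squares_le: "(\<Sum>k\<in>{1..n}. 1 / (real k)\<^sup>2) \<le> 2"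
proof -
  have *: "(\<Sum>k\<in>{1..n}. 1 / (real k)\<^sup>2) \<le> 2 - 1 / real n" if "n \<ge> 1" for n
    using that
  proof (induction n rule: nat_induct_at_least)
    case (Suc n)
    have "1 / (real (Suc n))\<^sup>2 \<le> 1 / (real n * real (Suc n))"
      using Suc by (intro divide_left_mono) (auto simp: power2_eq_square)
    also have "\<dots> = 1 / real n - 1 / real (Suc n)" using Suc by (simp add: field_simps)
    finally show ?case using Suc by simp
  qed simp
  show ?thesis
  proof (cases "n \<ge> 1")
    case True
    have "2 - 1 / real n \<le> 2" by simp
    then show ?thesis using *[OF True] by (rule order_trans[rotated])
  qed (simp add: not_le)
qed

text \<open>Separation makes the integer parts of \<open>t i - u\<close> distinct, so the sum is
  compared with one over all natural numbers: 1 from 0 and at most 2 from the rest.\<close>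

lemma separated_half_sum_le:
  fixes t :: "'i \<Rightarrow> real"
  assumes "finite A" and sep: "\<And>i j. i \<in> A \<Longrightarrow> j \<in> A \<Longrightarrow> i \<noteq> j \<Longrightarrow> \<bar>t i - t j\<bar> \<ge> 1"
    and u: "\<And>i. i \<in> A \<Longrightarrow> u \<le> t i"
  shows "(\<Sum>i\<in>A. 1 / (1 + (u - t i)\<^sup>2)) \<le> 3"
proof -
  define f where "f = (\<lambda>i. nat \<lfloor>t i - u\<rfloor>)"
  have fl: "real (f i) \<le> t i - u" "t i - u < real (f i) + 1" if "i \<in> A" for i
    using u[OF that] unfolding f_def by linarith+
  have inj: "inj_on f A"
  proof (rule inj_onI, rule ccontr)
    fix i j assume ij: "i \<in> A" "j \<in> A" "f i = f j" "i \<noteq> j"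
    have "\<bar>t i - t j\<bar> < 1" using fl[OF ij(1)] fl[OF ij(2)] ij(3) by linarith
    then show False using sep[OF ij(1,2,4)] by simp
  qed
  obtain K where K: "f ` A \<subseteq> {0..K}"
    using finite_nat_iff_bounded_le[of "f ` A"] assms(1) by (auto simp: atLeast0AtMost)
  have "(\<Sum>i\<in>A. 1 / (1 + (u - t i)\<^sup>2)) \<le> (\<Sum>i\<in>A. 1 / (1 + (real (f i))\<^sup>2))"
  proof (intro sum_mono divide_left_mono add_left_mono)
    fix i assume "i \<in> A"
    from fl[OF this] have "(real (f i))\<^sup>2 \<le> (t i - u)\<^sup>2" by (intro power_mono) auto
    then show "(real (f i))\<^sup>2 \<le> (u - t i)\<^sup>2" by (simp add: power2_commute)
  qed (auto intro!: mult_pos_pos add_pos_nonneg)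
  also have "\<dots> = (\<Sum>k\<in>f ` A. 1 / (1 + (real k)\<^sup>2))"
    using inj by (simp add: sum.reindex)
  also have "\<dots> \<le> (\<Sum>k\<in>{0..K}. 1 / (1 + (real k)\<^sup>2))"
    using K by (intro sum_mono2) (auto simp: add_nonneg_nonneg)
  also have "\<dots> = 1 + (\<Sum>k\<in>{1..K}. 1 / (1 + (real k)\<^sup>2))"
    by (simp add: sum.atLeast_Suc_atMost)
  also have "(\<Sum>k\<in>{1..K}. 1 / (1 + (real k)\<^sup>2)) \<le> (\<Sum>k\<in>{1..K}. 1 / (real k)\<^sup>2)"
    by (intro sum_mono divide_left_mono) (auto intro!: mult_pos_pos add_pos_nonneg)
  also have "\<dots> \<le> 2" by (rule sum_inverse_squares_le)
  finally show ?thesis by simp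
qed

lemma separated_sum_le:
  fixes t :: "'i \<Rightarrow> real"
  assumes "finite A" and sep: "\<And>i j. i \<in> A \<Longrightarrow> j \<in> A \<Longrightarrow> i \<noteq> j \<Longrightarrow> \<bar>t i - t j\<bar> \<ge> 1"
  shows "(\<Sum>i\<in>A. 1 / (1 + (u - t i)\<^sup>2)) \<le> 6"
proof -
  have "(\<Sum>i\<in>A. 1 / (1 + (u - t i)\<^sup>2)) =
    (\<Sum>i\<in>{i\<in>A. u \<le> t i}. 1 / (1 + (u - t i)\<^sup>2)) + (\<Sum>i\<in>{i\<in>A. \<not> u \<le> t i}. 1 / (1 + (u - t i)\<^sup>2))"
    using assms(1) by (subst sum.union_disjoint[symmetric]) (auto intro!: sum.cong)
  also have "(\<Sum>i\<in>{i\<in>A. u \<le> t i}. 1 / (1 + (u - t i)\<^sup>2)) \<le> 3"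
    using assms by (intro separated_half_sum_le) auto
  also have "(\<Sum>i\<in>{i\<in>A. \<not> u \<le> t i}. 1 / (1 + (u - t i)\<^sup>2)) =
     (\<Sum>i\<in>{i\<in>A. \<not> u \<le> t i}. 1 / (1 + (- u - (- t i))\<^sup>2))"
    by (intro sum.cong refl) (simp add: power2_commute)
  also have "\<dots> \<le> 3"
  proof (rule separated_half_sum_le)
    show "\<bar>- t i - - t j\<bar> \<ge> 1" if "i \<in> {i\<in>A. \<not> u \<le> t i}" "j \<in> {i\<in>A. \<not> u \<le> t i}" "i \<noteq> j" for i j
      using sep[of i j] that by (auto simp: abs_minus_commute)
  qed (use assms in auto)
  finally show ?thesis by simp
qed

lemma separated_card_le:
  fixes t :: "'i \<Rightarrow> real"
  assumes "finite A" and sep: "\<And>i j. i \<in> A \<Longrightarrow> j \<in> A \<Longrightarrow> i \<noteq> j \<Longrightarrow> \<bar>t i - t j\<bar> \<ge> 1"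
    and near: "\<And>i. i \<in> A \<Longrightarrow> \<bar>t i - \<tau>\<bar> \<le> G" and "G \<ge> 1"
  shows "real (card A) \<le> 4 * G"
proof -
  define f where "f = (\<lambda>i. nat \<lfloor>t i - (\<tau> - G)\<rfloor>)"
  have fl: "real (f i) \<le> t i - (\<tau> - G)" "t i - (\<tau> - G) < real (f i) + 1" if "i \<in> A" for i
    using near[OF that] unfolding f_def by linarith+
  have inj: "inj_on f A"
  proof (rule inj_onI, rule ccontr)
    fix i j assume ij: "i \<in> A" "j \<in> A" "f i = f j" "i \<noteq> j"
    have "\<bar>t i - t j\<bar> < 1" using fl[OF ij(1)] fl[OF ij(2)] ij(3) by linarith
    then show False using sep[OF ij(1,2,4)] by simp
  qed
  have "f ` A \<subseteq> {0..nat \<lfloor>2 * G\<rfloor>}"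
  proof
    fix k assume "k \<in> f ` A"
    then obtain i where i: "i \<in> A" "k = f i" by auto
    then have "real k \<le> 2 * G" using fl[OF i(1)] near[OF i(1)] by linarith
    then show "k \<in> {0..nat \<lfloor>2 * G\<rfloor>}" by (simp add: le_nat_floor)
  qed
  then have "card (f ` A) \<le> card {0..nat \<lfloor>2 * G\<rfloor>}" by (intro card_mono) auto
  then have "card A \<le> nat \<lfloor>2 * G\<rfloor> + 1" using inj by (simp add: card_image)
  then show ?thesis using assms(4) by linarith
qed

text \<open>Many Cauchy kernels of width 1 merge into one of width \<open>G\<close>, with no loss in
  \<open>G\<close>. Within \<open>2 * G\<close> of the centre separation bounds the sum by 6; at a
  larger distance \<open>d\<close> at most \<open>4 * G\<close> points contribute at most
  \<open>4 / d\<^sup>2\<close> each, and \<open>G \<ge> 1\<close>.\<close>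

lemma separated_cluster_le:
  fixes t :: "'i \<Rightarrow> real"
  assumes "finite A" and sep: "\<And>i j. i \<in> A \<Longrightarrow> j \<in> A \<Longrightarrow> i \<noteq> j \<Longrightarrow> \<bar>t i - t j\<bar> \<ge> 1"
    and near: "\<And>i. i \<in> A \<Longrightarrow> \<bar>t i - \<tau>\<bar> \<le> G" and G: "G \<ge> 1"
  shows "(\<Sum>i\<in>A. 1 / (1 + (u - t i)\<^sup>2)) \<le> 60 * (1 / (1 + ((u - \<tau>) / G)\<^sup>2))"
proof (cases "\<bar>u - \<tau>\<bar> \<le> 2 * G")
  case True
  then have "\<bar>(u - \<tau>) / G\<bar> \<le> 2" using G by (simp add: abs_divide divide_le_eq)
  then have "((u - \<tau>) / G)\<^sup>2 \<le> 2\<^sup>2" using abs_le_square_iff[of "(u - \<tau>) / G" 2] by simp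
  then have "1 / 5 \<le> 1 / (1 + ((u - \<tau>) / G)\<^sup>2)" by (intro divide_left_mono) (auto intro!: mult_pos_pos add_pos_nonneg)
  moreover have "(\<Sum>i\<in>A. 1 / (1 + (u - t i)\<^sup>2)) \<le> 6"
    using assms(1,2) by (rule separated_sum_le)
  ultimately show ?thesis by linarith
next
  case False
  define d where "d = \<bar>u - \<tau>\<bar>"
  have d: "d > 2 * G" "d > 0" using False G by (auto simp: d_def)
  have "(\<Sum>i\<in>A. 1 / (1 + (u - t i)\<^sup>2)) \<le> (\<Sum>i\<in>A. 4 / d\<^sup>2)"
  proof (rule sum_mono)
    fix i assume i: "i \<in> A"
    have "d / 2 \<le> \<bar>u - t i\<bar>" 
    proof -
      have "d \<le> \<bar>u - t i\<bar> + \<bar>t i - \<tau>\<bar>" unfolding d_def by linarith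
      then show ?thesis using near[OF i] d by simp
    qed
    then have "(d / 2)\<^sup>2 \<le> (u - t i)\<^sup>2" using abs_le_square_iff[of "d / 2" "u - t i"] d by simp
    then have "1 / (1 + (u - t i)\<^sup>2) \<le> 1 / ((d / 2)\<^sup>2)" using d by (intro divide_left_mono) (auto intro!: mult_pos_pos add_pos_nonneg)
    then show "1 / (1 + (u - t i)\<^sup>2) \<le> 4 / d\<^sup>2" by (simp add: power_divide)
  qed
  also have "\<dots> = real (card A) * (4 / d\<^sup>2)" by simp
  also have "\<dots> \<le> (4 * G) * (4 / d\<^sup>2)"
    using separated_card_le[OF assms] by (intro mult_right_mono) auto
  also have "\<dots> \<le> 60 * (1 / (1 + (d / G)\<^sup>2))"
  proof -
    have "G * G \<le> d * d" using d G by (intro mult_mono) auto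
    then have 1: "1 + (d / G)\<^sup>2 \<le> 2 * (d / G)\<^sup>2" using G by (simp add: power_divide power2_eq_square field_simps)
    have "(4 * G) * (4 / d\<^sup>2) = 16 * G / d\<^sup>2" by simp
    also have "\<dots> \<le> 30 * G\<^sup>2 / d\<^sup>2" using G by (intro divide_right_mono) (auto simp: power2_eq_square)
    also have "\<dots> = 60 * (1 / (2 * (d / G)\<^sup>2))" using G d by (simp add: power_divide)
    also have "\<dots> \<le> 60 * (1 / (1 + (d / G)\<^sup>2))" using 1 G d by (intro mult_left_mono divide_left_mono) (auto intro!: mult_pos_pos add_pos_nonneg)
    finally show ?thesis .
  qed
  also have "(d / G)\<^sup>2 = ((u - \<tau>) / G)\<^sup>2" by (simp add: d_def power_divide)
  finally show ?thesis .
qed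

text \<open>Translation by \<open>pi\<close> changes the sign of the cosine, so the two numerators
  add up to 2, while both denominators are at most \<open>20 * (1 + x\<^sup>2)\<close>.\<close>

lemma cauchy_le_two_fejer:
  assumes "\<sigma> = 1 \<or> \<sigma> = - 1"
  shows "1 / (1 + x\<^sup>2) \<le> 10 * (sqk 1 x + sqk 1 (x - \<sigma> * pi))"
proof -
  define y where "y = x - \<sigma> * pi"
  have cy: "cos y = - cos x" using assms by (auto simp: y_def cos_diff cos_add)
  have p: "1 + x\<^sup>2 > 0" by (simp add: add_pos_nonneg)
  have yb: "y\<^sup>2 \<le> 20 * (1 + x\<^sup>2)"
  proof -
    have "y\<^sup>2 \<le> 2 * x\<^sup>2 + 2 * (\<sigma> * pi)\<^sup>2"
      using sum_squares_bound[of x "- (\<sigma> * pi)"] by (simp add: y_def power2_diff)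
    also have "(\<sigma> * pi)\<^sup>2 = pi\<^sup>2" using assms by auto
    also have "pi\<^sup>2 \<le> (315/100)\<^sup>2" using pi_approx by (intro power_mono) auto
    finally have "y\<^sup>2 \<le> 2 * x\<^sup>2 + 20" by (simp add: power2_eq_square)
    then show ?thesis using zero_le_power2[of x] unfolding distrib_left by linarith
  qed
  have g: "(1 - cos z) / (20 * (1 + x\<^sup>2)) \<le> sqk 1 z" if "z\<^sup>2 \<le> 20 * (1 + x\<^sup>2)" for z
  proof (cases "z = 0")
    case False
    then show ?thesis unfolding sqk_def mult_1 using that p by (intro divide_left_mono) (auto intro!: mult_pos_pos)
  qed (simp add: sqk_def)
  have "x\<^sup>2 \<le> 20 * (1 + x\<^sup>2)" by simp
  from g[OF this] g[OF yb] have "(1 - cos x) / (20 * (1 + x\<^sup>2)) + (1 + cos x) / (20 * (1 + x\<^sup>2)) \<le> sqk 1 x + sqk 1 y"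
    by (simp add: cy)
  moreover have "(1 - c) / (20 * q) + (1 + c) / (20 * q) = (1 / q) / 10" for c q :: real
    by (simp add: add_divide_distrib[symmetric])
  ultimately have "(1 / (1 + x\<^sup>2)) / 10 \<le> sqk 1 x + sqk 1 y" by metis
  moreover have "a \<le> 10 * b" if "a / 10 \<le> b" for a b :: real using that by simp
  ultimately show ?thesis unfolding y_def by blast
qed

text \<open>The pointwise bounds are added up, the Cauchy kernels merged by
  \<open>separated_cluster_le\<close> and dominated by two Fejer kernels of width \<open>G\<close>,
  whose integrals are values of \<open>pform\<close>. In the constant, \<open>600 = 60 * 10\<close>
  and \<open>49 = 7 * 7\<close>. The sign \<open>\<sigma>\<close> is left open so that the
  translated centre can be kept inside \<open>{T..2 * T}\<close>.\<close>

lemma cluster_mean_square: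
  obtains C :: real where "C > 0"
    "\<And>N G \<Lambda> \<sigma> \<tau> (A :: nat set) t. G \<ge> 1 \<Longrightarrow> \<Lambda> \<ge> 1 \<Longrightarrow> ln (real N) \<le> \<Lambda> \<Longrightarrow> \<sigma> = 1 \<or> \<sigma> = - 1 \<Longrightarrow> finite A \<Longrightarrow>
      (\<And>i j. i \<in> A \<Longrightarrow> j \<in> A \<Longrightarrow> i \<noteq> j \<Longrightarrow> \<bar>t i - t j\<bar> \<ge> 1) \<Longrightarrow> (\<And>i. i \<in> A \<Longrightarrow> \<bar>t i - \<tau>\<bar> \<le> G) \<Longrightarrow>
      (\<Sum>i\<in>A. (norm (zeta_poly N (t i)))\<^sup>2) \<le> C * \<Lambda>\<^sup>2 * G * (pform N G \<tau> + pform N G (\<tau> + \<sigma> * (pi * G)))"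
proof -
  define w where "w = (\<lambda>v::real. 1 / (1 + v\<^sup>2))"
  define c1 where "c1 = (LBINT v. w v)"
  have w0: "w v \<ge> 0" for v by (simp add: w_def add_nonneg_nonneg)
  have iw: "integrable lborel w" unfolding w_def by (rule integrable_cauchy)
  have [measurable]: "w \<in> borel_measurable borel" unfolding w_def by measurable
  have c1: "c1 \<ge> 0" unfolding c1_def using w0 by simp
  note C0 = fejer_const_pos
  show ?thesis
  proof (rule that[of "600 * 49 * (c1 + 1) / fejer_const"])
    show "600 * 49 * (c1 + 1) / fejer_const > 0" using C0 c1 by simp
    fix N :: nat and G \<Lambda> \<sigma> \<tau> :: real and A :: "nat set" and t :: "nat \<Rightarrow> real"
    assume G: "G \<ge> 1" and \<Lambda>: "\<Lambda> \<ge> 1" "ln (real N) \<le> \<Lambda>" and \<sigma>: "\<sigma> = 1 \<or> \<sigma> = - 1" and A: "finite A"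
      and sep: "\<And>i j. i \<in> A \<Longrightarrow> j \<in> A \<Longrightarrow> i \<noteq> j \<Longrightarrow> \<bar>t i - t j\<bar> \<ge> 1" and near: "\<And>i. i \<in> A \<Longrightarrow> \<bar>t i - \<tau>\<bar> \<le> G"
    define g where "g = (\<lambda>u. (norm (zeta_poly N u))\<^sup>2)"
    have g0: "g u \<ge> 0" for u by (simp add: g_def)
    have [measurable]: "g \<in> borel_measurable borel" unfolding g_def by measurable
    define b where "b = 7 * \<Lambda> / fejer_const"
    have iQ: "integrable lborel (\<lambda>v. g v * w (v - a))" for a
    proof (rule Bochner_Integration.integrable_bound)
      show "integrable lborel (\<lambda>v. (real N)\<^sup>2 * w (v - a))"
        using lborel_integrable_real_affine[OF iw, of 1 "- a"] by (intro integrable_mult_right) (simp add: add.commute)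
      show "AE v in lborel. norm (g v * w (v - a)) \<le> norm ((real N)\<^sup>2 * w (v - a))"
        using w0 by (intro AE_I2) (auto simp: abs_mult g_def intro!: mult_right_mono power_mono norm_zeta_poly_le)
    qed measurable
    have pt: "g (t i) \<le> b\<^sup>2 * c1 * (LBINT v. g v * w (v - t i))" for i
    proof -
      have "g (t i) \<le> b\<^sup>2 * c1 * (LBINT v. g (t i + v) * w v)"
        unfolding g_def b_def c1_def w_def by (rule zeta_poly_pointwise[OF \<Lambda>])
      also have "(LBINT v. g (t i + v) * w v) = (LBINT v. g v * w (v - t i))"
        using lborel_integral_real_affine[of 1 "\<lambda>v. g v * w (v - t i)" "t i"] by simp
      finally show ?thesis .
    qed
    define k where "k = (\<lambda>s v. g v * sqk (1 / G) (v - s))"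
    have kk: "integrable lborel (k s)" "(LBINT v. k s v) = fejer_const / G * pform N G s" for s
    proof -
      have e: "(\<lambda>v. k s (s + 1 * v)) = (\<lambda>v. (norm (zeta_poly N (s + v)))\<^sup>2 * sqk (1 / G) v)"
        by (auto simp: k_def g_def)
      show "integrable lborel (k s)"
        using zeta_poly_sqk(1)[of G N s] G lborel_integrable_real_affine_iff[of 1 "k s" s] unfolding e by simp
      show "(LBINT v. k s v) = fejer_const / G * pform N G s"
        using zeta_poly_sqk(2)[of G N s] G lborel_integral_real_affine[of 1 "k s" s] unfolding e by simp
    qed
    have "(\<Sum>i\<in>A. g (t i)) \<le> (\<Sum>i\<in>A. b\<^sup>2 * c1 * (LBINT v. g v * w (v - t i)))"
      by (intro sum_mono pt)
    also have "\<dots> = b\<^sup>2 * c1 * (LBINT v. (\<Sum>i\<in>A. g v * w (v - t i)))"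
      using iQ by (simp add: sum_distrib_left Bochner_Integration.integral_sum)
    also have "(LBINT v. (\<Sum>i\<in>A. g v * w (v - t i))) \<le> (LBINT v. 600 * G\<^sup>2 * (k \<tau> v + k (\<tau> + \<sigma> * (pi * G)) v))"
    proof (rule Bochner_Integration.integral_mono)
      show "integrable lborel (\<lambda>v. \<Sum>i\<in>A. g v * w (v - t i))"
        using iQ by (intro Bochner_Integration.integrable_sum)
      show "integrable lborel (\<lambda>v. 600 * G\<^sup>2 * (k \<tau> v + k (\<tau> + \<sigma> * (pi * G)) v))"
        using kk by (intro integrable_mult_right Bochner_Integration.integrable_add)
      fix v
      have "(\<Sum>i\<in>A. g v * w (v - t i)) = g v * (\<Sum>i\<in>A. 1 / (1 + (v - t i)\<^sup>2))"
        by (simp add: sum_distrib_left w_def)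
      also have "\<dots> \<le> g v * (60 * (1 / (1 + ((v - \<tau>) / G)\<^sup>2)))"
        using g0 separated_cluster_le[OF A sep near G] by (intro mult_left_mono) auto
      also have "\<dots> \<le> g v * (60 * (10 * (sqk 1 ((v - \<tau>) / G) + sqk 1 ((v - \<tau>) / G - \<sigma> * pi))))"
        using g0 cauchy_le_two_fejer[OF \<sigma>, of "(v - \<tau>) / G"] by (intro mult_left_mono) auto
      also have "sqk 1 ((v - \<tau>) / G) = G\<^sup>2 * sqk (1 / G) (v - \<tau>)"
        using G by (simp add: sqk_def power_divide)
      also have "sqk 1 ((v - \<tau>) / G - \<sigma> * pi) = G\<^sup>2 * sqk (1 / G) (v - (\<tau> + \<sigma> * (pi * G)))"
      proof -
        have "(v - \<tau>) / G - \<sigma> * pi = (v - (\<tau> + \<sigma> * (pi * G))) / G" using G by (simp add: field_simps)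
        then show ?thesis using G by (simp add: sqk_def power_divide)
      qed
      finally show "(\<Sum>i\<in>A. g v * w (v - t i)) \<le> 600 * G\<^sup>2 * (k \<tau> v + k (\<tau> + \<sigma> * (pi * G)) v)"
        by (simp add: k_def algebra_simps)
    qed
    also have "(LBINT v. 600 * G\<^sup>2 * (k \<tau> v + k (\<tau> + \<sigma> * (pi * G)) v)) =
      600 * G\<^sup>2 * (fejer_const / G * pform N G \<tau> + fejer_const / G * pform N G (\<tau> + \<sigma> * (pi * G)))"
      using kk by simp
    also have "\<dots> = 600 * G * fejer_const * (pform N G \<tau> + pform N G (\<tau> + \<sigma> * (pi * G)))"
      using G by (simp add: power2_eq_square field_simps)
    finally have 1: "(\<Sum>i\<in>A. g (t i)) \<le> b\<^sup>2 * c1 * (600 * G * fejer_const * (pform N G \<tau> + pform N G (\<tau> + \<sigma> * (pi * G))))"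
      using c1 by (simp add: mult_left_mono)
    have pp: "0 \<le> pform N G s" for s
    proof -
      have "0 \<le> (LBINT v. k s v)" using g0 sqk_nonneg by (intro integral_nonneg_AE AE_I2) (simp add: k_def)
      then show ?thesis using C0 G unfolding kk by (simp add: zero_le_mult_iff zero_le_divide_iff)
    qed
    have "b\<^sup>2 * c1 * (600 * G * fejer_const * (pform N G \<tau> + pform N G (\<tau> + \<sigma> * (pi * G)))) =
       600 * 49 * c1 / fejer_const * \<Lambda>\<^sup>2 * G * (pform N G \<tau> + pform N G (\<tau> + \<sigma> * (pi * G)))"
      using C0 by (simp add: b_def power2_eq_square field_simps)
    also have "\<dots> \<le> 600 * 49 * (c1 + 1) / fejer_const * \<Lambda>\<^sup>2 * G * (pform N G \<tau> + pform N G (\<tau> + \<sigma> * (pi * G)))"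
      using C0 G pp by (intro mult_right_mono divide_right_mono) (auto intro: add_nonneg_nonneg)
    finally show "(\<Sum>i\<in>A. (norm (zeta_poly N (t i)))\<^sup>2) \<le>
       600 * 49 * (c1 + 1) / fejer_const * \<Lambda>\<^sup>2 * G * (pform N G \<tau> + pform N G (\<tau> + \<sigma> * (pi * G)))"
      using 1 by (simp add: g_def)
  qed
qed

section \<open>Continuation and approximation of zeta\<close>

text \<open>
  \<open>powr_rem m s n\<close> is the remainder of the binomial expansion of \<open>(n + 1) powr (1 - s)\<close>. Its term with \<open>i = 1\<close> is
  \<open>(1 - s) * n powr (- s)\<close>, so summing over \<open>n\<close> and telescoping expresses \<open>(s - 1) * zeta s\<close> by the values
  of \<open>zeta\<close> at \<open>s + 1, s + 2, ...\<close>, which continues it strip by strip.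
\<close>

definition fall :: "nat \<Rightarrow> complex \<Rightarrow> complex" where
  "fall i s = (\<Prod>l<i. 1 - s - of_nat l)"

definition powr_rem :: "nat \<Rightarrow> complex \<Rightarrow> nat \<Rightarrow> complex" where
  "powr_rem m s n = of_nat (Suc n) powr (1 - s) - (\<Sum>i\<le>m. fall i s * of_nat n powr (1 - s - of_nat i) / fact i)"

lemma fall_Suc: "fall (Suc i) s = fall i s * (1 - s - of_nat i)"
  by (simp add: fall_def)

text \<open>Taylor's theorem for \<open>z powr (1 - s)\<close> on the segment from \<open>n\<close>
  to \<open>n + 1\<close>; \<open>Re s + m \<ge> 0\<close> places the maximum of the last derivative
  at the left end.\<close>

lemma powr_rem_le:
  assumes n: "n \<ge> 1" and s: "Re s + real m \<ge> 0"
  shows "norm (powr_rem m s n) \<le> norm (fall (Suc m) s) * real n powr (- Re s - real m)"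
proof -
  define f where "f = (\<lambda>i z. fall i s * z powr (1 - s - of_nat i))"
  have seg: "\<exists>x\<ge>real n. z = of_real x" if z: "z \<in> closed_segment (of_nat n) (of_nat (Suc n))" for z :: complex
  proof -
    obtain u where "0 \<le> u" "u \<le> 1" "z = (1 - u) *\<^sub>R of_nat n + u *\<^sub>R of_nat (Suc n)"
      using iffD1[OF in_segment(1) z] by metis
    then have "z = of_real (real n + u)" by (simp add: scaleR_conv_of_real algebra_simps)
    then show ?thesis using \<open>0 \<le> u\<close> by (intro exI[of _ "real n + u"]) auto
  qed
  have "norm (f 0 (of_nat (Suc n)) - (\<Sum>i\<le>m. f i (of_nat n) * (of_nat (Suc n) - of_nat n) ^ i / fact i))
     \<le> (norm (fall (Suc m) s) * real n powr (- Re s - real m)) * norm (of_nat (Suc n) - of_nat n :: complex) ^ Suc m / fact m"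
  proof (rule complex_Taylor[of "closed_segment (of_nat n) (of_nat (Suc n))"])
    fix i :: nat and z :: complex assume z: "z \<in> closed_segment (of_nat n) (of_nat (Suc n))" "i \<le> m"
    obtain x where x: "x \<ge> real n" "z = of_real x" using seg[OF z(1)] by blast
    then have nz: "z \<notin> \<real>\<^sub>\<le>\<^sub>0" using n by auto
    have "(f i has_field_derivative fall i s * ((1 - s - of_nat i) * z powr (1 - s - of_nat i - 1))) (at z within closed_segment (of_nat n) (of_nat (Suc n)))"
      unfolding f_def using nz by (intro DERIV_cmult has_field_derivative_at_within[OF has_field_derivative_powr])
    moreover have "1 - s - of_nat i - 1 = 1 - s - of_nat (Suc i)" by simp
    ultimately show "(f i has_field_derivative f (Suc i) z) (at z within closed_segment (of_nat n) (of_nat (Suc n)))"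
      by (simp only: f_def fall_Suc mult.assoc)
  next
    fix z :: complex assume z: "z \<in> closed_segment (of_nat n) (of_nat (Suc n))"
    obtain x where x: "x \<ge> real n" "z = of_real x" using seg[OF z] by blast
    have "norm (z powr (1 - s - of_nat (Suc m))) = x powr (- Re s - real m)"
      using x n by (simp add: norm_powr_real_powr)
    also have "\<dots> \<le> real n powr (- Re s - real m)" using x n s by (intro powr_mono2') auto
    finally show "norm (f (Suc m) z) \<le> norm (fall (Suc m) s) * real n powr (- Re s - real m)"
      unfolding f_def norm_mult by (intro mult_left_mono) auto
  qed auto
  also have "\<dots> \<le> norm (fall (Suc m) s) * real n powr (- Re s - real m)"
  proof -
    have "(a::real) / fact m \<le> a" if "a \<ge> 0" for a
      using that fact_ge_1[of m, where 'a = real] by (simp add: divide_le_eq mult_le_cancel_left1)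
    then show ?thesis by simp
  qed
  also have "f 0 (of_nat (Suc n)) - (\<Sum>i\<le>m. f i (of_nat n) * (of_nat (Suc n) - of_nat n) ^ i / fact i) = powr_rem m s n"
    by (simp add: f_def powr_rem_def fall_def)
  finally show ?thesis .
qed

lemma fall_holomorphic [holomorphic_intros]: "f holomorphic_on A \<Longrightarrow> (\<lambda>s. fall i (f s)) holomorphic_on A"
  unfolding fall_def by (intro holomorphic_intros)

lemma powr_rem_holomorphic: "(\<lambda>s. powr_rem m s (Suc n)) holomorphic_on A"
  unfolding powr_rem_def by (intro holomorphic_intros) auto

text \<open>By \<open>powr_rem_le\<close> the terms are locally uniformly of order
  \<open>n powr (- Re s - m)\<close>, so the Weierstrass test applies. The offset \<open>k\<close>
  is 0 for the continuation and is the cutting point in \<open>zeta_eq\<close>.\<close>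

lemma powr_rem_sum:
  fixes m k :: nat
  defines "S \<equiv> {s. Re s > 1 - real m}"
  shows "(\<lambda>s. \<Sum>n. powr_rem m s (Suc (n + k))) holomorphic_on S"
    and "s \<in> S \<Longrightarrow> summable (\<lambda>n. powr_rem m s (Suc (n + k)))"
proof -
  have main: "\<exists>d>0. cball x d \<subseteq> S \<and> (\<exists>M. summable M \<and> (\<forall>n. \<forall>s\<in>cball x d. norm (powr_rem m s (Suc (n + k))) \<le> M n))"
    if x: "x \<in> S" for x
  proof -
    define d where "d = (Re x + real m - 1) / 2"
    have d: "d > 0" using x by (simp add: d_def S_def)
    have Re: "Re s + real m \<ge> 1 + d" if "s \<in> cball x d" for s
    proof -
      have "\<bar>Re x - Re s\<bar> \<le> d" using that abs_Re_le_cmod[of "x - s"] by (simp add: dist_norm)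
      moreover have "Re x + real m = 1 + 2 * d" by (simp add: d_def field_simps)
      ultimately show ?thesis by linarith
    qed
    have "compact ((fall (Suc m)) ` cball x d)"
      by (intro compact_continuous_image holomorphic_on_imp_continuous_on fall_holomorphic holomorphic_on_ident compact_cball)
    then obtain B where B: "\<And>s. s \<in> cball x d \<Longrightarrow> norm (fall (Suc m) s) \<le> B"
      using compact_imp_bounded bounded_iff by (metis imageI)
    define M where "M = (\<lambda>n. B * real (Suc (n + k)) powr (- 1 - d))"
    have "summable M"
    proof -
      have "summable (\<lambda>n. real n powr (- 1 - d))" using d by (subst summable_real_powr_iff) auto
      then have "summable (\<lambda>n. real (n + Suc k) powr (- 1 - d))" by (subst summable_iff_shift)
      then show ?thesis unfolding M_def by (intro summable_mult) (simp add: add.commute)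
    qed
    moreover have "norm (powr_rem m s (Suc (n + k))) \<le> M n" if s: "s \<in> cball x d" for n s
    proof -
      have "norm (powr_rem m s (Suc (n + k))) \<le> norm (fall (Suc m) s) * real (Suc (n + k)) powr (- Re s - real m)"
        using Re[OF s] d by (intro powr_rem_le) auto
      also have "\<dots> \<le> B * real (Suc (n + k)) powr (- 1 - d)"
        using Re[OF s] B[OF s] by (intro mult_mono powr_mono order_trans[OF norm_ge_zero B[OF s]]) auto
      finally show ?thesis by (simp add: M_def)
    qed
    moreover have "cball x d \<subseteq> S" using Re d by (force simp: S_def)
    ultimately show ?thesis using d by blast
  qed
  have "open S" unfolding S_def by (rule open_halfspace_Re_gt)
  show "(\<lambda>s. \<Sum>n. powr_rem m s (Suc (n + k))) holomorphic_on S"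
  proof (rule holomorphic_uniform_sequence[OF \<open>open S\<close>])
    show "(\<lambda>s. \<Sum>i<n. powr_rem m s (Suc (i + k))) holomorphic_on S" for n
      by (intro holomorphic_on_sum powr_rem_holomorphic)
    fix x assume "x \<in> S"
    from main[OF this] obtain d M where d: "d > 0" "cball x d \<subseteq> S" "summable M"
      and M: "\<And>n s. s \<in> cball x d \<Longrightarrow> norm (powr_rem m s (Suc (n + k))) \<le> M n" by blast
    have "uniform_limit (cball x d) (\<lambda>n s. \<Sum>i<n. powr_rem m s (Suc (i + k))) (\<lambda>s. \<Sum>i. powr_rem m s (Suc (i + k))) sequentially"
      by (rule Weierstrass_m_test[OF M d(3)])
    then show "\<exists>d>0. cball x d \<subseteq> S \<and> uniform_limit (cball x d) (\<lambda>n s. \<Sum>i<n. powr_rem m s (Suc (i + k))) (\<lambda>s. \<Sum>i. powr_rem m s (Suc (i + k))) sequentially"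
      using d by blast
  qed
  assume "s \<in> S"
  from main[OF this] obtain d M where d: "d > 0" "summable M"
      and M: "\<And>n s'. s' \<in> cball s d \<Longrightarrow> norm (powr_rem m s' (Suc (n + k))) \<le> M n" by blast
  show "summable (\<lambda>n. powr_rem m s (Suc (n + k)))"
    using d M by (intro summable_comparison_test'[OF d(2), of 0]) auto
qed

lemma dirichlet_term_eq:
  assumes n: "n \<ge> 1" and m: "m \<ge> 1"
  shows "(s - 1) / of_nat n powr s = (of_nat n powr (1 - s) - of_nat (Suc n) powr (1 - s)) +
     (\<Sum>i\<in>{2..m}. fall i s * of_nat n powr (1 - s - of_nat i) / fact i) + powr_rem m s n"
proof -
  have "{..m} = {0, 1} \<union> {2..m}" using m by auto
  then have "(\<Sum>i\<le>m. fall i s * of_nat n powr (1 - s - of_nat i) / fact i) =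
     of_nat n powr (1 - s) + (1 - s) * of_nat n powr (- s) + (\<Sum>i\<in>{2..m}. fall i s * of_nat n powr (1 - s - of_nat i) / fact i)"
    by (subst \<open>{..m} = _\<close>, subst sum.union_disjoint) (auto simp: fall_def)
  then show ?thesis
    unfolding powr_rem_def by (simp add: powr_minus_divide algebra_simps diff_divide_distrib)
qed

lemma telescope_powr:
  assumes "Re s > 1"
  shows "(\<lambda>n. of_nat (Suc (n + k)) powr (1 - s) - of_nat (Suc (Suc (n + k))) powr (1 - s)) sums (of_nat (Suc k) powr (1 - s))"
proof -
  have "(\<lambda>n. of_nat (Suc (n + k)) powr (1 - s)) \<longlonglongrightarrow> (0::complex)"
  proof (rule tendsto_norm_zero_cancel)
    have "(\<lambda>n. real n powr (1 - Re s)) \<longlonglongrightarrow> 0"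
      by (rule tendsto_neg_powr) (use assms filterlim_real_sequentially in auto)
    then have "(\<lambda>n. real (n + Suc k) powr (1 - Re s)) \<longlonglongrightarrow> 0"
      by (rule LIMSEQ_ignore_initial_segment)
    moreover have "norm (of_nat (Suc (n + k)) powr (1 - s)) = real (n + Suc k) powr (1 - Re s)" for n
      using norm_powr_real_powr[of "of_nat (Suc (n + k))" "1 - s"] by simp
    ultimately show "(\<lambda>n. norm (of_nat (Suc (n + k)) powr (1 - s) :: complex)) \<longlonglongrightarrow> 0" by simp
  qed
  from telescope_sums'[OF this] show ?thesis by simp
qed

text \<open>\<open>f\<close> continues \<open>(s - 1) * zeta s\<close> to \<open>Re s > 1 - j\<close>.\<close>

definition is_cont :: "nat \<Rightarrow> (complex \<Rightarrow> complex) \<Rightarrow> bool" where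
  "is_cont j f \<longleftrightarrow> f holomorphic_on {s. Re s > 1 - real j} \<and>
    (\<forall>s. Re s > 1 \<longrightarrow> (\<lambda>n. (s - 1) / of_nat (Suc n) powr s) sums f s)"

lemma dirichlet_tail_sums:
  assumes "Re s > 1"
  shows "(\<lambda>n. (s - 1) / of_nat (Suc (n + k)) powr s) sums (of_nat (Suc k) powr (1 - s) + (\<Sum>n. powr_rem 1 s (Suc (n + k))))"
proof -
  have "(\<lambda>n. (of_nat (Suc (n + k)) powr (1 - s) - of_nat (Suc (Suc (n + k))) powr (1 - s)) + powr_rem 1 s (Suc (n + k)))
     sums (of_nat (Suc k) powr (1 - s) + (\<Sum>n. powr_rem 1 s (Suc (n + k))))"
    using powr_rem_sum(2)[of s 1 k] assms by (intro sums_add telescope_powr) (auto intro: summable_sums)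
  then show ?thesis by (subst dirichlet_term_eq[of _ 1]) auto
qed

lemma is_cont_1: "is_cont 1 (\<lambda>s. 1 + (\<Sum>n. powr_rem 1 s (Suc (n + 0))))"
  unfolding is_cont_def
proof (intro conjI allI impI)
  show "(\<lambda>s. 1 + (\<Sum>n. powr_rem 1 s (Suc (n + 0)))) holomorphic_on {s. Re s > 1 - real 1}"
    by (intro holomorphic_intros powr_rem_sum)
  show "(\<lambda>n. (s - 1) / of_nat (Suc n) powr s) sums (1 + (\<Sum>n. powr_rem 1 s (Suc (n + 0))))" if "Re s > 1" for s
    using dirichlet_tail_sums[OF that, of 0] by simp
qed

text \<open>In \<open>dirichlet_term_eq\<close> the term with index \<open>i\<close> is, up to the
  factor \<open>- fall (i - 1) s / fact i\<close>, the term of the series for \<open>f\<close> at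
  \<open>s + (i - 1)\<close>. For \<open>i \<ge> 2\<close> this argument lies at least one unit
  further right, so the right side makes sense in one more strip.\<close>

lemma is_cont_Suc:
  assumes "is_cont j f"
  shows "\<exists>f. is_cont (Suc j) f"
proof -
  \<comment> \<open>With this order the remainder series converges for
    \<open>Re s > - 1 - j\<close>, a region containing the new strip.\<close>
  define m where "m = j + 2"
  define F where "F = (\<lambda>s. 1 + (\<Sum>i\<in>{2..m}. - (fall (i - 1) s * f (s + of_nat (i - 1)) / fact i)) + (\<Sum>n. powr_rem m s (Suc (n + 0))))"
  have fh: "f holomorphic_on {s. Re s > 1 - real j}"
    and fs: "\<And>s. Re s > 1 \<Longrightarrow> (\<lambda>n. (s - 1) / of_nat (Suc n) powr s) sums f s"
    using assms by (auto simp: is_cont_def)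
  have "F holomorphic_on {s. Re s > 1 - real (Suc j)}"
    unfolding F_def
  proof (intro holomorphic_intros)
    show "(\<lambda>s. \<Sum>n. powr_rem m s (Suc (n + 0))) holomorphic_on {s. Re s > 1 - real (Suc j)}"
      by (rule holomorphic_on_subset[OF powr_rem_sum(1)]) (auto simp: m_def)
    fix i assume i: "i \<in> {2..m}"
    show "(\<lambda>s. f (s + of_nat (i - 1))) holomorphic_on {s. Re s > 1 - real (Suc j)}"
      by (rule holomorphic_on_compose_gen[OF _ fh, unfolded o_def]) (use i in \<open>auto intro!: holomorphic_intros\<close>)
  qed auto
  moreover have "(\<lambda>n. (s - 1) / of_nat (Suc n) powr s) sums F s" if s: "Re s > 1" for s
  proof -
    have 1: "(\<lambda>n. of_nat (Suc n) powr (1 - s) - of_nat (Suc (Suc n)) powr (1 - s)) sums 1"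
      using telescope_powr[OF s, of 0] by simp
    have 2: "(\<lambda>n. powr_rem m s (Suc n)) sums (\<Sum>n. powr_rem m s (Suc (n + 0)))"
      using powr_rem_sum(2)[of s m 0] s by (simp add: summable_sums)
    have 3: "(\<lambda>n. fall i s * of_nat (Suc n) powr (1 - s - of_nat i) / fact i) sums (- (fall (i - 1) s * f (s + of_nat (i - 1)) / fact i))"
      if i: "i \<in> {2..m}" for i
    proof -
      obtain k where k: "i = Suc k" "k \<ge> 1" using i by (cases i) auto
      define z where "z = s + of_nat k"
      have "(\<lambda>n. (z - 1) / of_nat (Suc n) powr z) sums f z"
        using s k by (intro fs) (simp add: z_def)
      from sums_mult[OF this, of "- (fall k s / fact i)"]
      have "(\<lambda>n. - (fall k s / fact i) * ((z - 1) / of_nat (Suc n) powr z)) sums (- (fall k s / fact i) * f z)" .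
      moreover have "- (fall k s / fact i) * ((z - 1) / of_nat (Suc n) powr z) = fall i s * of_nat (Suc n) powr (1 - s - of_nat i) / fact i" for n
      proof -
        have "fall i s = - (fall k s * (z - 1))" by (simp add: k fall_Suc z_def algebra_simps)
        moreover have "1 - s - of_nat i = - z" by (simp add: k z_def)
        ultimately show ?thesis by (simp add: powr_minus_divide)
      qed
      ultimately show ?thesis by (simp add: k z_def)
    qed
    have "(\<lambda>n. (of_nat (Suc n) powr (1 - s) - of_nat (Suc (Suc n)) powr (1 - s)) +
      (\<Sum>i\<in>{2..m}. fall i s * of_nat (Suc n) powr (1 - s - of_nat i) / fact i) + powr_rem m s (Suc n)) sums F s"
      unfolding F_def by (intro sums_add sums_sum 1 2 3)
    moreover have "m \<ge> 1" by (simp add: m_def)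
    ultimately show ?thesis by (subst dirichlet_term_eq[of _ m]) auto
  qed
  ultimately show ?thesis unfolding is_cont_def by blast
qed

lemma is_cont_unique:
  assumes "is_cont i f" "is_cont j g" "Re s > 1 - real i" "Re s > 1 - real j"
  shows "f s = g s"
proof (rule analytic_continuation_open[of "{s. Re s > 1}" "{s. Re s > 1 - real (min i j)}" f g])
  show "connected {s. Re s > 1 - real (min i j)}"
    by (intro convex_connected convex_halfspace_Re_gt)
  show "f holomorphic_on {s. Re s > 1 - real (min i j)}"
    by (rule holomorphic_on_subset[of _ "{s. Re s > 1 - real i}"]) (use assms in \<open>auto simp: is_cont_def\<close>)
  show "g holomorphic_on {s. Re s > 1 - real (min i j)}"
    by (rule holomorphic_on_subset[of _ "{s. Re s > 1 - real j}"]) (use assms in \<open>auto simp: is_cont_def\<close>)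
  show "f z = g z" if "z \<in> {s. Re s > 1}" for z
    using that assms by (auto simp: is_cont_def intro: sums_unique2)
  show "{s::complex. Re s > 1} \<noteq> {}" by (auto intro: exI[of _ 2])
qed (use assms in \<open>auto simp: open_halfspace_Re_gt min_def\<close>)

lemma is_cont_exists: "\<exists>f. is_cont (Suc j) f"
proof (induction j)
  case 0
  then show ?case using is_cont_1 by auto
qed (use is_cont_Suc in blast)

text \<open>The choice operator in \<open>zeta\<close> needs a witness: the continuations to the
  half-planes agree where they overlap, glue to an entire function, and division by
  \<open>s - 1\<close> gives the function sought.\<close>

lemma zeta_spec: "zeta holomorphic_on (- {1})"
  "Re s > 1 \<Longrightarrow> (\<lambda>n. 1 / of_nat (Suc n) powr s) sums zeta s"
proof -
  obtain f where f: "\<And>j. is_cont (Suc j) (f j)" using is_cont_exists by metis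
  \<comment> \<open>At each point the continuation to a half-plane that contains it;
    \<open>F_eq\<close> shows that the choice does not matter.\<close>
  define F where "F = (\<lambda>s. f (nat \<lceil>- Re s\<rceil> + 1) s)"
  have F_eq: "F s = f j s" if "Re s > - real j" for s j
  proof -
    have "Re s > 1 - real (Suc (nat \<lceil>- Re s\<rceil> + 1))" by linarith
    then show ?thesis unfolding F_def using that by (intro is_cont_unique[OF f f]) auto
  qed
  have "F analytic_on {s}" for s
  proof -
    define j where "j = nat \<lceil>- Re s\<rceil> + 1"
    have j: "Re s > - real j" unfolding j_def by linarith
    have "f j holomorphic_on {s. Re s > - real j}" using f[of j] by (simp add: is_cont_def)
    then have "F holomorphic_on {s. Re s > - real j}"
      by (rule holomorphic_transform) (use F_eq in auto)
    moreover have "s \<in> {s. Re s > - real j}" using j by simp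
    ultimately show ?thesis unfolding analytic_at using open_halfspace_Re_gt[of "- real j"] by blast
  qed
  then have Fh: "F holomorphic_on A" for A
    by (meson analytic_imp_holomorphic analytic_on_analytic_at)
  define Z where "Z = (\<lambda>s. F s / (s - 1))"
  have "Z holomorphic_on (- {1})" unfolding Z_def by (intro holomorphic_intros Fh) auto
  moreover have "(\<lambda>n. 1 / of_nat (Suc n) powr s) sums Z s" if "Re s > 1" for s
  proof -
    have "(\<lambda>n. (s - 1) / of_nat (Suc n) powr s) sums F s"
      using f[of 0] that F_eq[of 0 s] by (auto simp: is_cont_def)
    moreover have "s - 1 \<noteq> 0" using that by auto
    ultimately show ?thesis using sums_divide[of "\<lambda>n. (s - 1) / of_nat (Suc n) powr s" "F s" "s - 1"] by (simp add: Z_def)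
  qed
  ultimately have "zeta holomorphic_on (- {1}) \<and> (\<forall>s. Re s > 1 \<longrightarrow> (\<lambda>n. 1 / of_nat (Suc n) powr s) sums zeta s)"
    unfolding zeta_def by (intro someI_ex[of "\<lambda>f. f holomorphic_on (- {1}) \<and>
     (\<forall>s. Re s > 1 \<longrightarrow> (\<lambda>n. 1 / of_nat (Suc n) powr s) sums f s)"]) blast
  then show "zeta holomorphic_on (- {1})" "Re s > 1 \<Longrightarrow> (\<lambda>n. 1 / of_nat (Suc n) powr s) sums zeta s"
    by auto
qed

text \<open>Both sides are holomorphic on the half-plane without the point 1 and agree for
  \<open>Re s > 1\<close>, where the tail of the series is
  \<open>dirichlet_tail_sums\<close>.\<close>

lemma zeta_eq:
  assumes "Re s > 0" "s \<noteq> 1"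
  shows "(s - 1) * zeta s = (s - 1) * (\<Sum>n<k. 1 / of_nat (Suc n) powr s) + of_nat (Suc k) powr (1 - s) + (\<Sum>n. powr_rem 1 s (Suc (n + k)))"
proof -
  define g where "g = (\<lambda>s. (s - 1) * (\<Sum>n<k. 1 / of_nat (Suc n) powr s) + of_nat (Suc k) powr (1 - s) + (\<Sum>n. powr_rem 1 s (Suc (n + k))))"
  have op: "open ({s. Re s > 0} - {1})" by (intro open_Diff open_halfspace_Re_gt) auto
  have "(s - 1) * zeta s = g s"
  proof (rule analytic_continuation_open[of "{s. Re s > 1}" "{s. Re s > 0} - {1}" "\<lambda>s. (s - 1) * zeta s" g])
    show "connected ({s. Re s > 0} - {1})"
      by (intro connected_open_delete open_halfspace_Re_gt convex_connected convex_halfspace_Re_gt) auto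
    show "(\<lambda>s. (s - 1) * zeta s) holomorphic_on {s. Re s > 0} - {1}"
      by (intro holomorphic_intros holomorphic_on_subset[OF zeta_spec(1)]) auto
    show "g holomorphic_on {s. Re s > 0} - {1}"
      unfolding g_def
      by (intro holomorphic_intros holomorphic_on_subset[OF powr_rem_sum(1)[of 1]]) auto
    show "(z - 1) * zeta z = g z" if "z \<in> {s. Re s > 1}" for z
    proof -
      have z: "Re z > 1" using that by simp
      have "(\<lambda>n. (z - 1) * (1 / of_nat (Suc n) powr z)) sums ((z - 1) * zeta z)"
        by (intro sums_mult zeta_spec z)
      from sums_split_initial_segment[OF this, of k]
      have "(\<lambda>n. (z - 1) / of_nat (Suc (n + k)) powr z) sums ((z - 1) * zeta z - (\<Sum>n<k. (z - 1) * (1 / of_nat (Suc n) powr z)))"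
        by (simp add: add.commute)
      from sums_unique2[OF this dirichlet_tail_sums[OF z, of k]] show ?thesis
        by (simp add: g_def sum_distrib_left algebra_simps)
    qed
    show "{s::complex. Re s > 1} \<noteq> {}" by (auto intro: exI[of _ 2])
  qed (use assms op in \<open>auto simp: open_halfspace_Re_gt\<close>)
  then show ?thesis by (simp add: g_def)
qed

text \<open>Comparison with the telescoping differences of \<open>2 / sqrt n\<close>.\<close>

lemma sum_inverse_three_halves:
  fixes k :: nat
  assumes "k \<ge> 1"
  shows "summable (\<lambda>n. real (Suc (n + k)) powr (- 3 / 2))" and "(\<Sum>n. real (Suc (n + k)) powr (- 3 / 2)) \<le> 2 / sqrt (real k)"
proof -
  show "summable (\<lambda>n. real (Suc (n + k)) powr (- 3 / 2))"
  proof -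
    have "summable (\<lambda>n. real n powr (- 3 / 2))" by (subst summable_real_powr_iff) auto
    then have "summable (\<lambda>n. real (n + Suc k) powr (- 3 / 2))" by (subst summable_iff_shift)
    then show ?thesis by (simp add: add.commute)
  qed
  moreover have "(\<lambda>n. 2 / sqrt (real (n + k)) - 2 / sqrt (real (Suc n + k))) sums (2 / sqrt (real (0 + k)) - 0)"
  proof (rule telescope_sums')
    have "(\<lambda>n. 2 / sqrt (real n)) \<longlonglongrightarrow> 0"
      by (intro tendsto_divide_0[OF tendsto_const] filterlim_at_top_imp_at_infinity
           filterlim_compose[OF sqrt_at_top filterlim_real_sequentially])
    then show "(\<lambda>n. 2 / sqrt (real (n + k))) \<longlonglongrightarrow> 0" by (rule LIMSEQ_ignore_initial_segment)
  qed
  moreover have "real (Suc (n + k)) powr (- 3 / 2) \<le> 2 / sqrt (real (n + k)) - 2 / sqrt (real (Suc n + k))" for n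
  proof -
    define x where "x = real (Suc (n + k))"
    define a where "a = sqrt (real (n + k))"
    define b where "b = sqrt x"
    have ab: "a > 0" "a \<le> b" "b * b = a * a + 1" using assms by (auto simp: a_def b_def x_def)
    have "b > 0" using ab by linarith
    have "x powr (- 3 / 2) = 1 / (b * b * b)"
    proof -
      have "x powr (3 / 2) = x powr (1 + 1 / 2)" by simp
      also have "\<dots> = x * b" by (subst powr_add) (simp add: b_def powr_half_sqrt x_def)
      also have "x * b = b * b * b" by (simp add: b_def x_def)
      finally have "x powr (3 / 2) = b * b * b" .
      moreover have "x powr (- 3 / 2) = 1 / x powr (3 / 2)" using powr_minus_divide[of x "3/2"] by simp
      ultimately show ?thesis by simp
    qed
    moreover have "1 / (b * b * b) \<le> 2 / a - 2 / b"
    proof -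
      have "(b - a) * (b + a) = 1" using ab by (simp add: algebra_simps)
      then have "b - a = 1 / (b + a)" using ab \<open>b > 0\<close> by (simp add: field_simps)
      have "2 / a - 2 / b = 2 * (b - a) / (a * b)" using ab \<open>b > 0\<close> by (simp add: field_simps)
      also have "\<dots> = 2 / ((b + a) * (a * b))" unfolding \<open>b - a = _\<close> by simp
      also have "\<dots> \<ge> 2 / ((b + b) * (b * b))"
        using ab \<open>b > 0\<close> by (intro divide_left_mono mult_mono mult_pos_pos) auto
      finally show ?thesis by (simp add: field_simps)
    qed
    ultimately show ?thesis by (simp add: a_def b_def x_def)
  qed
  ultimately show "(\<Sum>n. real (Suc (n + k)) powr (- 3 / 2)) \<le> 2 / sqrt (real k)"
    using suminf_le[of "\<lambda>n. real (Suc (n + k)) powr (- 3 / 2)" "\<lambda>n. 2 / sqrt (real (n + k)) - 2 / sqrt (real (Suc n + k))"]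
    by (simp add: sums_iff)
qed

text \<open>After division by \<open>s - 1\<close> in \<open>zeta_eq\<close>, the boundary term has
  size \<open>sqrt N / u\<close> and the remainder series size \<open>u / sqrt N\<close>. Balancing
  the latter against \<open>sqrt G\<close> leads to the length \<open>T^2 / G\<close> used
  below.\<close>

lemma zeta_approx:
  assumes N: "N \<ge> 2" and u: "u \<ge> 1"
  shows "norm (zeta (1 / 2 + \<i> * of_real u) - (\<Sum>n\<in>{1..N}. 1 / of_nat n powr (1 / 2 + \<i> * of_real u))) \<le> 2 * sqrt (real N) / u + 4 * u / sqrt (real N)"
proof -
  define s where "s = 1 / 2 + \<i> * complex_of_real u"
  have s: "Re s = 1 / 2" "Im s = u" by (auto simp: s_def)
  have s1: "s \<noteq> 1" "norm (s - 1) \<ge> u" "norm (s - 1) > 0" "norm s = norm (s - 1)"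
  proof -
    show "s \<noteq> 1" using s by (auto simp: complex_eq_iff)
    then show "norm (s - 1) > 0" by simp
    show "norm (s - 1) \<ge> u" using abs_Im_le_cmod[of "s - 1"] s u by simp
    show "norm s = norm (s - 1)" by (simp add: cmod_def s power2_eq_square)
  qed
  define E where "E = of_nat (Suc N) powr (1 - s) + (\<Sum>n. powr_rem 1 s (Suc (n + N)))"
  have sm: "(\<Sum>n<N. 1 / of_nat (Suc n) powr s) = (\<Sum>n\<in>{1..N}. 1 / of_nat n powr s)"
    by (rule sum.reindex_bij_witness[of _ "\<lambda>n. n - 1" Suc]) auto
  have "(s - 1) * (zeta s - (\<Sum>n\<in>{1..N}. 1 / of_nat n powr s)) = E"
    using zeta_eq[of s N] s s1 sm by (simp add: E_def algebra_simps)
  then have "norm (s - 1) * norm (zeta s - (\<Sum>n\<in>{1..N}. 1 / of_nat n powr s)) = norm E"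
    by (metis norm_mult)
  then have 1: "norm (zeta s - (\<Sum>n\<in>{1..N}. 1 / of_nat n powr s)) = norm E / norm (s - 1)"
    using s1 by (simp add: field_simps)
  have "norm (of_nat (Suc N) powr (1 - s) :: complex) = sqrt (real (Suc N))"
    using norm_powr_real_powr[of "of_nat (Suc N)" "1 - s"] s by (simp add: powr_half_sqrt)
  also have "\<dots> \<le> sqrt (4 * real N)" using N by simp
  also have "\<dots> = 2 * sqrt (real N)" by (simp add: real_sqrt_mult)
  finally have 2: "norm (of_nat (Suc N) powr (1 - s) :: complex) \<le> 2 * sqrt (real N)" .
  have b: "norm (powr_rem 1 s (Suc (n + N))) \<le> norm (s - 1) * norm s * real (Suc (n + N)) powr (- 3 / 2)" for n
  proof -
    have "norm (powr_rem 1 s (Suc (n + N))) \<le> norm (fall (Suc 1) s) * real (Suc (n + N)) powr (- Re s - real 1)"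
      using s by (intro powr_rem_le) auto
    also have "fall (Suc 1) s = (s - 1) * s" by (simp add: fall_def lessThan_Suc algebra_simps)
    finally show ?thesis using s by (simp add: norm_mult)
  qed
  note su = sum_inverse_three_halves[of N]
  have su1: "summable (\<lambda>n. norm (s - 1) * norm s * real (Suc (n + N)) powr (- 3 / 2))"
    using su N by (intro summable_mult) auto
  have "norm (\<Sum>n. powr_rem 1 s (Suc (n + N))) \<le> (\<Sum>n. norm (s - 1) * norm s * real (Suc (n + N)) powr (- 3 / 2))"
    using b su1 by (intro norm_suminf_le) auto
  also have "\<dots> = norm (s - 1) * norm s * (\<Sum>n. real (Suc (n + N)) powr (- 3 / 2))"
    using su N by (intro suminf_mult) auto
  also have "\<dots> \<le> norm (s - 1) * norm s * (2 / sqrt (real N))"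
    using su N by (intro mult_left_mono) auto
  finally have 3: "norm (\<Sum>n. powr_rem 1 s (Suc (n + N))) \<le> norm (s - 1) * norm s * (2 / sqrt (real N))" .
  have "norm E \<le> 2 * sqrt (real N) + norm (s - 1) * norm s * (2 / sqrt (real N))"
    unfolding E_def using 2 3 by (intro norm_triangle_le add_mono)
  then have "norm E / norm (s - 1) \<le> (2 * sqrt (real N) + norm (s - 1) * norm s * (2 / sqrt (real N))) / norm (s - 1)"
    by (intro divide_right_mono) auto
  also have "\<dots> = 2 * sqrt (real N) / norm (s - 1) + norm s * (2 / sqrt (real N))"
    using s1 by (simp add: add_divide_distrib)
  also have "\<dots> \<le> 2 * sqrt (real N) / u + (2 * u) * (2 / sqrt (real N))"
  proof (intro add_mono divide_left_mono mult_right_mono)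
    show "norm s \<le> 2 * u" using cmod_le[of s] s u by simp
  qed (use s1 u in auto)
  finally show ?thesis unfolding 1[unfolded s_def] s_def[symmetric] using 1 by simp
qed

section \<open>Large values\<close>

lemma zeta_poly_powr: "(\<Sum>n\<in>{1..N}. 1 / of_nat n powr (1 / 2 + \<i> * of_real u)) = zeta_poly N u"
  unfolding zeta_poly_def
proof (intro sum.cong refl)
  fix n assume "n \<in> {1..N}"
  then have n: "n > 0" by simp
  have "(of_nat n :: complex) powr (1 / 2 + \<i> * of_real u) = of_real (exp (ln (real n) / 2)) * cis (u * ln (real n))"
  proof -
    have "(of_nat n :: complex) powr (1 / 2 + \<i> * of_real u) = exp ((1 / 2 + \<i> * of_real u) * of_real (ln (real n)))"
      using n by (simp add: powr_def Ln_of_nat)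
    also have "(1 / 2 + \<i> * of_real u) * of_real (ln (real n)) = of_real (ln (real n) / 2) + \<i> * of_real (u * ln (real n))"
      by (simp add: algebra_simps)
    finally show ?thesis by (simp only: exp_add cis_conv_exp exp_of_real)
  qed
  also have "exp (ln (real n) / 2) = sqrt (real n)"
    using n powr_half_sqrt[of "real n"] powr_def[of "real n" "1 / 2"] by simp
  finally show "1 / of_nat n powr (1 / 2 + \<i> * of_real u) = of_real (1 / sqrt (real n)) * cis (- (u * ln (real n)))"
    by (simp only: of_real_divide of_real_1 of_real_inverse cis_inverse[symmetric] divide_inverse inverse_mult_distrib mult_1_left)
qed

lemma zeta_poly_close:
  assumes T: "T \<ge> 100" and G: "1 \<le> G" "G \<le> T" and t: "T \<le> t" "t \<le> 2 * T" and N: "N = nat \<lceil>T\<^sup>2 / G\<rceil>"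
  shows "norm (zeta (1 / 2 + \<i> * of_real t) - zeta_poly N t) \<le> 11 * sqrt G" "ln (real N) \<le> 3 * ln T"
proof -
  have ge: "real N \<ge> T\<^sup>2 / G" unfolding N by linarith
  have "0 \<le> T\<^sup>2 / G" using G by simp
  then have le: "real N \<le> T\<^sup>2 / G + 1" unfolding N by linarith
  have TG: "T \<le> T\<^sup>2 / G" using T G by (simp add: power2_eq_square pos_le_divide_eq)
  then have N2: "N \<ge> 2" using ge T by linarith
  have N_le: "real N \<le> (3 / 2 * T)\<^sup>2"
  proof -
    have "T\<^sup>2 / G \<le> T\<^sup>2 / 1" using G by (intro divide_left_mono) auto
    moreover have "1 \<le> T\<^sup>2" using T by simp
    ultimately show "real N \<le> (3 / 2 * T)\<^sup>2" unfolding power_mult_distrib using le by (simp add: power_divide)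
  qed
  then have "sqrt (real N) \<le> 3 / 2 * T" using T by (intro real_le_lsqrt) auto
  then have "2 * sqrt (real N) / t \<le> 2 * (3 / 2 * T) / T"
    using T t by (intro frac_le) auto
  also have "\<dots> = 3" using T by simp
  also have "\<dots> \<le> 3 * sqrt G" using G by simp
  finally have a: "2 * sqrt (real N) / t \<le> 3 * sqrt G" .
  have "T / sqrt G = sqrt (T\<^sup>2 / G)" using T by (simp add: real_sqrt_divide)
  also have "\<dots> \<le> sqrt (real N)" using ge by simp
  finally have "4 * t / sqrt (real N) \<le> 4 * (2 * T) / (T / sqrt G)"
    using T t G by (intro frac_le mult_left_mono) auto
  also have "\<dots> = 8 * sqrt G" using T by simp
  finally have b: "4 * t / sqrt (real N) \<le> 8 * sqrt G" .
  have "norm (zeta (1 / 2 + \<i> * of_real t) - zeta_poly N t) \<le> 2 * sqrt (real N) / t + 4 * t / sqrt (real N)"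
    unfolding zeta_poly_powr[symmetric] by (rule zeta_approx[OF N2]) (use t T in simp)
  then show "norm (zeta (1 / 2 + \<i> * of_real t) - zeta_poly N t) \<le> 11 * sqrt G" using a b by linarith
  have "real N \<le> T ^ 3"
  proof -
    have "(3 / 2 * T)\<^sup>2 = (9 / 4) * T\<^sup>2" by (simp add: power_mult_distrib power_divide)
    also have "\<dots> \<le> T * T\<^sup>2" using T by (intro mult_right_mono) auto
    finally show ?thesis using N_le by (simp add: eval_nat_numeral)
  qed
  then have "ln (real N) \<le> ln (T ^ 3)" using N2 T by (subst ln_le_cancel_iff) auto
  then show "ln (real N) \<le> 3 * ln T" using T by (simp add: ln_realpow)
qed

lemma log_power_le_powr:
  fixes a K :: real
  assumes "a > 0"
  obtains T0 :: real where "T0 \<ge> 1" "\<And>T. T \<ge> T0 \<Longrightarrow> K * (1 + ln T) ^ p \<le> T powr a"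
proof -
  \<comment> \<open>Half of the exponent \<open>a\<close> pays for the power of the logarithm, the
    other half for the constant, through \<open>Q\<close>.\<close>
  define b where "b = a / (2 * (real p + 1))"
  have b: "b > 0" "b * real p \<le> a / 2" using assms by (auto simp: b_def field_simps)
  define Q where "Q = max 1 (\<bar>K\<bar> * (1 + 1 / b) ^ p)"
  show ?thesis
  proof (rule that[of "Q powr (2 / a)"])
    show "Q powr (2 / a) \<ge> 1" using assms by (simp add: Q_def ge_one_powr_ge_zero)
    fix T assume T: "T \<ge> Q powr (2 / a)"
    then have T1: "T \<ge> 1" using \<open>Q powr (2 / a) \<ge> 1\<close> by simp
    have "Q = (Q powr (2 / a)) powr (a / 2)" using assms by (simp add: powr_powr Q_def)
    also have "\<dots> \<le> T powr (a / 2)" using T assms by (intro powr_mono2) auto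
    finally have Q: "Q \<le> T powr (a / 2)" .
    have "1 + ln T \<le> T powr b + T powr b / b"
      using T1 b ln_powr_bound[OF T1 b(1)] by (intro add_mono) (auto simp: ge_one_powr_ge_zero)
    also have "\<dots> = (1 + 1 / b) * T powr b" by (simp add: algebra_simps)
    finally have "(1 + ln T) ^ p \<le> ((1 + 1 / b) * T powr b) ^ p" using T1 by (intro power_mono) auto
    also have "\<dots> = (1 + 1 / b) ^ p * T powr (b * real p)"
      using T1 by (simp add: power_mult_distrib powr_power mult.commute)
    also have "\<dots> \<le> (1 + 1 / b) ^ p * T powr (a / 2)"
      using b T1 by (intro mult_left_mono powr_mono) auto
    finally have "\<bar>K\<bar> * (1 + ln T) ^ p \<le> \<bar>K\<bar> * ((1 + 1 / b) ^ p * T powr (a / 2))"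
      by (intro mult_left_mono) auto
    also have "\<dots> \<le> Q * T powr (a / 2)"
      unfolding mult.assoc[symmetric] by (intro mult_right_mono) (auto simp: Q_def)
    also have "\<dots> \<le> T powr (a / 2) * T powr (a / 2)" using Q by (intro mult_right_mono) auto
    also have "\<dots> = T powr a" using T1 by (simp add: powr_add[symmetric])
    finally have "\<bar>K\<bar> * (1 + ln T) ^ p \<le> T powr a" .
    moreover have "K * (1 + ln T) ^ p \<le> \<bar>K\<bar> * (1 + ln T) ^ p" using T1 by (intro mult_right_mono) auto
    ultimately show "K * (1 + ln T) ^ p \<le> T powr a" by linarith
  qed
qed

text \<open>\<open>cluster_mean_square\<close> and \<open>pform_le\<close> compare the number of
  points times the squared large value with \<open>G\<close> times logarithms times
  \<open>1 + S\<close>. As the squared large value is \<open>G * T powr (\<eta> / 2)\<close> up to a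
  constant, \<open>G\<close> cancels and the remaining power of \<open>T\<close> beats the
  logarithms.\<close>

lemma points_near_le:
  fixes \<eta> :: real
  assumes \<eta>: "0 < \<eta>"
  obtains F :: complex and T0 :: real where "T0 \<ge> 100"
    "\<And>T U G (A :: nat set) t \<tau> \<sigma>. T \<ge> T0 \<Longrightarrow> U > 0 \<Longrightarrow> G = U\<^sup>2 * T powr (- \<eta>) \<Longrightarrow> T \<le> G ^ 5 \<Longrightarrow> 1 \<le> G \<Longrightarrow> G \<le> T \<Longrightarrow>
      finite A \<Longrightarrow> (\<And>i j. i \<in> A \<Longrightarrow> j \<in> A \<Longrightarrow> i \<noteq> j \<Longrightarrow> \<bar>t i - t j\<bar> \<ge> 1) \<Longrightarrow>
      (\<And>i. i \<in> A \<Longrightarrow> T \<le> t i \<and> t i \<le> 2 * T \<and> \<bar>t i - \<tau>\<bar> \<le> G \<and> norm (zeta (1 / 2 + \<i> * of_real (t i))) \<ge> U * T powr (- (\<eta> / 4))) \<Longrightarrow>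
      \<sigma> = 1 \<or> \<sigma> = - 1 \<Longrightarrow> \<tau> \<in> {T..2 * T} \<Longrightarrow> \<tau> + \<sigma> * (pi * G) \<in> {T..2 * T} \<Longrightarrow>
      real (card A) \<le> norm (divisor_main F G (nat \<lfloor>2 * T / G\<^sup>2\<rfloor>) \<tau>) +
        norm (divisor_main F G (nat \<lfloor>2 * T / G\<^sup>2\<rfloor>) (\<tau> + \<sigma> * (pi * G)))"
proof -
  obtain F :: complex where F: "\<And>q. q > 0 \<Longrightarrow> norm (integral {-q..q} (\<lambda>x. cis (x\<^sup>2)) - F) \<le> 2 / q"
    using fresnel by blast
  obtain C :: real where C: "C > 0"
    "\<And>N G \<Lambda> \<sigma> \<tau> (A :: nat set) t. G \<ge> 1 \<Longrightarrow> \<Lambda> \<ge> 1 \<Longrightarrow> ln (real N) \<le> \<Lambda> \<Longrightarrow> \<sigma> = 1 \<or> \<sigma> = - 1 \<Longrightarrow> finite A \<Longrightarrow>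
      (\<And>i j. i \<in> A \<Longrightarrow> j \<in> A \<Longrightarrow> i \<noteq> j \<Longrightarrow> \<bar>t i - t j\<bar> \<ge> 1) \<Longrightarrow> (\<And>i. i \<in> A \<Longrightarrow> \<bar>t i - \<tau>\<bar> \<le> G) \<Longrightarrow>
      (\<Sum>i\<in>A. (norm (zeta_poly N (t i)))\<^sup>2) \<le> C * \<Lambda>\<^sup>2 * G * (pform N G \<tau> + pform N G (\<tau> + \<sigma> * (pi * G)))"
  proof -
    show thesis by (rule cluster_mean_square) (fact that)
  qed
  define D where "D = 100000 * (1 + norm F)"
  have D: "D \<ge> 0" by (simp add: D_def)
  obtain T1 where "T1 \<ge> 1" and T1: "\<And>T. T \<ge> T1 \<Longrightarrow> 22 * (1 + ln T) ^ 0 \<le> T powr (\<eta> / 4)"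
    using log_power_le_powr[of "\<eta> / 4" 22 0] \<eta> by (metis zero_less_divide_iff zero_less_numeral)
  obtain T2 :: real where "T2 \<ge> 1" and T2: "\<And>T. T \<ge> T2 \<Longrightarrow> 144 * C * (D + 1) * (1 + ln T) ^ 5 \<le> T powr (\<eta> / 2)"
    by (rule log_power_le_powr[of "\<eta> / 2" "144 * C * (D + 1)" 5]) (use \<eta> in auto)
  show ?thesis
  proof (rule that[of "max 100 (max T1 T2)" F])
    fix T U G :: real and A :: "nat set" and t :: "nat \<Rightarrow> real" and \<tau> \<sigma> :: real
    assume T0: "T \<ge> max 100 (max T1 T2)" and U: "U > 0" and Gdef: "G = U\<^sup>2 * T powr (- \<eta>)" and G: "T \<le> G ^ 5" "1 \<le> G" "G \<le> T"
      and A: "finite A" and sep: "\<And>i j. i \<in> A \<Longrightarrow> j \<in> A \<Longrightarrow> i \<noteq> j \<Longrightarrow> \<bar>t i - t j\<bar> \<ge> 1"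
      and t: "\<And>i. i \<in> A \<Longrightarrow> T \<le> t i \<and> t i \<le> 2 * T \<and> \<bar>t i - \<tau>\<bar> \<le> G \<and> norm (zeta (1 / 2 + \<i> * of_real (t i))) \<ge> U * T powr (- (\<eta> / 4))"
      and \<sigma>: "\<sigma> = 1 \<or> \<sigma> = - 1" and \<tau>: "\<tau> \<in> {T..2 * T}" "\<tau> + \<sigma> * (pi * G) \<in> {T..2 * T}"
    have T: "T \<ge> 100" using T0 by simp
    define N where "N = nat \<lceil>T\<^sup>2 / G\<rceil>"
    define S where "S = (\<lambda>t. norm (divisor_main F G (nat \<lfloor>2 * T / G\<^sup>2\<rfloor>) t))"
    \<comment> \<open>In this unit \<open>sqrt G = U / q\<^sup>2\<close>, whereas the large values
      are at least \<open>U / q\<close>; once \<open>q \<ge> 22\<close>, the approximation error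
      \<open>11 * sqrt G\<close> takes away at most half of them.\<close>
    define q where "q = T powr (\<eta> / 4)"
    define L where "L = 1 + ln T"
    have L: "L \<ge> 1" using T by (simp add: L_def)
    have q: "q \<ge> 22" using T1[of T] T0 by (simp add: q_def)
    have q2: "q\<^sup>2 = T powr (\<eta> / 2)" using T by (simp add: q_def powr_power)
    have q4: "T powr (- \<eta>) = 1 / q ^ 4" using T by (simp add: q_def powr_power powr_minus_divide)
    have GU: "G = (U / q\<^sup>2)\<^sup>2" unfolding Gdef q4 by (simp add: power_divide flip: power_mult)
    have sG: "sqrt G = U / q\<^sup>2" unfolding GU using U by simp
    have big: "norm (zeta_poly N (t i)) \<ge> U / (2 * q)" if i: "i \<in> A" for i
    proof -
      have "norm (zeta (1 / 2 + \<i> * of_real (t i)) - zeta_poly N (t i)) \<le> 11 * sqrt G"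
        using t[OF i] by (intro zeta_poly_close(1)[OF T G(2,3) _ _ N_def]) auto
      also have "\<dots> = 11 / q * (U / q)" unfolding sG by (simp add: power2_eq_square)
      also have "\<dots> \<le> 1 / 2 * (U / q)" using q U by (intro mult_right_mono) (auto simp: divide_le_eq)
      finally have "norm (zeta (1 / 2 + \<i> * of_real (t i)) - zeta_poly N (t i)) \<le> 1 / 2 * (U / q)" .
      moreover have "norm (zeta (1 / 2 + \<i> * of_real (t i))) \<ge> U / q"
        using t[OF i] T by (simp add: q_def powr_minus_divide)
      moreover have "norm (zeta (1 / 2 + \<i> * of_real (t i))) \<le> norm (zeta (1 / 2 + \<i> * of_real (t i)) - zeta_poly N (t i)) + norm (zeta_poly N (t i))"
        using norm_triangle_sub by (simp only: add.commute)
      moreover have "U / (2 * q) = 1 / 2 * (U / q)" by simp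
      ultimately show ?thesis by linarith
    qed
    have pf: "pform N G u \<le> D * L ^ 3 + 2 * S u" if "u \<in> {T..2 * T}" for u
      unfolding D_def L_def S_def using that
      by (intro pform_le[OF F T G(2) G(1) G(3)]) (auto simp: N_def)
    have "real (card A) * (G * q\<^sup>2 / 4) = (\<Sum>i\<in>A. (U / (2 * q))\<^sup>2)"
      unfolding GU using q by (simp add: power_divide power_mult_distrib power2_eq_square)
    also have "\<dots> \<le> (\<Sum>i\<in>A. (norm (zeta_poly N (t i)))\<^sup>2)"
      using big U q by (intro sum_mono power_mono) auto
    also have "\<dots> \<le> C * (3 * L)\<^sup>2 * G * (pform N G \<tau> + pform N G (\<tau> + \<sigma> * (pi * G)))"
    proof (rule C(2)[OF G(2) _ _ \<sigma> A sep])
      show "1 \<le> 3 * L" using L by simp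
      show "ln (real N) \<le> 3 * L" using zeta_poly_close(2)[OF T G(2,3) _ _ N_def, of T] T by (simp add: L_def)
    qed (use t in auto)
    also have "\<dots> \<le> C * (3 * L)\<^sup>2 * G * ((D * L ^ 3 + 2 * S \<tau>) + (D * L ^ 3 + 2 * S (\<tau> + \<sigma> * (pi * G))))"
      using C(1) G pf[OF \<tau>(1)] pf[OF \<tau>(2)] by (intro mult_left_mono add_mono mult_nonneg_nonneg) auto
    also have "\<dots> = G / 4 * (72 * C * D * L ^ 5 + 72 * C * L\<^sup>2 * (S \<tau> + S (\<tau> + \<sigma> * (pi * G))))"
      by (simp add: algebra_simps eval_nat_numeral)
    finally have "G / 4 * (real (card A) * q\<^sup>2) \<le> G / 4 * (72 * C * D * L ^ 5 + 72 * C * L\<^sup>2 * (S \<tau> + S (\<tau> + \<sigma> * (pi * G))))"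
      by (simp only: mult_ac times_divide_eq_left times_divide_eq_right)
    then have "real (card A) * q\<^sup>2 \<le> 72 * C * D * L ^ 5 + 72 * C * L\<^sup>2 * (S \<tau> + S (\<tau> + \<sigma> * (pi * G)))"
      using G by (simp only: mult_le_cancel_left_pos[of "G / 4"])
    also have "\<dots> \<le> q\<^sup>2 / 2 + q\<^sup>2 / 2 * (S \<tau> + S (\<tau> + \<sigma> * (pi * G)))"
    proof (intro add_mono mult_right_mono)
      have e: "144 * C * (D + 1) * L ^ 5 \<le> q\<^sup>2" using T2[of T] T0 unfolding q2 L_def by simp
      have "72 * C * D * L ^ 5 \<le> 72 * C * (D + 1) * L ^ 5" using C D L by (intro mult_right_mono mult_left_mono) auto
      then show "72 * C * D * L ^ 5 \<le> q\<^sup>2 / 2" using e by linarith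
      have "72 * C * 1 * L\<^sup>2 \<le> 72 * C * (D + 1) * L ^ 5" using C D L by (intro mult_mono power_increasing) auto
      then show "72 * C * L\<^sup>2 \<le> q\<^sup>2 / 2" using e by linarith
    qed (simp add: S_def)
    also have "\<dots> = q\<^sup>2 * (1 / 2 + (S \<tau> + S (\<tau> + \<sigma> * (pi * G))) / 2)" by (simp add: algebra_simps)
    finally have "real (card A) \<le> 1 / 2 + (S \<tau> + S (\<tau> + \<sigma> * (pi * G))) / 2"
      unfolding mult.commute[of "real (card A)"] using q by (simp only: mult_le_cancel_left_pos[of "q\<^sup>2"] zero_less_power)
    moreover have "S \<tau> \<ge> 0" "S (\<tau> + \<sigma> * (pi * G)) \<ge> 0" by (auto simp: S_def)
    \<comment> \<open>Integrality removes the summand 1/2: a positive number of points is at least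
      1, so 1/2 is at most half of it.\<close>
    moreover have "card A = 0 \<or> real (card A) \<ge> 1" by linarith
    ultimately have "real (card A) \<le> S \<tau> + S (\<tau> + \<sigma> * (pi * G))"
      by (cases "card A = 0") (auto simp: add_divide_distrib)
    then show "real (card A) \<le> norm (divisor_main F G (nat \<lfloor>2 * T / G\<^sup>2\<rfloor>) \<tau>) +
        norm (divisor_main F G (nat \<lfloor>2 * T / G\<^sup>2\<rfloor>) (\<tau> + \<sigma> * (pi * G)))" by (simp only: S_def)
  qed simp
qed

text \<open>Double counting: the number of windows containing \<open>x\<close>, integrated over
  \<open>x\<close>, is \<open>card A * G\<close>. The range \<open>{p..r}\<close> contains both
  \<open>{a..b}\<close> and its translate by \<open>c\<close>, so each of the two integrals of
  \<open>H\<close> is bounded by the one over \<open>{p..r}\<close>.\<close>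

lemma covering_integral:
  fixes H :: "real \<Rightarrow> real"
  assumes H: "continuous_on {p..r} H" "\<And>x. x \<in> {p..r} \<Longrightarrow> H x \<ge> 0"
    and ab: "a \<le> b" "p \<le> a" "b \<le> r" "p \<le> a + c" "b + c \<le> r"
    and A: "finite A" "\<And>i. i \<in> A \<Longrightarrow> a \<le> s i \<and> s i + G \<le> b" and G: "G \<ge> 0" and Q: "Q \<ge> 0"
    and le: "\<And>x. x \<in> {a..b} \<Longrightarrow> real (card {i\<in>A. x \<in> {s i..s i + G}}) \<le> Q * (H x + H (x + c))"
  shows "real (card A) * G \<le> 2 * Q * integral {p..r} H"
proof -
  have ci: "continuous_on {a..b} H" "continuous_on {a + c..b + c} H"
    using ab by (auto intro!: continuous_on_subset[OF H(1)])
  have cs: "continuous_on {a..b} (H \<circ> (+) c)"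
    by (rule continuous_on_compose) (auto intro!: continuous_intros continuous_on_subset[OF H(1)] simp: add.commute image_iff, use ab in auto)
  have 1: "((\<lambda>x. if x \<in> {s i..s i + G} then 1 else 0) has_integral G) {a..b}" if "i \<in> A" for i
    using has_integral_restrict[of "{s i..s i + G}" "{a..b}" "\<lambda>_. 1::real" G] has_integral_const_real[of "1::real" "s i" "s i + G"] A(2)[OF that] G
    by auto
  have 2: "((\<lambda>x. \<Sum>i\<in>A. if x \<in> {s i..s i + G} then 1 else 0) has_integral (\<Sum>i\<in>A. G)) {a..b}"
    using A(1) 1 by (rule has_integral_sum)
  have 3: "((\<lambda>x. Q * (H x + (H \<circ> (+) c) x)) has_integral Q * (integral {a..b} H + integral {a..b} (H \<circ> (+) c))) {a..b}"
    by (intro has_integral_mult_right has_integral_add integrable_integral integrable_continuous_real ci cs)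
  have "(\<Sum>i\<in>A. G) \<le> Q * (integral {a..b} H + integral {a..b} (H \<circ> (+) c))"
  proof (rule has_integral_le[OF 2 3])
    fix x assume x: "x \<in> {a..b}"
    have "(\<Sum>i\<in>A. if x \<in> {s i..s i + G} then 1 else 0) = real (card {i\<in>A. x \<in> {s i..s i + G}})"
      using A(1) by (simp add: sum.If_cases Int_def)
    then show "(\<Sum>i\<in>A. if x \<in> {s i..s i + G} then 1 else 0) \<le> Q * (H x + (H \<circ> (+) c) x)"
      using le[OF x] by (simp add: add.commute)
  qed
  also have "integral {a..b} (H \<circ> (+) c) = integral {a + c..b + c} H" by (rule integral_shift_Icc_real)
  also have "Q * (integral {a..b} H + integral {a + c..b + c} H) \<le> Q * (integral {p..r} H + integral {p..r} H)"
    using ab Q by (intro mult_left_mono add_mono integral_subset_le integrable_continuous_real ci H) (auto intro: H(2))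
  finally show ?thesis by (simp add: algebra_simps)
qed

theorem theorem1:
  fixes M :: nat and \<epsilon> :: real
  assumes "M \<ge> 1" and "\<epsilon> > 0"
  shows "\<exists>\<delta>>0. \<exists>T0::real. \<forall>A::nat \<Rightarrow> real. \<exists>C::real.
    \<forall>(T::real) (V::real) (R::nat) (t::nat \<Rightarrow> real) (\<phi>::real \<Rightarrow> real).
      T \<ge> T0 \<longrightarrow>
      V \<ge> T powr (1 / 10 + \<epsilon>) \<longrightarrow>
      strict_mono_on {1..R} t \<longrightarrow>
      (\<forall>r\<in>{1..R}. T \<le> t r \<and> t r \<le> 2 * T) \<longrightarrow>
      (\<forall>r\<in>{1..R}. norm (zeta (1 / 2 + \<i> * of_real (t r))) \<ge> V * T powr (- \<delta>)) \<longrightarrow>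
      (\<forall>r\<in>{1..<R}. t (r + 1) - t r \<ge> V) \<longrightarrow>
      smooth_weight A T \<phi> \<longrightarrow>
      real R \<le> C * T powr (\<epsilon> - real M / 2) * V powr (- 2) *
        max_moment M T \<phi> (T powr (1 + \<epsilon>) * V powr (- 4))"
proof -
  \<comment> \<open>The exponent lost in \<open>G\<close>.
    \<open>4 * \<eta> \<le> \<epsilon>\<close> makes the length \<open>2 * T / G\<^sup>2\<close> fit
    below \<open>T powr (1 + \<epsilon>) * V powr (- 4)\<close>, and
    \<open>\<eta> \<le> 1 / 4\<close> keeps \<open>G\<close> below \<open>T powr (3 / 4)\<close>.
    The theorem's \<open>\<delta>\<close> is \<open>\<eta> / 4\<close>, as in
    \<open>points_near_le\<close>.\<close>
  define \<eta> where "\<eta> = min \<epsilon> 1 / 4"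
  have \<eta>: "0 < \<eta>" "\<eta> \<le> \<epsilon> / 4" "\<eta> \<le> 1 / 4" using assms by (auto simp: \<eta>_def)
  obtain F :: complex and T1 :: real where T1: "T1 \<ge> 100"
    "\<And>T U G (A :: nat set) t \<tau> \<sigma>. T \<ge> T1 \<Longrightarrow> U > 0 \<Longrightarrow> G = U\<^sup>2 * T powr (- \<eta>) \<Longrightarrow> T \<le> G ^ 5 \<Longrightarrow> 1 \<le> G \<Longrightarrow> G \<le> T \<Longrightarrow>
      finite A \<Longrightarrow> (\<And>i j. i \<in> A \<Longrightarrow> j \<in> A \<Longrightarrow> i \<noteq> j \<Longrightarrow> \<bar>t i - t j\<bar> \<ge> 1) \<Longrightarrow>
      (\<And>i. i \<in> A \<Longrightarrow> T \<le> t i \<and> t i \<le> 2 * T \<and> \<bar>t i - \<tau>\<bar> \<le> G \<and> norm (zeta (1 / 2 + \<i> * of_real (t i))) \<ge> U * T powr (- (\<eta> / 4))) \<Longrightarrow>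
      \<sigma> = 1 \<or> \<sigma> = - 1 \<Longrightarrow> \<tau> \<in> {T..2 * T} \<Longrightarrow> \<tau> + \<sigma> * (pi * G) \<in> {T..2 * T} \<Longrightarrow>
      real (card A) \<le> norm (divisor_main F G (nat \<lfloor>2 * T / G\<^sup>2\<rfloor>) \<tau>) +
        norm (divisor_main F G (nat \<lfloor>2 * T / G\<^sup>2\<rfloor>) (\<tau> + \<sigma> * (pi * G)))"
  proof -
    show thesis by (rule points_near_le[OF \<eta>(1)]) (fact that)
  qed
  obtain T2 :: real where T2: "T2 \<ge> 1" "\<And>T. T \<ge> T2 \<Longrightarrow> 1 * (1 + ln T) ^ (2 * M) \<le> T powr (\<epsilon> / 2)"
    by (rule log_power_le_powr[of "\<epsilon> / 2" 1 "2 * M"]) (use assms in auto)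
  obtain T3 :: real where T3: "T3 \<ge> 1" "\<And>T. T \<ge> T3 \<Longrightarrow> 3 * (1 + ln T) ^ 0 \<le> T powr (2 * \<eta>)"
    by (rule log_power_le_powr[of "2 * \<eta>" 3 0]) (use \<eta> in auto)
  obtain T4 :: real where T4: "T4 \<ge> 1" "\<And>T. T \<ge> T4 \<Longrightarrow> 20 * (1 + ln T) ^ 0 \<le> T powr (1 / 4)"
    by (rule log_power_le_powr[of "1 / 4" 20 0]) auto
  \<comment> \<open>4 from the two halves of the points and the two integrals in
    \<open>covering_integral\<close>, \<open>4 ^ M\<close> from the power of a sum of two terms, and
    \<open>52 = 2 * 26\<close> from \<open>1 + 2 * ln T \<le> 2 * (1 + ln T)\<close>.\<close>
  define C where "C = 4 * 4 ^ M * (52 * norm F) ^ (2 * M)"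
  have "real R \<le> C * T powr (\<epsilon> - real M / 2) * V powr (- 2) * max_moment M T \<phi> (T powr (1 + \<epsilon>) * V powr (- 4))"
    if T0: "T \<ge> max T1 (max T2 (max T3 T4))" and V: "V \<ge> T powr (1 / 10 + \<epsilon>)" and mono: "strict_mono_on {1..R} t"
      and t: "\<forall>r\<in>{1..R}. T \<le> t r \<and> t r \<le> 2 * T" and z: "\<forall>r\<in>{1..R}. norm (zeta (1 / 2 + \<i> * of_real (t r))) \<ge> V * T powr (- (\<eta> / 4))"
      and gap: "\<forall>r\<in>{1..<R}. t (r + 1) - t r \<ge> V" and sw: "smooth_weight A T \<phi>"
    for A :: "nat \<Rightarrow> real" and T V :: real and R :: nat and t :: "nat \<Rightarrow> real" and \<phi> :: "real \<Rightarrow> real"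
  proof -
    have T: "T \<ge> 100" using T0 T1(1) by simp
    have Tp: "3 \<le> T powr (2 * \<eta>)" "20 \<le> T powr (1 / 4)" using T3(2)[of T] T4(2)[of T] T0 by auto
    have V1: "V \<ge> 1"
      using V T assms ge_one_powr_ge_zero[of T "1 / 10 + \<epsilon>"] by simp
    have sep': "t j - t i \<ge> 1" if "i \<in> {1..R}" "j \<in> {1..R}" "i < j" for i j
    proof -
      have "t (i + 1) \<le> t j"
        using that strict_mono_onD[OF mono, of "i + 1" j] by (cases "i + 1 = j") auto
      moreover have "t (i + 1) - t i \<ge> V" using gap that by simp
      ultimately show ?thesis using V1 by linarith
    qed
    have sep: "\<bar>t i - t j\<bar> \<ge> 1" if "i \<in> {1..R}" "j \<in> {1..R}" "i \<noteq> j" for i j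
      using sep'[OF that(1,2)] sep'[OF that(2,1)] that(3) by (cases i j rule: linorder_cases) auto
    \<comment> \<open>Truncating \<open>V\<close> keeps the windows short compared with
      \<open>T\<close> however large \<open>V\<close> is; the lower bounds for \<open>zeta\<close>
      persist with the smaller \<open>U\<close>.\<close>
    define U where "U = min V (T powr (1 / 4 + \<eta>))"
    define G where "G = U\<^sup>2 * T powr (- \<eta>)"
    define Y where "Y = nat \<lfloor>2 * T / G\<^sup>2\<rfloor>"
    have U: "U > 0" "U \<le> V" "U \<le> T powr (1 / 4 + \<eta>)" using V1 T by (auto simp: U_def)
    have Ule: "T powr (1 / 10 + \<eta> / 2) \<le> U"
    proof -
      have "T powr (1 / 10 + \<eta> / 2) \<le> T powr (1 / 10 + \<epsilon>)" "T powr (1 / 10 + \<eta> / 2) \<le> T powr (1 / 4 + \<eta>)"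
        using T \<eta> assms by (auto intro!: powr_mono)
      then show ?thesis using V by (simp add: U_def)
    qed
    \<comment> \<open>Here the exponent 1/10 enters: squaring the lower bound for \<open>U\<close>
      gives \<open>G \<ge> T powr (1 / 5)\<close>, which is the condition
      \<open>T \<le> G ^ 5\<close>.\<close>
    have "T powr (1 / 5) = (T powr (1 / 10 + \<eta> / 2))\<^sup>2 * T powr (- \<eta>)"
      using T by (simp add: powr_power powr_add[symmetric])
    also have "\<dots> \<le> G" unfolding G_def using Ule by (intro mult_right_mono power_mono) auto
    finally have G5: "T powr (1 / 5) \<le> G" .
    have "T = (T powr (1 / 5)) ^ 5" using T by (simp add: powr_power)
    also have "\<dots> \<le> G ^ 5" using G5 by (intro power_mono) auto
    finally have TG: "T \<le> G ^ 5" .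
    have G1: "G \<ge> 1" using G5 ge_one_powr_ge_zero[of T "1 / 5"] T by simp
    have "G \<le> (T powr (1 / 4 + \<eta>))\<^sup>2 * T powr (- \<eta>)"
      unfolding G_def using U by (intro mult_right_mono power_mono) auto
    also have "\<dots> = T powr (1 / 2 + \<eta>)" using T by (simp add: powr_power powr_add[symmetric] add.commute)
    also have "\<dots> \<le> T powr (3 / 4)" using T \<eta> by (intro powr_mono) auto
    finally have "20 * G \<le> T powr (1 / 4) * T powr (3 / 4)" using Tp G1 by (intro mult_mono) auto
    also have "\<dots> = T" using T by (simp add: powr_add[symmetric])
    finally have G20: "20 * G \<le> T" .
    define g where "g = pi * G"
    have g: "0 < g" "g \<le> T / 5"
    proof -
      have "pi * G \<le> 4 * G" using pi_less_4 G1 by (intro mult_right_mono) auto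
      then show "g \<le> T / 5" using G20 by (simp add: g_def)
    qed (use G1 in \<open>simp add: g_def\<close>)
    have zU: "norm (zeta (1 / 2 + \<i> * of_real (t r))) \<ge> U * T powr (- (\<eta> / 4))" if "r \<in> {1..R}" for r
    proof -
      have "U * T powr (- (\<eta> / 4)) \<le> V * T powr (- (\<eta> / 4))" using U by (intro mult_right_mono) auto
      then show ?thesis using z that by fastforce
    qed
    have near: "real (card B) \<le> norm (divisor_main F G Y \<tau>) + norm (divisor_main F G Y (\<tau> + \<sigma> * g))"
      if "B \<subseteq> {1..R}" "\<And>i. i \<in> B \<Longrightarrow> \<bar>t i - \<tau>\<bar> \<le> G" "\<sigma> = 1 \<or> \<sigma> = - 1" "\<tau> \<in> {T..2 * T}" "\<tau> + \<sigma> * g \<in> {T..2 * T}" for B \<tau> \<sigma>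
      unfolding Y_def g_def
    proof (rule T1(2)[OF _ U(1) G_def TG G1 _ _ _ _ that(3-5)[unfolded g_def]])
      show "finite B" using that(1) finite_subset by blast
      show "\<bar>t i - t j\<bar> \<ge> 1" if "i \<in> B" "j \<in> B" "i \<noteq> j" for i j using sep that \<open>B \<subseteq> {1..R}\<close> by blast
      show "T \<le> t i \<and> t i \<le> 2 * T \<and> \<bar>t i - \<tau>\<bar> \<le> G \<and> norm (zeta (1 / 2 + \<i> * of_real (t i))) \<ge> U * T powr (- (\<eta> / 4))" if "i \<in> B" for i
        using t zU that(1) \<open>B \<subseteq> {1..R}\<close> \<open>\<And>i. i \<in> B \<Longrightarrow> \<bar>t i - \<tau>\<bar> \<le> G\<close> by blast
    qed (use T0 G20 G1 in auto)
    let ?X = "T powr (1 + \<epsilon>) * V powr (- 4)"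
    show ?thesis
    proof (cases "V \<le> T powr (1 / 4 + \<eta>)")
      case True
      then have UV: "U = V" by (simp add: U_def)
      \<comment> \<open>The factor 2 is absorbed by \<open>T powr (2 * \<eta>)\<close>; a second
        such factor comes from \<open>G\<^sup>2 = V ^ 4 * T powr (- (2 * \<eta>))\<close>.\<close>
      have X: "2 * T / G\<^sup>2 \<le> ?X"
      proof -
        have "G\<^sup>2 = V ^ 4 * T powr (- (2 * \<eta>))"
          unfolding G_def UV using T by (simp add: power_mult_distrib powr_power flip: power_mult)
        then have "2 * T / G\<^sup>2 = 2 * T powr 1 * T powr (2 * \<eta>) * V powr (- 4)"
          using T V1 by (simp add: powr_minus_divide powr_numeral)
        also have "\<dots> \<le> T powr (2 * \<eta>) * T powr 1 * T powr (2 * \<eta>) * V powr (- 4)"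
          using Tp by (intro mult_right_mono) auto
        also have "\<dots> = T powr (1 + 4 * \<eta>) * V powr (- 4)"
          using T by (simp only: powr_add[symmetric]) (simp add: algebra_simps)
        also have "\<dots> \<le> ?X" using T \<eta> by (intro mult_right_mono powr_mono) auto
        finally show ?thesis .
      qed
      obtain H where H: "continuous_on {T..2 * T} H" "\<And>t. t \<in> {T..2 * T} \<Longrightarrow> norm (divisor_main F G Y t) ^ (2 * M) \<le> H t"
        "integral {T..2 * T} H \<le> (norm F * (26 * (1 + 2 * ln T))) ^ (2 * M) * T powr (- (real M / 2)) * max_moment M T \<phi> ?X"
      proof -
        show thesis by (rule divisor_main_moment[where F = F, OF assms(1) T G1 TG sw X Y_def]) (fact that)
      qed
      have H0: "H x \<ge> 0" if "x \<in> {T..2 * T}" for x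
        using order_trans[OF _ H(2)[OF that]] by simp
      have nearH: "real (card B) \<le> 4 ^ M * (H \<tau> + H (\<tau> + \<sigma> * g))"
        if "B \<subseteq> {1..R}" "\<And>i. i \<in> B \<Longrightarrow> \<bar>t i - \<tau>\<bar> \<le> G" "\<sigma> = 1 \<or> \<sigma> = - 1" "\<tau> \<in> {T..2 * T}" "\<tau> + \<sigma> * g \<in> {T..2 * T}" for B \<tau> \<sigma>
      proof -
        define a b where "a = norm (divisor_main F G Y \<tau>)" and "b = norm (divisor_main F G Y (\<tau> + \<sigma> * g))"
        have ab: "a \<ge> 0" "b \<ge> 0" by (auto simp: a_def b_def)
        \<comment> \<open>A cardinality is 0 or at least 1, so it does not decrease when raised to
          the power \<open>2 * M\<close>.\<close>
        have "real (card B) \<le> real (card B) ^ (2 * M)"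
        proof (cases "card B = 0")
          case False
          then show ?thesis using assms(1) self_le_power[of "real (card B)" "2 * M"] by simp
        qed simp
        also have "\<dots> \<le> (a + b) ^ (2 * M)" unfolding a_def b_def by (intro power_mono near that) auto
        also have "\<dots> \<le> (2 * max a b) ^ (2 * M)" using ab by (intro power_mono) auto
        also have "\<dots> = 4 ^ M * max a b ^ (2 * M)" by (simp add: power_mult_distrib power_mult)
        also have "max a b ^ (2 * M) \<le> a ^ (2 * M) + b ^ (2 * M)" using ab by (auto simp: max_def)
        also have "\<dots> \<le> H \<tau> + H (\<tau> + \<sigma> * g)"
          unfolding a_def b_def by (intro add_mono H(2) that)
        finally show ?thesis by simp
      qed
      \<comment> \<open>The translate by \<open>g\<close> has to stay in \<open>{T..2 * T}\<close>, so it goes to the right on the left half and vice versa.\<close>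
      define L where "L = {r\<in>{1..R}. t r \<le> 3 / 2 * T}"
      have "real (card L) * G \<le> 2 * 4 ^ M * integral {T..2 * T} H"
      proof (rule covering_integral[OF H(1) H0, where a = T and b = "7 / 4 * T" and c = "1 * g" and s = t])
        show "real (card {i \<in> L. x \<in> {t i..t i + G}}) \<le> 4 ^ M * (H x + H (x + 1 * g))" if "x \<in> {T..7 / 4 * T}" for x
          by (rule nearH) (use that T G20 G1 g in \<open>auto simp: L_def\<close>)
      qed (use T t G20 G1 g in \<open>auto simp: L_def\<close>)
      \<comment> \<open>In the right half the windows also extend to the left of their points, so
        that they stay below \<open>2 * T\<close>.\<close>
      moreover have "real (card ({1..R} - L)) * G \<le> 2 * 4 ^ M * integral {T..2 * T} H"
      proof (rule covering_integral[OF H(1) H0, where a = "5 / 4 * T" and b = "2 * T" and c = "(- 1) * g" and s = "\<lambda>r. t r - G"])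
        show "real (card {i \<in> {1..R} - L. x \<in> {t i - G..t i - G + G}}) \<le> 4 ^ M * (H x + H (x + (- 1) * g))" if "x \<in> {5 / 4 * T..2 * T}" for x
          by (rule nearH) (use that T G20 G1 g in \<open>auto simp: L_def\<close>)
        show "5 / 4 * T \<le> t i - G \<and> t i - G + G \<le> 2 * T" if "i \<in> {1..R} - L" for i
          using that t G20 G1 by (auto simp: L_def not_le)
      qed (use T G20 G1 g in auto)
      moreover have "real R = real (card L) + real (card ({1..R} - L))"
      proof -
        have "L \<subseteq> {1..R}" by (auto simp: L_def)
        then show ?thesis using card_Diff_subset[of L "{1..R}"] card_mono[of "{1..R}" L] by (simp add: finite_subset)
      qed
      ultimately have "real R * G \<le> 4 * 4 ^ M * integral {T..2 * T} H"
        by (simp only: distrib_right)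
      also have "\<dots> \<le> 4 * 4 ^ M * ((norm F * (26 * (1 + 2 * ln T))) ^ (2 * M) * T powr (- (real M / 2)) * max_moment M T \<phi> ?X)"
        by (intro mult_left_mono H) auto
      also have "\<dots> \<le> 4 * 4 ^ M * (((52 * norm F) ^ (2 * M) * T powr (\<epsilon> / 2)) * T powr (- (real M / 2)) * max_moment M T \<phi> ?X)"
      proof (intro mult_left_mono mult_right_mono max_moment_nonneg)
        have "ln T \<ge> 0" using T by simp
        then have "(norm F * (26 * (1 + 2 * ln T))) ^ (2 * M) \<le> ((52 * norm F) * (1 + ln T)) ^ (2 * M)"
          by (intro power_mono) (auto simp: algebra_simps)
        also have "\<dots> = (52 * norm F) ^ (2 * M) * (1 + ln T) ^ (2 * M)" by (rule power_mult_distrib)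
        also have "\<dots> \<le> (52 * norm F) ^ (2 * M) * T powr (\<epsilon> / 2)"
          using T2(2)[of T] T0 by (intro mult_left_mono) auto
        finally show "(norm F * (26 * (1 + 2 * ln T))) ^ (2 * M) \<le> (52 * norm F) ^ (2 * M) * T powr (\<epsilon> / 2)" .
      qed auto
      also have "\<dots> = C * (T powr (\<epsilon> / 2) * T powr (- (real M / 2))) * max_moment M T \<phi> ?X"
        by (simp add: C_def)
      finally have "real R \<le> C * (T powr (\<epsilon> / 2) * T powr (- (real M / 2))) * max_moment M T \<phi> ?X / G"
        using G1 by (simp add: pos_le_divide_eq)
      also have "\<dots> = C * (T powr (\<epsilon> / 2) * T powr (- (real M / 2)) * T powr \<eta>) * V powr (- 2) * max_moment M T \<phi> ?X"
        using T V1 by (simp add: G_def UV powr_minus_divide powr_numeral)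
      \<comment> \<open>The logarithms used up \<open>\<epsilon> / 2\<close> and the division by
        \<open>G\<close> costs \<open>\<eta>\<close>, together at most
        \<open>\<epsilon>\<close>.\<close>
      also have "\<dots> \<le> C * T powr (\<epsilon> - real M / 2) * V powr (- 2) * max_moment M T \<phi> ?X"
        unfolding powr_add[symmetric] using T \<eta> assms
        by (intro mult_left_mono mult_right_mono max_moment_nonneg powr_mono) (auto simp: C_def)
      finally show ?thesis .
    next
      case False
      then have "U = T powr (1 / 4 + \<eta>)" by (simp add: U_def)
      then have "G = T powr (1 / 2 + \<eta>)"
        using T by (simp add: G_def powr_power powr_add[symmetric] add.commute)
      then have "G\<^sup>2 = T * T powr (2 * \<eta>)"
        using T by (simp add: powr_power powr_add algebra_simps)
      then have "2 * T / G\<^sup>2 = 2 / T powr (2 * \<eta>)" using T by simp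
      also have "\<dots> < 1" using Tp(1) by (subst pos_divide_less_eq) auto
      finally have "Y = 0" by (simp add: Y_def)
      then have S: "norm (divisor_main F G Y x) = 0" for x by (simp add: divisor_main_def)
      \<comment> \<open>The divisor sums are empty, so a single point would give
        \<open>1 \<le> 0\<close>.\<close>
      have "R = 0"
      proof (rule ccontr)
        assume "R \<noteq> 0"
        then have 1: "1 \<in> {1..R}" by simp
        then have t1: "T \<le> t 1" "t 1 \<le> 2 * T" using t by blast+
        define \<sigma> :: real where "\<sigma> = (if t 1 \<le> 3 / 2 * T then 1 else - 1)"
        have "real (card {1::nat}) \<le> norm (divisor_main F G Y (t 1)) + norm (divisor_main F G Y (t 1 + \<sigma> * g))"
          by (rule near) (use 1 t1 T G20 G1 g in \<open>auto simp: \<sigma>_def not_le\<close>)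
        then show False by (simp add: S)
      qed
      then show ?thesis using max_moment_nonneg[of M T \<phi> ?X] by (simp add: C_def)
    qed
  qed
  then show ?thesis using \<eta>(1) by (intro exI[of _ "\<eta> / 4"] conjI exI[of _ "max T1 (max T2 (max T3 T4))"] allI exI[of _ C] impI) auto
qed

end
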